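(* Let $H$ be a fixed simple graph on the vertex set $[p]=\{1,\ldots,p\}$, let $s>0$, and put $F_H(y_1,\ldots,y_p)=B_H(-y_1,\ldots,-y_p)$, with partial derivatives $F_{H,i}=\partial F_H/\partial y_i$. Let $\alpha_i>0$ with $\sum_{i=1}^p\alpha_i=1$, and let $\lambda_i=\alpha_iN+\delta_i$ be nonnegative integers, where $\delta_i=O(1)$ and $\sum_i\delta_i=0$. Assume that, after possibly relabelling the vertices of $H$, there is a point $r=(r_1,\ldots,r_p)\in(0,\infty)^p$ such that $$F_H(r)=0,\qquad F_{H,p}(r)\neq0,\qquad \frac{\alpha_i}{r_i}=\frac{\alpha_pF_{H,i}(r)}{r_pF_{H,p}(r)}\quad(1\le i<p).$$ Let $h$ be the local analytic solution of $F_H(y_1,\ldots,y_{p-1},h(y_1,\ldots,y_{p-1}))=0$ with $h(r_1,\ldots,r_{p-1})=r_p$, and define $$\Phi_H(y_1,\ldots,y_{p-1})=-\sum_{i=1}^{p-1}\alpha_i\log y_i-\alpha_p\log h(y_1,\ldots,y_{p-1}).$$ Let $\mathcal H_H$ be the Hessian of $\Phi_H$ at $(r_1,\ldots,r_{p-1})$, and set $A_H=-r_pF_{H,p}(r)$ (with $A_H^{-s}$ taken on the local branch induced by the chosen branch of $F_H^{-s}$). Assume that this smooth critical point $r$ is strictly minimal and nondegenerate for the direction $\alpha$, so that $\mathcal H_H$ is nonsingular and is positive definite in the positive real case. Then, as $N\to\infty$, $$(-1)^N\chi_{H[\lambda]}(-s)\sim\left(\prod_{i=1}^p\lambda_i!\right)\left(\prod_{i=1}^pr_i^{-\delta_i}\right)\frac{\lambda_p^{s-1}}{\Gamma(s)}\,\frac{A_H^{-s}}{\prod_{i=1}^{p-1}r_i}\,\frac{\exp(N\Phi_H(r_1,\ldots,r_{p-1}))}{(2\pi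 N)^{(p-1)/2}\sqrt{\det\mathcal H_H}}.$$ If $H$ is connected, then $H[\lambda]$ is connected for all sufficiently large $N$, and this is also the value $s\,T_{H[\lambda]}(1+s,0)$.
   Context: For $\lambda=(\lambda_1,\ldots,\lambda_p)$, $H[\lambda]$ is the graph obtained from $H$ by replacing vertex $i$ with an independent set of size $\lambda_i$ and each edge $ij\in E(H)$ with all edges between the $i$-th and $j$-th sets. $\mathrm{Ind}(H)$ is the collection of independent sets of $H$ including the empty set, and $$B_H(x_1,\ldots,x_p)=\sum_{I\in\mathrm{Ind}(H)}\prod_{i\in I}(e^{x_i}-1),$$ so $B_H(0)=1$; the branch of $F_H^{-s}$ is the one equal to $1$ at the origin, continued analytically. $\chi_G$ and $T_G(x,y)$ are the chromatic and Tutte polynomials. Strictly minimal (in the sense of the smooth-point theorem of analytic combinatorics in several variables) means that $r$ is the only zero of $F_H$ in the closed polydisc $\{y\in\mathbb C^p:|y_i|\le r_i\ \forall i\}$; nondegenerate means that the reduced Hessian $\mathcal H_H$ is nonsingular (positive definite in the positive real case considered here). $a_N\sim b_N$ means $a_N/b_N\to1$. *)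

theory Defs
  imports
    "HOL-Analysis.Analysis"
    "HOL-Library.Landau_Symbols"
    "Jordan_Normal_Form.Determinant"
begin

subsection \<open>Graphs\<close>

definition simple_graph :: "'a set \<Rightarrow> 'a set set \<Rightarrow> bool" where
  "simple_graph V E \<longleftrightarrow> finite V \<and> (\<forall>e\<in>E. e \<subseteq> V \<and> card e = 2)"

definition independent_sets :: "'a set \<Rightarrow> 'a set set \<Rightarrow> 'a set set" where
  "independent_sets V E = {I. I \<subseteq> V \<and> (\<forall>u\<in>I. \<forall>v\<in>I. {u, v} \<notin> E)}"

definition reachability :: "'a set \<Rightarrow> 'a set set \<Rightarrow> ('a \<times> 'a) set" where
  "reachability V E = {(u, v). u \<in> V \<and> v \<in> V \<and> (u, v) \<in> {(x, y). {x, y} \<in> E}\<^sup>*}"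

definition connected_graph :: "'a set \<Rightarrow> 'a set set \<Rightarrow> bool" where
  "connected_graph V E \<longleftrightarrow> V \<noteq> {} \<and> (\<forall>u\<in>V. \<forall>v\<in>V. (u, v) \<in> reachability V E)"

definition num_components :: "'a set \<Rightarrow> 'a set set \<Rightarrow> nat" where
  "num_components V E = card (V // reachability V E)"

definition blowup_verts :: "'a set \<Rightarrow> ('a \<Rightarrow> nat) \<Rightarrow> ('a \<times> nat) set" where
  "blowup_verts V l = (SIGMA i:V. {..<l i})"

definition blowup_edges :: "'a set set \<Rightarrow> ('a \<Rightarrow> nat) \<Rightarrow> ('a \<times> nat) set set" where
  "blowup_edges E l = {{(i, a), (j, b)} | i j a b. {i, j} \<in> E \<and> a < l i \<and> b < l j}"

definition proper_colorings :: "'a set \<Rightarrow> 'a set set \<Rightarrow> nat \<Rightarrow> ('a \<Rightarrow> nat) set" where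
  "proper_colorings V E q = {c \<in> V \<rightarrow>\<^sub>E {..<q}. \<forall>u v. {u, v} \<in> E \<longrightarrow> c u \<noteq> c v}"

text \<open>Existence and uniqueness of this polynomial, for finite \<open>V\<close>, are proved below.\<close>

definition chromatic_poly :: "'a set \<Rightarrow> 'a set set \<Rightarrow> real poly" where
  "chromatic_poly V E = (THE P. \<forall>q. poly P (of_nat q) = of_nat (card (proper_colorings V E q)))"

text \<open>Both exponents are nonnegative as integers for \<open>A \<subseteq> E\<close>, so the truncated
  subtraction is harmless.\<close>

definition tutte :: "'a set \<Rightarrow> 'a set set \<Rightarrow> real \<Rightarrow> real \<Rightarrow> real" where
  "tutte V E x y = (\<Sum>A\<in>Pow E. (x - 1) ^ (num_components V A - num_components V E) *
     (y - 1) ^ (num_components V A + card A - card V))"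


subsection \<open>Well-definedness of the chromatic polynomial\<close>

definition onto_colorings :: "'a set \<Rightarrow> 'a set set \<Rightarrow> nat set \<Rightarrow> ('a \<Rightarrow> nat) set" where
  "onto_colorings V E S = {c \<in> V \<rightarrow>\<^sub>E S. (\<forall>u v. {u, v} \<in> E \<longrightarrow> c u \<noteq> c v) \<and> c ` V = S}"

lemma finite_onto_colorings: "finite V \<Longrightarrow> finite S \<Longrightarrow> finite (onto_colorings V E S)"
  unfolding onto_colorings_def by (simp add: finite_PiE)

lemma card_onto_colorings_le:
  assumes V: "finite V" and E: "\<forall>e\<in>E. e \<subseteq> V" and T: "finite T" and f: "bij_betw f S T"
  shows "card (onto_colorings V E S) \<le> card (onto_colorings V E T)"
proof (rule card_inj_on_le[where f = "\<lambda>c. restrict (f \<circ> c) V"])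
  have inj: "inj_on f S" and im: "f ` S = T"
    using f by (auto simp: bij_betw_def)
  show "inj_on (\<lambda>c. restrict (f \<circ> c) V) (onto_colorings V E S)"
  proof (rule inj_onI)
    fix c d
    assume c: "c \<in> onto_colorings V E S" and d: "d \<in> onto_colorings V E S"
      and eq: "restrict (f \<circ> c) V = restrict (f \<circ> d) V"
    have cd: "c \<in> V \<rightarrow>\<^sub>E S" "d \<in> V \<rightarrow>\<^sub>E S"
      using c d by (auto simp: onto_colorings_def)
    show "c = d"
    proof (rule PiE_ext[OF cd])
      fix v assume v: "v \<in> V"
      have "f (c v) = f (d v)"
        using fun_cong[OF eq, of v] v by simp
      moreover have "c v \<in> S" "d v \<in> S"
        using cd v by auto
      ultimately show "c v = d v"
        using inj by (auto dest: inj_onD)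
    qed
  qed
  show "(\<lambda>c. restrict (f \<circ> c) V) ` onto_colorings V E S \<subseteq> onto_colorings V E T"
  proof
    fix d assume "d \<in> (\<lambda>c. restrict (f \<circ> c) V) ` onto_colorings V E S"
    then obtain c where c: "c \<in> V \<rightarrow>\<^sub>E S" "\<forall>u v. {u, v} \<in> E \<longrightarrow> c u \<noteq> c v" "c ` V = S"
      and d: "d = restrict (f \<circ> c) V"
      by (auto simp: onto_colorings_def)
    have "d ` V = T"
      using c(3) im by (auto simp: d)
    moreover have "d \<in> V \<rightarrow>\<^sub>E T"
      using c(1) im by (auto simp: d)
    moreover have "d u \<noteq> d v" if "{u, v} \<in> E" for u v
    proof -
      have "u \<in> V" "v \<in> V"
        using E that by auto
      then show ?thesis
        using c(1) c(2) that inj by (auto simp: d dest!: inj_onD)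
    qed
    ultimately show "d \<in> onto_colorings V E T"
      by (auto simp: onto_colorings_def)
  qed
  show "finite (onto_colorings V E T)"
    using V T by (rule finite_onto_colorings)
qed

lemma card_onto_colorings_cong:
  assumes "finite V" "\<forall>e\<in>E. e \<subseteq> V" "finite S" "finite T" "card S = card T"
  shows "card (onto_colorings V E S) = card (onto_colorings V E T)"
proof -
  obtain f where "bij_betw f S T"
    using finite_same_card_bij[OF assms(3,4,5)] by auto
  then show ?thesis
    using card_onto_colorings_le[OF assms(1,2,4), of f S]
      card_onto_colorings_le[OF assms(1,2,3), of "inv_into S f" T] bij_betw_inv_into[of f S T]
    by simp
qed

lemma card_proper_colorings:
  assumes V: "finite V" and E: "\<forall>e\<in>E. e \<subseteq> V"
  shows "card (proper_colorings V E q) =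
    (\<Sum>k\<le>card V. (q choose k) * card (onto_colorings V E {..<k}))"
proof -
  have split: "proper_colorings V E q = (\<Union>S\<in>Pow {..<q}. onto_colorings V E S)"
    by (auto simp: proper_colorings_def onto_colorings_def PiE_iff)
  have "card (proper_colorings V E q) = (\<Sum>S\<in>Pow {..<q}. card (onto_colorings V E S))"
    unfolding split
  proof (rule card_UN_disjoint)
    show "\<forall>S\<in>Pow {..<q}. finite (onto_colorings V E S)"
      using V by (auto intro: finite_onto_colorings finite_subset)
  qed (auto simp: onto_colorings_def)
  also have "\<dots> = (\<Sum>S\<in>Pow {..<q}. card (onto_colorings V E {..<card S}))"
    using V E by (intro sum.cong card_onto_colorings_cong) (auto intro: finite_subset)
  also have "\<dots> = (\<Sum>k\<le>q. \<Sum>S | S \<in> Pow {..<q} \<and> card S = k. card (onto_colorings V E {..<card S}))"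
    by (rule sum.group[symmetric]) (auto dest: card_mono[rotated])
  also have "\<dots> = (\<Sum>k\<le>q. (q choose k) * card (onto_colorings V E {..<k}))"
  proof (rule sum.cong)
    fix k
    have "(\<Sum>S | S \<in> Pow {..<q} \<and> card S = k. card (onto_colorings V E {..<card S})) =
        (\<Sum>S | S \<subseteq> {..<q} \<and> card S = k. card (onto_colorings V E {..<k}))"
      by (rule sum.cong) auto
    then show "(\<Sum>S | S \<in> Pow {..<q} \<and> card S = k. card (onto_colorings V E {..<card S})) =
        (q choose k) * card (onto_colorings V E {..<k})"
      by (simp add: n_subsets)
  qed simp
  also have "\<dots> = (\<Sum>k\<le>max q (card V). (q choose k) * card (onto_colorings V E {..<k}))"
    by (rule sum.mono_neutral_left) auto
  also have "\<dots> = (\<Sum>k\<le>card V. (q choose k) * card (onto_colorings V E {..<k}))"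
  proof (rule sum.mono_neutral_right)
    show "\<forall>k\<in>{..max q (card V)} - {..card V}. (q choose k) * card (onto_colorings V E {..<k}) = 0"
    proof
      fix k assume "k \<in> {..max q (card V)} - {..card V}"
      then have k: "card V < k" by auto
      have "onto_colorings V E {..<k} = {}"
      proof (rule ccontr)
        assume "onto_colorings V E {..<k} \<noteq> {}"
        then obtain c where "c ` V = {..<k}"
          by (auto simp: onto_colorings_def)
        then show False
          using card_image_le[OF V, of c] k by simp
      qed
      then show "(q choose k) * card (onto_colorings V E {..<k}) = 0"
        by simp
    qed
  qed auto
  finally show ?thesis .
qed

definition choose_poly :: "nat \<Rightarrow> real poly" where
  "choose_poly k = Polynomial.smult (1 / fact k) (\<Prod>i<k. [:- of_nat i, 1:])"

lemma poly_choose_poly: "poly (choose_poly k) (of_nat q) = of_nat (q choose k)"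
proof -
  have "poly (choose_poly k) (of_nat q) = (of_nat q gchoose k)"
    by (simp add: choose_poly_def poly_prod gbinomial_prod_rev atLeast0LessThan)
  then show ?thesis
    by (simp add: binomial_gbinomial)
qed

lemma ex1_chromatic_poly:
  assumes V: "finite V" and E: "\<forall>e\<in>E. e \<subseteq> V"
  shows "\<exists>!P :: real poly. \<forall>q. poly P (of_nat q) = of_nat (card (proper_colorings V E q))"
proof (rule ex_ex1I)
  show "\<exists>P :: real poly. \<forall>q. poly P (of_nat q) = of_nat (card (proper_colorings V E q))"
    by (rule exI[of _ "\<Sum>k\<le>card V. Polynomial.smult (of_nat (card (onto_colorings V E {..<k}))) (choose_poly k)"])
      (simp add: card_proper_colorings[OF V E] poly_sum poly_choose_poly mult.commute)
next
  fix P Q :: "real poly"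
  assume P: "\<forall>q. poly P (of_nat q) = of_nat (card (proper_colorings V E q))"
    and Q: "\<forall>q. poly Q (of_nat q) = of_nat (card (proper_colorings V E q))"
  have "range (of_nat :: nat \<Rightarrow> real) \<subseteq> {x. poly (P - Q) x = 0}"
    using P Q by auto
  moreover have "infinite (range (of_nat :: nat \<Rightarrow> real))"
    by (simp add: range_inj_infinite inj_of_nat)
  ultimately have "P - Q = 0"
    using poly_roots_finite finite_subset by blast
  then show "P = Q" by simp
qed

lemma poly_chromatic_poly:
  assumes "finite V" and "\<forall>e\<in>E. e \<subseteq> V"
  shows "poly (chromatic_poly V E) (of_nat q) = of_nat (card (proper_colorings V E q))"
  using theI'[OF ex1_chromatic_poly[OF assms]] unfolding chromatic_poly_def by blast


subsection \<open>Functions of several complex variables\<close>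

text \<open>A point of \<open>p\<close>-dimensional complex space is a function \<open>nat \<Rightarrow> complex\<close> of which only
  the values at \<open>1, \<dots>, p\<close> matter.\<close>

definition partial_deriv :: "nat \<Rightarrow> ((nat \<Rightarrow> complex) \<Rightarrow> complex) \<Rightarrow> (nat \<Rightarrow> complex) \<Rightarrow> complex" where
  "partial_deriv i f y = deriv (\<lambda>z. f (y(i := z))) (y i)"

text \<open>Analyticity at \<open>a\<close> in the variables with index in the finite set \<open>J\<close>: the function is the
  sum of a power series, indexed by multi-indices on \<open>J\<close>, in a polydisc around \<open>a\<close>.  In
  particular it does not depend on the other coordinates there.\<close>

definition analytic_at :: "nat set \<Rightarrow> ((nat \<Rightarrow> complex) \<Rightarrow> complex) \<Rightarrow> (nat \<Rightarrow> complex) \<Rightarrow> bool" where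
  "analytic_at J f a \<longleftrightarrow> (\<exists>c. \<exists>\<epsilon>>0. \<forall>y. (\<forall>i\<in>J. norm (y i - a i) < \<epsilon>) \<longrightarrow>
     ((\<lambda>k. c k * (\<Prod>i\<in>J. (y i - a i) ^ k i)) has_sum f y) (J \<rightarrow>\<^sub>E UNIV))"

definition open_polydisc :: "nat \<Rightarrow> (nat \<Rightarrow> real) \<Rightarrow> (nat \<Rightarrow> complex) set" where
  "open_polydisc p r = {y. \<forall>i\<in>{1..p}. norm (y i) < r i}"

definition closed_polydisc :: "nat \<Rightarrow> (nat \<Rightarrow> real) \<Rightarrow> (nat \<Rightarrow> complex) set" where
  "closed_polydisc p r = {y. \<forall>i\<in>{1..p}. norm (y i) \<le> r i}"

definition strictly_minimal :: "nat \<Rightarrow> ((nat \<Rightarrow> complex) \<Rightarrow> complex) \<Rightarrow> (nat \<Rightarrow> real) \<Rightarrow> bool" where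
  "strictly_minimal p F r \<longleftrightarrow>
     (\<forall>y\<in>closed_polydisc p r. F y = 0 \<longleftrightarrow> (\<forall>i\<in>{1..p}. y i = of_real (r i)))"

definition local_solution ::
  "nat \<Rightarrow> ((nat \<Rightarrow> complex) \<Rightarrow> complex) \<Rightarrow> (nat \<Rightarrow> complex) \<Rightarrow> ((nat \<Rightarrow> complex) \<Rightarrow> complex) \<Rightarrow> bool" where
  "local_solution p F a h \<longleftrightarrow> analytic_at {1..<p} h a \<and> h a = a p \<and>
     (\<exists>\<epsilon>>0. \<forall>y. (\<forall>i\<in>{1..<p}. norm (y i - a i) < \<epsilon>) \<longrightarrow> F (y(p := h y)) = 0)"

text \<open>\<open>G\<close> is the analytic branch of the power \<open>F\<close> to the \<open>- s\<close> on the open polydisc with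
  \<open>G = 1\<close> at the origin; \<open>L\<close> is an analytic logarithm of \<open>F\<close>.\<close>

definition neg_power_branch ::
  "nat \<Rightarrow> ((nat \<Rightarrow> complex) \<Rightarrow> complex) \<Rightarrow> real \<Rightarrow> (nat \<Rightarrow> real) \<Rightarrow> ((nat \<Rightarrow> complex) \<Rightarrow> complex) \<Rightarrow> bool" where
  "neg_power_branch p F s r G \<longleftrightarrow> G (\<lambda>_. 0) = 1 \<and>
     (\<exists>L. \<forall>y\<in>open_polydisc p r. analytic_at {1..p} L y \<and> exp (L y) = F y \<and>
       G y = exp (- of_real s * L y))"

text \<open>Near the zero \<open>a\<close> one has \<open>F y = (1 - y p / h y) * A y\<close> with \<open>A\<close> analytic and
  \<open>A a = - a p * partial_deriv p F a\<close>.  A branch \<open>G\<close> of \<open>F\<close> to the \<open>- s\<close> therefore induces, together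
  with the principal power of \<open>1 - y p / h y\<close> (in the open polydisc and near a strictly minimal
  zero, \<open>norm (y p) < norm (h y)\<close>), a branch of \<open>A\<close> to the \<open>- s\<close>, and hence a value \<open>w\<close> of this
  power at \<open>a\<close>.\<close>

definition induced_neg_power ::
  "nat \<Rightarrow> ((nat \<Rightarrow> complex) \<Rightarrow> complex) \<Rightarrow> real \<Rightarrow> (nat \<Rightarrow> real) \<Rightarrow>
     ((nat \<Rightarrow> complex) \<Rightarrow> complex) \<Rightarrow> ((nat \<Rightarrow> complex) \<Rightarrow> complex) \<Rightarrow> complex \<Rightarrow> bool" where
  "induced_neg_power p F s r h G w \<longleftrightarrow>
     (let a = (\<lambda>i. complex_of_real (r i)) in
       (\<exists>l. exp l = - a p * partial_deriv p F a \<and> w = exp (- of_real s * l)) \<and>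
       ((\<lambda>y. G y * (1 - y p / h y) powr of_real s) \<longlongrightarrow> w) (at a within open_polydisc p r))"

text \<open>Row and column \<open>i\<close> of the matrix belong to the variable \<open>Suc i\<close>.\<close>

definition hessian :: "nat \<Rightarrow> ((nat \<Rightarrow> complex) \<Rightarrow> complex) \<Rightarrow> (nat \<Rightarrow> complex) \<Rightarrow> complex Matrix.mat" where
  "hessian n f a = Matrix.mat n n (\<lambda>(i, j). partial_deriv (Suc i) (partial_deriv (Suc j) f) a)"

definition positive_definite :: "real Matrix.mat \<Rightarrow> bool" where
  "positive_definite M \<longleftrightarrow> square_mat M \<and> transpose_mat M = M \<and>
     (\<forall>v\<in>carrier_vec (dim_row M). v \<noteq> 0\<^sub>v (dim_row M) \<longrightarrow> 0 < scalar_prod v (mult_mat_vec M v))"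

text \<open>Nonsingular and, as at a positive real point, real and positive definite.\<close>

definition nondegenerate :: "complex Matrix.mat \<Rightarrow> bool" where
  "nondegenerate M \<longleftrightarrow> Determinant.det M \<noteq> 0 \<and>
     (\<exists>R. M = map_mat complex_of_real R \<and> positive_definite R)"


subsection \<open>The generating function of a graph on \<open>{1..p}\<close>\<close>

definition B_fun :: "nat \<Rightarrow> nat set set \<Rightarrow> (nat \<Rightarrow> complex) \<Rightarrow> complex" where
  "B_fun p E x = (\<Sum>I\<in>independent_sets {1..p} E. \<Prod>i\<in>I. (exp (x i) - 1))"

definition F_fun :: "nat \<Rightarrow> nat set set \<Rightarrow> (nat \<Rightarrow> complex) \<Rightarrow> complex" where
  "F_fun p E y = B_fun p E (\<lambda>i. - y i)"

definition Phi_fun ::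
  "nat \<Rightarrow> (nat \<Rightarrow> real) \<Rightarrow> ((nat \<Rightarrow> complex) \<Rightarrow> complex) \<Rightarrow> (nat \<Rightarrow> complex) \<Rightarrow> complex" where
  "Phi_fun p \<alpha> h y = - (\<Sum>i\<in>{1..<p}. of_real (\<alpha> i) * Ln (y i)) - of_real (\<alpha> p) * Ln (h y)"

end

theory Submission
  imports Defs "HOL-Probability.Probability" "HOL-Complex_Analysis.Complex_Analysis"
begin

text \<open>
  Up to sign and factorials, the values \<open>chi (- s)\<close> for the blow-ups are the power series
  coefficients of \<open>F\<close> to the power \<open>- s\<close>: for a natural number \<open>q\<close> in place of \<open>- s\<close> one counts
  colourings by the independent set of vertices of \<open>H\<close> that use a given colour, and both sides are
  polynomials in the exponent.

  Near the critical point \<open>r\<close>, at \<open>y i = r i * exp (- u + \<i> \<theta> i)\<close>, the function \<open>F\<close> behaves like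
  \<open>A / \<alpha> p\<close> times \<open>u + Q \<theta> / 2 - \<i> (\<Sum> \<alpha> i * \<theta> i)\<close>, where \<open>Q\<close> is the Hessian of \<open>\<Phi>\<close> in logarithmic
  coordinates. By strict minimality a multiple of \<open>u + \<bar>\<Sum> \<alpha> i * \<theta> i\<bar> + \<Sum> (\<theta> i)^2\<close> bounds \<open>F\<close> from below
  on the whole torus. The coefficients are Fourier integrals over the torus with \<open>u = 1 / N\<close>. Scaling
  \<open>\<theta>\<close> by \<open>1 / N\<close> along \<open>\<alpha>\<close> and by \<open>1 / sqrt N\<close> across it, dominated convergence gives an integral
  that factors into the Fourier inversion of the Gamma density and a Gaussian integral. To have
  an integrable bound, the Euler operator is applied \<open>p + 1\<close> times first, which multiplies
  the coefficients of degree \<open>N\<close> by \<open>N ^ (p + 1)\<close>.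

  For connected \<open>H\<close>, the Tutte polynomial comes from the subgraph expansion of the chromatic polynomial.
\<close>

subsection \<open>Chromatic and Tutte polynomial\<close>

text \<open>The nondegeneracy hypothesis concerns \<Phi>, the integrals concern F. The bridge is the
  logarithm w of \<open>y p / h y\<close>: F is affine in \<open>exp (- y p)\<close> and vanishes on
  the graph of h, so it is w times an explicit factor that does not vanish at r, while
  \<open>\<alpha> p * w\<close> is an affine function of u and \<theta> plus the increment of
  \<Phi>. The critical equations remove the gradient of \<Phi>, so only the Hessian remains. For
  general s the singularity is a branch point, and no residue is available. The tori therefore stay
  inside the polydisc, where the chosen branch lives; the factor \<open>exp (- 1)\<close> that the
  radii \<open>r i * exp (- 1 / N)\<close> produce in degree N cancels against the
  \<open>exp (- 1)\<close> in the inverted Gamma density. The Euler operator raises the Gamma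
  function to \<open>Gamma (s + p + 1)\<close> and brings in a Pochhammer symbol; their quotient
  restores \<open>Gamma s\<close>. Identities between coefficients are checked on complex lines
  \<open>z * y\<close>: homogeneous parts become coefficients of series in the one variable
  z.\<close>

lemma equiv_reachability:
  assumes "\<forall>e\<in>A. e \<subseteq> V"
  shows "equiv V (reachability V A)"
proof (rule equivI)
  show "reachability V A \<subseteq> V \<times> V"
    by (auto simp: reachability_def)
  show "refl_on V (reachability V A)"
    by (auto simp: reachability_def refl_on_def)
  have "sym ({(x, y). {x, y} \<in> A}\<^sup>*)"
    by (rule sym_rtrancl) (auto simp: sym_def insert_commute)
  then show "sym (reachability V A)"
    by (auto simp: reachability_def sym_def)
  show "trans (reachability V A)"
    by (auto simp: reachability_def trans_def)
qed

text \<open>Constancy on edges propagates along walks, so such a colouring is a free choice of one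
  colour per class of the quotient.\<close>

lemma card_monochromatic_colorings:
  assumes V: "finite V" and A: "\<forall>e\<in>A. e \<subseteq> V"
  shows "card {c \<in> V \<rightarrow>\<^sub>E {..<q}. \<forall>u v. {u, v} \<in> A \<longrightarrow> c u = c v} = q ^ num_components V A"
proof -
  let ?R = "reachability V A"
  let ?Q = "V // ?R"
  let ?f = "\<lambda>g. \<lambda>v\<in>V. g (?R `` {v})"
  have eq: "equiv V ?R" using A by (rule equiv_reachability)
  have finQ: "finite ?Q" using V eq finite_quotient equiv_type by metis
  have "bij_betw ?f (?Q \<rightarrow>\<^sub>E {..<q}) {c \<in> V \<rightarrow>\<^sub>E {..<q}. \<forall>u v. {u, v} \<in> A \<longrightarrow> c u = c v}"
  proof (rule bij_betw_imageI)
    show "inj_on ?f (?Q \<rightarrow>\<^sub>E {..<q})"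
    proof (rule inj_onI)
      fix g g' assume g: "g \<in> ?Q \<rightarrow>\<^sub>E {..<q}" "g' \<in> ?Q \<rightarrow>\<^sub>E {..<q}" and e: "?f g = ?f g'"
      show "g = g'"
      proof (rule PiE_ext[OF g])
        fix X assume "X \<in> ?Q"
        then obtain v where "v \<in> V" "X = ?R `` {v}" by (rule quotientE)
        then show "g X = g' X" using fun_cong[OF e, of v] by simp
      qed
    qed
    show "?f ` (?Q \<rightarrow>\<^sub>E {..<q}) = {c \<in> V \<rightarrow>\<^sub>E {..<q}. \<forall>u v. {u, v} \<in> A \<longrightarrow> c u = c v}" (is "_ = ?C")
    proof (intro equalityI subsetI)
      fix c assume "c \<in> ?f ` (?Q \<rightarrow>\<^sub>E {..<q})"
      then obtain g where g: "g \<in> ?Q \<rightarrow>\<^sub>E {..<q}" and c: "c = ?f g" by auto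
      have "c u = c v" if e: "{u, v} \<in> A" for u v
      proof -
        have uv: "u \<in> V" "v \<in> V" using A e by auto
        then have "(u, v) \<in> ?R" using e by (auto simp: reachability_def)
        then have "?R `` {u} = ?R `` {v}" using eq by (simp add: equiv_class_eq)
        then show ?thesis using uv c by simp
      qed
      then show "c \<in> ?C" using g c by (auto simp: quotientI)
    next
      fix c assume c: "c \<in> ?C"
      have const: "c u = c v" if "(u, v) \<in> ?R" for u v
      proof -
        from that have "(u, v) \<in> {(x, y). {x, y} \<in> A}\<^sup>*" by (auto simp: reachability_def)
        then show ?thesis
        proof induction
          case (step y z)
          then have "c y = c z" using c by blast
          with step.IH show ?case by (rule trans)
        qed (rule refl)
      qed
      let ?g = "\<lambda>X\<in>?Q. c (SOME v. v \<in> X)"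
      have g: "?g (?R `` {v}) = c v" if v: "v \<in> V" for v
      proof -
        have "v \<in> ?R `` {v}" using v eq by (auto simp: equiv_def refl_on_def)
        then have "(SOME w. w \<in> ?R `` {v}) \<in> ?R `` {v}" by (rule someI)
        then show ?thesis using const v by (auto simp: quotientI)
      qed
      have "c = ?f ?g"
      proof
        fix v
        show "c v = ?f ?g v"
        proof (cases "v \<in> V")
          case True
          then show ?thesis by (simp only: restrict_apply' g)
        next
          case False
          then have "c v = undefined" using c by (intro PiE_arb[of c V]) auto
          then show ?thesis using False by simp
        qed
      qed
      moreover have "?g \<in> ?Q \<rightarrow>\<^sub>E {..<q}"
      proof (rule PiE_I)
        fix X assume "X \<in> ?Q"
        then obtain v where "v \<in> V" "X = ?R `` {v}" by (rule quotientE)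
        then have "?g X = c v" by (simp only: g)
        then show "?g X \<in> {..<q}" using c \<open>v \<in> V\<close> by auto
      qed simp
      ultimately show "c \<in> ?f ` (?Q \<rightarrow>\<^sub>E {..<q})" by (rule image_eqI)
    qed
  qed
  then have "card {c \<in> V \<rightarrow>\<^sub>E {..<q}. \<forall>u v. {u, v} \<in> A \<longrightarrow> c u = c v} = card (?Q \<rightarrow>\<^sub>E {..<q})"
    by (simp add: bij_betw_same_card)
  then show ?thesis using finQ by (simp add: card_funcsetE num_components_def)
qed

text \<open>Whitney's expansion: properness is the product over the edges of 1 minus the indicator
  of being monochromatic. Multiplying out sums over edge sets \<open>A\<close>, each weighted by the
  number of colourings monochromatic on \<open>A\<close>.\<close>

lemma card_proper_colorings_subgraph_expansion:
  assumes V: "finite V" and E: "\<forall>e\<in>E. e \<subseteq> V \<and> card e = 2"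
  shows "real (card (proper_colorings V E q)) =
    (\<Sum>A\<in>Pow E. (-1) ^ card A * real q ^ num_components V A)"
proof -
  have finE: "finite E" using V E by (intro finite_subset[of E "Pow V"]) auto
  \<comment> \<open>The indicator that e is monochromatic under c, quantified over all presentations
    of e so that no ends need to be chosen.\<close>
  let ?m = "\<lambda>c e. of_bool (\<forall>u v. e = {u, v} \<longrightarrow> c u = c v) :: real"
  let ?U = "V \<rightarrow>\<^sub>E {..<q}"
  have finU: "finite ?U" using V by (simp add: finite_PiE)
  have ex: "\<exists>u v. e = {u, v}" if "e \<in> E" for e
    using E that by (metis card_2_iff)
  have 1: "of_bool (c \<in> proper_colorings V E q) = (\<Prod>e\<in>E. 1 - ?m c e)" if c: "c \<in> ?U" for c
  proof (cases "c \<in> proper_colorings V E q")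
    case True
    have "?m c e = 0" if e: "e \<in> E" for e
    proof -
      obtain u v where uv: "e = {u, v}" using ex e by blast
      then have "c u \<noteq> c v" using True e by (auto simp: proper_colorings_def)
      then show ?thesis using uv by auto
    qed
    then have "(\<Prod>e\<in>E. 1 - ?m c e) = (\<Prod>e\<in>E. 1)" by (intro prod.cong) (simp_all del: of_bool_eq_0_iff)
    then show ?thesis using True by simp
  next
    case False
    then obtain u v where uv: "{u, v} \<in> E" "c u = c v"
      using c by (auto simp: proper_colorings_def)
    have "?m c {u, v} = 1" using uv(2) by (auto simp: doubleton_eq_iff)
    then show ?thesis using uv(1) False finE by (auto simp: prod_zero_iff intro!: bexI[of _ "{u, v}"])
  qed
  have 2: "(\<Prod>e\<in>A. ?m c e) = of_bool (\<forall>u v. {u, v} \<in> A \<longrightarrow> c u = c v)" if "A \<subseteq> E" for A c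
  proof -
    have finA: "finite A" using that finE by (rule finite_subset)
    show ?thesis
    proof (cases "\<forall>u v. {u, v} \<in> A \<longrightarrow> c u = c v")
      case True
      then have "(\<Prod>e\<in>A. ?m c e) = (\<Prod>e\<in>A. 1)" by (intro prod.cong) auto
      then show ?thesis using True by simp
    next
      case False
      then obtain u v where "{u, v} \<in> A" "c u \<noteq> c v" by blast
      then have "(\<Prod>e\<in>A. ?m c e) = 0" using finA by (subst prod_zero_iff) auto
      then show ?thesis using False by (simp del: prod_zero_iff)
    qed
  qed
  have "real (card (proper_colorings V E q)) = (\<Sum>c\<in>?U. of_bool (c \<in> proper_colorings V E q))"
    using finU by (subst sum_of_bool_eq) (auto simp: proper_colorings_def intro!: arg_cong[of _ _ card])
  also have "\<dots> = (\<Sum>c\<in>?U. \<Prod>e\<in>E. 1 - ?m c e)"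
    by (rule sum.cong[OF refl]) (rule 1)
  also have "\<dots> = (\<Sum>c\<in>?U. \<Sum>A\<in>Pow E. (-1) ^ card A * (\<Prod>e\<in>A. ?m c e))"
  proof (rule sum.cong[OF refl])
    fix c
    have "(\<Prod>e\<in>E. 1 - ?m c e) = (\<Prod>e\<in>E. - ?m c e + 1)" by (simp add: algebra_simps)
    also have "\<dots> = (\<Sum>A\<in>Pow E. (\<Prod>e\<in>A. - ?m c e) * (\<Prod>e\<in>E-A. 1))"
      by (rule prod_add[OF finE])
    finally show "(\<Prod>e\<in>E. 1 - ?m c e) = (\<Sum>A\<in>Pow E. (-1) ^ card A * (\<Prod>e\<in>A. ?m c e))"
      by (simp only: prod_uminus prod.neutral_const mult_1_right)
  qed
  also have "\<dots> = (\<Sum>A\<in>Pow E. \<Sum>c\<in>?U. (-1) ^ card A * (\<Prod>e\<in>A. ?m c e))"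
    by (rule sum.swap)
  also have "\<dots> = (\<Sum>A\<in>Pow E. (-1) ^ card A * real q ^ num_components V A)"
  proof (rule sum.cong[OF refl])
    fix A assume A: "A \<in> Pow E"
    have "(\<Sum>c\<in>?U. (-1) ^ card A * (\<Prod>e\<in>A. ?m c e)) =
        (-1) ^ card A * (\<Sum>c\<in>?U. of_bool (\<forall>u v. {u, v} \<in> A \<longrightarrow> c u = c v))"
      using A by (simp add: 2 sum_distrib_left)
    also have "(\<Sum>c\<in>?U. of_bool (\<forall>u v. {u, v} \<in> A \<longrightarrow> c u = c v)) =
        real (card {c \<in> ?U. \<forall>u v. {u, v} \<in> A \<longrightarrow> c u = c v})"
      using finU by (subst sum_of_bool_eq) (auto intro!: arg_cong[of _ _ card])
    also have "\<dots> = real q ^ num_components V A"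
      using card_monochromatic_colorings[OF V, of A q] A E by auto
    finally show "(\<Sum>c\<in>?U. (-1) ^ card A * (\<Prod>e\<in>A. ?m c e)) = (-1) ^ card A * real q ^ num_components V A" .
  qed
  finally show ?thesis .
qed

text \<open>The expansion holds for every natural number of colours, hence as an identity of
  polynomials; this is what permits the evaluation at \<open>- s\<close>.\<close>

lemma poly_chromatic_poly_eq_sum:
  assumes V: "finite V" and E: "\<forall>e\<in>E. e \<subseteq> V \<and> card e = 2"
  shows "poly (chromatic_poly V E) x = (\<Sum>A\<in>Pow E. (-1) ^ card A * x ^ num_components V A)"
proof -
  let ?P = "\<Sum>A\<in>Pow E. Polynomial.monom ((-1) ^ card A) (num_components V A) :: real poly"
  have "\<forall>q. poly ?P (of_nat q) = of_nat (card (proper_colorings V E q))"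
    using card_proper_colorings_subgraph_expansion[OF assms] by (simp add: poly_sum poly_monom)
  moreover have "\<forall>q. poly (chromatic_poly V E) (of_nat q) = of_nat (card (proper_colorings V E q))"
    using poly_chromatic_poly V E by blast
  ultimately have "chromatic_poly V E = ?P"
    using ex1_chromatic_poly[OF V] E by blast
  then show ?thesis by (simp add: poly_sum poly_monom)
qed

text \<open>A new edge merges at most the classes of its two ends: away from the old class of u,
  passing to the coarser class is injective.\<close>

lemma num_components_insert_edge:
  assumes V: "finite V" and A: "\<forall>e\<in>A. e \<subseteq> V" and uv: "u \<in> V" "v \<in> V"
  shows "num_components V A \<le> num_components V (insert {u, v} A) + 1"
proof -
  let ?R = "reachability V A" and ?R' = "reachability V (insert {u, v} A)"
  \<comment> \<open>The new equivalence written out: the old one, with the classes of u and v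
    joined.\<close>
  define S where "S = ?R \<union> (?R `` {u, v}) \<times> (?R `` {u, v})"
  have eq: "equiv V ?R" and eq': "equiv V ?R'"
    using A uv by (auto intro!: equiv_reachability)
  have symR: "(b, a) \<in> ?R" if "(a, b) \<in> ?R" for a b
    using eq that by (meson equiv_def symD)
  have transR: "(a, c) \<in> ?R" if "(a, b) \<in> ?R" "(b, c) \<in> ?R" for a b c
    using eq that by (meson equiv_def transD)
  have reflR: "(a, a) \<in> ?R" if "a \<in> V" for a
    using eq that by (meson equiv_def refl_onD)
  have "(a, b) \<in> S" if ab: "(a, b) \<in> ?R'" for a b
  proof -
    have "(a, b) \<in> {(x, y). {x, y} \<in> insert {u, v} A}\<^sup>*" and a: "a \<in> V"
      using ab by (auto simp: reachability_def)
    then show ?thesis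
    proof induction
      case base
      then show ?case using reflR[OF a] by (simp add: S_def)
    next
      case (step y z)
      let ?D = "?R `` {u, v}"
      have "y \<in> ?D \<and> z \<in> ?D \<or> (y, z) \<in> ?R"
      proof (cases "{y, z} = {u, v}")
        case True
        then show ?thesis using reflR[OF uv(1)] reflR[OF uv(2)] by (auto simp: doubleton_eq_iff)
      next
        case False
        then have "{y, z} \<in> A" using step.hyps(2) by auto
        then show ?thesis using A by (auto simp: reachability_def)
      qed
      moreover have cl: "d \<in> ?D" if "(c, d) \<in> ?R" "c \<in> ?D" for c d
        using that transR by (auto simp: Image_iff)
      moreover have "(a, y) \<in> ?R \<or> a \<in> ?D \<and> y \<in> ?D"
        using step.IH[OF step.prems] by (auto simp only: S_def)
      ultimately have "(a, z) \<in> ?R \<or> a \<in> ?D \<and> z \<in> ?D"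
        using symR transR by metis
      then show ?case by (auto simp only: S_def)
    qed
  qed
  then have R'S: "?R' \<subseteq> S" by auto
  have "{(x, y). {x, y} \<in> A}\<^sup>* \<subseteq> {(x, y). {x, y} \<in> insert {u, v} A}\<^sup>*"
    by (rule rtrancl_mono) auto
  then have RR': "?R \<subseteq> ?R'"
    by (auto simp: reachability_def)
  have transR': "(a, c) \<in> ?R'" if "(a, b) \<in> ?R'" "(b, c) \<in> ?R'" for a b c
    using eq' that by (meson equiv_def transD)
  let ?Q = "V // ?R" and ?Q' = "V // ?R'"
  have fin: "finite ?Q" "finite ?Q'"
    using V eq eq' finite_quotient equiv_type by metis+
  have inj: "inj_on (\<lambda>X. ?R' `` X) (?Q - {?R `` {u}})"
  proof (rule inj_onI)
    fix X Y assume X: "X \<in> ?Q - {?R `` {u}}" and Y: "Y \<in> ?Q - {?R `` {u}}" and e: "?R' `` X = ?R' `` Y"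
    obtain x where x: "x \<in> V" "X = ?R `` {x}" using X by (auto elim: quotientE)
    obtain y where y: "y \<in> V" "Y = ?R `` {y}" using Y by (auto elim: quotientE)
    have "y \<in> ?R' `` Y" using y reflR RR' by auto
    then obtain x' where x': "(x, x') \<in> ?R" "(x', y) \<in> ?R'" using e x by auto
    have "(x, y) \<in> S" using transR'[of x x' y] x' RR' R'S by blast
    moreover have "(u, x) \<notin> ?R" "(u, y) \<notin> ?R"
      using X Y x y equiv_class_eq[OF eq, of u x] equiv_class_eq[OF eq, of u y] by auto
    ultimately have "(x, y) \<in> ?R"
      using symR transR unfolding S_def by blast
    then show "X = Y" using x y eq by (simp add: equiv_class_eq)
  qed
  have "(\<lambda>X. ?R' `` X) ` (?Q - {?R `` {u}}) \<subseteq> ?Q'"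
  proof
    fix Z assume "Z \<in> (\<lambda>X. ?R' `` X) ` (?Q - {?R `` {u}})"
    then obtain x where x: "x \<in> V" "Z = ?R' `` (?R `` {x})" by (auto elim: quotientE)
    have "?R' `` (?R `` {x}) = ?R' `` {x}"
      using x reflR RR' transR' by blast
    then show "Z \<in> ?Q'" using x by (simp add: quotientI)
  qed
  then have "card (?Q - {?R `` {u}}) \<le> card ?Q'"
    using card_inj_on_le[OF inj] fin by blast
  moreover have "card ?Q \<le> card (?Q - {?R `` {u}}) + 1"
    using fin(1) by (auto simp: card_Diff_singleton_if)
  ultimately show ?thesis by (simp add: num_components_def)
qed

text \<open>Guarantees that the exponent of \<open>y - 1\<close> in \<open>tutte\<close>, a
  truncated difference, is the true nullity: starting from \<open>card V\<close> singletons, each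
  edge lowers the number of components by at most one.\<close>

lemma card_le_num_components:
  assumes V: "finite V" and A: "finite A" "\<forall>e\<in>A. e \<subseteq> V \<and> card e = 2"
  shows "card V \<le> num_components V A + card A"
  using A
proof (induction A)
  case empty
  have "reachability V {} = Id_on V" by (auto simp: reachability_def)
  then have "V // reachability V {} = (\<lambda>v. {v}) ` V" by (auto simp: quotient_def)
  then show ?case by (simp add: num_components_def card_image)
next
  case (insert e A)
  then obtain u v where e: "e = {u, v}" by (auto simp: card_2_iff)
  have "num_components V A \<le> num_components V (insert {u, v} A) + 1"
    using V insert.prems e by (intro num_components_insert_edge) auto
  then show ?case using insert e by auto
qed

lemma num_components_connected:
  assumes "connected_graph V E"
  shows "num_components V E = 1"
proof -
  obtain v where v: "v \<in> V" using assms by (auto simp: connected_graph_def)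
  have "reachability V E = V \<times> V"
    using assms by (auto simp: connected_graph_def reachability_def)
  then have "V // reachability V E = {V}" using v by (auto simp: quotient_def)
  then show ?thesis by (simp add: num_components_def)
qed

text \<open>At \<open>y = 0\<close> and \<open>x = 1 + s\<close> each edge set contributes a sign
  and a power of s. The extra factor s raises the exponent to the number of components, and the sum
  agrees term by term with the subgraph expansion at \<open>- s\<close>.\<close>

lemma chromatic_poly_eq_tutte:
  assumes V: "finite V" and E: "\<forall>e\<in>E. e \<subseteq> V \<and> card e = 2" and conn: "connected_graph V E"
  shows "(-1) ^ card V * poly (chromatic_poly V E) (- s) = s * tutte V E (1 + s) 0"
proof -
  have finE: "finite E" using V E by (intro finite_subset[of E "Pow V"]) auto
  have "s * tutte V E (1 + s) 0 =
      (\<Sum>A\<in>Pow E. s * s ^ (num_components V A - 1) * (-1) ^ (num_components V A + card A - card V))"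
    by (simp add: tutte_def num_components_connected[OF conn] sum_distrib_left mult.assoc)
  also have "\<dots> = (\<Sum>A\<in>Pow E. (-1) ^ card V * ((-1) ^ card A * (- s) ^ num_components V A))"
  proof (rule sum.cong[OF refl])
    fix A assume A: "A \<in> Pow E"
    let ?c = "num_components V A"
    have le: "card V \<le> ?c + card A"
      using A E finE by (intro card_le_num_components V) (auto intro: finite_subset)
    have "V \<noteq> {}" using conn by (simp add: connected_graph_def)
    then have "V // reachability V A \<noteq> {}" by (simp add: quotient_def)
    moreover have "finite (V // reachability V A)"
      using V A E by (metis PowD equiv_reachability equiv_type finite_quotient subsetD)
    ultimately have c: "?c > 0" by (simp add: num_components_def card_gt_0_iff)
    \<comment> \<open>Only parity counts: subtracting and adding \<open>card V\<close> differ by an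
      even number, provided that the subtraction is exact.\<close>
    have "(-1 :: real) ^ (?c + card A - card V) = (-1) ^ (?c + card A + card V)"
    proof -
      obtain k where "?c + card A = card V + k" using le le_Suc_ex by blast
      then show ?thesis by (simp add: power_add flip: power2_eq_square power_mult mult.assoc)
    qed
    moreover have "s * s ^ (?c - 1) = s ^ ?c" using c by (cases ?c) auto
    ultimately show "s * s ^ (?c - 1) * (-1) ^ (?c + card A - card V) =
        (-1) ^ card V * ((-1) ^ card A * (- s) ^ ?c)"
      by (simp only: power_add power_minus[of s] mult_ac)
  qed
  finally show ?thesis
    by (simp add: poly_chromatic_poly_eq_sum[OF V E] sum_distrib_left)
qed

section \<open>Well-formedness and connectedness of blow-ups\<close>

lemma blowup_edges_wf:
  assumes "\<forall>e\<in>E. e \<subseteq> V \<and> card e = 2"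
  shows "\<forall>e\<in>blowup_edges E l. e \<subseteq> blowup_verts V l \<and> card e = 2"
proof
  fix e assume "e \<in> blowup_edges E l"
  then obtain i j a b where e: "e = {(i, a), (j, b)}" "{i, j} \<in> E" "a < l i" "b < l j"
    by (auto simp: blowup_edges_def)
  then have "i \<noteq> j" using assms by fastforce
  then show "e \<subseteq> blowup_verts V l \<and> card e = 2"
    using e assms by (auto simp: blowup_verts_def)
qed

text \<open>Copies of the same vertex are not adjacent, so it is walks of positive length that lift
  to the blow-up. Hence the closure \<open>?A\<^sup>+\<close> and the second vertex, through which
  every vertex has a closed walk.\<close>

lemma connected_blowup:
  assumes E: "\<forall>e\<in>E. e \<subseteq> V" and conn: "connected_graph V E" and uv: "u \<in> V" "v \<in> V" "u \<noteq> v"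
    and l: "\<And>i. i \<in> V \<Longrightarrow> l i > 0"
  shows "connected_graph (blowup_verts V l) (blowup_edges E l)"
proof -
  let ?A = "{(x, y). {x, y} \<in> E}" and ?B = "{(x, y). {x, y} \<in> blowup_edges E l}"
  have *: "((i, a), (j, b)) \<in> ?B\<^sup>*" if "(i, j) \<in> ?A\<^sup>+" "a < l i" "b < l j" for i j a b
    using that
  proof (induction arbitrary: b)
    case (base y)
    then have "{(i, a), (y, b)} \<in> blowup_edges E l"
      unfolding blowup_edges_def by blast
    then show ?case by blast
  next
    case (step y z)
    have "y \<in> V" using E step.hyps by auto
    then have p: "((i, a), (y, 0)) \<in> ?B\<^sup>*" using step.IH step.prems l by auto
    have "{(y, 0), (z, b)} \<in> blowup_edges E l"
      using step.hyps(2) step.prems l[OF \<open>y \<in> V\<close>] unfolding blowup_edges_def by blast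
    then have "((y, 0), (z, b)) \<in> ?B" by simp
    with p show ?case by (rule rtrancl_into_rtrancl)
  qed
  have ne: "(i, j) \<in> ?A\<^sup>+" if "i \<in> V" "j \<in> V" "i \<noteq> j" for i j
  proof -
    have "(i, j) \<in> ?A\<^sup>*" using conn that by (auto simp: connected_graph_def reachability_def)
    then show ?thesis using that by (simp add: rtrancl_eq_or_trancl)
  qed
  have all: "(i, j) \<in> ?A\<^sup>+" if "i \<in> V" "j \<in> V" for i j
  proof (cases "i = j")
    case True
    obtain k where "k \<in> V" "k \<noteq> i" using uv by metis
    then have "(i, k) \<in> ?A\<^sup>+" "(k, i) \<in> ?A\<^sup>+" using ne that True by blast+
    then have "(i, i) \<in> ?A\<^sup>+" by (rule trancl_trans)
    then show ?thesis using True by simp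
  next
    case False
    then show ?thesis by (rule ne[OF that])
  qed
  show ?thesis
    unfolding connected_graph_def
  proof (intro conjI ballI)
    have "(u, 0) \<in> blowup_verts V l" using uv l by (auto simp: blowup_verts_def)
    then show "blowup_verts V l \<noteq> {}" by blast
    fix x y assume xy: "x \<in> blowup_verts V l" "y \<in> blowup_verts V l"
    then obtain i a j b where "x = (i, a)" "y = (j, b)" "i \<in> V" "j \<in> V" "a < l i" "b < l j"
      by (auto simp: blowup_verts_def)
    then have "(x, y) \<in> ?B\<^sup>*" using *[OF all] by blast
    then show "(x, y) \<in> reachability (blowup_verts V l) (blowup_edges E l)"
      using xy by (simp add: reachability_def)
  qed
qed

subsection \<open>The exponential generating function of blow-up colourings\<close>

text \<open>Introduced because its exponential generating function in n is
  \<open>(exp x - 1) ^ card S\<close>, the shape of the factors of \<open>B_fun\<close>.\<close>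

definition num_surj :: "nat \<Rightarrow> 'a set \<Rightarrow> nat" where
  "num_surj n S = card {f \<in> {..<n} \<rightarrow>\<^sub>E S. f ` {..<n} = S}"

lemma sum_num_surj:
  assumes S: "finite S"
  shows "(\<Sum>T\<in>Pow S. num_surj n T) = card S ^ n"
proof -
  let ?A = "{..<n} \<rightarrow>\<^sub>E S"
  have fin: "finite ?A" using S by (simp add: finite_PiE)
  have "card ?A = (\<Sum>f\<in>?A. 1)" by simp
  also have "\<dots> = (\<Sum>T\<in>Pow S. \<Sum>f | f \<in> ?A \<and> f ` {..<n} = T. 1)"
    by (rule sum.group[symmetric]) (use S fin in auto)
  also have "\<dots> = (\<Sum>T\<in>Pow S. num_surj n T)"
  proof (rule sum.cong[OF refl])
    fix T assume "T \<in> Pow S"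
    then have "{f \<in> ?A. f ` {..<n} = T} = {f \<in> {..<n} \<rightarrow>\<^sub>E T. f ` {..<n} = T}"
      by (auto simp: PiE_iff)
    then show "(\<Sum>f | f \<in> ?A \<and> f ` {..<n} = T. 1) = num_surj n T"
      by (simp add: num_surj_def)
  qed
  finally show ?thesis by (simp add: card_funcsetE)
qed

text \<open>Summed over all subsets of S, both sides become the coefficient of
  \<open>exp (card S * x)\<close>: one by the binomial theorem, the other by sorting maps according
  to their image. The induction hypothesis removes the proper subsets.\<close>

lemma fps_nth_exp_minus_one_power:
  fixes x :: complex
  assumes "finite S"
  shows "fps_nth ((fps_exp x - 1) ^ card S) n = of_nat (num_surj n S) * x ^ n / fact n"
  using assms
proof (induction S rule: finite_psubset_induct)
  case (psubset S)
  let ?g = "fps_exp x - 1"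
  have fin: "finite (Pow S)" using psubset.hyps by simp
  have "(\<Sum>T\<in>Pow S. ?g ^ card T) = (\<Prod>t\<in>S. ?g + 1)"
    by (subst prod_add[OF psubset.hyps]) simp
  also have "\<dots> = fps_exp (of_nat (card S) * x)"
    by (simp add: fps_exp_power_mult)
  finally have "(\<Sum>T\<in>Pow S. fps_nth (?g ^ card T) n) = (of_nat (card S) * x) ^ n / fact n"
    by (simp flip: fps_sum_nth)
  also have "\<dots> = of_nat (\<Sum>T\<in>Pow S. num_surj n T) * x ^ n / fact n"
    by (simp add: sum_num_surj[OF psubset.hyps] power_mult_distrib)
  also have "\<dots> = (\<Sum>T\<in>Pow S. of_nat (num_surj n T) * x ^ n / fact n)"
    by (simp add: sum_distrib_right sum_divide_distrib)
  finally have "fps_nth (?g ^ card S) n + (\<Sum>T\<in>Pow S - {S}. fps_nth (?g ^ card T) n) =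
     of_nat (num_surj n S) * x ^ n / fact n + (\<Sum>T\<in>Pow S - {S}. of_nat (num_surj n T) * x ^ n / fact n)"
    unfolding sum.remove[OF fin Pow_top] .
  moreover have "(\<Sum>T\<in>Pow S - {S}. fps_nth (?g ^ card T) n) =
      (\<Sum>T\<in>Pow S - {S}. of_nat (num_surj n T) * x ^ n / fact n)"
    by (rule sum.cong[OF refl], rule psubset.IH) auto
  ultimately show ?case by (simp only: add_right_cancel)
qed

text \<open>\<open>S i\<close> is the set of colours used on the block of i. Read the other way
  round, each colour selects the independent set of those i whose block uses it.\<close>

definition image_families :: "'a set \<Rightarrow> 'a set set \<Rightarrow> nat \<Rightarrow> ('a \<Rightarrow> nat set) set" where
  "image_families V E q = {S \<in> V \<rightarrow>\<^sub>E Pow {..<q}. \<forall>i j. {i, j} \<in> E \<longrightarrow> S i \<inter> S j = {}}"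

lemma finite_image_families: "finite V \<Longrightarrow> finite (image_families V E q)"
  by (auto simp: image_families_def intro!: finite_PiE)

text \<open>Blocks are independent and adjacent blocks are completely joined, so properness only
  says that adjacent blocks have disjoint images. Once the images are fixed, each block carries an
  arbitrary surjection.\<close>

lemma card_proper_colorings_blowup:
  assumes V: "finite V" and E: "\<forall>e\<in>E. e \<subseteq> V \<and> card e = 2"
  shows "card (proper_colorings (blowup_verts V l) (blowup_edges E l) q) =
    (\<Sum>S\<in>image_families V E q. \<Prod>i\<in>V. num_surj (l i) (S i))"
proof -
  let ?W = "blowup_verts V l"
  let ?C = "proper_colorings ?W (blowup_edges E l) q"
  let ?im = "\<lambda>c. \<lambda>i\<in>V. (\<lambda>a. c (i, a)) ` {..<l i}"
  have "finite ?W" using V by (simp add: blowup_verts_def)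
  then have finC: "finite ?C"
    by (auto simp: proper_colorings_def intro!: finite_subset[OF _ finite_PiE[of ?W "\<lambda>_. {..<q}"]])
  have rng: "c (i, a) < q" if "c \<in> ?C" "i \<in> V" "a < l i" for c i a
    using that by (auto simp: proper_colorings_def blowup_verts_def PiE_iff)
  have proper: "c (i, a) \<noteq> c (j, b)" if "c \<in> ?C" "{i, j} \<in> E" "a < l i" "b < l j" for c i j a b
  proof -
    have "{(i, a), (j, b)} \<in> blowup_edges E l"
      using that unfolding blowup_edges_def by blast
    then show ?thesis using that(1) by (auto simp: proper_colorings_def)
  qed
  have im: "?im ` ?C \<subseteq> image_families V E q"
  proof
    fix S assume "S \<in> ?im ` ?C"
    then obtain c where c: "c \<in> ?C" and S: "S = ?im c" by auto
    have "S \<in> V \<rightarrow>\<^sub>E Pow {..<q}" using rng[OF c] by (auto simp: S)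
    moreover have "S i \<inter> S j = {}" if ij: "{i, j} \<in> E" for i j
    proof -
      have "i \<in> V" "j \<in> V" using ij E by auto
      then show ?thesis using proper[OF c ij] by (auto simp: S)
    qed
    ultimately show "S \<in> image_families V E q" by (simp add: image_families_def)
  qed
  have "card ?C = (\<Sum>c\<in>?C. 1)" by simp
  also have "\<dots> = (\<Sum>S\<in>image_families V E q. \<Sum>c | c \<in> ?C \<and> ?im c = S. 1)"
    by (rule sum.group[OF finC finite_image_families[OF V] im, symmetric])
  also have "\<dots> = (\<Sum>S\<in>image_families V E q. \<Prod>i\<in>V. num_surj (l i) (S i))"
  proof (rule sum.cong[OF refl])
    fix S assume S: "S \<in> image_families V E q"
    let ?P = "PiE V (\<lambda>i. {f \<in> {..<l i} \<rightarrow>\<^sub>E S i. f ` {..<l i} = S i})"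
    have "bij_betw (\<lambda>c. \<lambda>i\<in>V. \<lambda>a\<in>{..<l i}. c (i, a)) {c \<in> ?C. ?im c = S} ?P"
    proof (rule bij_betw_byWitness[where f' = "\<lambda>f. \<lambda>w\<in>?W. f (fst w) (snd w)"])
      show "\<forall>c\<in>{c \<in> ?C. ?im c = S}. (\<lambda>w\<in>?W. (\<lambda>i\<in>V. \<lambda>a\<in>{..<l i}. c (i, a)) (fst w) (snd w)) = c"
      proof
        fix c assume "c \<in> {c \<in> ?C. ?im c = S}"
        then have "c \<in> ?W \<rightarrow>\<^sub>E {..<q}" by (auto simp: proper_colorings_def)
        then have "c = restrict c ?W" by (metis PiE_restrict)
        then show "(\<lambda>w\<in>?W. (\<lambda>i\<in>V. \<lambda>a\<in>{..<l i}. c (i, a)) (fst w) (snd w)) = c"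
          by (subst \<open>c = restrict c ?W\<close>, intro restrict_ext) (auto simp: blowup_verts_def)
      qed
      show "\<forall>f\<in>?P. (\<lambda>i\<in>V. \<lambda>a\<in>{..<l i}. (\<lambda>w\<in>?W. f (fst w) (snd w)) (i, a)) = f"
      proof
        fix f assume f: "f \<in> ?P"
        show "(\<lambda>i\<in>V. \<lambda>a\<in>{..<l i}. (\<lambda>w\<in>?W. f (fst w) (snd w)) (i, a)) = f"
        proof
          fix i
          show "(\<lambda>i\<in>V. \<lambda>a\<in>{..<l i}. (\<lambda>w\<in>?W. f (fst w) (snd w)) (i, a)) i = f i"
          proof (cases "i \<in> V")
            case True
            then have "f i \<in> {..<l i} \<rightarrow>\<^sub>E S i" using f by (auto simp: PiE_iff)
            then have fi: "f i = restrict (f i) {..<l i}" by (metis PiE_restrict)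
            have "(\<lambda>i\<in>V. \<lambda>a\<in>{..<l i}. (\<lambda>w\<in>?W. f (fst w) (snd w)) (i, a)) i = restrict (f i) {..<l i}"
              using True by (auto simp: blowup_verts_def restrict_def fun_eq_iff)
            then show ?thesis by (simp only: fi[symmetric])
          next
            case False
            then show ?thesis using PiE_arb[OF f False] by simp
          qed
        qed
      qed
      show "(\<lambda>c. \<lambda>i\<in>V. \<lambda>a\<in>{..<l i}. c (i, a)) ` {c \<in> ?C. ?im c = S} \<subseteq> ?P"
      proof
        fix f assume "f \<in> (\<lambda>c. \<lambda>i\<in>V. \<lambda>a\<in>{..<l i}. c (i, a)) ` {c \<in> ?C. ?im c = S}"
        then obtain c where c: "c \<in> ?C" "?im c = S" and f: "f = (\<lambda>i\<in>V. \<lambda>a\<in>{..<l i}. c (i, a))" by auto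
        have "S i = (\<lambda>a. c (i, a)) ` {..<l i}" if "i \<in> V" for i
          using fun_cong[OF c(2), of i] that by simp
        then show "f \<in> ?P" unfolding f by (intro PiE_I) auto
      qed
      show "(\<lambda>f. \<lambda>w\<in>?W. f (fst w) (snd w)) ` ?P \<subseteq> {c \<in> ?C. ?im c = S}"
      proof
        fix c assume "c \<in> (\<lambda>f. \<lambda>w\<in>?W. f (fst w) (snd w)) ` ?P"
        then obtain f where f: "f \<in> ?P" and c: "c = (\<lambda>w\<in>?W. f (fst w) (snd w))" by auto
        have fi: "f i ` {..<l i} = S i" if "i \<in> V" for i
          using f that by (auto simp: PiE_iff)
        have cv: "c (i, a) = f i a" if "i \<in> V" "a < l i" for i a
          using that by (simp add: c blowup_verts_def)
        have mem: "f i a \<in> S i" if "i \<in> V" "a < l i" for i a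
          using fi[OF that(1)] that(2) by blast
        have Sq: "S i \<subseteq> {..<q}" if "i \<in> V" for i
          using S that by (auto simp: image_families_def)
        have "?im c = S"
        proof
          fix i
          show "?im c i = S i"
          proof (cases "i \<in> V")
            case True
            have "(\<lambda>a. c (i, a)) ` {..<l i} = f i ` {..<l i}"
              by (rule image_cong) (use cv[OF True] in auto)
            then show ?thesis using True fi by simp
          next
            case False
            have "S \<in> V \<rightarrow>\<^sub>E Pow {..<q}" using S by (simp add: image_families_def)
            then show ?thesis using PiE_arb[of S V _ i] False by simp
          qed
        qed
        moreover have "c \<in> ?C"
          unfolding proper_colorings_def
        proof (intro CollectI conjI allI impI)
          show "c \<in> ?W \<rightarrow>\<^sub>E {..<q}"
          proof (rule PiE_I)
            fix w assume "w \<in> ?W"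
            then obtain i a where w: "w = (i, a)" "i \<in> V" "a < l i" by (auto simp: blowup_verts_def)
            have "f i a \<in> {..<q}" using mem[OF w(2,3)] Sq[OF w(2)] by (rule subsetD[rotated])
            then show "c w \<in> {..<q}" by (simp only: w(1) cv[OF w(2,3)])
          qed (simp add: c)
          fix u v assume "{u, v} \<in> blowup_edges E l"
          then obtain i j a b where uv: "{u, v} = {(i, a), (j, b)}" "{i, j} \<in> E" "a < l i" "b < l j"
            unfolding blowup_edges_def by blast
          have V2: "i \<in> V" "j \<in> V" using uv(2) E by auto
          have "S i \<inter> S j = {}" using S uv(2) by (auto simp: image_families_def)
          then have "f i a \<noteq> f j b" using mem[OF V2(1) uv(3)] mem[OF V2(2) uv(4)] by auto
          then have "c (i, a) \<noteq> c (j, b)" using cv V2 uv by simp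
          then show "c u \<noteq> c v" using uv(1) by (auto simp: doubleton_eq_iff)
        qed
        ultimately show "c \<in> {c \<in> ?C. ?im c = S}" by simp
      qed
    qed
    then have "card {c \<in> ?C. ?im c = S} = card ?P" by (rule bij_betw_same_card)
    then show "(\<Sum>c | c \<in> ?C \<and> ?im c = S. 1) = (\<Prod>i\<in>V. num_surj (l i) (S i))"
      using V by (simp add: card_PiE num_surj_def)
  qed
  finally show ?thesis .
qed

text \<open>The q-th power sums over q-tuples of independent sets. Transposing the incidence between
  colours and vertices turns tuples into families and collects \<open>g i\<close> once for every
  colour in \<open>S i\<close>.\<close>

lemma independent_sets_gf_power:
  fixes g :: "'a \<Rightarrow> 'b::comm_ring_1"
  assumes V: "finite V" and E: "\<forall>e\<in>E. e \<subseteq> V \<and> card e = 2"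
  shows "(\<Sum>I\<in>independent_sets V E. \<Prod>i\<in>I. g i) ^ q = (\<Sum>S\<in>image_families V E q. \<Prod>i\<in>V. g i ^ card (S i))"
proof -
  let ?I = "independent_sets V E"
  have finI: "finite ?I" using V by (auto simp: independent_sets_def)
  have "(\<Sum>I\<in>?I. \<Prod>i\<in>I. g i) ^ q = (\<Prod>t<q. \<Sum>I\<in>?I. \<Prod>i\<in>I. g i)" by simp
  also have "\<dots> = (\<Sum>f\<in>{..<q} \<rightarrow>\<^sub>E ?I. \<Prod>t<q. \<Prod>i\<in>f t. g i)"
    using finI by (subst prod_sum_PiE) auto
  also have "\<dots> = (\<Sum>f\<in>{..<q} \<rightarrow>\<^sub>E ?I. \<Prod>i\<in>V. g i ^ card {t \<in> {..<q}. i \<in> f t})"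
  proof (rule sum.cong[OF refl])
    fix f assume f: "f \<in> {..<q} \<rightarrow>\<^sub>E ?I"
    have "(\<Prod>t<q. \<Prod>i\<in>f t. g i) = (\<Prod>t<q. \<Prod>i\<in>V. if i \<in> f t then g i else 1)"
    proof (rule prod.cong[OF refl])
      fix t assume "t \<in> {..<q}"
      then have "f t \<subseteq> V" using f by (auto simp: independent_sets_def PiE_iff)
      then have "f t = V \<inter> f t" by blast
      then have "(\<Prod>i\<in>f t. g i) = (\<Prod>i\<in>V \<inter> f t. g i)" by (rule arg_cong)
      also have "\<dots> = (\<Prod>i\<in>V. if i \<in> f t then g i else 1)" by (rule prod.inter_restrict[OF V])
      finally show "(\<Prod>i\<in>f t. g i) = (\<Prod>i\<in>V. if i \<in> f t then g i else 1)" .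
    qed
    also have "\<dots> = (\<Prod>i\<in>V. \<Prod>t<q. if i \<in> f t then g i else 1)" by (rule prod.swap)
    also have "\<dots> = (\<Prod>i\<in>V. g i ^ card {t \<in> {..<q}. i \<in> f t})"
    proof (rule prod.cong[OF refl])
      fix i
      have "(\<Prod>t<q. if i \<in> f t then g i else 1) = (\<Prod>t | t \<in> {..<q} \<and> i \<in> f t. g i)"
        by (rule prod.inter_filter[symmetric]) simp
      then show "(\<Prod>t<q. if i \<in> f t then g i else 1) = g i ^ card {t \<in> {..<q}. i \<in> f t}" by simp
    qed
    finally show "(\<Prod>t<q. \<Prod>i\<in>f t. g i) = (\<Prod>i\<in>V. g i ^ card {t \<in> {..<q}. i \<in> f t})" .
  qed
  also have "\<dots> = (\<Sum>S\<in>image_families V E q. \<Prod>i\<in>V. g i ^ card (S i))"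
  proof (rule sum.reindex_bij_witness[where
      i = "\<lambda>S. \<lambda>t\<in>{..<q}. {i \<in> V. t \<in> S i}" and j = "\<lambda>f. \<lambda>i\<in>V. {t \<in> {..<q}. i \<in> f t}"])
    fix f assume f: "f \<in> {..<q} \<rightarrow>\<^sub>E ?I"
    then have fV: "f t \<subseteq> V" if "t < q" for t
      using that by (auto simp: independent_sets_def PiE_iff)
    show "(\<lambda>t\<in>{..<q}. {i \<in> V. t \<in> (\<lambda>i\<in>V. {t \<in> {..<q}. i \<in> f t}) i}) = f" (is "?l = f")
    proof
      fix t show "?l t = f t"
      proof (cases "t < q")
        case True then show ?thesis using fV[OF True] by auto
      next
        case False then show ?thesis using PiE_arb[OF f, of t] by simp
      qed
    qed
    have "{t \<in> {..<q}. i \<in> f t} \<inter> {t \<in> {..<q}. j \<in> f t} = {}" if "{i, j} \<in> E" for i j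
    proof (rule ccontr)
      assume "{t \<in> {..<q}. i \<in> f t} \<inter> {t \<in> {..<q}. j \<in> f t} \<noteq> {}"
      then obtain t where t: "t < q" "i \<in> f t" "j \<in> f t" by blast
      then have "f t \<in> ?I" using f by (auto simp: PiE_iff)
      then show False using t that by (auto simp: independent_sets_def)
    qed
    moreover have "i \<in> V \<and> j \<in> V" if "{i, j} \<in> E" for i j
      using that E by auto
    ultimately show "(\<lambda>i\<in>V. {t \<in> {..<q}. i \<in> f t}) \<in> image_families V E q"
      unfolding image_families_def
    proof (intro CollectI conjI allI impI)
      fix i j assume disj: "\<And>i j. {i, j} \<in> E \<Longrightarrow> {t \<in> {..<q}. i \<in> f t} \<inter> {t \<in> {..<q}. j \<in> f t} = {}"
        and VV: "\<And>i j. {i, j} \<in> E \<Longrightarrow> i \<in> V \<and> j \<in> V" and ij: "{i, j} \<in> E"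
      show "(\<lambda>i\<in>V. {t \<in> {..<q}. i \<in> f t}) i \<inter> (\<lambda>i\<in>V. {t \<in> {..<q}. i \<in> f t}) j = {}"
        using disj[OF ij] VV[OF ij] by simp
    qed auto
    show "(\<Prod>i\<in>V. g i ^ card ((\<lambda>i\<in>V. {t \<in> {..<q}. i \<in> f t}) i)) =
        (\<Prod>i\<in>V. g i ^ card {t \<in> {..<q}. i \<in> f t})"
      by (rule prod.cong) simp_all
  next
    fix S assume S: "S \<in> image_families V E q"
    then have S': "S \<in> V \<rightarrow>\<^sub>E Pow {..<q}" by (simp add: image_families_def)
    then have Sq: "S i \<subseteq> {..<q}" if "i \<in> V" for i using that by (auto simp: PiE_iff)
    show "(\<lambda>i\<in>V. {t \<in> {..<q}. i \<in> (\<lambda>t\<in>{..<q}. {i \<in> V. t \<in> S i}) t}) = S" (is "?l = S")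
    proof
      fix i show "?l i = S i"
      proof (cases "i \<in> V")
        case True then show ?thesis using Sq[OF True] by auto
      next
        case False then show ?thesis using PiE_arb[OF S' False] by simp
      qed
    qed
    have "t \<notin> S u \<or> t \<notin> S v" if "{u, v} \<in> E" for t u v
      using S that by (force simp: image_families_def)
    then have "{i \<in> V. t \<in> S i} \<in> ?I" for t
      by (auto simp: independent_sets_def)
    then show "(\<lambda>t\<in>{..<q}. {i \<in> V. t \<in> S i}) \<in> {..<q} \<rightarrow>\<^sub>E ?I" by auto
  qed
  finally show ?thesis .
qed

text \<open>The multi-indices of total degree M. Extensionality makes them finite in number and lets
  equality be checked on J.\<close>

definition degs :: "'a set \<Rightarrow> nat \<Rightarrow> ('a \<Rightarrow> nat) set" where
  "degs J M = {l \<in> J \<rightarrow>\<^sub>E UNIV. sum l J = M}"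

lemma finite_degs:
  assumes "finite J"
  shows "finite (degs J M)"
proof (rule finite_subset)
  show "degs J M \<subseteq> J \<rightarrow>\<^sub>E {..M}"
    using assms by (auto simp: degs_def PiE_iff extensional_def member_le_sum)
  show "finite (J \<rightarrow>\<^sub>E {..M})" using assms by (simp add: finite_PiE)
qed

lemma fps_nth_prod_degs:
  fixes f :: "'a \<Rightarrow> 'b::comm_ring_1 fps"
  assumes "finite J"
  shows "fps_nth (\<Prod>i\<in>J. f i) M = (\<Sum>l\<in>degs J M. \<Prod>i\<in>J. fps_nth (f i) (l i))"
  using assms
proof (induction J arbitrary: M)
  case empty
  have "degs ({} :: 'a set) M = (if M = 0 then {\<lambda>_. undefined} else {})"
    by (auto simp: degs_def)
  then show ?case by simp
next
  case (insert j J)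
  have "fps_nth (\<Prod>i\<in>insert j J. f i) M = (\<Sum>k=0..M. fps_nth (f j) k * fps_nth (\<Prod>i\<in>J. f i) (M - k))"
    using insert by (simp add: fps_mult_nth)
  also have "\<dots> = (\<Sum>k=0..M. \<Sum>l\<in>degs J (M - k). fps_nth (f j) k * (\<Prod>i\<in>J. fps_nth (f i) (l i)))"
    by (simp add: insert.IH sum_distrib_left)
  also have "\<dots> = (\<Sum>(k, l)\<in>(SIGMA k:{0..M}. degs J (M - k)). fps_nth (f j) k * (\<Prod>i\<in>J. fps_nth (f i) (l i)))"
    using insert.hyps by (intro sum.Sigma) (auto intro: finite_degs)
  also have "\<dots> = (\<Sum>l\<in>degs (insert j J) M. \<Prod>i\<in>insert j J. fps_nth (f i) (l i))"
  proof (rule sum.reindex_bij_witness[where i = "\<lambda>l. (l j, l(j := undefined))" and j = "\<lambda>(k, l). l(j := k)"])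
    fix kl assume "kl \<in> (SIGMA k:{0..M}. degs J (M - k))"
    then obtain k l where kl: "kl = (k, l)" "k \<le> M" "l \<in> J \<rightarrow>\<^sub>E UNIV" "sum l J = M - k"
      by (auto simp: degs_def)
    have lj: "l j = undefined" by (rule PiE_arb[OF kl(3) insert.hyps(2)])
    then show "((case kl of (k, l) \<Rightarrow> l(j := k)) j, (case kl of (k, l) \<Rightarrow> l(j := k))(j := undefined)) = kl"
      using kl by (auto simp: fun_eq_iff)
    have eqs: "sum (l(j := k)) J = sum l J" using insert.hyps(2) by (intro sum.cong) auto
    have "l(j := k) \<in> insert j J \<rightarrow>\<^sub>E UNIV" using kl(3) by (simp add: PiE_iff extensional_def)
    moreover have "sum (l(j := k)) (insert j J) = k + sum l J"
      by (simp only: sum.insert[OF insert.hyps] eqs fun_upd_same)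
    ultimately show "(case kl of (k, l) \<Rightarrow> l(j := k)) \<in> degs (insert j J) M"
      using kl(2,4) by (simp add: degs_def kl(1))
    have "(\<Prod>i\<in>J. fps_nth (f i) ((l(j := k)) i)) = (\<Prod>i\<in>J. fps_nth (f i) (l i))"
      using insert.hyps(2) by (intro prod.cong) auto
    then show "(\<Prod>i\<in>insert j J. fps_nth (f i) ((case kl of (k, l) \<Rightarrow> l(j := k)) i)) =
        (case kl of (k, l) \<Rightarrow> fps_nth (f j) k * (\<Prod>i\<in>J. fps_nth (f i) (l i)))"
      by (simp only: kl(1) prod.case prod.insert[OF insert.hyps] fun_upd_same)
  next
    fix l assume "l \<in> degs (insert j J) M"
    then have l: "l \<in> insert j J \<rightarrow>\<^sub>E UNIV" "sum l (insert j J) = M" by (simp_all add: degs_def)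
    have "sum (l(j := undefined)) J = sum l J" using insert.hyps(2) by (intro sum.cong) auto
    moreover have "l j + sum l J = M" using l(2) by (simp only: sum.insert[OF insert.hyps])
    moreover have "l(j := undefined) \<in> J \<rightarrow>\<^sub>E UNIV" using l(1) by (auto simp: PiE_iff extensional_def)
    ultimately show "(l j, l(j := undefined)) \<in> (SIGMA k:{0..M}. degs J (M - k))"
      by (simp add: degs_def)
  qed auto
  finally show ?case .
qed

text \<open>The series of B along the line through x: the formal variable is the scale z in
  \<open>z * x i\<close>, so coefficient M is the homogeneous part of degree M at x.\<close>

definition B_fps :: "'a set \<Rightarrow> 'a set set \<Rightarrow> ('a \<Rightarrow> complex) \<Rightarrow> complex fps" where
  "B_fps V E x = (\<Sum>I\<in>independent_sets V E. \<Prod>i\<in>I. (fps_exp (x i) - 1))"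

text \<open>Each factor \<open>(exp (x i) - 1) ^ card (S i)\<close> counts surjections onto
  \<open>S i\<close>. Interchanging the sums over families and degrees leaves the colourings of the
  blow-up with block sizes l.\<close>

lemma B_fps_power_nth:
  assumes V: "finite V" and E: "\<forall>e\<in>E. e \<subseteq> V \<and> card e = 2"
  shows "fps_nth (B_fps V E x ^ q) M = (\<Sum>l\<in>degs V M.
     of_nat (card (proper_colorings (blowup_verts V l) (blowup_edges E l) q)) * (\<Prod>i\<in>V. x i ^ l i / fact (l i)))"
proof -
  have finS: "finite (S i)" if "S \<in> image_families V E q" "i \<in> V" for S i
    using that by (auto simp: image_families_def PiE_iff intro: finite_subset)
  have "fps_nth (B_fps V E x ^ q) M =
      (\<Sum>S\<in>image_families V E q. \<Sum>l\<in>degs V M. \<Prod>i\<in>V. fps_nth ((fps_exp (x i) - 1) ^ card (S i)) (l i))"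
    unfolding B_fps_def independent_sets_gf_power[OF V E] fps_sum_nth fps_nth_prod_degs[OF V] ..
  also have "\<dots> = (\<Sum>S\<in>image_families V E q. \<Sum>l\<in>degs V M.
      of_nat (\<Prod>i\<in>V. num_surj (l i) (S i)) * (\<Prod>i\<in>V. x i ^ l i / fact (l i)))"
    using finS by (intro sum.cong refl)
      (simp add: fps_nth_exp_minus_one_power prod.distrib[symmetric])
  also have "\<dots> = (\<Sum>l\<in>degs V M. \<Sum>S\<in>image_families V E q.
      of_nat (\<Prod>i\<in>V. num_surj (l i) (S i)) * (\<Prod>i\<in>V. x i ^ l i / fact (l i)))"
    by (rule sum.swap)
  also have "\<dots> = (\<Sum>l\<in>degs V M.
     of_nat (card (proper_colorings (blowup_verts V l) (blowup_edges E l) q)) * (\<Prod>i\<in>V. x i ^ l i / fact (l i)))"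
    by (simp only: card_proper_colorings_blowup[OF V E] of_nat_sum sum_distrib_right)
  finally show ?thesis .
qed

lemma B_fps_nth_0: 
  assumes V: "finite V"
  shows "fps_nth (B_fps V E x) 0 = 1"
proof -
  have fin: "finite (independent_sets V E)" using V by (auto simp: independent_sets_def)
  have "fps_nth (\<Prod>i\<in>I. (fps_exp (x i) - 1)) 0 = of_bool (I = {})" if "I \<in> independent_sets V E" for I
  proof -
    have "finite I" using that V by (auto simp: independent_sets_def intro: finite_subset)
    then show ?thesis
    proof (induction I)
      case (insert i I) then show ?case by (simp add: fps_mult_nth)
    qed simp
  qed
  then have "fps_nth (B_fps V E x) 0 = (\<Sum>I\<in>independent_sets V E. of_bool (I = {}))"
    by (simp add: B_fps_def fps_sum_nth)
  also have "\<dots> = (\<Sum>I\<in>{{} :: 'a set}. of_bool (I = {}))"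
    by (rule sum.mono_neutral_right[OF fin]) (auto simp: independent_sets_def)
  finally show ?thesis by simp
qed

text \<open>The power \<open>b\<close> to the \<open>t\<close> is the solution of \<open>\<phi>' b = t b' \<phi>\<close> with constant term 1; this
  recursion makes its coefficients polynomials in \<open>t\<close>, so that they are known once they are known
  for natural \<open>t\<close>.\<close>

lemma fps_power_ode_coeff_poly:
  fixes b :: "complex fps"
  assumes b: "fps_nth b 0 = 1"
  shows "\<exists>P. \<forall>\<phi> t. fps_nth \<phi> 0 = 1 \<and> fps_deriv \<phi> * b = fps_const t * fps_deriv b * \<phi> \<longrightarrow>
     fps_nth \<phi> M = poly P t"
proof (induction M rule: less_induct)
  case (less M)
  show ?case
  proof (cases M)
    case 0
    then show ?thesis by (intro exI[of _ 1]) auto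
  next
    case (Suc m)
    have "\<forall>k\<in>{..m}. \<exists>P. \<forall>\<phi> t. fps_nth \<phi> 0 = 1 \<and> fps_deriv \<phi> * b = fps_const t * fps_deriv b * \<phi> \<longrightarrow>
        fps_nth \<phi> k = poly P t"
      using less.IH Suc by auto
    from bchoice[OF this] obtain P where P: "\<And>k \<phi> t. k \<le> m \<Longrightarrow> fps_nth \<phi> 0 = 1 \<Longrightarrow>
        fps_deriv \<phi> * b = fps_const t * fps_deriv b * \<phi> \<Longrightarrow> fps_nth \<phi> k = poly (P k) t"
      by auto
    \<comment> \<open>Coefficient m of the equation with the top term
      \<open>fps_nth \<phi> (Suc m)\<close> isolated; its factor is \<open>Suc m\<close> since b has
      constant term 1.\<close>
    let ?R = "[:0, 1:] * (\<Sum>i=0..m. Polynomial.smult (of_nat (Suc i) * fps_nth b (Suc i)) (P (m - i)))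
       - (\<Sum>i=0..<m. Polynomial.smult (of_nat (Suc i) * fps_nth b (m - i)) (P (Suc i)))"
    have "fps_nth \<phi> M = poly (Polynomial.smult (1 / of_nat (Suc m)) ?R) t"
      if \<phi>: "fps_nth \<phi> 0 = 1" "fps_deriv \<phi> * b = fps_const t * fps_deriv b * \<phi>" for \<phi> t
    proof -
      have "(\<Sum>i=0..m. of_nat (Suc i) * fps_nth \<phi> (Suc i) * fps_nth b (m - i)) =
          t * (\<Sum>i=0..m. of_nat (Suc i) * fps_nth b (Suc i) * fps_nth \<phi> (m - i))"
      proof -
        have "fps_nth (fps_deriv \<phi> * b) m = t * fps_nth (fps_deriv b * \<phi>) m"
          by (simp only: \<phi>(2) mult.assoc fps_mult_left_const_nth)
        then show ?thesis by (simp add: fps_mult_nth)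
      qed
      moreover have "(\<Sum>i=0..m. of_nat (Suc i) * fps_nth \<phi> (Suc i) * fps_nth b (m - i)) =
         (\<Sum>i=0..<m. of_nat (Suc i) * fps_nth b (m - i) * poly (P (Suc i)) t) + of_nat (Suc m) * fps_nth \<phi> (Suc m)"
        using b P[OF _ \<phi>] by (simp add: sum.last_plus atLeast0_atMost_Suc atLeastLessThanSuc_atLeastAtMost[symmetric] mult_ac)
      moreover have "(\<Sum>i=0..m. of_nat (Suc i) * fps_nth b (Suc i) * fps_nth \<phi> (m - i)) =
          (\<Sum>i=0..m. of_nat (Suc i) * fps_nth b (Suc i) * poly (P (m - i)) t)"
        by (intro sum.cong refl) (simp add: P[OF _ \<phi>])
      ultimately have "of_nat (Suc m) * fps_nth \<phi> (Suc m) = poly ?R t"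
        by (simp add: poly_sum algebra_simps)
      then show ?thesis
        by (simp add: Suc field_simps del: of_nat_Suc)
    qed
    then show ?thesis by blast
  qed
qed

lemma fps_ode_power:
  fixes b :: "complex fps"
  shows "fps_deriv (b ^ q) * b = fps_const (of_nat q) * fps_deriv b * b ^ q"
proof (induction q)
  case (Suc q)
  have "fps_deriv (b ^ Suc q) * b = fps_deriv b * b ^ q * b + b * (fps_deriv (b ^ q) * b)"
    by (simp add: algebra_simps)
  also have "\<dots> = fps_const (of_nat (Suc q)) * fps_deriv b * b ^ Suc q"
  proof -
    have c: "fps_const (of_nat (Suc q) :: complex) = fps_const (of_nat q) + 1"
      by (rule fps_ext) simp
    show ?thesis unfolding Suc.IH c by (simp add: algebra_simps)
  qed
  finally show ?case .
qed simp

text \<open>The recursion yields one polynomial in the exponent, the chromatic polynomials another.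
  At natural exponents both count colourings, so they coincide, and the identity extends to every
  real t.\<close>

lemma B_fps_real_power_nth:
  assumes V: "finite V" and E: "\<forall>e\<in>E. e \<subseteq> V \<and> card e = 2"
    and \<phi>: "fps_nth \<phi> 0 = 1" "fps_deriv \<phi> * B_fps V E x = fps_const (of_real t) * fps_deriv (B_fps V E x) * \<phi>"
  shows "fps_nth \<phi> M = (\<Sum>l\<in>degs V M.
     of_real (poly (chromatic_poly (blowup_verts V l) (blowup_edges E l)) t) * (\<Prod>i\<in>V. x i ^ l i / fact (l i)))"
proof -
  let ?b = "B_fps V E x"
  let ?chi = "\<lambda>l. chromatic_poly (blowup_verts V l) (blowup_edges E l)"
  obtain P where P: "\<And>\<phi> t. fps_nth \<phi> 0 = 1 \<Longrightarrow> fps_deriv \<phi> * ?b = fps_const t * fps_deriv ?b * \<phi> \<Longrightarrow>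
     fps_nth \<phi> M = poly P t"
    using fps_power_ode_coeff_poly[OF B_fps_nth_0[OF V]] by blast
  let ?Q = "\<Sum>l\<in>degs V M. Polynomial.smult (\<Prod>i\<in>V. x i ^ l i / fact (l i)) (map_poly complex_of_real (?chi l))"
  have of_real_poly: "poly (map_poly complex_of_real p) (of_real y) = of_real (poly p y)" for p y
    by (induction p) (simp_all add: map_poly_pCons)
  have Q: "poly ?Q (of_real y) = (\<Sum>l\<in>degs V M. of_real (poly (?chi l) y) * (\<Prod>i\<in>V. x i ^ l i / fact (l i)))" for y
    by (simp add: poly_sum of_real_poly mult.commute)
  have "poly P (of_nat q) = poly ?Q (of_nat q)" for q
  proof -
    have W: "finite (blowup_verts V l)" "\<forall>e\<in>blowup_edges E l. e \<subseteq> blowup_verts V l" for l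
      using V E by (auto simp: blowup_verts_def blowup_edges_def)
    have "poly P (of_nat q) = fps_nth (?b ^ q) M"
    proof (rule P[symmetric, OF _ fps_ode_power])
      show "fps_nth (?b ^ q) 0 = 1" by (simp only: fps_nth_power_0 B_fps_nth_0[OF V] power_one)
    qed
    also have "\<dots> = poly ?Q (of_real (real q))"
      unfolding Q B_fps_power_nth[OF V E] by (simp add: poly_chromatic_poly[OF W])
    finally show ?thesis by simp
  qed
  then have "range (of_nat :: nat \<Rightarrow> complex) \<subseteq> {x. poly (P - ?Q) x = 0}" by auto
  moreover have "infinite (range (of_nat :: nat \<Rightarrow> complex))"
    by (simp add: range_inj_infinite inj_of_nat)
  ultimately have "infinite {x. poly (P - ?Q) x = 0}" by (rule infinite_super)
  then have "P - ?Q = 0" using poly_roots_finite by blast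
  then have "P = ?Q" by simp
  then show ?thesis using P[OF \<phi>] Q by simp
qed

subsection \<open>Integration over finite powers of the real line\<close>

abbreviation lborel_power :: "nat set \<Rightarrow> (nat \<Rightarrow> real) measure" where
  "lborel_power I \<equiv> Pi\<^sub>M I (\<lambda>_. lborel)"

interpretation lborel_power: product_sigma_finite "\<lambda>_ :: nat. lborel :: real measure"
  by standard

text \<open>One affine substitution per coordinate, with Tonelli's theorem in the induction
  step.\<close>

lemma nn_integral_lborel_power_scale:
  fixes f :: "(nat \<Rightarrow> real) \<Rightarrow> ennreal"
  assumes I: "finite I" and a: "a > 0" and f: "f \<in> borel_measurable (lborel_power I)"
  shows "(\<integral>\<^sup>+ x. f x \<partial>lborel_power I) = ennreal (a ^ card I) * (\<integral>\<^sup>+ x. f (\<lambda>i\<in>I. a * x i) \<partial>lborel_power I)"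
  using I f
proof (induction I arbitrary: f)
  case empty
  show ?case by (simp add: PiM_empty nn_integral_count_space_finite restrict_def)
next
  case (insert j I)
  note [measurable] = insert.prems
  have [measurable]: "(\<lambda>x. \<lambda>i\<in>insert j I. a * x i) \<in> lborel_power (insert j I) \<rightarrow>\<^sub>M lborel_power (insert j I)"
    by (intro measurable_restrict) measurable
  have [measurable]: "(\<lambda>x. \<lambda>i\<in>I. a * x i) \<in> lborel_power I \<rightarrow>\<^sub>M lborel_power I"
    by (intro measurable_restrict) measurable
  have "(\<integral>\<^sup>+ x. f x \<partial>lborel_power (insert j I)) = (\<integral>\<^sup>+ x. \<integral>\<^sup>+ y. f (x(j := y)) \<partial>lborel \<partial>lborel_power I)"
    by (rule lborel_power.product_nn_integral_insert[OF insert.hyps insert.prems])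
  also have "\<dots> = ennreal (a ^ card I) *
      (\<integral>\<^sup>+ x. \<integral>\<^sup>+ y. f ((\<lambda>i\<in>I. a * x i)(j := y)) \<partial>lborel \<partial>lborel_power I)"
  proof (rule insert.IH)
    have [measurable]: "(\<lambda>(x, y). x(j := y)) \<in> lborel_power I \<Otimes>\<^sub>M lborel \<rightarrow>\<^sub>M lborel_power (insert j I)"
      using measurable_add_dim[of j I "\<lambda>_. lborel :: real measure"] by simp
    show "(\<lambda>x. \<integral>\<^sup>+ y. f (x(j := y)) \<partial>lborel) \<in> borel_measurable (lborel_power I)"
      by measurable
  qed
  also have "(\<integral>\<^sup>+ x. \<integral>\<^sup>+ y. f ((\<lambda>i\<in>I. a * x i)(j := y)) \<partial>lborel \<partial>lborel_power I) =
      (\<integral>\<^sup>+ x. ennreal a * \<integral>\<^sup>+ y. f ((\<lambda>i\<in>insert j I. a * (x(j := y)) i)) \<partial>lborel \<partial>lborel_power I)"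
  proof (rule nn_integral_cong)
    fix x assume x: "x \<in> space (lborel_power I)"
    have "(\<lambda>i\<in>I. a * x i) \<in> space (lborel_power I)" by (simp add: space_PiM)
    then have [measurable]: "(\<lambda>y. f ((\<lambda>i\<in>I. a * x i)(j := y))) \<in> borel_measurable borel"
      using measurable_compose[OF measurable_fun_upd[of "insert j I" I j "\<lambda>_. (\<lambda>i\<in>I. a * x i)" lborel "\<lambda>_. lborel" "\<lambda>y. y"] insert.prems]
      by simp
    have "(\<integral>\<^sup>+ y. f ((\<lambda>i\<in>I. a * x i)(j := y)) \<partial>lborel) =
        ennreal \<bar>a\<bar> * (\<integral>\<^sup>+ y. f ((\<lambda>i\<in>I. a * x i)(j := 0 + a * y)) \<partial>lborel)"
      by (rule nn_integral_real_affine) (use a in auto)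
    moreover have "(\<lambda>i\<in>I. a * x i)(j := 0 + a * y) = (\<lambda>i\<in>insert j I. a * (x(j := y)) i)" for y
      using insert.hyps(2) by (auto simp: fun_eq_iff)
    ultimately show "(\<integral>\<^sup>+ y. f ((\<lambda>i\<in>I. a * x i)(j := y)) \<partial>lborel) =
        ennreal a * \<integral>\<^sup>+ y. f ((\<lambda>i\<in>insert j I. a * (x(j := y)) i)) \<partial>lborel"
      using a by simp
  qed
  also have "\<dots> = ennreal a * (\<integral>\<^sup>+ x. \<integral>\<^sup>+ y. f ((\<lambda>i\<in>insert j I. a * (x(j := y)) i)) \<partial>lborel \<partial>lborel_power I)"
  proof (rule nn_integral_cmult)
    have [measurable]: "(\<lambda>(x, y). x(j := y)) \<in> lborel_power I \<Otimes>\<^sub>M lborel \<rightarrow>\<^sub>M lborel_power (insert j I)"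
      using measurable_add_dim[of j I "\<lambda>_. lborel :: real measure"] by simp
    have [measurable]: "(\<lambda>x. f (\<lambda>i\<in>insert j I. a * x i)) \<in> borel_measurable (lborel_power (insert j I))"
      by measurable
    show "(\<lambda>x. \<integral>\<^sup>+ y. f ((\<lambda>i\<in>insert j I. a * (x(j := y)) i)) \<partial>lborel) \<in> borel_measurable (lborel_power I)"
      by measurable
  qed
  also have "(\<integral>\<^sup>+ x. \<integral>\<^sup>+ y. f ((\<lambda>i\<in>insert j I. a * (x(j := y)) i)) \<partial>lborel \<partial>lborel_power I) =
      (\<integral>\<^sup>+ x. f (\<lambda>i\<in>insert j I. a * x i) \<partial>lborel_power (insert j I))"
    by (rule lborel_power.product_nn_integral_insert[OF insert.hyps, symmetric]) measurable
  moreover have "ennreal (a ^ card (insert j I)) = ennreal (a ^ card I) * ennreal a"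
    using insert.hyps a by (simp add: ennreal_mult[symmetric] mult.commute)
  ultimately show ?case by (simp only: mult.assoc)
qed

section \<open>Triangular changes of variables\<close>

definition shear_map :: "nat \<Rightarrow> nat set \<Rightarrow> real \<Rightarrow> real \<Rightarrow> ((nat \<Rightarrow> real) \<Rightarrow> real) \<Rightarrow> (nat \<Rightarrow> real) \<Rightarrow> nat \<Rightarrow> real" where
  "shear_map j I a c m x = (\<lambda>i\<in>insert j I. if i = j then m x + c * x j else a * x i)"

lemma measurable_shear_map:
  assumes [measurable]: "m \<in> borel_measurable (lborel_power (insert j I))"
  shows "shear_map j I a c m \<in> lborel_power (insert j I) \<rightarrow>\<^sub>M lborel_power (insert j I)"
  unfolding shear_map_def by (rule measurable_restrict) (auto split: if_splits intro!: measurable_If)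

text \<open>The translation m of coordinate j does not depend on that coordinate, hence is invisible
  to the integral over it; the Jacobian is the product of the scales.\<close>

lemma nn_integral_shear_map:
  fixes f :: "(nat \<Rightarrow> real) \<Rightarrow> ennreal"
  assumes I: "finite I" "j \<notin> I" and a: "a > 0" and c: "c > 0"
    and f: "f \<in> borel_measurable (lborel_power (insert j I))"
    and m: "m \<in> borel_measurable (lborel_power (insert j I))"
    and dep: "\<And>x y. m (x(j := y)) = m x"
  shows "(\<integral>\<^sup>+ x. f x \<partial>lborel_power (insert j I)) =
    ennreal (a ^ card I * c) * (\<integral>\<^sup>+ x. f (shear_map j I a c m x) \<partial>lborel_power (insert j I))"
proof -
  note [measurable] = f m measurable_shear_map[OF m, of a c]
  have add[measurable]: "(\<lambda>(x, y). x(j := y)) \<in> lborel_power I \<Otimes>\<^sub>M lborel \<rightarrow>\<^sub>M lborel_power (insert j I)"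
    using measurable_add_dim[of j I "\<lambda>_. lborel :: real measure"] by simp
  have fS[measurable]: "(\<lambda>x. f (shear_map j I a c m x)) \<in> borel_measurable (lborel_power (insert j I))"
    by measurable
  have "(\<integral>\<^sup>+ x. f x \<partial>lborel_power (insert j I)) = (\<integral>\<^sup>+ x. \<integral>\<^sup>+ y. f (x(j := y)) \<partial>lborel \<partial>lborel_power I)"
    by (rule lborel_power.product_nn_integral_insert[OF I f])
  also have "\<dots> = ennreal (a ^ card I) *
      (\<integral>\<^sup>+ x. \<integral>\<^sup>+ y. f ((\<lambda>i\<in>I. a * x i)(j := y)) \<partial>lborel \<partial>lborel_power I)"
    by (rule nn_integral_lborel_power_scale[OF I(1) a]) measurable
  also have "(\<integral>\<^sup>+ x. \<integral>\<^sup>+ y. f ((\<lambda>i\<in>I. a * x i)(j := y)) \<partial>lborel \<partial>lborel_power I) =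
      (\<integral>\<^sup>+ x. ennreal c * \<integral>\<^sup>+ y. f (shear_map j I a c m (x(j := y))) \<partial>lborel \<partial>lborel_power I)"
  proof (rule nn_integral_cong)
    fix x assume x: "x \<in> space (lborel_power I)"
    have "(\<lambda>i\<in>I. a * x i) \<in> space (lborel_power I)" by (simp add: space_PiM)
    then have [measurable]: "(\<lambda>y. f ((\<lambda>i\<in>I. a * x i)(j := y))) \<in> borel_measurable borel"
      using measurable_compose[OF measurable_fun_upd[of "insert j I" I j "\<lambda>_. (\<lambda>i\<in>I. a * x i)" lborel "\<lambda>_. lborel" "\<lambda>y. y"] f]
      by simp
    have "(\<integral>\<^sup>+ y. f ((\<lambda>i\<in>I. a * x i)(j := y)) \<partial>lborel) =
        ennreal \<bar>c\<bar> * (\<integral>\<^sup>+ y. f ((\<lambda>i\<in>I. a * x i)(j := m x + c * y)) \<partial>lborel)"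
      by (rule nn_integral_real_affine) (use c in auto)
    moreover have "(\<lambda>i\<in>I. a * x i)(j := m x + c * y) = shear_map j I a c m (x(j := y))" for y
      using I(2) by (auto simp: fun_eq_iff shear_map_def dep)
    ultimately show "(\<integral>\<^sup>+ y. f ((\<lambda>i\<in>I. a * x i)(j := y)) \<partial>lborel) =
        ennreal c * \<integral>\<^sup>+ y. f (shear_map j I a c m (x(j := y))) \<partial>lborel"
      using c by simp
  qed
  also have "\<dots> = ennreal c * (\<integral>\<^sup>+ x. \<integral>\<^sup>+ y. f (shear_map j I a c m (x(j := y))) \<partial>lborel \<partial>lborel_power I)"
  proof (rule nn_integral_cmult)
    have [measurable]: "(\<lambda>(x, y). f (shear_map j I a c m (x(j := y)))) \<in> borel_measurable (lborel_power I \<Otimes>\<^sub>M lborel)"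
      using measurable_compose[OF add fS] by (simp add: case_prod_unfold)
    show "(\<lambda>x. \<integral>\<^sup>+ y. f (shear_map j I a c m (x(j := y))) \<partial>lborel) \<in> borel_measurable (lborel_power I)"
      by measurable
  qed
  also have "(\<integral>\<^sup>+ x. \<integral>\<^sup>+ y. f (shear_map j I a c m (x(j := y))) \<partial>lborel \<partial>lborel_power I) =
      (\<integral>\<^sup>+ x. f (shear_map j I a c m x) \<partial>lborel_power (insert j I))"
    by (rule lborel_power.product_nn_integral_insert[OF I fS, symmetric])
  finally show ?thesis
    using a c by (simp add: ennreal_mult mult_ac)
qed

text \<open>Applied to indicators, the nonnegative formula becomes an identity of measures, which
  carries over to complex integrands.\<close>

lemma integral_shear_map:
  fixes f :: "(nat \<Rightarrow> real) \<Rightarrow> complex"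
  assumes I: "finite I" "j \<notin> I" and a: "a > 0" and c: "c > 0"
    and f: "f \<in> borel_measurable (lborel_power (insert j I))"
    and m: "m \<in> borel_measurable (lborel_power (insert j I))"
    and dep: "\<And>x y. m (x(j := y)) = m x"
  shows "(LINT x|lborel_power (insert j I). f x) =
    (a ^ card I * c) *\<^sub>R (LINT x|lborel_power (insert j I). f (shear_map j I a c m x))"
proof -
  let ?M = "lborel_power (insert j I)" and ?T = "shear_map j I a c m" and ?J = "a ^ card I * c"
  note T[measurable] = measurable_shear_map[OF m, of a c]
  have J: "?J > 0" using a c by simp
  have "?M = density (distr ?M ?M ?T) (\<lambda>_. ennreal ?J)"
  proof (rule measure_eqI)
    fix A assume A: "A \<in> sets ?M"
    then have [measurable]: "indicator A \<in> borel_measurable ?M" by simp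
    have "emeasure ?M A = (\<integral>\<^sup>+ x. indicator A x \<partial>?M)" using A by simp
    also have "\<dots> = ennreal ?J * (\<integral>\<^sup>+ x. indicator A (?T x) \<partial>?M)"
      by (rule nn_integral_shear_map[OF I a c _ m dep]) measurable
    also have "(\<integral>\<^sup>+ x. indicator A (?T x) \<partial>?M) = (\<integral>\<^sup>+ x. indicator A x \<partial>distr ?M ?M ?T)"
      by (rule nn_integral_distr[symmetric]) auto
    finally show "emeasure ?M A = emeasure (density (distr ?M ?M ?T) (\<lambda>_. ennreal ?J)) A"
      using A by (simp add: emeasure_density_const)
  qed simp
  then have "(LINT x|?M. f x) = (LINT x|density (distr ?M ?M ?T) (\<lambda>_. ennreal ?J). f x)"
    by simp
  also have "\<dots> = (LINT x|distr ?M ?M ?T. ?J *\<^sub>R f x)"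
    by (rule integral_density) (use f J in auto)
  also have "\<dots> = (LINT x|?M. ?J *\<^sub>R f (?T x))"
    by (rule integral_distr[OF T]) (use f in auto)
  finally show ?thesis by simp
qed

subsection \<open>Gaussian integrals\<close>

text \<open>Matrix index i belongs to variable \<open>Suc i\<close>, the convention of
  \<open>hessian\<close>.\<close>

definition quad_form :: "nat \<Rightarrow> (nat \<Rightarrow> nat \<Rightarrow> real) \<Rightarrow> (nat \<Rightarrow> real) \<Rightarrow> real" where
  "quad_form n C x = (\<Sum>i<n. \<Sum>j<n. C i j * x (Suc i) * x (Suc j))"

definition pos_def_form :: "nat \<Rightarrow> (nat \<Rightarrow> nat \<Rightarrow> real) \<Rightarrow> bool" where
  "pos_def_form n C \<longleftrightarrow> (\<forall>i<n. \<forall>j<n. C i j = C j i) \<and>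
     (\<forall>x. (\<exists>i<n. x (Suc i) \<noteq> 0) \<longrightarrow> quad_form n C x > 0)"

lemma quad_form_Suc:
  assumes "\<forall>i<Suc n. \<forall>j<Suc n. C i j = C j i"
  shows "quad_form (Suc n) C x = quad_form n C x + 2 * (\<Sum>i<n. C i n * x (Suc i)) * x (Suc n)
    + C n n * (x (Suc n))\<^sup>2"
proof -
  have "(\<Sum>j<n. C n j * x (Suc n) * x (Suc j)) = (\<Sum>i<n. C i n * x (Suc i)) * x (Suc n)"
    unfolding sum_distrib_right by (intro sum.cong refl) (use assms in auto)
  then show ?thesis
    by (simp add: quad_form_def sum.distrib sum_distrib_right power2_eq_square mult.assoc)
qed

lemma quad_form_complete_square:
  assumes sym: "\<forall>i<Suc n. \<forall>j<Suc n. C i j = C j i" and c: "C n n \<noteq> 0"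
  shows "quad_form (Suc n) C x = quad_form n (\<lambda>i j. C i j - C i n * C j n / C n n) x +
    C n n * (x (Suc n) + (\<Sum>i<n. C i n * x (Suc i)) / C n n)\<^sup>2"
proof -
  let ?b = "\<Sum>i<n. C i n * x (Suc i)"
  have "?b * ?b = (\<Sum>i<n. \<Sum>j<n. C i n * x (Suc i) * (C j n * x (Suc j)))"
    by (rule sum_product)
  moreover have "quad_form n (\<lambda>i j. C i j - C i n * C j n / C n n) x =
      (\<Sum>i<n. \<Sum>j<n. C i j * x (Suc i) * x (Suc j) - C i n * x (Suc i) * (C j n * x (Suc j)) / C n n)"
    unfolding quad_form_def by (intro sum.cong refl) (simp add: algebra_simps)
  ultimately have "quad_form n (\<lambda>i j. C i j - C i n * C j n / C n n) x = quad_form n C x - ?b * ?b / C n n"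
    by (simp only: sum_subtractf sum_divide_distrib quad_form_def)
  moreover have "C n n * (y + ?b / C n n)\<^sup>2 = C n n * y\<^sup>2 + 2 * ?b * y + ?b * ?b / C n n" for y
    using c by (simp add: power2_eq_square field_simps)
  ultimately show ?thesis
    by (simp only: quad_form_Suc[OF sym])
qed

lemma pos_def_form_diag:
  assumes "pos_def_form (Suc n) C"
  shows "C n n > 0"
proof -
  have "quad_form (Suc n) C (\<lambda>i. if i = Suc n then 1 else 0) > 0"
    using assms by (auto simp: pos_def_form_def)
  moreover have "quad_form (Suc n) C (\<lambda>i. if i = Suc n then 1 else 0) = C n n"
    using assms by (subst quad_form_Suc) (auto simp: pos_def_form_def quad_form_def)
  ultimately show ?thesis by simp
qed

text \<open>The Schur complement is the value of the form once the last coordinate is chosen to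
  annihilate the completed square.\<close>

lemma pos_def_form_schur:
  assumes C: "pos_def_form (Suc n) C"
  shows "pos_def_form n (\<lambda>i j. C i j - C i n * C j n / C n n)"
proof -
  let ?C' = "\<lambda>i j. C i j - C i n * C j n / C n n"
  have sym: "\<forall>i<Suc n. \<forall>j<Suc n. C i j = C j i" using C by (simp add: pos_def_form_def)
  have c: "C n n > 0" by (rule pos_def_form_diag[OF C])
  have "quad_form n ?C' x > 0" if nz: "\<exists>i<n. x (Suc i) \<noteq> 0" for x
  proof -
    let ?x = "x(Suc n := - (\<Sum>i<n. C i n * x (Suc i)) / C n n)"
    obtain i where "i < n" "x (Suc i) \<noteq> 0" using nz by blast
    then have "\<exists>i<Suc n. ?x (Suc i) \<noteq> 0" by (intro exI[of _ i]) simp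
    then have "quad_form (Suc n) C ?x > 0"
      using C unfolding pos_def_form_def by blast
    also have "quad_form (Suc n) C ?x = quad_form n ?C' ?x"
      by (subst quad_form_complete_square[OF sym]) (use c in auto)
    also have "\<dots> = quad_form n ?C' x" by (simp add: quad_form_def)
    finally show ?thesis .
  qed
  then show ?thesis using sym by (simp add: pos_def_form_def)
qed

text \<open>Column operations clear the last row: \<open>?U\<close> is unipotent, and the product
  with it is block triangular with diagonal blocks the Schur complement and
  \<open>C n n\<close>.\<close>

lemma det_schur:
  fixes C :: "nat \<Rightarrow> nat \<Rightarrow> real"
  assumes sym: "\<forall>i<Suc n. \<forall>j<Suc n. C i j = C j i" and c: "C n n \<noteq> 0"
  shows "Determinant.det (Matrix.mat (Suc n) (Suc n) (\<lambda>(i, j). C i j)) =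
    C n n * Determinant.det (Matrix.mat n n (\<lambda>(i, j). C i j - C i n * C j n / C n n))"
proof -
  let ?C = "Matrix.mat (Suc n) (Suc n) (\<lambda>(i, j). C i j)"
  let ?A = "Matrix.mat n n (\<lambda>(i, j). C i j)" and ?B = "Matrix.mat n 1 (\<lambda>(i, j). C i n)"
  let ?D = "Matrix.mat 1 n (\<lambda>(i, j). C n j)" and ?E = "Matrix.mat 1 1 (\<lambda>(i, j). C n n)"
  let ?L = "Matrix.mat 1 n (\<lambda>(i, j). - C n j / C n n)"
  let ?U = "four_block_mat (1\<^sub>m n) (0\<^sub>m n 1) ?L (1\<^sub>m 1)"
  let ?S = "Matrix.mat n n (\<lambda>(i, j). C i j - C i n * C j n / C n n)"
  have C: "?C = four_block_mat ?A ?B ?D ?E"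
    by (rule eq_matI) (auto simp: less_Suc_eq)
  have U: "?U \<in> carrier_mat (Suc n) (Suc n)" and C': "?C \<in> carrier_mat (Suc n) (Suc n)"
    using four_block_carrier_mat[of "1\<^sub>m n" n n "1\<^sub>m 1" 1 1] by auto
  have "?C * ?U = four_block_mat (?A * 1\<^sub>m n + ?B * ?L) (?A * 0\<^sub>m n 1 + ?B * 1\<^sub>m 1)
      (?D * 1\<^sub>m n + ?E * ?L) (?D * 0\<^sub>m n 1 + ?E * 1\<^sub>m 1)"
    unfolding C by (rule mult_four_block_mat) auto
  also have "?A * 1\<^sub>m n + ?B * ?L = ?S"
    using sym by (intro eq_matI) (auto simp: scalar_prod_def)
  also have "?D * 1\<^sub>m n + ?E * ?L = 0\<^sub>m 1 n"
    using c by (intro eq_matI) (auto simp: scalar_prod_def)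
  also have "?A * 0\<^sub>m n 1 + ?B * 1\<^sub>m 1 = ?B" by (intro eq_matI) auto
  also have "?D * 0\<^sub>m n 1 + ?E * 1\<^sub>m 1 = ?E" by (intro eq_matI) auto
  finally have "Determinant.det (?C * ?U) = Determinant.det ?S * Determinant.det ?E"
    by (simp only:) (rule det_four_block_mat_lower_left_zero[of _ n _ 1], auto)
  moreover have "Determinant.det ?U = 1"
    by (subst det_four_block_mat_upper_right_zero[of _ n _ 1]) auto
  moreover have "Determinant.det ?E = C n n" by (simp add: det_single)
  ultimately show ?thesis
    using det_mult[OF C' U] by (simp add: mult.commute)
qed

lemma nn_integral_gaussian_1:
  assumes c: "c > 0"
  shows "(\<integral>\<^sup>+ y. ennreal (exp (- (c * (y + b)\<^sup>2) / 2)) \<partial>lborel) = ennreal (sqrt (2 * pi / c))"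
proof -
  let ?s = "1 / sqrt c"
  have d: "exp (- (c * (y + b)\<^sup>2) / 2) = sqrt (2 * pi / c) * normal_density (- b) ?s y" for y
    using c by (simp add: normal_density_def power_divide real_sqrt_divide real_sqrt_mult)
  have "(\<integral>\<^sup>+ y. ennreal (exp (- (c * (y + b)\<^sup>2) / 2)) \<partial>lborel) =
      ennreal (sqrt (2 * pi / c)) * (\<integral>\<^sup>+ y. ennreal (normal_density (- b) ?s y) \<partial>lborel)"
    unfolding d using c
    by (subst nn_integral_cmult[symmetric]) (auto simp: ennreal_mult normal_density_nonneg)
  also have "(\<integral>\<^sup>+ y. ennreal (normal_density (- b) ?s y) \<partial>lborel) = 1"
    using c by (subst nn_integral_eq_integral) (auto simp: normal_density_nonneg)
  finally show ?thesis by simp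
qed

lemma measurable_quad_form:
  assumes "{1..<Suc n} \<subseteq> J"
  shows "quad_form n C \<in> borel_measurable (lborel_power J)"
proof -
  have "(\<lambda>x. x (Suc i)) \<in> borel_measurable (lborel_power J)" if "i < n" for i
  proof -
    have "Suc i \<in> J" using that assms by auto
    then have "(\<lambda>x. x (Suc i)) \<in> lborel_power J \<rightarrow>\<^sub>M (lborel :: real measure)"
      by (rule measurable_component_singleton)
    then show ?thesis by simp
  qed
  then show ?thesis unfolding quad_form_def by (intro borel_measurable_sum borel_measurable_times) auto
qed

text \<open>The last coordinate is integrated out after completing the square, and the determinant
  factors accordingly. Its positivity is carried along in the induction, where the square root of
  the smaller determinant occurs.\<close>

lemma nn_integral_gaussian:
  assumes "pos_def_form n C"
  shows "(\<integral>\<^sup>+ x. ennreal (exp (- quad_form n C x / 2)) \<partial>lborel_power {1..<Suc n}) =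
      ennreal ((2 * pi) powr (real n / 2) / sqrt (Determinant.det (Matrix.mat n n (\<lambda>(i, j). C i j))))
    \<and> Determinant.det (Matrix.mat n n (\<lambda>(i, j). C i j)) > 0"
  using assms
proof (induction n arbitrary: C)
  case 0
  show ?case by (simp add: quad_form_def PiM_empty nn_integral_count_space_finite)
next
  case (Suc n)
  let ?C' = "\<lambda>i j. C i j - C i n * C j n / C n n"
  let ?d = "Determinant.det (Matrix.mat (Suc n) (Suc n) (\<lambda>(i, j). C i j))"
  let ?d' = "Determinant.det (Matrix.mat n n (\<lambda>(i, j). ?C' i j))"
  have sym: "\<forall>i<Suc n. \<forall>j<Suc n. C i j = C j i" using Suc.prems by (simp add: pos_def_form_def)
  have c: "C n n > 0" by (rule pos_def_form_diag[OF Suc.prems])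
  note IH = Suc.IH[OF pos_def_form_schur[OF Suc.prems]]
  have d: "?d = C n n * ?d'" using det_schur[OF sym] c by simp
  have ins: "{1..<Suc (Suc n)} = insert (Suc n) {1..<Suc n}" by auto
  have [measurable]: "quad_form (Suc n) C \<in> borel_measurable (lborel_power (insert (Suc n) {1..<Suc n}))"
    "quad_form n ?C' \<in> borel_measurable (lborel_power {1..<Suc n})"
    by (rule measurable_quad_form, force)+
  have "(\<integral>\<^sup>+ x. ennreal (exp (- quad_form (Suc n) C x / 2)) \<partial>lborel_power {1..<Suc (Suc n)}) =
    (\<integral>\<^sup>+ x. \<integral>\<^sup>+ y. ennreal (exp (- quad_form (Suc n) C (x(Suc n := y)) / 2)) \<partial>lborel \<partial>lborel_power {1..<Suc n})"
    unfolding ins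
  proof (rule lborel_power.product_nn_integral_insert)
    show "(\<lambda>x. ennreal (exp (- quad_form (Suc n) C x / 2))) \<in> borel_measurable (lborel_power (insert (Suc n) {1..<Suc n}))"
      by measurable
  qed simp_all
  also have "\<dots> = (\<integral>\<^sup>+ x. ennreal (sqrt (2 * pi / C n n)) * ennreal (exp (- quad_form n ?C' x / 2)) \<partial>lborel_power {1..<Suc n})"
  proof (rule nn_integral_cong)
    fix x :: "nat \<Rightarrow> real"
    let ?b = "(\<Sum>i<n. C i n * x (Suc i)) / C n n"
    have "quad_form (Suc n) C (x(Suc n := y)) = quad_form n ?C' x + C n n * (y + ?b)\<^sup>2" for y
      by (subst quad_form_complete_square[OF sym]) (use c in \<open>auto simp: quad_form_def\<close>)
    then have "exp (- quad_form (Suc n) C (x(Suc n := y)) / 2) =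
        exp (- quad_form n ?C' x / 2) * exp (- (C n n * (y + ?b)\<^sup>2) / 2)" for y
      by (simp add: exp_add[symmetric] field_simps)
    then have "(\<integral>\<^sup>+ y. ennreal (exp (- quad_form (Suc n) C (x(Suc n := y)) / 2)) \<partial>lborel) =
        ennreal (exp (- quad_form n ?C' x / 2)) * (\<integral>\<^sup>+ y. ennreal (exp (- (C n n * (y + ?b)\<^sup>2) / 2)) \<partial>lborel)"
      by (subst nn_integral_cmult[symmetric]) (auto simp: ennreal_mult)
    then show "(\<integral>\<^sup>+ y. ennreal (exp (- quad_form (Suc n) C (x(Suc n := y)) / 2)) \<partial>lborel) =
        ennreal (sqrt (2 * pi / C n n)) * ennreal (exp (- quad_form n ?C' x / 2))"
      by (simp only: nn_integral_gaussian_1[OF c] mult.commute)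
  qed
  also have "\<dots> = ennreal (sqrt (2 * pi / C n n)) * (\<integral>\<^sup>+ x. ennreal (exp (- quad_form n ?C' x / 2)) \<partial>lborel_power {1..<Suc n})"
    by (rule nn_integral_cmult) measurable
  also have "\<dots> = ennreal (sqrt (2 * pi / C n n) * ((2 * pi) powr (real n / 2) / sqrt ?d'))"
    unfolding conjunct1[OF IH] using c IH by (intro ennreal_mult[symmetric]) auto
  also have "sqrt (2 * pi / C n n) * ((2 * pi) powr (real n / 2) / sqrt ?d') =
      (2 * pi) powr (real (Suc n) / 2) / sqrt ?d"
    by (simp add: d real_sqrt_divide real_sqrt_mult powr_half_sqrt[symmetric] powr_add[symmetric] add_divide_distrib
       powr_mult mult_ac)
  finally show ?case using IH c d by simp
qed

lemma gaussian_integral: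
  assumes "pos_def_form n C"
  shows "integrable (lborel_power {1..<Suc n}) (\<lambda>x. exp (- quad_form n C x / 2))"
    and "(LINT x|lborel_power {1..<Suc n}. exp (- quad_form n C x / 2)) =
      (2 * pi) powr (real n / 2) / sqrt (Determinant.det (Matrix.mat n n (\<lambda>(i, j). C i j)))"
    and "Determinant.det (Matrix.mat n n (\<lambda>(i, j). C i j)) > 0"
proof -
  note g = nn_integral_gaussian[OF assms]
  have [measurable]: "quad_form n C \<in> borel_measurable (lborel_power {1..<Suc n})"
    by (rule measurable_quad_form) simp
  show "integrable (lborel_power {1..<Suc n}) (\<lambda>x. exp (- quad_form n C x / 2))"
  proof (rule integrableI_nonneg)
    show "(\<lambda>x. exp (- quad_form n C x / 2)) \<in> borel_measurable (lborel_power {1..<Suc n})"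
      by measurable
    show "(\<integral>\<^sup>+ x. ennreal (exp (- quad_form n C x / 2)) \<partial>lborel_power {1..<Suc n}) < \<infinity>"
      unfolding conjunct1[OF g] by simp
  qed simp
  show "(LINT x|lborel_power {1..<Suc n}. exp (- quad_form n C x / 2)) =
      (2 * pi) powr (real n / 2) / sqrt (Determinant.det (Matrix.mat n n (\<lambda>(i, j). C i j)))"
  proof (subst integral_eq_nn_integral)
    show "(\<lambda>x. exp (- quad_form n C x / 2)) \<in> borel_measurable (lborel_power {1..<Suc n})"
      by measurable
    have "0 \<le> (2 * pi) powr (real n / 2) / sqrt (Determinant.det (Matrix.mat n n (\<lambda>(i, j). C i j)))"
      using conjunct2[OF g] by simp
    then show "enn2real (\<integral>\<^sup>+ x. ennreal (exp (- quad_form n C x / 2)) \<partial>lborel_power {1..<Suc n}) =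
        (2 * pi) powr (real n / 2) / sqrt (Determinant.det (Matrix.mat n n (\<lambda>(i, j). C i j)))"
      unfolding conjunct1[OF g] by (rule enn2real_ennreal)
  qed simp
qed (use nn_integral_gaussian[OF assms] in simp)

subsection \<open>Fourier inversion of the Gamma density\<close>

lemma integrable_inverse_1_plus_square_lborel: "integrable lborel (\<lambda>x :: real. 1 / (1 + x\<^sup>2))"
  using integrable_inverse_1_plus_square by (simp add: set_integrable_def einterval_eq field_simps)

lemma integral_exp_ii_int:
  "(LINT x|lborel. indicator {-pi..pi} x *\<^sub>R exp (\<i> * of_int k * of_real x)) = (if k = 0 then 2 * of_real pi else 0)"
proof (cases "k = 0")
  case False
  let ?F = "\<lambda>x. exp (\<i> * of_int k * of_real x) / (\<i> * of_int k)"
  have "(LINT x|lborel. indicator {-pi..pi} x *\<^sub>R exp (\<i> * of_int k * of_real x)) = ?F pi - ?F (-pi)"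
  proof (rule integral_FTC_atLeastAtMost)
    fix x :: real
    show "(?F has_vector_derivative exp (\<i> * of_int k * of_real x)) (at x within {-pi..pi})"
      using False
      by (intro has_vector_derivative_real_field[of "\<lambda>z. exp (\<i> * of_int k * z) / (\<i> * of_int k)", THEN has_vector_derivative_at_within])
         (auto intro!: derivative_eq_intros simp: field_simps)
  qed (auto intro!: continuous_intros)
  also have "exp (\<i> * of_int k * of_real pi) = exp (\<i> * of_int k * of_real (-pi))"
  proof -
    have "exp (\<i> * of_int k * of_real pi) / exp (\<i> * of_int k * of_real (-pi)) = exp (\<i> * (2 * of_int k * pi))"
      by (subst exp_diff[symmetric]) (simp add: algebra_simps)
    also have "\<dots> = 1" by (auto simp: exp_eq_1 intro!: exI[of _ k])
    finally show ?thesis by simp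
  qed
  finally show ?thesis using False by simp
qed (simp add: scaleR_conv_of_real)

text \<open>Absolute summability permits integration term by term, and orthogonality leaves the term
  m = n.\<close>

lemma fourier_coefficient:
  fixes c :: "nat \<Rightarrow> complex"
  assumes c: "summable (\<lambda>m. norm (c m))"
  shows "(LINT x|lborel. indicator {-pi..pi} x *\<^sub>R ((\<Sum>m. c m * exp (\<i> * of_nat m * of_real x)) * exp (- (\<i> * of_nat n * of_real x)))) =
    2 * of_real pi * c n"
proof -
  let ?g = "\<lambda>m x. indicator {-pi..pi} x *\<^sub>R (c m * exp (\<i> * of_int (int m - int n) * of_real x))"
  have n1: "norm (exp (\<i> * of_int k * of_real x)) = 1" for k and x :: real by simp
  have n2: "norm (exp (\<i> * of_nat m * of_real x)) = 1" for m and x :: real by simp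
  have sm: "summable (\<lambda>m. c m * exp (\<i> * of_nat m * of_real x))" for x :: real
    by (rule summable_norm_cancel) (use c in \<open>simp add: norm_mult n2 del: norm_exp_eq_Re\<close>)
  have "(\<Sum>m. c m * exp (\<i> * of_nat m * of_real x)) * exp (- (\<i> * of_nat n * of_real x)) =
      (\<Sum>m. c m * exp (\<i> * of_int (int m - int n) * of_real x))" for x :: real
    by (subst suminf_mult2[OF sm]) (simp add: exp_minus exp_diff[symmetric] algebra_simps divide_simps flip: exp_add)
  then have "indicator {-pi..pi} x *\<^sub>R ((\<Sum>m. c m * exp (\<i> * of_nat m * of_real x)) * exp (- (\<i> * of_nat n * of_real x))) =
      (\<Sum>m. ?g m x)" for x :: real
    by (cases "x \<in> {-pi..pi}") simp_all
  then have "(LINT x|lborel. indicator {-pi..pi} x *\<^sub>R ((\<Sum>m. c m * exp (\<i> * of_nat m * of_real x)) * exp (- (\<i> * of_nat n * of_real x)))) =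
    (LINT x|lborel. (\<Sum>m. ?g m x))" by simp
  also have "\<dots> = (\<Sum>m. LINT x|lborel. ?g m x)"
  proof (rule integral_suminf)
    show "integrable lborel (?g m)" for m
    proof -
      have "continuous_on {-pi..pi} (\<lambda>x. c m * exp (\<i> * of_int (int m - int n) * of_real x))"
        by (intro continuous_intros)
      then show ?thesis
        using borel_integrable_atLeastAtMost' unfolding set_integrable_def by blast
    qed
    have nrm: "norm (?g m x) = indicator {-pi..pi} x *\<^sub>R norm (c m)" for m x
      by (simp only: norm_scaleR norm_mult n1) (simp add: indicator_def)
    show "AE x in lborel. summable (\<lambda>m. norm (?g m x))"
      unfolding nrm using c by (auto intro!: AE_I2 summable_mult simp: indicator_def)
    show "summable (\<lambda>m. LINT x|lborel. norm (?g m x))"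
      unfolding nrm using c by (simp add: summable_mult)
  qed
  also have "\<dots> = (\<Sum>m. if m = n then 2 * of_real pi * c n else 0)"
  proof (rule suminf_cong)
    fix m
    have "(LINT x|lborel. ?g m x) = c m * (LINT x|lborel. indicator {-pi..pi} x *\<^sub>R exp (\<i> * of_int (int m - int n) * of_real x))"
      by (simp only: integral_mult_right_zero[symmetric] mult_scaleR_right)
    then show "(LINT x|lborel. ?g m x) = (if m = n then 2 * of_real pi * c n else 0)"
      by (simp only: integral_exp_ii_int) auto
  qed
  also have "(\<Sum>m. if m = n then 2 * of_real pi * c n else 0) = 2 * of_real pi * c n"
    by (rule sums_unique[symmetric]) (rule sums_single)
  finally show ?thesis .
qed

text \<open>The quotient \<open>(exp v - 1) / v\<close> with its removable singularity filled, so
  that differences of exponentials factor without a case distinction at 0.\<close>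

definition exp_quot :: "complex \<Rightarrow> complex" where
  "exp_quot v = (if v = 0 then 1 else (exp v - 1) / v)"

lemma exp_quot_mult: "v * exp_quot v = exp v - 1"
  by (simp add: exp_quot_def)

lemma isCont_exp_quot: "isCont exp_quot v"
proof (cases "v = 0")
  case True
  have "((\<lambda>h. (exp (0 + h) - exp 0) / h) \<longlongrightarrow> exp 0) (at (0::complex))"
    using DERIV_exp[of "0::complex"] by (simp add: DERIV_def)
  then have "((\<lambda>h. (exp h - 1) / h) \<longlongrightarrow> 1) (at (0::complex))" by simp
  then have "(exp_quot \<longlongrightarrow> 1) (at 0)"
    by (rule Lim_transform_eventually) (auto simp: exp_quot_def eventually_at_filter)
  then show ?thesis using True by (simp add: isCont_def exp_quot_def)
next
  case False
  have "eventually (\<lambda>w. w \<noteq> 0) (nhds v)" using False by (rule t1_space_nhds)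
  then have "eventually (\<lambda>w. exp_quot w = (exp w - 1) / w) (nhds v)" by eventually_elim (simp add: exp_quot_def)
  moreover have "isCont (\<lambda>w. (exp w - 1) / w) v" using False by (intro continuous_intros) auto
  ultimately show ?thesis by (subst isCont_cong) auto
qed

lemma tendsto_exp_quot: "(f \<longlongrightarrow> 0) G \<Longrightarrow> ((\<lambda>t. exp_quot (f t)) \<longlongrightarrow> 1) G"
  using isCont_tendsto_compose[OF isCont_exp_quot, of f 0 G] by (simp add: exp_quot_def)

text \<open>\<open>exp_quot\<close> has no zero on the compact rectangle, the nonzero multiples of
  \<open>2 * pi * \<i>\<close> lying outside, so its modulus is bounded below there.\<close>

lemma norm_one_minus_exp_ge:
  obtains c :: real where "c > 0" "\<And>v. -1 \<le> Re v \<Longrightarrow> Re v \<le> 0 \<Longrightarrow> \<bar>Im v\<bar> \<le> pi \<Longrightarrow> norm (1 - exp v) \<ge> c * norm v"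
proof -
  let ?K = "cbox (Complex (-1) (-pi)) (Complex 0 pi)"
  have cont: "continuous_on ?K (\<lambda>v. norm (exp_quot v))"
    by (intro continuous_on_norm continuous_at_imp_continuous_on ballI isCont_exp_quot)
  have ne: "?K \<noteq> {}" using pi_gt_zero by (auto simp: box_ne_empty Basis_complex_def)
  obtain v0 where v0: "v0 \<in> ?K" "\<And>v. v \<in> ?K \<Longrightarrow> norm (exp_quot v0) \<le> norm (exp_quot v)"
    using continuous_attains_inf[OF compact_cbox ne cont] by (auto simp only: Ball_def Bex_def)
  have K: "v \<in> ?K \<longleftrightarrow> -1 \<le> Re v \<and> Re v \<le> 0 \<and> \<bar>Im v\<bar> \<le> pi" for v
    by (auto simp: mem_box Basis_complex_def abs_le_iff)
  have "exp_quot v0 \<noteq> 0"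
  proof
    assume "exp_quot v0 = 0"
    then have "v0 \<noteq> 0" "exp v0 = 1" by (auto simp: exp_quot_def split: if_splits)
    then obtain n :: int where n: "Re v0 = 0" "Im v0 = of_int (2 * n) * pi" by (auto simp: exp_eq_1)
    have "\<bar>real_of_int (2 * n)\<bar> * pi \<le> 1 * pi" using v0(1) n by (simp add: K abs_mult)
    then have "\<bar>real_of_int (2 * n)\<bar> \<le> 1" using pi_gt_zero by (simp only: mult_le_cancel_right_pos)
    then have "n = 0" by linarith
    then show False using n \<open>v0 \<noteq> 0\<close> by (simp add: complex_eq_iff)
  qed
  moreover have "norm (1 - exp v) \<ge> norm (exp_quot v0) * norm v" if "-1 \<le> Re v" "Re v \<le> 0" "\<bar>Im v\<bar> \<le> pi" for v
  proof (cases "v = 0")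
    case False
    have "norm (exp_quot v0) \<le> norm (exp_quot v)" by (rule v0) (use that K in auto)
    also have "\<dots> = norm (1 - exp v) / norm v" using False by (simp add: exp_quot_def norm_divide norm_minus_commute)
    finally show ?thesis using False by (simp add: field_simps)
  qed simp
  ultimately show ?thesis using that[of "norm (exp_quot v0)"] by simp
qed

lemma norm_powr_of_real: "norm (z powr complex_of_real t) = (if z = 0 then 0 else norm z powr t)"
  by (simp add: powr_def norm_exp_eq_Re)

lemma powr_of_real_mult_left:
  assumes "x > 0" "z \<noteq> 0"
  shows "(complex_of_real x * z) powr of_real t = of_real (x powr t) * z powr of_real t"
  using assms by (simp add: powr_def Ln_times_of_real Ln_of_real distrib_left exp_add exp_of_real[symmetric])

text \<open>A limit of Cauchy integrals. The coefficient of \<open>z ^ n\<close> in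
  \<open>(1 - z) powr (- S)\<close> has modulus asymptotic to
  \<open>n powr (S - 1) / Gamma S\<close>. Extracted on the circle of radius
  \<open>exp (- b / n)\<close>, with the angle stretched by n, it is an integral that converges to
  the one in question.\<close>

lemma gamma_density_inversion:
  fixes S b :: real
  assumes S: "S \<ge> 2" and b: "b \<ge> 1"
  shows "(LINT t|lborel. exp (- (\<i> * of_real t)) * (of_real b - \<i> * of_real t) powr (- of_real S)) =
    2 * of_real (pi * exp (- b) / Gamma S)"
proof -
  \<comment> \<open>The Taylor coefficients of \<open>(1 - z) powr (- S)\<close>.\<close>
  define a where "a n = (-1) ^ n * ((- complex_of_real S) gchoose n)" for n
  define w where "w t = - of_real b + \<i> * complex_of_real t" for t
  \<comment> \<open>The Cauchy integrand in the stretched angle; the factor n inside the power makes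
    it converge pointwise.\<close>
  define s where "s n t = indicator {-pi..pi} (t / real n) *\<^sub>R
     ((of_real (real n) * (1 - exp (w t / of_nat n))) powr (- of_real S) * exp (- (\<i> * of_real t)))" for n t
  let ?L = "\<lambda>t. (- w t) powr (- of_real S) * exp (- (\<i> * of_real t))"
  obtain c :: real where c: "c > 0"
    "\<And>v. -1 \<le> Re v \<Longrightarrow> Re v \<le> 0 \<Longrightarrow> \<bar>Im v\<bar> \<le> pi \<Longrightarrow> norm (1 - exp v) \<ge> c * norm v"
    by (rule norm_one_minus_exp_ge) blast
  have ser: "(\<lambda>m. a m * z ^ m) sums (1 - z) powr (- of_real S)" if "norm z < 1" for z
    using gen_binomial_complex[of "- z" "- of_real S"] that
    by (simp add: a_def power_minus[of z] mult_ac)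
  have int: "(LINT t|lborel. s n t) = of_real (real n powr (1 - S)) * (2 * of_real pi * (a n * of_real (exp (- b))))"
    if n: "n > 0" for n
  proof -
    define r where "r = exp (- b / real n)"
    have r: "r < 1" "r > 0" using b n by (auto simp: r_def)
    have "summable (\<lambda>m. norm (a m * of_real r ^ m))"
    proof (rule powser_insidea)
      show "summable (\<lambda>m. a m * of_real ((1 + r) / 2) ^ m)"
      proof (rule sums_summable[OF ser])
        have "\<bar>(1 + r) / 2\<bar> < 1" unfolding abs_less_iff using r by auto
        then show "norm (complex_of_real ((1 + r) / 2)) < 1" by (simp only: norm_of_real)
      qed
      show "norm (complex_of_real r) < norm (complex_of_real ((1 + r) / 2))"
        using r by (simp only: norm_of_real) simp
    qed
    then have F: "(LINT x|lborel. indicator {-pi..pi} x *\<^sub>R ((\<Sum>m. a m * of_real r ^ m * exp (\<i> * of_nat m * of_real x)) * exp (- (\<i> * of_nat n * of_real x)))) =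
      2 * of_real pi * (a n * of_real r ^ n)" by (rule fourier_coefficient)
    have rn: "complex_of_real r ^ n = of_real (exp (- b))"
      using n by (simp add: r_def exp_of_nat_mult[symmetric] flip: of_real_power)
    let ?z = "\<lambda>x. of_real r * exp (\<i> * of_real x)"
    have z: "norm (?z x) < 1" "?z x \<noteq> 1" for x :: real
    proof -
      show "norm (?z x) < 1" using r by (simp add: norm_mult)
      then show "?z x \<noteq> 1" by auto
    qed
    have sm: "(\<Sum>m. a m * of_real r ^ m * exp (\<i> * of_nat m * of_real x)) = (1 - ?z x) powr (- of_real S)" for x :: real
      using sums_unique[OF ser[OF z(1)], of x]
      by (simp add: power_mult_distrib exp_of_nat_mult[symmetric] mult_ac)
    have "2 * of_real pi * (a n * of_real (exp (- b))) =
      (LINT x|lborel. indicator {-pi..pi} x *\<^sub>R ((1 - ?z x) powr (- of_real S) * exp (- (\<i> * of_nat n * of_real x))))"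
      using F unfolding sm rn by simp
    also have "\<dots> = \<bar>1 / real n\<bar> *\<^sub>R (LINT t|lborel. indicator {-pi..pi} (0 + (1 / real n) * t) *\<^sub>R
        ((1 - ?z (0 + (1 / real n) * t)) powr (- of_real S) * exp (- (\<i> * of_nat n * of_real (0 + (1 / real n) * t)))))"
      by (rule lborel_integral_real_affine) (use n in auto)
    also have "(\<lambda>t. indicator {-pi..pi} (0 + (1 / real n) * t) *\<^sub>R
        ((1 - ?z (0 + (1 / real n) * t)) powr (- of_real S) * exp (- (\<i> * of_nat n * of_real (0 + (1 / real n) * t))))) =
        (\<lambda>t. of_real (real n powr S) * s n t)"
    proof
      fix t :: real
      have e: "exp (w t / of_nat n) = ?z (0 + (1 / real n) * t)"
      proof -
        have "w t / of_nat n = of_real (- b / real n) + \<i> * of_real (0 + (1 / real n) * t)"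
          by (simp add: w_def add_divide_distrib diff_divide_distrib)
        then show ?thesis by (simp only: exp_add exp_of_real r_def)
      qed
      have "(of_real (real n) * (1 - exp (w t / of_nat n))) powr (- of_real S) =
         of_real (real n powr (- S)) * (1 - exp (w t / of_nat n)) powr (- of_real S)"
      proof -
        have "1 - exp (w t / of_nat n) \<noteq> 0"
        proof
          assume "1 - exp (w t / of_nat n) = 0"
          then have "exp (w t / of_nat n) = 1" by simp
          then have "?z (0 + (1 / real n) * t) = 1" by (simp only: e)
          with z(2) show False by blast
        qed
        then show ?thesis using powr_of_real_mult_left[of "real n" "1 - exp (w t / of_nat n)" "- S"] n by simp
      qed
      moreover have "of_real (real n powr S) * complex_of_real (real n powr (- S)) = 1"
        using n by (simp add: powr_add[symmetric] flip: of_real_mult)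
      ultimately have "of_real (real n powr S) * (of_real (real n) * (1 - exp (w t / of_nat n))) powr (- of_real S) =
         (1 - exp (w t / of_nat n)) powr (- of_real S)"
        by (metis mult.assoc mult_1)
      moreover have "exp (- (\<i> * of_nat n * of_real (0 + (1 / real n) * t))) = exp (- (\<i> * of_real t))"
        using n by simp
      ultimately show "indicator {-pi..pi} (0 + (1 / real n) * t) *\<^sub>R
        ((1 - ?z (0 + (1 / real n) * t)) powr (- of_real S) * exp (- (\<i> * of_nat n * of_real (0 + (1 / real n) * t)))) =
        of_real (real n powr S) * s n t"
        unfolding s_def e[symmetric] by (simp add: mult_ac)
    qed
    also have "(LINT t|lborel. of_real (real n powr S) * s n t) = of_real (real n powr S) * (LINT t|lborel. s n t)"
      by simp
    finally have X: "2 * of_real pi * (a n * of_real (exp (- b))) = of_real (real n powr S / real n) * (LINT t|lborel. s n t)"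
      using n by (simp add: scaleR_conv_of_real)
    have "real n powr (1 - S) * (real n powr S / real n) = 1"
      using n by (simp add: powr_add[symmetric])
    then have "complex_of_real (real n powr (1 - S)) * of_real (real n powr S / real n) = 1"
      by (metis of_real_1 of_real_mult)
    then show ?thesis unfolding X by (metis mult.assoc mult_1)
  qed
  have "(\<lambda>n. LINT t|lborel. s n t) \<longlonglongrightarrow> (LINT t|lborel. ?L t)"
  proof (rule LIMSEQ_offset[where k = "nat \<lceil>b\<rceil>"])
    \<comment> \<open>From the ceiling of b on, \<open>- b / n\<close> lies between -1 and 0, as
      \<open>norm_one_minus_exp_ge\<close> requires.\<close>
    let ?k = "nat \<lceil>b\<rceil>"
    let ?B = "\<lambda>t :: real. c powr (- S) * (1 / (1 + t\<^sup>2))"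
    have nb: "real (n + ?k) \<ge> b" "n + ?k > 0" for n using b by linarith+
    have Rew: "Re (w t) = - b" "Im (w t) = t" for t by (simp_all add: w_def)
    have Re1: "Re (of_real (real n) * (1 - exp (w t / of_nat n))) > 0" if "n > 0" for n t
    proof -
      have "Re (exp (w t / of_nat n)) \<le> norm (exp (w t / of_nat n))" by (rule complex_Re_le_cmod)
      also have "\<dots> = exp (- b / real n)" by (simp add: Re_divide_of_nat Rew)
      also have "\<dots> < 1" using b that by simp
      finally show ?thesis using that by simp
    qed
    show "(\<lambda>n. LINT t|lborel. s (n + ?k) t) \<longlonglongrightarrow> (LINT t|lborel. ?L t)"
    proof (rule integral_dominated_convergence[where w = ?B])
      show "integrable lborel ?B"
        by (intro integrable_mult_right integrable_inverse_1_plus_square_lborel)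
      show "?L \<in> borel_measurable lborel"
      proof -
        have w: "continuous_on UNIV (\<lambda>t. - w t)"
          unfolding w_def by (intro continuous_intros)
        have "continuous_on UNIV (\<lambda>t. (- w t) powr (- of_real S))"
        proof (rule continuous_on_powr_complex[OF _ _ w continuous_on_const])
          show "UNIV \<subseteq> {t. 0 \<le> Re (- w t) \<or> Im (- w t) \<noteq> 0}" using b by (auto simp: Rew)
          show "0 < Re (- complex_of_real S)" if "- w t = 0" for t
            using Rew(1)[of t] b that by simp
        qed
        then have "continuous_on UNIV ?L"
          by (intro continuous_on_mult) (auto intro!: continuous_intros)
        then show ?thesis by (simp add: borel_measurable_continuous_onI)
      qed
      have meas: "s m \<in> borel_measurable lborel" if m: "m > 0" for m
      proof -
        let ?f = "\<lambda>t. of_real (real m) * (1 - exp (w t / of_nat m))"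
        have f: "continuous_on UNIV ?f"
          unfolding w_def using m by (intro continuous_intros) auto
        have "continuous_on UNIV (\<lambda>t. ?f t powr (- of_real S))"
        proof (rule continuous_on_powr_complex[OF _ _ f continuous_on_const])
          show "UNIV \<subseteq> {t. 0 \<le> Re (?f t) \<or> Im (?f t) \<noteq> 0}"
            using Re1[OF m] by (auto intro: less_imp_le)
          show "0 < Re (- complex_of_real S)" if "?f t = 0" for t
            using Re1[OF m, of t] unfolding that by simp
        qed
        then have "continuous_on UNIV (\<lambda>t. ?f t powr (- of_real S) * exp (- (\<i> * of_real t)))"
          by (intro continuous_on_mult) (auto intro!: continuous_intros)
        then have h: "(\<lambda>t. ?f t powr (- of_real S) * exp (- (\<i> * of_real t))) \<in> borel_measurable borel"
          by (rule borel_measurable_continuous_onI)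
        have i: "(\<lambda>t. indicator {-pi..pi} (t / real m) :: real) \<in> borel_measurable borel"
          by measurable
        have eq: "s m = (\<lambda>t. indicator {-pi..pi} (t / real m) *\<^sub>R (?f t powr (- of_real S) * exp (- (\<i> * of_real t))))"
          by (rule ext) (simp only: s_def)
        show ?thesis using borel_measurable_scaleR[OF i h] unfolding eq by simp
      qed
      show "s (n + ?k) \<in> borel_measurable lborel" for n
        by (rule meas[OF nb(2)])
      show "AE t in lborel. (\<lambda>n. s (n + ?k) t) \<longlonglongrightarrow> ?L t"
      proof (rule AE_I2)
        fix t :: real
        have "(\<lambda>n. s n t) \<longlonglongrightarrow> 1 *\<^sub>R ?L t"
          unfolding s_def
        proof (intro tendsto_scaleR tendsto_mult tendsto_powr_complex tendsto_const)
          show "(\<lambda>n. indicator {-pi..pi} (t / real n)) \<longlonglongrightarrow> (1 :: real)"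
          proof (rule tendsto_eventually)
            have "(\<lambda>n. t / real n) \<longlonglongrightarrow> 0" by (rule lim_const_over_n)
            then have "eventually (\<lambda>n. t / real n \<in> {-pi<..<pi}) sequentially"
              by (rule topological_tendstoD) auto
            then show "eventually (\<lambda>n. indicator {-pi..pi} (t / real n) = (1 :: real)) sequentially"
              by eventually_elim auto
          qed
          show "- w t \<notin> \<real>\<^sub>\<le>\<^sub>0" using b by (auto simp: complex_nonpos_Reals_iff Rew)
          \<comment> \<open>The base of the power is minus the difference quotient of
            \<open>exp (w t * h)\<close> at h = 1 / n.\<close>
          have "((\<lambda>h. exp (w t * h)) has_field_derivative w t) (at 0)"
            by (auto intro!: derivative_eq_intros)
          then have "((\<lambda>h. - ((exp (w t * h) - 1) / h)) \<longlongrightarrow> - w t) (at 0)"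
            by (intro tendsto_minus) (simp add: DERIV_def)
          moreover have "filterlim (\<lambda>n. 1 / complex_of_nat n) (at 0) sequentially"
            unfolding filterlim_at
            by (intro conjI lim_1_over_n eventually_mono[OF eventually_gt_at_top[of 0]]) auto
          ultimately have "(\<lambda>n. - ((exp (w t * (1 / complex_of_nat n)) - 1) / (1 / complex_of_nat n))) \<longlonglongrightarrow> - w t"
            by (rule filterlim_compose)
          then show "(\<lambda>n. of_real (real n) * (1 - exp (w t / of_nat n))) \<longlonglongrightarrow> - w t"
            by (simp add: algebra_simps)
        qed
        then have "(\<lambda>n. s n t) \<longlonglongrightarrow> ?L t" by simp
        then show "(\<lambda>n. s (n + ?k) t) \<longlonglongrightarrow> ?L t" by (rule LIMSEQ_ignore_initial_segment)
      qed
      have dom: "norm (s m t) \<le> ?B t" if m: "m > 0" "real m \<ge> b" for m t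
      proof (cases "t / real m \<in> {-pi..pi}")
        case True
        have npos: "real m > 0" using m(1) by (simp only: of_nat_0_less_iff)
        have Rv: "Re (w t / of_nat m) = - b / real m" "Im (w t / of_nat m) = t / real m"
          by (simp_all add: Re_divide_of_nat Im_divide_of_nat Rew)
        have "b / real m \<le> 1" "b / real m \<ge> 0" using m b npos by (simp_all add: divide_le_eq)
        then have "c * norm (w t / of_nat m) \<le> norm (1 - exp (w t / of_nat m))"
          using True by (intro c(2)) (simp_all only: Rv, auto simp: abs_le_iff)
        then have "real m * (c * norm (w t / of_nat m)) \<le> real m * norm (1 - exp (w t / of_nat m))"
          using npos by (intro mult_left_mono) auto
        moreover have "real m * (c * norm (w t / of_nat m)) = c * norm (w t)"
          using npos by (simp add: norm_divide)
        moreover have "norm (of_real (real m) * (1 - exp (w t / of_nat m))) = real m * norm (1 - exp (w t / of_nat m))"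
          by (simp add: norm_mult)
        ultimately have lower: "c * norm (w t) \<le> norm (of_real (real m) * (1 - exp (w t / of_nat m)))" by simp
        have w1: "norm (w t) ^ 2 \<ge> 1 + t\<^sup>2" "norm (w t) \<ge> 1"
        proof -
          show 1: "norm (w t) ^ 2 \<ge> 1 + t\<^sup>2" using b by (simp add: cmod_power2 Rew)
          then have "1 \<le> norm (w t) ^ 2" using zero_le_power2[of t] by linarith
          then show "norm (w t) \<ge> 1" using power2_le_imp_le[of 1 "norm (w t)"] by simp
        qed
        have "norm (s m t) = norm (of_real (real m) * (1 - exp (w t / of_nat m))) powr (- S)"
        proof -
          have "(of_real (real m) * (1 - exp (w t / of_nat m))) \<noteq> 0"
            using Re1[OF m(1), of t] m(1) by (auto simp: complex_eq_iff)
          then show ?thesis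
            using True norm_powr_of_real[of "of_real (real m) * (1 - exp (w t / of_nat m))" "- S"]
            unfolding s_def by (simp add: norm_mult)
        qed
        also have "\<dots> \<le> (c * norm (w t)) powr (- S)"
        proof (rule powr_mono2')
          show "0 < c * norm (w t)" by (rule mult_pos_pos) (use c(1) w1(2) in linarith)+
        qed (use lower S in auto)
        also have "\<dots> = c powr (- S) * norm (w t) powr (- S)"
          using c by (simp add: powr_mult)
        \<comment> \<open>Both lower bounds enter here: \<open>b \<ge> 1\<close> makes the modulus
          at least 1, and \<open>S \<ge> 2\<close> then yields an integrable majorant.\<close>
        also have "norm (w t) powr (- S) \<le> norm (w t) powr (- 2)"
          using S w1 by (intro powr_mono) auto
        also have "norm (w t) powr (- 2) = 1 / norm (w t) ^ 2"
          using w1(2) by (simp add: powr_minus_divide)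
        also have "\<dots> \<le> 1 / (1 + t\<^sup>2)"
          using w1(1) by (intro frac_le) (auto simp: add_pos_nonneg)
        finally show ?thesis using c by (simp add: mult_left_mono)
      next
        case False
        then show ?thesis by (simp add: s_def)
      qed
      show "AE t in lborel. norm (s (n + ?k) t) \<le> ?B t" for n
        by (rule AE_I2) (rule dom[OF nb(2) nb(1)])
    qed
  qed
  moreover have "(\<lambda>n. LINT t|lborel. s n t) \<longlonglongrightarrow> inverse (Gamma (of_real S)) * (2 * of_real pi * of_real (exp (- b)))"
  proof -
    have "(\<lambda>n. (- of_real S gchoose n) / ((- 1) ^ n / exp ((- of_real S + 1) * of_real (ln (real n))))) \<longlonglongrightarrow>
        inverse (Gamma (complex_of_real S))"
      using gbinomial_asymptotic[of "- complex_of_real S"] by simp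
    then have "(\<lambda>n. (- of_real S gchoose n) / ((- 1) ^ n / exp ((- of_real S + 1) * of_real (ln (real n)))) * (2 * of_real pi * of_real (exp (- b)))) \<longlonglongrightarrow>
        inverse (Gamma (complex_of_real S)) * (2 * of_real pi * of_real (exp (- b)))"
      by (intro tendsto_mult_right)
    then show ?thesis
    proof (rule Lim_transform_eventually)
      show "eventually (\<lambda>n. (- of_real S gchoose n) / ((- 1) ^ n / exp ((- of_real S + 1) * of_real (ln (real n)))) * (2 * of_real pi * of_real (exp (- b))) =
         (LINT t|lborel. s n t)) at_top"
        using eventually_gt_at_top[of 0]
      proof eventually_elim
        case (elim n)
        have "exp ((- of_real S + 1) * complex_of_real (ln (real n))) = of_real (real n powr (1 - S))"
          using elim by (simp add: powr_def exp_of_real[symmetric] algebra_simps)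
        moreover have "(x :: complex) / ((-1) ^ n / y) = (-1) ^ n * x * y" for x y
          by (cases "even n") auto
        ultimately show ?case
          unfolding int[OF elim] a_def by (simp add: mult_ac)
      qed
    qed
  qed
  ultimately have "(LINT t|lborel. ?L t) = inverse (Gamma (of_real S)) * (2 * of_real pi * of_real (exp (- b)))"
    by (rule LIMSEQ_unique)
  then show ?thesis
    by (simp add: w_def Gamma_complex_of_real mult_ac divide_inverse)
qed

subsection \<open>Second-order expansions in several complex variables\<close>

text \<open>The l1 norm over J, complex-valued because the Landau symbols compare functions with
  values in one common field.\<close>

definition cnorm1 :: "nat set \<Rightarrow> (nat \<Rightarrow> complex) \<Rightarrow> complex" where
  "cnorm1 J x = of_real (\<Sum>i\<in>J. norm (x i))"

text \<open>Coordinates in J tend to 0, the others are unconstrained. The value 0 itself is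
  included, so O-bounds also determine the value at the base point.\<close>

definition small :: "nat set \<Rightarrow> (nat \<Rightarrow> complex) filter" where
  "small J = filtercomap (cnorm1 J) (nhds 0)"

lemma norm_cnorm1: "norm (cnorm1 J x) = (\<Sum>i\<in>J. norm (x i))"
  unfolding cnorm1_def norm_of_real by (simp add: sum_nonneg)

lemma cnorm1_ge:
  assumes "finite J" "i \<in> J"
  shows "norm (x i) \<le> norm (cnorm1 J x)"
  unfolding norm_cnorm1 using assms by (intro member_le_sum) auto

lemma eventually_small:
  "eventually P (small J) \<longleftrightarrow> (\<exists>d>0. \<forall>x. norm (cnorm1 J x) < d \<longrightarrow> P x)"
proof -
  have "eventually P (small J) \<longleftrightarrow> (\<exists>Q. (\<exists>d>0. \<forall>z. norm z < d \<longrightarrow> Q z) \<and> (\<forall>x. Q (cnorm1 J x) \<longrightarrow> P x))"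
    by (simp add: small_def eventually_filtercomap eventually_nhds_metric)
  also have "\<dots> \<longleftrightarrow> (\<exists>d>0. \<forall>x. norm (cnorm1 J x) < d \<longrightarrow> P x)"
  proof safe
    fix d :: real assume "d > 0" "\<forall>x. norm (cnorm1 J x) < d \<longrightarrow> P x"
    then show "\<exists>Q. (\<exists>d>0. \<forall>z. norm z < d \<longrightarrow> Q z) \<and> (\<forall>x. Q (cnorm1 J x) \<longrightarrow> P x)"
      by (intro exI[of _ "\<lambda>z. norm z < d"]) auto
  qed blast
  finally show ?thesis .
qed

lemma cnorm1_tendsto_0: "(cnorm1 J \<longlongrightarrow> 0) (small J)"
  unfolding small_def by (rule filterlim_filtercomap)

lemma coord_bigo_cnorm1:
  assumes "finite J" "i \<in> J"
  shows "(\<lambda>x. x i) \<in> O[small J](cnorm1 J)"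
  by (rule bigoI[of _ 1]) (simp add: cnorm1_ge[OF assms])

lemma bigo_cnorm1_power_le:
  assumes "m \<le> n"
  shows "(\<lambda>x. cnorm1 J x ^ n) \<in> O[small J](\<lambda>x. cnorm1 J x ^ m)"
proof (rule bigoI[of _ 1])
  show "eventually (\<lambda>x. norm (cnorm1 J x ^ n) \<le> 1 * norm (cnorm1 J x ^ m)) (small J)"
    unfolding eventually_small
    using assms by (intro exI[of _ 1]) (auto simp: norm_power intro!: power_decreasing)
qed

lemma filterlim_small:
  assumes J: "finite J" and lim: "\<And>i. i \<in> J \<Longrightarrow> ((\<lambda>t. \<gamma> t i) \<longlongrightarrow> a i) G"
  shows "filterlim (\<lambda>t i. \<gamma> t i - a i) (small J) G"
  unfolding small_def
proof (rule filterlim_filtercomap_iff[THEN iffD2])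
  have "((\<lambda>t. of_real (\<Sum>i\<in>J. norm (\<gamma> t i - a i))) \<longlongrightarrow> complex_of_real (\<Sum>i\<in>J. norm (a i - a i))) G"
    by (intro tendsto_of_real tendsto_sum tendsto_norm tendsto_diff lim tendsto_const)
  then show "filterlim (cnorm1 J \<circ> (\<lambda>t i. \<gamma> t i - a i)) (nhds 0) G"
    by (simp add: cnorm1_def o_def)
qed

lemma bigo_imp_tendsto_0:
  fixes f g :: "'a \<Rightarrow> 'b::real_normed_field"
  assumes "f \<in> O[F](g)" "(g \<longlongrightarrow> 0) F"
  shows "(f \<longlongrightarrow> 0) F"
proof -
  obtain C where "eventually (\<lambda>x. norm (f x) \<le> C * norm (g x)) F"
    using assms(1) by (elim landau_o.bigE)
  moreover have "((\<lambda>x. C * norm (g x)) \<longlongrightarrow> 0) F"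
    using tendsto_mult[OF tendsto_const tendsto_norm[OF assms(2)], of C] by simp
  ultimately show ?thesis by (rule Lim_null_comparison)
qed

definition lin_part :: "nat set \<Rightarrow> (nat \<Rightarrow> complex) \<Rightarrow> (nat \<Rightarrow> complex) \<Rightarrow> complex" where
  "lin_part J l x = (\<Sum>i\<in>J. l i * x i)"

definition quad_part :: "nat set \<Rightarrow> (nat \<Rightarrow> nat \<Rightarrow> complex) \<Rightarrow> (nat \<Rightarrow> complex) \<Rightarrow> complex" where
  "quad_part J q x = (\<Sum>i\<in>J. \<Sum>j\<in>J. q i j * x i * x j)"

text \<open>A notion stable under sums, products and composition, matched with derivatives only
  afterwards. The form q carries no factor 1/2 and may be asymmetric, so second partial derivatives
  are \<open>q i j + q j i\<close>.\<close>

definition taylor2 :: "nat set \<Rightarrow> ((nat \<Rightarrow> complex) \<Rightarrow> complex) \<Rightarrow> (nat \<Rightarrow> complex) \<Rightarrow>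
    complex \<Rightarrow> (nat \<Rightarrow> complex) \<Rightarrow> (nat \<Rightarrow> nat \<Rightarrow> complex) \<Rightarrow> bool" where
  "taylor2 J f a c l q \<longleftrightarrow>
    (\<lambda>x. f (\<lambda>i. a i + x i) - (c + lin_part J l x + quad_part J q x)) \<in> O[small J](\<lambda>x. cnorm1 J x ^ 3)"

lemma cmult_bigo:
  fixes f g :: "'a \<Rightarrow> 'b::real_normed_field"
  assumes "f \<in> O[F](g)"
  shows "(\<lambda>x. c * f x) \<in> O[F](g)"
proof -
  obtain C where "eventually (\<lambda>x. norm (f x) \<le> C * norm (g x)) F"
    using assms by (elim landau_o.bigE)
  then have "eventually (\<lambda>x. norm (c * f x) \<le> (norm c * C) * norm (g x)) F"
    by eventually_elim (simp add: norm_mult mult.assoc mult_left_mono)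
  then show ?thesis by (rule bigoI)
qed

lemma lin_part_bigo:
  assumes "finite J"
  shows "lin_part J l \<in> O[small J](cnorm1 J)"
  unfolding lin_part_def using assms
  by (intro big_sum_in_bigo cmult_bigo coord_bigo_cnorm1)

lemma quad_part_bigo:
  assumes "finite J"
  shows "quad_part J q \<in> O[small J](\<lambda>x. cnorm1 J x ^ 2)"
  unfolding quad_part_def
proof (intro big_sum_in_bigo)
  fix i j assume ij: "i \<in> J" "j \<in> J"
  have "(\<lambda>x. q i j * (x i * x j)) \<in> O[small J](\<lambda>x. cnorm1 J x * cnorm1 J x)"
    using ij assms by (intro cmult_bigo landau_o.big.mult coord_bigo_cnorm1)
  then show "(\<lambda>x. q i j * x i * x j) \<in> O[small J](\<lambda>x. cnorm1 J x ^ 2)"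
    by (simp add: power2_eq_square mult.assoc)
qed

lemma taylor2_const: "taylor2 J (\<lambda>_. c) a c (\<lambda>_. 0) (\<lambda>_ _. 0)"
  by (simp add: taylor2_def lin_part_def quad_part_def)

lemma taylor2_coord:
  assumes "finite J" "i \<in> J"
  shows "taylor2 J (\<lambda>y. y i) a (a i) (\<lambda>j. if j = i then 1 else 0) (\<lambda>_ _. 0)"
proof -
  have "lin_part J (\<lambda>j. if j = i then 1 else 0) x = x i" for x
    using assms by (simp add: lin_part_def if_distrib[of "\<lambda>u. u * _"] cong: if_cong)
  then show ?thesis by (simp add: taylor2_def quad_part_def)
qed

lemma taylor2_add:
  assumes "taylor2 J f a c l q" "taylor2 J g a c' l' q'"
  shows "taylor2 J (\<lambda>y. f y + g y) a (c + c') (\<lambda>i. l i + l' i) (\<lambda>i j. q i j + q' i j)"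
proof -
  have eq: "f (\<lambda>i. a i + x i) + g (\<lambda>i. a i + x i) -
      (c + c' + lin_part J (\<lambda>i. l i + l' i) x + quad_part J (\<lambda>i j. q i j + q' i j) x) =
    (f (\<lambda>i. a i + x i) - (c + lin_part J l x + quad_part J q x)) +
    (g (\<lambda>i. a i + x i) - (c' + lin_part J l' x + quad_part J q' x))" for x
    by (simp add: lin_part_def quad_part_def algebra_simps sum.distrib)
  show ?thesis
    unfolding taylor2_def eq by (rule sum_in_bigo(1)[OF assms[unfolded taylor2_def]])
qed

text \<open>The products of the linear parts supply the new quadratic term. What is left has total
  degree at least three or contains the remainder of a factor.\<close>

lemma taylor2_mult:
  assumes J: "finite J" and f: "taylor2 J f a c l q" and g: "taylor2 J g a c' l' q'"
  shows "taylor2 J (\<lambda>y. f y * g y) a (c * c') (\<lambda>i. c * l' i + c' * l i)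
    (\<lambda>i j. c * q' i j + c' * q i j + l i * l' j)"
proof -
  let ?N = "cnorm1 J" and ?L = "lin_part J l" and ?L' = "lin_part J l'"
    and ?Q = "quad_part J q" and ?Q' = "quad_part J q'"
  let ?R = "\<lambda>x. f (\<lambda>i. a i + x i) - (c + ?L x + ?Q x)" and ?R' = "\<lambda>x. g (\<lambda>i. a i + x i) - (c' + ?L' x + ?Q' x)"
  note R = f[unfolded taylor2_def] and R' = g[unfolded taylor2_def]
  note L = lin_part_bigo[OF J, of l] and L' = lin_part_bigo[OF J, of l']
  note Q = quad_part_bigo[OF J, of q] and Q' = quad_part_bigo[OF J, of q']
  have 1: "?N \<in> O[small J](\<lambda>_. 1)" using bigo_cnorm1_power_le[of 0 1 J] by simp
  have up: "u \<in> O[small J](\<lambda>x. ?N x ^ 3)" if "u \<in> O[small J](\<lambda>x. ?N x ^ n)" "n \<ge> 3" for u n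
    by (rule landau_o.big.trans[OF that(1) bigo_cnorm1_power_le[OF that(2)]])
  have b1: "(\<lambda>x. ?L x * ?Q' x) \<in> O[small J](\<lambda>x. ?N x ^ 3)"
    using landau_o.big.mult[OF L Q'] by (simp add: power3_eq_cube power2_eq_square mult_ac)
  have b2: "(\<lambda>x. ?Q x * ?L' x) \<in> O[small J](\<lambda>x. ?N x ^ 3)"
    using landau_o.big.mult[OF Q L'] by (simp add: power3_eq_cube power2_eq_square mult_ac)
  have b3: "(\<lambda>x. ?Q x * ?Q' x) \<in> O[small J](\<lambda>x. ?N x ^ 3)"
    using landau_o.big.mult[OF Q Q'] by (intro up[of _ 4]) (simp_all flip: power_add)
  have t1: "(\<lambda>x. c + ?L x + ?Q x) \<in> O[small J](\<lambda>_. 1)"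
    using landau_o.big.trans[OF L 1] landau_o.big.trans[OF Q bigo_cnorm1_power_le[of 0 2 J]]
    by (intro sum_in_bigo) simp_all
  have t2: "(\<lambda>x. c' + ?L' x + ?Q' x) \<in> O[small J](\<lambda>_. 1)"
    using landau_o.big.trans[OF L' 1] landau_o.big.trans[OF Q' bigo_cnorm1_power_le[of 0 2 J]]
    by (intro sum_in_bigo) simp_all
  have b4: "(\<lambda>x. (c + ?L x + ?Q x) * ?R' x) \<in> O[small J](\<lambda>x. ?N x ^ 3)"
    using landau_o.big.mult[OF t1 R'] by simp
  have b5: "(\<lambda>x. ?R x * (c' + ?L' x + ?Q' x)) \<in> O[small J](\<lambda>x. ?N x ^ 3)"
    using landau_o.big.mult[OF R t2] by simp
  have b6: "(\<lambda>x. ?R x * ?R' x) \<in> O[small J](\<lambda>x. ?N x ^ 3)"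
    using landau_o.big.mult[OF R R'] by (intro up[of _ 6]) (simp_all flip: power_add)
  have LL: "?L x * ?L' x = quad_part J (\<lambda>i j. l i * l' j) x" for x
    by (simp add: lin_part_def quad_part_def sum_product mult_ac)
  have e1: "lin_part J (\<lambda>i. c * l' i + c' * l i) x = c * ?L' x + c' * ?L x" for x
    by (simp add: lin_part_def algebra_simps sum.distrib sum_distrib_left)
  have e2: "quad_part J (\<lambda>i j. c * q' i j + c' * q i j + l i * l' j) x =
      c * ?Q' x + c' * ?Q x + ?L x * ?L' x" for x
    unfolding LL by (simp add: quad_part_def algebra_simps sum.distrib sum_distrib_left)
  have "f (\<lambda>i. a i + x i) * g (\<lambda>i. a i + x i) - (c * c' + lin_part J (\<lambda>i. c * l' i + c' * l i) x +
      quad_part J (\<lambda>i j. c * q' i j + c' * q i j + l i * l' j) x) =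
    ?L x * ?Q' x + ?Q x * ?L' x + ?Q x * ?Q' x + (c + ?L x + ?Q x) * ?R' x + ?R x * (c' + ?L' x + ?Q' x) + ?R x * ?R' x" for x
    unfolding e1 e2 by (simp add: algebra_simps)
  then show ?thesis
    unfolding taylor2_def using b1 b2 b3 b4 b5 b6 by (simp only:) (intro sum_in_bigo)
qed

text \<open>From here on the closure rules assert existence only; the coefficients are recovered
  later from partial derivatives.\<close>

lemma taylor2_cmult:
  assumes "finite J" "taylor2 J f a c l q"
  shows "\<exists>c' l' q'. taylor2 J (\<lambda>y. b * f y) a c' l' q'"
  using taylor2_mult[OF assms(1) taylor2_const assms(2)] by blast

lemma taylor2_sum:
  assumes "finite S" "\<And>s. s \<in> S \<Longrightarrow> \<exists>c l q. taylor2 J (f s) a c l q"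
  shows "\<exists>c l q. taylor2 J (\<lambda>y. \<Sum>s\<in>S. f s y) a c l q"
  using assms
proof (induction S)
  case empty
  show ?case using taylor2_const[of J 0 a] by auto
next
  case (insert s S)
  obtain c l q where "taylor2 J (f s) a c l q" using insert.prems by blast
  moreover obtain c' l' q' where "taylor2 J (\<lambda>y. \<Sum>s\<in>S. f s y) a c' l' q'" using insert by blast
  ultimately have "\<exists>c l q. taylor2 J (\<lambda>y. f s y + (\<Sum>s\<in>S. f s y)) a c l q"
    using taylor2_add by blast
  then show ?case using insert.hyps by simp
qed

lemma taylor2_power:
  assumes J: "finite J" and f: "\<exists>c l q. taylor2 J f a c l q"
  shows "\<exists>c l q. taylor2 J (\<lambda>y. f y ^ n) a c l q"
proof (induction n)
  case 0
  show ?case using taylor2_const[of J 1 a] by auto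
next
  case (Suc n)
  then show ?case using f taylor2_mult[OF J] unfolding power_Suc by blast
qed

lemma taylor2_prod:
  assumes J: "finite J" and "finite S" "\<And>s. s \<in> S \<Longrightarrow> \<exists>c l q. taylor2 J (f s) a c l q"
  shows "\<exists>c l q. taylor2 J (\<lambda>y. \<Prod>s\<in>S. f s y) a c l q"
  using assms(2,3)
proof (induction S)
  case empty
  show ?case using taylor2_const[of J 1 a] by auto
next
  case (insert s S)
  obtain c l q where "taylor2 J (f s) a c l q" using insert.prems by blast
  moreover obtain c' l' q' where "taylor2 J (\<lambda>y. \<Prod>s\<in>S. f s y) a c' l' q'" using insert by blast
  ultimately have "\<exists>c l q. taylor2 J (\<lambda>y. f s y * (\<Prod>s\<in>S. f s y)) a c l q"
    using taylor2_mult[OF J] by blast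
  then show ?case using insert.hyps by simp
qed

lemma taylor2_at_point:
  assumes "taylor2 J f a c l q"
  shows "f a = c"
proof -
  obtain C where "eventually (\<lambda>x. norm (f (\<lambda>i. a i + x i) - (c + lin_part J l x + quad_part J q x)) \<le>
      C * norm (cnorm1 J x ^ 3)) (small J)"
    using assms unfolding taylor2_def by (auto elim!: landau_o.bigE)
  then obtain d where "d > 0" "\<And>x. norm (cnorm1 J x) < d \<Longrightarrow>
      norm (f (\<lambda>i. a i + x i) - (c + lin_part J l x + quad_part J q x)) \<le> C * norm (cnorm1 J x ^ 3)"
    unfolding eventually_small by blast
  from this(2)[of "\<lambda>_. 0"] this(1) show ?thesis by (simp add: cnorm1_def lin_part_def quad_part_def)
qed

lemma taylor2_diff_bigo:
  assumes J: "finite J" and f: "taylor2 J f a c l q"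
  shows "(\<lambda>x. f (\<lambda>i. a i + x i) - c) \<in> O[small J](cnorm1 J)"
proof -
  have 1: "(\<lambda>x. f (\<lambda>i. a i + x i) - (c + lin_part J l x + quad_part J q x)) \<in> O[small J](cnorm1 J)"
    using landau_o.big.trans[OF f[unfolded taylor2_def] bigo_cnorm1_power_le[of 1 3 J]] by simp
  have 2: "(\<lambda>x. quad_part J q x) \<in> O[small J](cnorm1 J)"
    using landau_o.big.trans[OF quad_part_bigo[OF J] bigo_cnorm1_power_le[of 1 2 J]] by simp
  have 3: "(\<lambda>x. lin_part J l x) \<in> O[small J](cnorm1 J)" by (rule lin_part_bigo[OF J])
  from sum_in_bigo(1)[OF 1 sum_in_bigo(1)[OF 3 2]] show ?thesis by (simp add: algebra_simps)
qed

lemma holomorphic_taylor2: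
  assumes g: "g holomorphic_on ball c r" and r: "r > 0"
  shows "(\<lambda>t. g (c + t) - (g c + deriv g c * t + (deriv ^^ 2) g c / 2 * t ^ 2)) \<in> O[nhds 0](\<lambda>t. t ^ 3)"
proof -
  let ?S = "cball c (r / 2)"
  have hol: "(deriv ^^ n) g holomorphic_on ball c r" for n
    by (rule holomorphic_higher_deriv[OF g]) simp
  have sub: "?S \<subseteq> ball c r" using r by auto
  have "continuous_on ?S ((deriv ^^ 3) g)"
    using holomorphic_on_imp_continuous_on[OF hol] sub continuous_on_subset by blast
  then have "compact ((deriv ^^ 3) g ` ?S)" using compact_continuous_image compact_cball by blast
  then have "bounded ((deriv ^^ 3) g ` ?S)" by (rule compact_imp_bounded)
  then obtain B where "\<forall>y\<in>(deriv ^^ 3) g ` ?S. norm y \<le> B" by (auto simp only: bounded_iff)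
  then have B: "norm ((deriv ^^ 3) g x) \<le> B" if "x \<in> ?S" for x using that by blast
  have "norm (g z - (\<Sum>i\<le>2. (deriv ^^ i) g c * (z - c) ^ i / fact i)) \<le> B * norm (z - c) ^ Suc 2 / fact 2"
    if z: "z \<in> ?S" for z
  proof -
    have "norm ((\<lambda>i. (deriv ^^ i) g) 0 z - (\<Sum>i\<le>2. (\<lambda>i. (deriv ^^ i) g) i c * (z - c) ^ i / fact i)) \<le> B * norm (z - c) ^ Suc 2 / fact 2"
    proof (rule complex_Taylor)
      fix i x assume "x \<in> ?S"
      then have "x \<in> ball c r" using sub by blast
      then have "((deriv ^^ i) g has_field_derivative deriv ((deriv ^^ i) g) x) (at x)"
        using hol holomorphic_derivI open_ball by blast
      then show "((deriv ^^ i) g has_field_derivative (deriv ^^ Suc i) g x) (at x within ?S)"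
        by (simp add: has_field_derivative_at_within)
    next
      fix x assume "x \<in> ?S"
      then show "norm ((deriv ^^ Suc 2) g x) \<le> B" using B[of x] by (simp add: eval_nat_numeral)
    qed (use z r in auto)
    then show ?thesis by simp
  qed
  note Taylor = this
  have "norm (g (c + t) - (g c + deriv g c * t + (deriv ^^ 2) g c / 2 * t ^ 2)) \<le> B / 2 * norm (t ^ 3)"
    if "norm t < r / 2" for t
  proof -
    have "c + t \<in> ?S" using that by (auto simp: dist_norm)
    moreover have "(\<Sum>i\<le>2. (deriv ^^ i) g c * t ^ i / fact i) = g c + deriv g c * t + (deriv ^^ 2) g c / 2 * t ^ 2"
      by (simp add: eval_nat_numeral)
    ultimately show ?thesis
      using Taylor[of "c + t"] by (simp add: norm_power norm_mult eval_nat_numeral)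
  qed
  then show ?thesis
    using r by (intro bigoI[of _ "B / 2"]) (auto simp: eventually_nhds_metric intro!: exI[of _ "r / 2"])
qed

text \<open>The quadratic Taylor polynomial of g, evaluated at f, is a polynomial in f and falls
  under the closure rules. The error is cubic in \<open>f - c\<close>, hence cubic in the
  displacement.\<close>

lemma taylor2_comp:
  assumes J: "finite J" and f: "taylor2 J f a c l q" and g: "g holomorphic_on ball c r" "r > 0"
  shows "\<exists>c' l' q'. taylor2 J (\<lambda>y. g (f y)) a c' l' q'"
proof -
  let ?N = "cnorm1 J" and ?t = "\<lambda>x. f (\<lambda>i. a i + x i) - c"
  let ?d1 = "deriv g c" and ?d2 = "(deriv ^^ 2) g c / 2"
  have 1: "?N \<in> O[small J](\<lambda>_. 1)" using bigo_cnorm1_power_le[of 0 1 J] by simp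
  have tO: "?t \<in> O[small J](?N)" by (rule taylor2_diff_bigo[OF J f])
  then have "(?t \<longlongrightarrow> 0) (small J)"
    by (rule bigo_imp_tendsto_0[OF _ cnorm1_tendsto_0])
  then have "(\<lambda>x. g (c + ?t x) - (g c + ?d1 * ?t x + ?d2 * ?t x ^ 2)) \<in> O[small J](\<lambda>x. ?t x ^ 3)"
    by (rule landau_o.big.compose[OF holomorphic_taylor2[OF g]])
  also have "(\<lambda>x. ?t x ^ 3) \<in> O[small J](\<lambda>x. ?N x ^ 3)"
    by (rule landau_o.big_power[OF tO])
  finally have R: "(\<lambda>x. g (f (\<lambda>i. a i + x i)) -
      (g c + ?d1 * (f (\<lambda>i. a i + x i) + (- c)) + ?d2 * (f (\<lambda>i. a i + x i) + (- c)) ^ 2)) \<in> O[small J](\<lambda>x. ?N x ^ 3)"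
    by simp
  have "\<exists>c' l' q'. taylor2 J (\<lambda>y. g c + ?d1 * (f y + (- c)) + ?d2 * (f y + (- c)) ^ 2) a c' l' q'"
  proof -
    have *: "\<exists>c' l' q'. taylor2 J (\<lambda>y. u y + v y) a c' l' q'"
      if "\<exists>c' l' q'. taylor2 J u a c' l' q'" "\<exists>c' l' q'. taylor2 J v a c' l' q'" for u v
      using that taylor2_add by blast
    have c: "\<exists>c' l' q'. taylor2 J (\<lambda>_. b) a c' l' q'" for b using taylor2_const by blast
    have m: "\<exists>c' l' q'. taylor2 J (\<lambda>y. b * u y) a c' l' q'" if "\<exists>c' l' q'. taylor2 J u a c' l' q'" for b u
      using that taylor2_cmult[OF J] by blast
    have "\<exists>c' l' q'. taylor2 J (\<lambda>y. f y + (- c)) a c' l' q'" using f by (intro * c) blast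
    then show ?thesis
      using *[OF *[OF c m] m[OF taylor2_power[OF J]], of "\<lambda>y. f y + (- c)" "\<lambda>y. f y + (- c)"] by blast
  qed
  then obtain c' l' q' where T: "taylor2 J (\<lambda>y. g c + ?d1 * (f y + (- c)) + ?d2 * (f y + (- c)) ^ 2) a c' l' q'"
    by blast
  have "taylor2 J (\<lambda>y. g (f y)) a c' l' q'"
    using sum_in_bigo(1)[OF R T[unfolded taylor2_def]]
    unfolding taylor2_def diff_add_cancel add_diff_eq .
  then show ?thesis by blast
qed

text \<open>Cauchy's estimate on a circle of radius \<open>cnorm1 J x\<close> turns the cubic remainder of \<open>f\<close>
  into a quadratic remainder of its partial derivatives.\<close>

lemma taylor2_partial_deriv:
  assumes J: "finite J" and f: "taylor2 J f a c l q" and j: "j \<in> J"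
    and diff: "\<epsilon> > 0" "\<And>y j. \<lbrakk>\<And>i. i \<in> J \<Longrightarrow> norm (y i - a i) < \<epsilon>; j \<in> J\<rbrakk> \<Longrightarrow>
      (\<lambda>z. f (y(j := z))) field_differentiable at (y j)"
  shows "\<exists>C d. d > 0 \<and> (\<forall>x. norm (cnorm1 J x) < d \<longrightarrow>
    norm (partial_deriv j f (\<lambda>i. a i + x i) - (l j + (\<Sum>i\<in>J. (q i j + q j i) * x i))) \<le> C * norm (cnorm1 J x) ^ 2)"
proof -
  let ?N = "\<lambda>x. norm (cnorm1 J x)"
  let ?T = "\<lambda>x. c + lin_part J l x + quad_part J q x"
  let ?D = "\<lambda>x. l j + (\<Sum>i\<in>J. (q i j + q j i) * x i)"
  obtain C0 where "eventually (\<lambda>x. norm (f (\<lambda>i. a i + x i) - ?T x) \<le> C0 * norm (cnorm1 J x ^ 3)) (small J)"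
    using f unfolding taylor2_def by (auto elim!: landau_o.bigE)
  then obtain d0 where d0: "d0 > 0" "\<And>x. ?N x < d0 \<Longrightarrow> norm (f (\<lambda>i. a i + x i) - ?T x) \<le> C0 * ?N x ^ 3"
    unfolding eventually_small norm_power by blast
  define C where "C = max C0 0"
  have C: "C \<ge> 0" "C0 \<le> C" by (auto simp: C_def)
  define d where "d = min d0 \<epsilon> / 2"
  have d: "d > 0" "2 * d \<le> d0" "2 * d \<le> \<epsilon>" using d0(1) diff(1) by (auto simp: d_def)
  let ?x = "\<lambda>x w i. x i + (if i = j then w else 0 :: complex)"
  have N: "?N (?x x w) \<le> ?N x + norm w" for x w
  proof -
    have "?N (?x x w) \<le> (\<Sum>i\<in>J. norm (x i) + (if i = j then norm w else 0))"
      unfolding norm_cnorm1 by (intro sum_mono) (auto intro: norm_triangle_ineq)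
    also have "\<dots> = ?N x + norm w" unfolding norm_cnorm1 using J j by (simp add: sum.distrib)
    finally show ?thesis .
  qed
  have Tx: "?T (?x x w) = ?T x + w * ?D x + w\<^sup>2 * q j j" for x w
  proof -
    have 1: "lin_part J l (?x x w) = lin_part J l x + w * l j"
      using J j by (simp add: lin_part_def distrib_left sum.distrib if_distrib[of "\<lambda>u. _ * u"] mult.commute cong: if_cong)
    have "quad_part J q (?x x w) = (\<Sum>i\<in>J. \<Sum>k\<in>J. q i k * x i * x k + (if k = j then q i j * x i * w else 0) +
        (if i = j then q j k * w * x k else 0) + (if i = j then if k = j then q j j * w * w else 0 else 0))"
      unfolding quad_part_def by (intro sum.cong refl) (auto simp: algebra_simps)
    also have "\<dots> = quad_part J q x + (\<Sum>i\<in>J. q i j * x i * w) + (\<Sum>k\<in>J. q j k * w * x k) + q j j * w * w"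
    proof -
      have "(\<Sum>i\<in>J. \<Sum>k\<in>J. if i = j then q j k * w * x k else 0) = (\<Sum>i\<in>J. if i = j then \<Sum>k\<in>J. q j k * w * x k else 0)"
        by (intro sum.cong refl) auto
      moreover have "(\<Sum>i\<in>J. \<Sum>k\<in>J. if i = j then if k = j then q j j * w * w else 0 else 0) =
          (\<Sum>i\<in>J. if i = j then \<Sum>k\<in>J. if k = j then q j j * w * w else 0 else 0)"
        by (intro sum.cong refl) auto
      ultimately show ?thesis using J j by (simp add: sum.distrib quad_part_def)
    qed
    finally show ?thesis unfolding 1
      by (simp add: algebra_simps sum.distrib sum_distrib_left power2_eq_square)
  qed
  have fx: "(\<lambda>i. a i + ?x x w i) = (\<lambda>i. a i + x i)(j := a j + x j + w)" for x w
    by (auto simp: fun_eq_iff)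
  \<comment> \<open>On the circle of radius \<rho> in coordinate j the l1 norm is at most
    \<open>2 * \<rho>\<close>, whence 8 = 2^3 in Cauchy's inequality.\<close>
  have bound: "norm (partial_deriv j f (\<lambda>i. a i + x i) - ?D x) \<le> 8 * C * \<rho>\<^sup>2"
    if x: "?N x \<le> \<rho>" and \<rho>: "0 < \<rho>" "\<rho> < d" for x \<rho>
  proof -
    let ?e = "\<lambda>w. f (\<lambda>i. a i + ?x x w i) - ?T (?x x w)"
    let ?y = "\<lambda>i. a i + x i"
    have fd: "(\<lambda>w. f (\<lambda>i. a i + ?x x w i)) field_differentiable at w" if w: "norm w \<le> \<rho>" for w
    proof -
      let ?z = "?y(j := a j + x j + w)"
      have "norm (?z i - a i) < \<epsilon>" if i: "i \<in> J" for i
      proof -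
        have "norm (?x x w i) \<le> ?N (?x x w)" by (rule cnorm1_ge[OF J i])
        also have "\<dots> < \<epsilon>" using N[of x w] x \<rho> d w by linarith
        also have "?x x w i = ?z i - a i" by auto
        finally show ?thesis .
      qed
      then have "(\<lambda>z. f (?z(j := z))) field_differentiable at (?z j)" by (rule diff(2)[OF _ j])
      then have "(\<lambda>z. f (?y(j := z))) field_differentiable at (a j + x j + w)" by simp
      moreover have "(\<lambda>w. a j + x j + w) field_differentiable at w" by (intro derivative_intros)
      ultimately have "((\<lambda>z. f (?y(j := z))) \<circ> (\<lambda>w. a j + x j + w)) field_differentiable at w"
        using field_differentiable_compose by blast
      then show ?thesis unfolding fx o_def .
    qed
    have De: "(?e has_field_derivative (partial_deriv j f ?y - ?D x)) (at 0)"
    proof -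
      have "((\<lambda>w. f (\<lambda>i. a i + ?x x w i)) has_field_derivative partial_deriv j f ?y) (at 0)"
      proof -
        have "(\<lambda>z. f (?y(j := z))) field_differentiable at (?y j)"
        proof (rule diff(2)[OF _ j])
          fix i assume "i \<in> J"
          then have "norm (x i) \<le> ?N x" by (rule cnorm1_ge[OF J])
          then show "norm (?y i - a i) < \<epsilon>" using x \<rho> d by simp
        qed
        then have "((\<lambda>z. f (?y(j := z))) has_field_derivative partial_deriv j f ?y) (at (a j + x j))"
          by (simp add: partial_deriv_def DERIV_deriv_iff_field_differentiable)
        then have "((\<lambda>w. f (?y(j := w + (a j + x j)))) has_field_derivative partial_deriv j f ?y) (at 0)"
          using DERIV_shift[of "\<lambda>z. f (?y(j := z))" _ 0 "a j + x j"] by simp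
        then show ?thesis unfolding fx by (simp add: add_ac)
      qed
      moreover have "((\<lambda>w. ?T (?x x w)) has_field_derivative ?D x) (at 0)"
        unfolding Tx by (auto intro!: derivative_eq_intros)
      ultimately show ?thesis by (rule DERIV_diff)
    qed
    have "?e field_differentiable at w" if "norm w \<le> \<rho>" for w
    proof -
      have "(\<lambda>w. ?T (?x x w)) field_differentiable at w"
        unfolding Tx by (auto intro!: derivative_intros simp: field_differentiable_def) (auto intro!: derivative_eq_intros)
      then show ?thesis using fd[OF that] by (rule field_differentiable_diff[rotated])
    qed
    then have "?e holomorphic_on cball 0 \<rho>"
      by (auto simp: holomorphic_on_def intro: field_differentiable_at_within)
    then have "?e holomorphic_on ball 0 \<rho>" "continuous_on (cball 0 \<rho>) ?e"
      by (auto intro: holomorphic_on_subset holomorphic_on_imp_continuous_on)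
    moreover have "norm (?e w) \<le> 8 * C * \<rho> ^ 3" if "norm (0 - w) = \<rho>" for w
    proof -
      have w: "norm w = \<rho>" using that by simp
      have Nx: "?N (?x x w) \<le> 2 * \<rho>" using N[of x w] x w by simp
      then have "norm (?e w) \<le> C0 * ?N (?x x w) ^ 3" using \<rho> d by (intro d0(2)) linarith
      also have "\<dots> \<le> C * (2 * \<rho>) ^ 3" using C Nx by (intro mult_mono power_mono) auto
      finally show ?thesis by (simp add: power_mult_distrib)
    qed
    ultimately have "norm ((deriv ^^ 1) ?e 0) \<le> fact 1 * (8 * C * \<rho> ^ 3) / \<rho> ^ 1"
      using \<rho>(1) by (intro Cauchy_inequality) auto
    also have "fact 1 * (8 * C * \<rho> ^ 3) / \<rho> ^ 1 = 8 * C * \<rho>\<^sup>2" using \<rho> by (simp add: eval_nat_numeral)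
    finally show ?thesis using DERIV_imp_deriv[OF De] by simp
  qed
  have "norm (partial_deriv j f (\<lambda>i. a i + x i) - ?D x) \<le> 8 * C * ?N x ^ 2" if x: "?N x < d" for x
  proof (cases "?N x = 0")
    case False
    then show ?thesis using x by (intro bound) auto
  next
    \<comment> \<open>There is no circle of radius 0; the bound is obtained in the limit of
      shrinking radii.\<close>
    case True
    have "norm (partial_deriv j f (\<lambda>i. a i + x i) - ?D x) \<le> 8 * C * 0\<^sup>2"
    proof (rule tendsto_lowerbound)
      show "((\<lambda>\<rho>. 8 * C * \<rho>\<^sup>2) \<longlongrightarrow> 8 * C * 0\<^sup>2) (at_right (0 :: real))"
        by (intro tendsto_intros)
      show "\<forall>\<^sub>F \<rho> in at_right 0. norm (partial_deriv j f (\<lambda>i. a i + x i) - ?D x) \<le> 8 * C * \<rho>\<^sup>2"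
        using eventually_at_right_less[of 0] eventually_at_right_real[OF d(1)]
        by eventually_elim (rule bound, use True in auto)
    qed simp
    then show ?thesis using True by simp
  qed
  then show ?thesis using d(1) by (intro exI[of _ "8 * C"] exI[of _ d]) simp
qed

text \<open>The quadratic remainder of a first partial derivative makes its difference quotients
  converge, which yields the second derivatives, mixed ones included.\<close>

lemma taylor2_partial_derivs:
  assumes J: "finite J" and f: "taylor2 J f a c l q" and j: "j \<in> J"
    and diff: "\<epsilon> > 0" "\<And>y j. \<lbrakk>\<And>i. i \<in> J \<Longrightarrow> norm (y i - a i) < \<epsilon>; j \<in> J\<rbrakk> \<Longrightarrow>
      (\<lambda>z. f (y(j := z))) field_differentiable at (y j)"
  shows "partial_deriv j f a = l j"
    and "i \<in> J \<Longrightarrow> partial_deriv i (partial_deriv j f) a = q i j + q j i"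
proof -
  obtain C d where d: "d > 0" and C: "\<And>x. norm (cnorm1 J x) < d \<Longrightarrow>
    norm (partial_deriv j f (\<lambda>i. a i + x i) - (l j + (\<Sum>i\<in>J. (q i j + q j i) * x i))) \<le> C * norm (cnorm1 J x) ^ 2"
    using taylor2_partial_deriv[OF J f j diff] by blast
  show 1: "partial_deriv j f a = l j"
    using C[of "\<lambda>_. 0"] d by (simp add: cnorm1_def)
  show "partial_deriv i (partial_deriv j f) a = q i j + q j i" if i: "i \<in> J"
  proof -
    let ?g = "\<lambda>z. partial_deriv j f (a(i := z))"
    have b: "norm (?g z - ?g (a i) - (q i j + q j i) * (z - a i)) \<le> C * norm (z - a i) ^ 2"
      if z: "norm (z - a i) < d" for z
    proof -
      let ?x = "\<lambda>k. if k = i then z - a i else 0"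
      have e1: "(\<lambda>k. a k + ?x k) = a(i := z)" by (auto simp: fun_eq_iff)
      have e2: "norm (cnorm1 J ?x) = norm (z - a i)"
        unfolding norm_cnorm1 using J i by (simp add: if_distrib[of norm] cong: if_cong)
      have e3: "(\<Sum>k\<in>J. (q k j + q j k) * ?x k) = (q i j + q j i) * (z - a i)"
        using J i by (simp add: if_distrib[of "\<lambda>u. _ * u"] cong: if_cong)
      have "norm (?g z - (l j + (q i j + q j i) * (z - a i))) \<le> C * norm (z - a i) ^ 2"
        using C[of ?x] z unfolding e1 e2 e3 by blast
      then show ?thesis by (simp only: fun_upd_triv 1 diff_diff_eq)
    qed
    have "((\<lambda>z. (?g z - ?g (a i)) / (z - a i) - (q i j + q j i)) \<longlongrightarrow> 0) (at (a i))"
    proof (rule Lim_null_comparison)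
      show "((\<lambda>z. C * norm (z - a i)) \<longlongrightarrow> 0) (at (a i))"
        by (rule tendsto_eq_intros refl)+ simp
      show "\<forall>\<^sub>F z in at (a i). norm ((?g z - ?g (a i)) / (z - a i) - (q i j + q j i)) \<le> C * norm (z - a i)"
        unfolding eventually_at
      proof (intro exI[of _ d] conjI ballI impI)
        fix z assume "z \<noteq> a i \<and> dist z (a i) < d"
        then have z: "z \<noteq> a i" "norm (z - a i) < d" by (auto simp: dist_norm)
        have "(?g z - ?g (a i)) / (z - a i) - (q i j + q j i) = (?g z - ?g (a i) - (q i j + q j i) * (z - a i)) / (z - a i)"
          using z(1) by (simp add: field_simps)
        then show "norm ((?g z - ?g (a i)) / (z - a i) - (q i j + q j i)) \<le> C * norm (z - a i)"
          using b[OF z(2)] z(1) by (simp add: norm_divide divide_le_eq power2_eq_square mult.assoc)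
      qed (rule d)
    qed
    then have "((\<lambda>z. (?g z - ?g (a i)) / (z - a i)) \<longlongrightarrow> q i j + q j i) (at (a i))"
      by (rule LIM_zero_cancel)
    then have "(?g has_field_derivative (q i j + q j i)) (at (a i))"
      by (simp add: has_field_derivative_iff)
    then show ?thesis unfolding partial_deriv_def[of i] by (rule DERIV_imp_deriv)
  qed
qed

subsection \<open>Functions given by a power series\<close>

text \<open>Terms of degree at least three are bounded by the cube of
  \<open>cnorm1 J x / \<rho>\<close> times their absolute sum at polyradius \<rho>; for complex
  numbers unconditional summability is absolute.\<close>

lemma analytic_at_taylor2:
  assumes J: "finite J" and f: "analytic_at J f a"
  shows "\<exists>c l q. taylor2 J f a c l q"
proof -
  obtain c \<epsilon> where \<epsilon>: "\<epsilon> > 0" and c: "\<And>y. (\<forall>i\<in>J. norm (y i - a i) < \<epsilon>) \<Longrightarrow>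
     ((\<lambda>k. c k * (\<Prod>i\<in>J. (y i - a i) ^ k i)) has_sum f y) (J \<rightarrow>\<^sub>E UNIV)"
    using f unfolding analytic_at_def by blast
  let ?U = "J \<rightarrow>\<^sub>E (UNIV :: nat set)"
  let ?K = "{k \<in> ?U. sum k J \<le> 2}"
  define \<rho> where "\<rho> = \<epsilon> / 2"
  have \<rho>: "\<rho> > 0" "\<rho> < \<epsilon>" using \<epsilon> by (auto simp: \<rho>_def)
  let ?N = "\<lambda>x. norm (cnorm1 J x)"
  have finK: "finite ?K"
  proof (rule finite_subset)
    show "?K \<subseteq> J \<rightarrow>\<^sub>E {..2}"
    proof
      fix k assume k: "k \<in> ?K"
      have "k i \<le> 2" if "i \<in> J" for i
      proof -
        have "k i \<le> sum k J" by (rule member_le_sum[OF that _ J]) simp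
        also have "\<dots> \<le> 2" using k by simp
        finally show ?thesis .
      qed
      then show "k \<in> J \<rightarrow>\<^sub>E {..2}" using k by (simp add: PiE_iff)
    qed
  qed (use J in \<open>simp add: finite_PiE\<close>)
  have "((\<lambda>k. c k * (\<Prod>i\<in>J. (a i + of_real \<rho> - a i) ^ k i)) has_sum f (\<lambda>i. a i + of_real \<rho>)) ?U"
    by (rule c) (use \<rho> in simp)
  from has_sum_imp_summable[OF this] have "(\<lambda>k. c k * (\<Prod>i\<in>J. of_real \<rho> ^ k i)) summable_on ?U"
    by (simp only: add_diff_cancel_left')
  then have "(\<lambda>k. norm (c k * (\<Prod>i\<in>J. of_real \<rho> ^ k i))) summable_on ?U"
    by (simp only: summable_on_iff_abs_summable_on_complex)
  then have S: "(\<lambda>k. norm (c k) * \<rho> ^ sum k J) summable_on ?U"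
    using \<rho> by (simp add: norm_mult norm_power prod_norm[symmetric] power_sum)
  let ?M = "infsum (\<lambda>k. norm (c k) * \<rho> ^ sum k J) (?U - ?K)"
  have S': "(\<lambda>k. norm (c k) * \<rho> ^ sum k J) summable_on (?U - ?K)"
    by (rule summable_on_subset_banach[OF S]) auto
  have bound: "norm (f (\<lambda>i. a i + x i) - (\<Sum>k\<in>?K. c k * (\<Prod>i\<in>J. x i ^ k i))) \<le> ?M / \<rho> ^ 3 * ?N x ^ 3"
    if x: "?N x < \<rho>" for x
  proof -
    let ?t = "\<lambda>k. c k * (\<Prod>i\<in>J. x i ^ k i)"
    let ?u = "?N x / \<rho>"
    have u: "0 \<le> ?u" "?u \<le> 1" using x \<rho> by auto
    have xi: "norm (x i) \<le> ?N x" if "i \<in> J" for i by (rule cnorm1_ge[OF J that])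
    have "((\<lambda>k. c k * (\<Prod>i\<in>J. (a i + x i - a i) ^ k i)) has_sum f (\<lambda>i. a i + x i)) ?U"
    proof (intro c ballI)
      fix i assume "i \<in> J"
      then show "norm (a i + x i - a i) < \<epsilon>" using xi[of i] x \<rho> by simp
    qed
    then have "(?t has_sum f (\<lambda>i. a i + x i)) ?U"
      by (simp only: add_diff_cancel_left')
    then have d: "(?t has_sum (f (\<lambda>i. a i + x i) - sum ?t ?K)) (?U - ?K)"
      by (rule has_sum_Diff[OF _ has_sum_finite[OF finK]]) auto
    have le: "norm (?t k) \<le> ?u ^ 3 * (norm (c k) * \<rho> ^ sum k J)" if k: "k \<in> ?U - ?K" for k
    proof -
      have "norm (?t k) = norm (c k) * (\<Prod>i\<in>J. norm (x i) ^ k i)"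
        by (simp add: norm_mult prod_norm[symmetric] norm_power)
      also have "\<dots> \<le> norm (c k) * (\<Prod>i\<in>J. ?N x ^ k i)"
        by (intro mult_left_mono prod_mono conjI power_mono xi) auto
      also have "(\<Prod>i\<in>J. ?N x ^ k i) = ?N x ^ sum k J" by (simp add: power_sum)
      also have "?N x ^ sum k J = ?u ^ sum k J * \<rho> ^ sum k J"
        using \<rho> by (simp add: power_divide)
      also have "norm (c k) * (?u ^ sum k J * \<rho> ^ sum k J) \<le> norm (c k) * (?u ^ 3 * \<rho> ^ sum k J)"
        using k u \<rho> by (intro mult_left_mono mult_right_mono power_decreasing) auto
      finally show ?thesis by (simp only: mult_ac)
    qed
    have s3: "(\<lambda>k. ?u ^ 3 * (norm (c k) * \<rho> ^ sum k J)) summable_on (?U - ?K)"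
      by (intro summable_on_cmult_right S')
    have abs: "(\<lambda>k. norm (?t k)) summable_on (?U - ?K)"
      by (rule summable_on_comparison_test[OF s3]) (use le in auto)
    have "norm (infsum ?t (?U - ?K)) \<le> infsum (\<lambda>k. norm (?t k)) (?U - ?K)"
      by (rule norm_infsum_bound[OF abs])
    also have "\<dots> \<le> infsum (\<lambda>k. ?u ^ 3 * (norm (c k) * \<rho> ^ sum k J)) (?U - ?K)"
      by (rule infsum_mono[OF abs s3 le])
    also have "\<dots> = ?u ^ 3 * ?M" by (rule infsum_cmult_right) (use S' in simp)
    also have "infsum ?t (?U - ?K) = f (\<lambda>i. a i + x i) - sum ?t ?K" by (rule infsumI[OF d])
    finally show ?thesis by (simp add: power_divide mult_ac)
  qed
  have "\<exists>c' l q. taylor2 J (\<lambda>y. \<Sum>k\<in>?K. c k * (\<Prod>i\<in>J. (y i + - a i) ^ k i)) a c' l q"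
  proof (rule taylor2_sum[OF finK])
    fix k
    have "\<exists>c l q. taylor2 J (\<lambda>y. y i + - a i) a c l q" if "i \<in> J" for i
      using taylor2_add[OF taylor2_coord[OF J that] taylor2_const] by blast
    then have "\<exists>c l q. taylor2 J (\<lambda>y. \<Prod>i\<in>J. (y i + - a i) ^ k i) a c l q"
      by (intro taylor2_prod[OF J J] taylor2_power[OF J])
    then show "\<exists>c' l q. taylor2 J (\<lambda>y. c k * (\<Prod>i\<in>J. (y i + - a i) ^ k i)) a c' l q"
      using taylor2_cmult[OF J] by blast
  qed
  then obtain c' l q where T: "taylor2 J (\<lambda>y. \<Sum>k\<in>?K. c k * (\<Prod>i\<in>J. (y i + - a i) ^ k i)) a c' l q" by blast
  have A: "(\<lambda>x. f (\<lambda>i. a i + x i) - (\<Sum>k\<in>?K. c k * (\<Prod>i\<in>J. x i ^ k i))) \<in> O[small J](\<lambda>x. cnorm1 J x ^ 3)"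
    by (rule bigoI[of _ "?M / \<rho> ^ 3"]) (use bound \<rho> in \<open>auto simp: eventually_small norm_power\<close>)
  have B: "(\<lambda>x. (\<Sum>k\<in>?K. c k * (\<Prod>i\<in>J. x i ^ k i)) - (c' + lin_part J l x + quad_part J q x)) \<in> O[small J](\<lambda>x. cnorm1 J x ^ 3)"
    using T unfolding taylor2_def by simp
  have "taylor2 J f a c' l q"
    using sum_in_bigo(1)[OF A B] unfolding taylor2_def diff_add_cancel add_diff_eq .
  then show ?thesis by blast
qed

text \<open>The Weierstrass test on the net of finite partial sums exhibits the restriction to the
  line as a uniform limit of polynomials.\<close>

lemma analytic_at_line:
  assumes J: "finite J" and f: "analytic_at J f a"
  obtains \<epsilon> where "\<epsilon> > 0" "\<And>b d. (\<And>i. i \<in> J \<Longrightarrow> norm (b i - a i) < \<epsilon>) \<Longrightarrow>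
    (\<lambda>z. f (\<lambda>i. b i + z * d i)) field_differentiable at 0"
proof -
  obtain c \<epsilon> where \<epsilon>: "\<epsilon> > 0" and c: "\<And>y. (\<forall>i\<in>J. norm (y i - a i) < \<epsilon>) \<Longrightarrow>
     ((\<lambda>k. c k * (\<Prod>i\<in>J. (y i - a i) ^ k i)) has_sum f y) (J \<rightarrow>\<^sub>E UNIV)"
    using f unfolding analytic_at_def by blast
  let ?U = "J \<rightarrow>\<^sub>E (UNIV :: nat set)"
  have "(\<lambda>z. f (\<lambda>i. b i + z * d i)) field_differentiable at 0" if b: "\<And>i. i \<in> J \<Longrightarrow> norm (b i - a i) < \<epsilon>" for b d
  proof -
    \<comment> \<open>A polyradius strictly between the finitely many distances and \<epsilon>
      leaves room for a small disc of parameters z.\<close>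
    obtain \<rho> where \<rho>: "\<rho> > 0" "\<rho> < \<epsilon>" "\<And>i. i \<in> J \<Longrightarrow> norm (b i - a i) < \<rho>"
    proof -
      let ?m = "Max (insert 0 ((\<lambda>i. norm (b i - a i)) ` J))"
      have "?m < \<epsilon>" using J b \<epsilon> by auto
      then obtain \<rho> where "?m < \<rho>" "\<rho> < \<epsilon>" using dense by blast
      then show ?thesis using that[of \<rho>] J by auto
    qed
    obtain \<delta> where \<delta>: "\<delta> > 0" "\<And>i. i \<in> J \<Longrightarrow> norm (b i - a i) + \<delta> * norm (d i) \<le> \<rho>"
    proof -
      have "\<forall>i\<in>J. \<forall>\<^sub>F \<delta> in at_right (0::real). norm (b i - a i) + \<delta> * norm (d i) < \<rho>"
      proof
        fix i assume "i \<in> J"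
        have "((\<lambda>\<delta>. norm (b i - a i) + \<delta> * norm (d i)) \<longlongrightarrow> norm (b i - a i) + 0 * norm (d i)) (at_right 0)"
          by (intro tendsto_intros)
        then show "\<forall>\<^sub>F \<delta> in at_right (0::real). norm (b i - a i) + \<delta> * norm (d i) < \<rho>"
          by (rule order_tendstoD(2)) (use \<rho>(3)[OF \<open>i \<in> J\<close>] in simp)
      qed
      then have "\<forall>\<^sub>F \<delta> in at_right (0::real). \<forall>i\<in>J. norm (b i - a i) + \<delta> * norm (d i) < \<rho>"
        using J by (simp add: eventually_ball_finite_distrib)
      then have "\<forall>\<^sub>F \<delta> in at_right (0::real). \<delta> > 0 \<and> (\<forall>i\<in>J. norm (b i - a i) + \<delta> * norm (d i) < \<rho>)"
        using eventually_at_right_less[of 0] by eventually_elim auto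
      then obtain \<delta> where "\<delta> > 0 \<and> (\<forall>i\<in>J. norm (b i - a i) + \<delta> * norm (d i) < \<rho>)"
        using eventually_happens'[OF trivial_limit_at_right_real] by blast
      then show ?thesis using that[of \<delta>] by (auto intro: less_imp_le)
    qed
    let ?g = "\<lambda>k z. c k * (\<Prod>i\<in>J. (b i + z * d i - a i) ^ k i)"
    have le: "norm (b i + z * d i - a i) \<le> \<rho>" if "i \<in> J" "z \<in> cball 0 \<delta>" for i z
    proof -
      have "norm (b i + z * d i - a i) \<le> norm (b i - a i) + norm (z * d i)"
        by (metis add_diff_eq add.commute norm_triangle_ineq add_diff_add diff_0_right)
      also have "\<dots> \<le> norm (b i - a i) + \<delta> * norm (d i)"
        using that by (auto simp: norm_mult intro: mult_right_mono)
      finally show ?thesis using \<delta>(2)[OF that(1)] by linarith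
    qed
    have "((\<lambda>k. c k * (\<Prod>i\<in>J. (a i + of_real \<rho> - a i) ^ k i)) has_sum f (\<lambda>i. a i + of_real \<rho>)) ?U"
      by (rule c) (use \<rho> in simp)
    from has_sum_imp_summable[OF this] have "(\<lambda>k. c k * (\<Prod>i\<in>J. of_real \<rho> ^ k i)) summable_on ?U"
      by (simp only: add_diff_cancel_left')
    then have "(\<lambda>k. norm (c k * (\<Prod>i\<in>J. of_real \<rho> ^ k i))) summable_on ?U"
      by (simp only: summable_on_iff_abs_summable_on_complex)
    then have S: "(\<lambda>k. norm (c k) * (\<Prod>i\<in>J. \<rho> ^ k i)) summable_on ?U"
      using \<rho> by (simp add: norm_mult norm_power prod_norm[symmetric])
    have "uniform_limit (cball 0 \<delta>) (\<lambda>X z. \<Sum>k\<in>X. ?g k z) (\<lambda>z. \<Sum>\<^sub>\<infinity>k\<in>?U. ?g k z) (finite_subsets_at_top ?U)"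
    proof (rule Weierstrass_m_test_general[OF _ S])
      fix k z assume "k \<in> ?U" "z \<in> cball (0::complex) \<delta>"
      then show "norm (?g k z) \<le> norm (c k) * (\<Prod>i\<in>J. \<rho> ^ k i)"
        unfolding norm_mult prod_norm[symmetric] norm_power
        by (intro mult_left_mono prod_mono conjI power_mono le) auto
    qed
    then have "(\<lambda>z. \<Sum>\<^sub>\<infinity>k\<in>?U. ?g k z) holomorphic_on ball 0 \<delta>"
    proof (rule holomorphic_uniform_limit[rotated])
      show "\<forall>\<^sub>F X in finite_subsets_at_top ?U. continuous_on (cball 0 \<delta>) (\<lambda>z. \<Sum>k\<in>X. ?g k z) \<and>
          (\<lambda>z. \<Sum>k\<in>X. ?g k z) holomorphic_on ball 0 \<delta>"
        by (intro always_eventually allI conjI continuous_intros holomorphic_intros)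
    qed auto
    moreover have "(\<Sum>\<^sub>\<infinity>k\<in>?U. ?g k z) = f (\<lambda>i. b i + z * d i)" if "z \<in> ball 0 \<delta>" for z
    proof (intro infsumI c ballI)
      fix i assume "i \<in> J"
      then have "norm (b i + z * d i - a i) \<le> \<rho>" using that by (intro le) auto
      then show "norm (b i + z * d i - a i) < \<epsilon>" using \<rho>(2) by linarith
    qed
    ultimately have "(\<lambda>z. f (\<lambda>i. b i + z * d i)) holomorphic_on ball 0 \<delta>"
      by (subst holomorphic_cong[OF refl, symmetric]) auto
    then show ?thesis using \<delta>(1) holomorphic_on_imp_differentiable_at[OF _ open_ball, of _ 0 \<delta> 0] by simp
  qed
  then show ?thesis using that \<epsilon> by blast
qed

lemma analytic_at_slice:
  assumes J: "finite J" and f: "analytic_at J f a"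
  obtains \<epsilon> where "\<epsilon> > 0" "\<And>y j. (\<And>i. i \<in> J \<Longrightarrow> norm (y i - a i) < \<epsilon>) \<Longrightarrow>
    (\<lambda>z. f (y(j := z))) field_differentiable at (y j)"
proof -
  obtain \<epsilon> where \<epsilon>: "\<epsilon> > 0" "\<And>b d. (\<And>i. i \<in> J \<Longrightarrow> norm (b i - a i) < \<epsilon>) \<Longrightarrow>
    (\<lambda>z. f (\<lambda>i. b i + z * d i)) field_differentiable at 0"
    by (rule analytic_at_line[OF J f]) blast
  have "(\<lambda>z. f (y(j := z))) field_differentiable at (y j)" if "\<And>i. i \<in> J \<Longrightarrow> norm (y i - a i) < \<epsilon>" for y j
  proof -
    let ?d = "\<lambda>i. if i = j then 1 else 0 :: complex"
    have "(\<lambda>z. f (\<lambda>i. y i + z * ?d i)) field_differentiable at (y j - y j)" using \<epsilon>(2)[OF that] by simp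
    moreover have "(\<lambda>z. z - y j) field_differentiable at (y j)" by (intro derivative_intros)
    ultimately have "((\<lambda>z. f (\<lambda>i. y i + z * ?d i)) \<circ> (\<lambda>z. z - y j)) field_differentiable at (y j)"
      by (intro field_differentiable_compose)
    moreover have "(\<lambda>i. y i + (z - y j) * ?d i) = y(j := z)" for z by (auto simp: fun_eq_iff)
    ultimately show ?thesis by (simp add: o_def)
  qed
  then show ?thesis using that \<epsilon>(1) by blast
qed

lemma analytic_at_tendsto:
  assumes J: "finite J" and f: "analytic_at J f a"
    and lim: "\<And>i. i \<in> J \<Longrightarrow> ((\<lambda>t. \<gamma> t i) \<longlongrightarrow> a i) G"
  shows "((\<lambda>t. f (\<gamma> t)) \<longlongrightarrow> f a) G"
proof -
  let ?N = "cnorm1 J"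
  obtain c l q where T: "taylor2 J f a c l q" using analytic_at_taylor2[OF J f] by blast
  have "(\<lambda>x. f (\<lambda>i. a i + x i) - c) \<in> O[small J](?N)" by (rule taylor2_diff_bigo[OF J T])
  then have "((\<lambda>x. f (\<lambda>i. a i + x i) - c) \<longlongrightarrow> 0) (small J)"
    by (rule bigo_imp_tendsto_0[OF _ cnorm1_tendsto_0])
  moreover have "filterlim (\<lambda>t i. \<gamma> t i - a i) (small J) G" by (rule filterlim_small[OF J lim])
  ultimately have "((\<lambda>t. f (\<lambda>i. a i + (\<gamma> t i - a i)) - c) \<longlongrightarrow> 0) G" by (rule filterlim_compose)
  then
  have "((\<lambda>t. f (\<gamma> t) - c) \<longlongrightarrow> 0) G" by simp
  then have "((\<lambda>t. f (\<gamma> t)) \<longlongrightarrow> c) G" by (rule LIM_zero_cancel)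
  then show ?thesis by (simp add: taylor2_at_point[OF T])
qed

subsection \<open>Positive definite forms\<close>

text \<open>Coercivity by completing the square: the last coordinate is controlled by the completed
  square and by \<open>?\<beta>\<close>, which is a linear function of the other
  coordinates.\<close>

lemma pos_def_form_lower_bound:
  assumes "pos_def_form n C"
  shows "\<exists>c>0. \<forall>x. quad_form n C x \<ge> c * (\<Sum>i<n. (x (Suc i))\<^sup>2)"
  using assms
proof (induction n arbitrary: C)
  case 0
  show ?case by (intro exI[of _ 1]) (simp add: quad_form_def)
next
  case (Suc n)
  let ?d = "C n n"
  have sym: "\<forall>i<Suc n. \<forall>j<Suc n. C i j = C j i" using Suc.prems by (simp add: pos_def_form_def)
  have d: "?d > 0" by (rule pos_def_form_diag[OF Suc.prems])
  obtain c where c: "c > 0" "\<And>x. quad_form n (\<lambda>i j. C i j - C i n * C j n / ?d) x \<ge> c * (\<Sum>i<n. (x (Suc i))\<^sup>2)"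
    using Suc.IH[OF pos_def_form_schur[OF Suc.prems]] by blast
  define K where "K = (\<Sum>i<n. (C i n / ?d)\<^sup>2)"
  have K: "K \<ge> 0" by (simp add: K_def sum_nonneg)
  \<comment> \<open>Adapted to the estimate of \<open>?S + ?y^2\<close> by
    \<open>(1 + 2 * K) * ?S + 2 * (?y + ?\<beta>)^2\<close> below, where K comes from the
    Cauchy-Schwarz inequality.\<close>
  define c' where "c' = min (c / (1 + 2 * K)) (?d / 2)"
  have c': "c' > 0" "c' * (1 + 2 * K) \<le> c" "2 * c' \<le> ?d"
  proof -
    have "c' \<le> c / (1 + 2 * K)" "c' \<le> ?d / 2"
      unfolding c'_def by (rule min.cobounded1, rule min.cobounded2)
    then show "c' * (1 + 2 * K) \<le> c" "2 * c' \<le> ?d" using K by (simp add: pos_le_divide_eq, linarith)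
    show "c' > 0" using c(1) d K by (simp add: c'_def)
  qed
  have "quad_form (Suc n) C x \<ge> c' * (\<Sum>i<Suc n. (x (Suc i))\<^sup>2)" for x
  proof -
    let ?S = "\<Sum>i<n. (x (Suc i))\<^sup>2" and ?y = "x (Suc n)"
    let ?\<beta> = "(\<Sum>i<n. C i n * x (Suc i)) / ?d"
    have "?\<beta> = (\<Sum>i<n. C i n / ?d * x (Suc i))" by (simp add: sum_divide_distrib)
    then have \<beta>: "?\<beta>\<^sup>2 \<le> K * ?S" unfolding K_def by (simp only: Cauchy_Schwarz_ineq_sum)
    have "?y\<^sup>2 \<le> 2 * (?y + ?\<beta>)\<^sup>2 + 2 * ?\<beta>\<^sup>2"
      using zero_le_power2[of "?y + 2 * ?\<beta>"] by (simp add: power2_eq_square algebra_simps)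
    then have "?S + ?y\<^sup>2 \<le> (1 + 2 * K) * ?S + 2 * (?y + ?\<beta>)\<^sup>2"
      using \<beta> by (simp add: algebra_simps)
    then have "c' * (?S + ?y\<^sup>2) \<le> c' * ((1 + 2 * K) * ?S + 2 * (?y + ?\<beta>)\<^sup>2)"
      using c' by (intro mult_left_mono) auto
    also have "\<dots> = c' * (1 + 2 * K) * ?S + 2 * c' * (?y + ?\<beta>)\<^sup>2" by (simp add: algebra_simps)
    also have "\<dots> \<le> c * ?S + ?d * (?y + ?\<beta>)\<^sup>2"
      using c' by (intro add_mono mult_right_mono) (auto intro: sum_nonneg)
    also have "\<dots> \<le> quad_form (Suc n) C x"
      using c(2)[of x] quad_form_complete_square[OF sym, of x] d by simp
    finally show ?thesis by simp
  qed
  then show ?case using c'(1) by blast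
qed

text \<open>In each summand of the Leibniz formula every row scale and every column scale occurs
  exactly once.\<close>

lemma det_diag_scale:
  fixes a :: "nat \<Rightarrow> real"
  assumes R: "R \<in> carrier_mat n n"
  shows "Determinant.det (Matrix.mat n n (\<lambda>(i, j). a i * a j * R $$ (i, j))) = (\<Prod>i<n. a i)\<^sup>2 * Determinant.det R"
proof -
  have "(\<Prod>i = 0..<n. a i * a (\<pi> i) * R $$ (i, \<pi> i)) = (\<Prod>i<n. a i)\<^sup>2 * (\<Prod>i = 0..<n. R $$ (i, \<pi> i))"
    if "\<pi> permutes {0..<n}" for \<pi>
  proof -
    have "(\<Prod>i = 0..<n. a (\<pi> i)) = (\<Prod>i = 0..<n. a i)"
      by (rule prod.permute[OF that, symmetric, unfolded o_def])
    then show ?thesis by (simp add: prod.distrib power2_eq_square lessThan_atLeast0)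
  qed
  moreover have "(\<Prod>i = 0..<n. Matrix.mat n n (\<lambda>(i, j). a i * a j * R $$ (i, j)) $$ (i, \<pi> i)) =
      (\<Prod>i = 0..<n. a i * a (\<pi> i) * R $$ (i, \<pi> i))" if "\<pi> permutes {0..<n}" for \<pi>
    using that permutes_in_image[OF that] by (intro prod.cong refl) auto
  ultimately show ?thesis
    using R by (simp add: Determinant.det_def sum_distrib_left mult_ac)
qed

subsection \<open>The generating function in the last variable\<close>

text \<open>Together with \<open>F_lead\<close>, the coefficients of F as an affine function of
  \<open>exp (- y p) - 1\<close>. This explicit form takes the place of a preparation theorem in the
  variable \<open>y p\<close>.\<close>

definition F_free :: "nat \<Rightarrow> nat set set \<Rightarrow> (nat \<Rightarrow> complex) \<Rightarrow> complex" where
  "F_free p E y = (\<Sum>I | I \<in> independent_sets {1..p} E \<and> p \<notin> I. \<Prod>i\<in>I. (exp (- y i) - 1))"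

definition F_lead :: "nat \<Rightarrow> nat set set \<Rightarrow> (nat \<Rightarrow> complex) \<Rightarrow> complex" where
  "F_lead p E y = (\<Sum>I | I \<in> independent_sets {1..p} E \<and> p \<in> I. \<Prod>i\<in>I - {p}. (exp (- y i) - 1))"

lemma finite_independent_sets: "finite V \<Longrightarrow> finite (independent_sets V E)"
  by (auto simp: independent_sets_def)

lemma F_fun_split: "F_fun p E y = F_free p E y + (exp (- y p) - 1) * F_lead p E y"
proof -
  let ?I = "independent_sets {1..p} E" and ?g = "\<lambda>i. exp (- y i) - 1"
  have fin: "finite ?I" by (simp add: finite_independent_sets)
  have "F_fun p E y = (\<Sum>I\<in>?I. \<Prod>i\<in>I. ?g i)" by (simp add: F_fun_def B_fun_def)
  also have "\<dots> = (\<Sum>I\<in>{I \<in> ?I. p \<notin> I} \<union> {I \<in> ?I. p \<in> I}. \<Prod>i\<in>I. ?g i)"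
    by (intro sum.cong refl) auto
  also have "\<dots> = F_free p E y + (\<Sum>I | I \<in> ?I \<and> p \<in> I. \<Prod>i\<in>I. ?g i)"
    unfolding F_free_def using fin by (intro sum.union_disjoint) auto
  also have "(\<Sum>I | I \<in> ?I \<and> p \<in> I. \<Prod>i\<in>I. ?g i) = (exp (- y p) - 1) * F_lead p E y"
    unfolding F_lead_def sum_distrib_left
  proof (rule sum.cong[OF refl])
    fix I assume "I \<in> {I. I \<in> ?I \<and> p \<in> I}"
    then have "finite I" "p \<in> I" by (auto simp: independent_sets_def intro: finite_subset)
    then show "(\<Prod>i\<in>I. ?g i) = ?g p * (\<Prod>i\<in>I - {p}. ?g i)" by (rule prod.remove)
  qed
  finally show ?thesis .
qed

lemma F_free_upd [simp]: "F_free p E (y(p := z)) = F_free p E y"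
  unfolding F_free_def by (intro sum.cong prod.cong refl) auto

lemma F_lead_upd [simp]: "F_lead p E (y(p := z)) = F_lead p E y"
  unfolding F_lead_def by (intro sum.cong prod.cong refl) auto

lemma holomorphic_on_if_const: "(\<lambda>z. if P then z else c) holomorphic_on S"
  by (cases P) simp_all

lemma F_free_slice: "(\<lambda>z. F_free p E (y(j := z))) field_differentiable at w"
proof -
  have "(\<lambda>z. F_free p E (y(j := z))) holomorphic_on UNIV"
    unfolding F_free_def fun_upd_apply by (intro holomorphic_intros holomorphic_on_if_const)
  then show ?thesis by (simp add: holomorphic_on_imp_differentiable_at)
qed

lemma F_lead_slice: "(\<lambda>z. F_lead p E (y(j := z))) field_differentiable at w"
proof -
  have "(\<lambda>z. F_lead p E (y(j := z))) holomorphic_on UNIV"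
    unfolding F_lead_def fun_upd_apply by (intro holomorphic_intros holomorphic_on_if_const)
  then show ?thesis by (simp add: holomorphic_on_imp_differentiable_at)
qed

lemma F_lead_tendsto:
  assumes "\<And>i. i \<in> {1..<p} \<Longrightarrow> ((\<lambda>t. \<gamma> t i) \<longlongrightarrow> a i) G"
  shows "((\<lambda>t. F_lead p E (\<gamma> t)) \<longlongrightarrow> F_lead p E a) G"
  unfolding F_lead_def
proof (intro tendsto_sum tendsto_prod tendsto_diff tendsto_exp tendsto_minus tendsto_const assms)
  fix I i assume "I \<in> {I. I \<in> independent_sets {1..p} E \<and> p \<in> I}" "i \<in> I - {p}"
  then have "i \<in> {1..p}" "i \<noteq> p" by (auto simp: independent_sets_def)
  then show "i \<in> {1..<p}" by auto
qed

text \<open>Shows that the smoothness hypothesis amounts to the nonvanishing of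
  \<open>F_lead\<close> at the critical point.\<close>

lemma partial_deriv_F_last: "partial_deriv p (F_fun p E) y = - exp (- y p) * F_lead p E y"
  unfolding partial_deriv_def
proof (rule DERIV_imp_deriv)
  show "((\<lambda>z. F_fun p E (y(p := z))) has_field_derivative - exp (- y p) * F_lead p E y) (at (y p))"
    unfolding F_fun_split by (auto intro!: derivative_eq_intros)
qed

section \<open>The phase function at the critical point\<close>

locale critical_point =
  fixes p :: nat and E :: "nat set set" and \<alpha> r :: "nat \<Rightarrow> real"
    and h :: "(nat \<Rightarrow> complex) \<Rightarrow> complex"
  assumes graph: "simple_graph {1..p} E"
    and alpha_pos: "\<And>i. i \<in> {1..p} \<Longrightarrow> \<alpha> i > 0"
    and alpha_sum: "(\<Sum>i\<in>{1..p}. \<alpha> i) = 1"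
    and r_pos: "\<And>i. i \<in> {1..p} \<Longrightarrow> r i > 0"
    and zero: "F_fun p E (\<lambda>i. of_real (r i)) = 0"
    and smooth: "partial_deriv p (F_fun p E) (\<lambda>i. of_real (r i)) \<noteq> 0"
    and critical: "\<And>i. i \<in> {1..<p} \<Longrightarrow> of_real (\<alpha> i) / of_real (r i) =
      of_real (\<alpha> p) * partial_deriv i (F_fun p E) (\<lambda>i. of_real (r i)) /
        (of_real (r p) * partial_deriv p (F_fun p E) (\<lambda>i. of_real (r i)))"
    and h: "local_solution p (F_fun p E) (\<lambda>i. of_real (r i)) h"
    and minimal: "strictly_minimal p (F_fun p E) r"
    and nondeg: "nondegenerate (hessian (p - 1) (Phi_fun p \<alpha> h) (\<lambda>i. of_real (r i)))"
begin

abbreviation "F \<equiv> F_fun p E"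
abbreviation "rc \<equiv> \<lambda>i. complex_of_real (r i)"
abbreviation "\<Phi> \<equiv> Phi_fun p \<alpha> h"
definition n where "n = p - 1"

lemma Suc_less_p: "i < n \<Longrightarrow> Suc i \<in> {1..<p}" "i < n \<Longrightarrow> Suc i \<in> {1..p}"
  by (auto simp: n_def)

lemma p_pos: "p \<ge> 1"
proof (rule ccontr)
  assume "\<not> p \<ge> 1"
  then have "{1..p} = {}" by auto
  then show False using alpha_sum by (metis sum.empty zero_neq_one)
qed

lemma h_analytic: "analytic_at {1..<p} h rc" and h_rc: "h rc = of_real (r p)"
  using h by (auto simp: local_solution_def)

definition A :: complex where "A = - of_real (r p) * partial_deriv p F rc"

lemma A_nonzero: "A \<noteq> 0"
  using smooth r_pos[of p] p_pos by (auto simp: A_def)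

lemma F_h_eq_0: "\<exists>\<epsilon>>0. \<forall>y. (\<forall>i\<in>{1..<p}. norm (y i - rc i) < \<epsilon>) \<longrightarrow> F (y(p := h y)) = 0"
  using h by (simp add: local_solution_def)

lemma coord_tendsto_small:
  assumes "finite J" "i \<in> J"
  shows "((\<lambda>x. a i + x i) \<longlongrightarrow> a i) (small J)"
proof -
  have "((\<lambda>x. x i) \<longlongrightarrow> 0) (small J)"
    by (rule bigo_imp_tendsto_0[OF coord_bigo_cnorm1[OF assms] cnorm1_tendsto_0])
  then show ?thesis using tendsto_add[OF tendsto_const, of _ 0 "small J" "a i"] by simp
qed

text \<open>Near the critical point the coordinates and h have positive real part, so the logarithms
  in \<Phi> stay off their cut. This provides the separate differentiability that
  \<open>taylor2_partial_derivs\<close> asks for.\<close>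

lemma Phi_sep:
  obtains \<epsilon> where "\<epsilon> > 0" "\<And>y j. \<lbrakk>\<And>i. i \<in> {1..<p} \<Longrightarrow> norm (y i - rc i) < \<epsilon>; j \<in> {1..<p}\<rbrakk> \<Longrightarrow>
      (\<lambda>z. \<Phi> (y(j := z))) field_differentiable at (y j)"
proof -
  let ?J = "{1..<p}"
  obtain \<epsilon>1 where \<epsilon>1: "\<epsilon>1 > 0" "\<And>y j. (\<And>i. i \<in> ?J \<Longrightarrow> norm (y i - rc i) < \<epsilon>1) \<Longrightarrow>
    (\<lambda>z. h (y(j := z))) field_differentiable at (y j)"
    by (rule analytic_at_slice[OF _ h_analytic]) auto
  have "((\<lambda>x. h (\<lambda>i. rc i + x i)) \<longlongrightarrow> h rc) (small ?J)"
    by (rule analytic_at_tendsto[OF _ h_analytic]) (auto intro: coord_tendsto_small)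
  then have "((\<lambda>x. Re (h (\<lambda>i. rc i + x i))) \<longlongrightarrow> r p) (small ?J)"
    using tendsto_Re h_rc by force
  then have "eventually (\<lambda>x. Re (h (\<lambda>i. rc i + x i)) > 0) (small ?J)"
    by (rule order_tendstoD) (use r_pos p_pos in auto)
  moreover have "eventually (\<lambda>x. \<forall>i\<in>?J. Re (rc i + x i) > 0) (small ?J)"
  proof (subst eventually_ball_finite_distrib)
    show "\<forall>i\<in>?J. eventually (\<lambda>x. Re (rc i + x i) > 0) (small ?J)"
    proof
      fix i assume i: "i \<in> ?J"
      have "((\<lambda>x. Re (rc i + x i)) \<longlongrightarrow> Re (rc i)) (small ?J)"
        by (intro tendsto_Re coord_tendsto_small i) simp
      then show "eventually (\<lambda>x. Re (rc i + x i) > 0) (small ?J)"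
        by (rule order_tendstoD) (use r_pos i in auto)
    qed
  qed simp
  ultimately have "eventually (\<lambda>x. Re (h (\<lambda>i. rc i + x i)) > 0 \<and> (\<forall>i\<in>?J. Re (rc i + x i) > 0)) (small ?J)"
    by (rule eventually_conj)
  then obtain d where d: "d > 0" "\<And>x. norm (cnorm1 ?J x) < d \<Longrightarrow>
      Re (h (\<lambda>i. rc i + x i)) > 0 \<and> (\<forall>i\<in>?J. Re (rc i + x i) > 0)"
    unfolding eventually_small by blast
  \<comment> \<open>Division by p turns bounds on the p - 1 separate coordinates into one on their
    l1 norm.\<close>
  define \<epsilon> where "\<epsilon> = min \<epsilon>1 (d / real p)"
  have \<epsilon>: "\<epsilon> > 0" "\<epsilon> \<le> \<epsilon>1" "\<epsilon> * real p \<le> d"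
    using \<epsilon>1(1) d(1) p_pos by (auto simp: \<epsilon>_def min_def field_simps)
  have "(\<lambda>z. \<Phi> (y(j := z))) field_differentiable at (y j)"
    if y: "\<And>i. i \<in> ?J \<Longrightarrow> norm (y i - rc i) < \<epsilon>" and j: "j \<in> ?J" for y j
  proof -
    let ?x = "\<lambda>i. y i - rc i"
    have "norm (cnorm1 ?J ?x) \<le> (\<Sum>i\<in>?J. \<epsilon>)" unfolding norm_cnorm1 using y by (intro sum_mono) (auto intro: less_imp_le)
    also have "\<dots> = real (p - 1) * \<epsilon>" by simp
    also have "\<dots> < real p * \<epsilon>" using \<epsilon>(1) p_pos by simp
    also have "\<dots> \<le> d" using \<epsilon>(3) by (simp add: mult.commute)
    finally have Re: "Re (h y) > 0" "\<And>i. i \<in> ?J \<Longrightarrow> Re (y i) > 0" using d(2)[of ?x] by auto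
    have 1: "(\<lambda>z. h (y(j := z))) field_differentiable at (y j)"
      by (rule \<epsilon>1(2)) (use y \<epsilon>(2) in force)
    have 2: "(\<lambda>z. (y(j := z)) i) field_differentiable at (y j)" for i
      by (cases "i = j") (auto intro: derivative_intros)
    have 3: "(\<lambda>z. Ln (g z)) field_differentiable at (y j)"
      if "g field_differentiable at (y j)" "Re (g (y j)) > 0" for g
    proof -
      have "Ln field_differentiable at (g (y j))"
        by (rule field_differentiable_at_Ln) (use that in \<open>auto simp: complex_nonpos_Reals_iff\<close>)
      then show ?thesis using field_differentiable_compose[OF that(1)] by (simp add: o_def)
    qed
    have L: "(\<lambda>z. Ln ((y(j := z)) i)) field_differentiable at (y j)" if "i \<in> ?J" for i
      by (rule 3[OF 2]) (use Re(2)[OF that] in auto)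
    have S: "(\<lambda>z. \<Sum>i\<in>?J. of_real (\<alpha> i) * Ln ((y(j := z)) i)) field_differentiable at (y j)"
      by (intro field_differentiable_sum field_differentiable_mult field_differentiable_const L)
    have H: "(\<lambda>z. Ln (h (y(j := z)))) field_differentiable at (y j)"
      by (rule 3[OF 1]) (use Re(1) in simp)
    show ?thesis
      unfolding Phi_fun_def
      by (intro field_differentiable_diff field_differentiable_minus field_differentiable_mult field_differentiable_const S H)
  qed
  then show ?thesis using that \<epsilon>(1) by blast
qed

lemma Phi_taylor2: "\<exists>c l q. taylor2 {1..<p} \<Phi> rc c l q"
proof -
  let ?J = "{1..<p}"
  have J: "finite ?J" by simp
  have Ln: "\<exists>c l q. taylor2 ?J (\<lambda>y. Ln (f y)) rc c l q" if f: "taylor2 ?J f rc (of_real x) l q" and x: "x > 0" for f x l q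
  proof (rule taylor2_comp[OF J f, where g = Ln and r = x])
    show "Ln holomorphic_on ball (of_real x) x"
    proof (rule holomorphic_on_Ln)
      have "z \<notin> \<real>\<^sub>\<le>\<^sub>0" if z: "z \<in> ball (complex_of_real x) x" for z
      proof -
      have "x - Re z \<le> norm (of_real x - z)" using complex_Re_le_cmod[of "of_real x - z"] by simp
      also have "\<dots> < x" using z by (simp add: dist_norm)
      finally show ?thesis by (auto simp: complex_nonpos_Reals_iff)
      qed
      then show "ball (complex_of_real x) x \<inter> \<real>\<^sub>\<le>\<^sub>0 = {}" by blast
    qed
  qed (rule x)
  have add: "\<exists>c l q. taylor2 ?J (\<lambda>y. u y + v y) rc c l q"
    if "\<exists>c l q. taylor2 ?J u rc c l q" "\<exists>c l q. taylor2 ?J v rc c l q" for u v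
    using that taylor2_add by blast
  have mult: "\<exists>c l q. taylor2 ?J (\<lambda>y. b * u y) rc c l q" if "\<exists>c l q. taylor2 ?J u rc c l q" for b u
    using that taylor2_cmult[OF J] by blast
  have "\<exists>c l q. taylor2 ?J (\<lambda>y. \<Sum>i\<in>?J. - of_real (\<alpha> i) * Ln (y i)) rc c l q"
  proof (rule taylor2_sum[OF J])
    fix i assume i: "i \<in> ?J"
    have "\<exists>c l q. taylor2 ?J (\<lambda>y. Ln (y i)) rc c l q"
      by (rule Ln[OF taylor2_coord[OF J i]]) (use r_pos i in auto)
    then show "\<exists>c l q. taylor2 ?J (\<lambda>y. - of_real (\<alpha> i) * Ln (y i)) rc c l q" by (rule mult)
  qed
  moreover have "\<exists>c l q. taylor2 ?J (\<lambda>y. - of_real (\<alpha> p) * Ln (h y)) rc c l q"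
  proof (rule mult)
    obtain c l q where T: "taylor2 ?J h rc c l q" using analytic_at_taylor2[OF J h_analytic] by blast
    have "c = of_real (r p)" using taylor2_at_point[OF T] h_rc by simp
    then show "\<exists>c l q. taylor2 ?J (\<lambda>y. Ln (h y)) rc c l q" using Ln[of h "r p"] T r_pos[of p] p_pos by auto
  qed
  ultimately have "\<exists>c l q. taylor2 ?J (\<lambda>y. (\<Sum>i\<in>?J. - of_real (\<alpha> i) * Ln (y i)) + (- of_real (\<alpha> p) * Ln (h y))) rc c l q"
    by (rule add)
  moreover have "(\<lambda>y. (\<Sum>i\<in>?J. - of_real (\<alpha> i) * Ln (y i)) + (- of_real (\<alpha> p) * Ln (h y))) = \<Phi>"
    by (simp add: Phi_fun_def fun_eq_iff sum_negf)
  ultimately show ?thesis by simp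
qed

text \<open>Differentiating \<open>F (y(p := h y)) = 0\<close> gives h the slope
  \<open>- F_j / F_p\<close>, F_j being the j-th partial derivative; with it, the critical equations
  say exactly that the gradient of \<Phi> vanishes.\<close>

lemma Phi_gradient:
  assumes j: "j \<in> {1..<p}"
  shows "partial_deriv j \<Phi> rc = 0"
proof -
  let ?J = "{1..<p}"
  let ?H = "\<lambda>z. h (rc(j := z))" and ?u = "\<lambda>z. F_free p E (rc(j := z))" and ?v = "\<lambda>z. F_lead p E (rc(j := z))"
  have jp: "j \<noteq> p" using j by auto
  have rj: "r j > 0" "r p > 0" using r_pos j p_pos by auto
  obtain \<epsilon>1 where \<epsilon>1: "\<epsilon>1 > 0" "\<And>y j. (\<And>i. i \<in> ?J \<Longrightarrow> norm (y i - rc i) < \<epsilon>1) \<Longrightarrow>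
    (\<lambda>z. h (y(j := z))) field_differentiable at (y j)"
    by (rule analytic_at_slice[OF _ h_analytic]) auto
  have "?H field_differentiable at (rc j)" by (rule \<epsilon>1(2)) (use \<epsilon>1(1) in simp)
  then obtain H' where H': "(?H has_field_derivative H') (at (rc j))" by (auto simp: field_differentiable_def)
  obtain u' where u': "(?u has_field_derivative u') (at (rc j))" using F_free_slice[of p E rc j "rc j"] unfolding field_differentiable_def by blast
  obtain v' where v': "(?v has_field_derivative v') (at (rc j))" using F_lead_slice[of p E rc j "rc j"] unfolding field_differentiable_def by blast
  have triv: "rc(j := rc j) = rc" by (auto simp: fun_eq_iff)
  have Hr: "?H (rc j) = of_real (r p)" unfolding triv by (rule h_rc)
  have Fj: "partial_deriv j F rc = u' + (exp (- rc p) - 1) * v'"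
    unfolding partial_deriv_def
  proof (rule DERIV_imp_deriv)
    show "((\<lambda>z. F (rc(j := z))) has_field_derivative u' + (exp (- rc p) - 1) * v') (at (rc j))"
      unfolding F_fun_split using jp by (auto intro!: derivative_eq_intros u' v')
  qed
  have Fp: "partial_deriv p F rc = - exp (- rc p) * ?v (rc j)"
    unfolding triv by (rule partial_deriv_F_last)
  obtain \<epsilon> where \<epsilon>: "\<epsilon> > 0" "\<And>y. (\<forall>i\<in>?J. norm (y i - rc i) < \<epsilon>) \<Longrightarrow> F (y(p := h y)) = 0"
    using F_h_eq_0 by blast
  have "((\<lambda>z. ?u z + (exp (- ?H z) - 1) * ?v z) has_field_derivative 0) (at (rc j))"
  proof (rule has_field_derivative_transform_within_open[where f = "\<lambda>_. 0" and S = "ball (rc j) \<epsilon>"])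
    fix z assume z: "z \<in> ball (rc j) \<epsilon>"
    have "F ((rc(j := z))(p := ?H z)) = 0"
      by (rule \<epsilon>(2)) (use z \<epsilon>(1) in \<open>auto simp: dist_norm norm_minus_commute\<close>)
    then show "0 = ?u z + (exp (- ?H z) - 1) * ?v z" by (simp add: F_fun_split)
  qed (use \<epsilon>(1) in auto)
  moreover have "((\<lambda>z. ?u z + (exp (- ?H z) - 1) * ?v z) has_field_derivative
      u' + ((- H' * exp (- rc p)) * ?v (rc j) + (exp (- rc p) - 1) * v')) (at (rc j))"
    by (auto intro!: derivative_eq_intros u' v' H' simp: Hr[simplified])
  ultimately have "u' + ((- H' * exp (- rc p)) * ?v (rc j) + (exp (- rc p) - 1) * v') = 0"
    by (rule DERIV_unique[symmetric])
  then have eq: "partial_deriv j F rc + H' * partial_deriv p F rc = 0"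
    unfolding Fj Fp by (simp add: algebra_simps)
  have "((\<lambda>z. \<Phi> (rc(j := z))) has_field_derivative - (of_real (\<alpha> j) / rc j) - of_real (\<alpha> p) * (H' / rc p)) (at (rc j))"
  proof -
    have 1: "((\<lambda>z. Ln ((rc(j := z)) i)) has_field_derivative (if i = j then 1 / rc j else 0)) (at (rc j))" for i
      using rj by (auto intro!: derivative_eq_intros simp: complex_nonpos_Reals_iff inverse_eq_divide)
    have "((\<lambda>z. \<Sum>i\<in>?J. of_real (\<alpha> i) * Ln ((rc(j := z)) i)) has_field_derivative
        (\<Sum>i\<in>?J. of_real (\<alpha> i) * (if i = j then 1 / rc j else 0))) (at (rc j))"
      by (intro DERIV_sum DERIV_cmult 1)
    also have "(\<Sum>i\<in>?J. of_real (\<alpha> i) * (if i = j then 1 / rc j else 0)) = of_real (\<alpha> j) / rc j"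
      using j by (simp add: if_distrib[of "\<lambda>u. _ * u"] cong: if_cong)
    finally have S: "((\<lambda>z. \<Sum>i\<in>?J. of_real (\<alpha> i) * Ln ((rc(j := z)) i)) has_field_derivative of_real (\<alpha> j) / rc j) (at (rc j))" .
    have "((\<lambda>z. Ln (?H z)) has_field_derivative inverse (?H (rc j)) * H') (at (rc j))"
      by (rule DERIV_chain2[OF has_field_derivative_Ln H']) (use rj Hr in \<open>auto simp: complex_nonpos_Reals_iff\<close>)
    then have "((\<lambda>z. Ln (?H z)) has_field_derivative H' / rc p) (at (rc j))"
      unfolding Hr by (simp add: field_simps)
    then show ?thesis unfolding Phi_fun_def by (intro DERIV_diff DERIV_minus S DERIV_cmult)
  qed
  then have "partial_deriv j \<Phi> rc = - (of_real (\<alpha> j) / rc j) - of_real (\<alpha> p) * (H' / rc p)"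
    unfolding partial_deriv_def by (rule DERIV_imp_deriv)
  also have "H' = - partial_deriv j F rc / partial_deriv p F rc"
    using eq smooth by (simp add: field_simps eq_neg_iff_add_eq_0)
  also have "of_real (\<alpha> j) / rc j = of_real (\<alpha> p) * partial_deriv j F rc / (rc p * partial_deriv p F rc)"
    using critical[OF j] .
  finally show ?thesis using smooth rj by (simp add: field_simps)
qed

definition Hess :: "nat \<Rightarrow> nat \<Rightarrow> complex" where
  "Hess i j = partial_deriv i (partial_deriv j \<Phi>) rc"

text \<open>The linear part is zero by \<open>Phi_gradient\<close>, and symmetrising q turns the
  quadratic part into half the Hessian form.\<close>

lemma Phi_expansion:
  "(\<lambda>x. \<Phi> (\<lambda>i. rc i + x i) - \<Phi> rc - quad_part {1..<p} Hess x / 2) \<in> O[small {1..<p}](\<lambda>x. cnorm1 {1..<p} x ^ 3)"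
proof -
  let ?J = "{1..<p}"
  have J: "finite ?J" by simp
  obtain c l q where T: "taylor2 ?J \<Phi> rc c l q" using Phi_taylor2 by blast
  obtain \<epsilon> where \<epsilon>: "\<epsilon> > 0" "\<And>y j. \<lbrakk>\<And>i. i \<in> {1..<p} \<Longrightarrow> norm (y i - rc i) < \<epsilon>; j \<in> {1..<p}\<rbrakk> \<Longrightarrow>
      (\<lambda>z. \<Phi> (y(j := z))) field_differentiable at (y j)"
    by (rule Phi_sep) blast
  have l: "l j = 0" if "j \<in> ?J" for j
    using taylor2_partial_derivs(1)[OF J T that \<epsilon>] Phi_gradient[OF that] by simp
  have q: "Hess i j = q i j + q j i" if "i \<in> ?J" "j \<in> ?J" for i j
    unfolding Hess_def by (rule taylor2_partial_derivs(2)[OF J T that(2) \<epsilon> that(1)])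
  have lin: "lin_part ?J l x = 0" for x
    unfolding lin_part_def by (rule sum.neutral) (use l in auto)
  have quad: "quad_part ?J Hess x / 2 = quad_part ?J q x" for x
  proof -
    have "quad_part ?J Hess x = (\<Sum>i\<in>?J. \<Sum>j\<in>?J. q i j * x i * x j) + (\<Sum>i\<in>?J. \<Sum>j\<in>?J. q j i * x i * x j)"
      unfolding quad_part_def sum.distrib[symmetric] by (intro sum.cong refl) (simp add: q algebra_simps)
    also have "(\<Sum>i\<in>?J. \<Sum>j\<in>?J. q j i * x i * x j) = (\<Sum>j\<in>?J. \<Sum>i\<in>?J. q j i * x j * x i)"
      by (subst sum.swap) (intro sum.cong refl, simp add: mult_ac)
    finally show ?thesis by (simp add: quad_part_def)
  qed
  have eq: "\<Phi> (\<lambda>i. rc i + x i) - \<Phi> rc - quad_part ?J Hess x / 2 =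
      \<Phi> (\<lambda>i. rc i + x i) - (c + lin_part ?J l x + quad_part ?J q x)" for x
    unfolding quad lin taylor2_at_point[OF T] by simp
  show ?thesis unfolding eq using T unfolding taylor2_def .
qed

text \<open>The Hessian of \<Phi> in the coordinates \<open>y i = r i * exp (x i)\<close>: as the
  gradient vanishes, the substitution merely multiplies rows and columns by r.\<close>

definition C :: "nat \<Rightarrow> nat \<Rightarrow> real" where
  "C i j = r (Suc i) * r (Suc j) * Re (Hess (Suc i) (Suc j))"

text \<open>The square in \<open>det_C\<close> is the origin of the product of the
  \<open>r i\<close> in the denominator of the final formula, through the square root in the
  Gaussian integral.\<close>

lemma Hess_real: "i < n \<Longrightarrow> j < n \<Longrightarrow> Hess (Suc i) (Suc j) = of_real (Re (Hess (Suc i) (Suc j)))"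
  and C_pos_def: "pos_def_form n C"
  and det_C: "Determinant.det (Matrix.mat n n (\<lambda>(i, j). C i j)) =
    (\<Prod>i\<in>{1..<p}. r i)\<^sup>2 * Re (Determinant.det (hessian n \<Phi> rc))"
  and det_hessian_real: "Determinant.det (hessian n \<Phi> rc) = of_real (Re (Determinant.det (hessian n \<Phi> rc)))"
proof -
  obtain R where R: "hessian n \<Phi> rc = map_mat complex_of_real R" and pd: "positive_definite R"
    using nondeg by (auto simp: nondegenerate_def n_def)
  have "dim_row (hessian n \<Phi> rc) = n" "dim_col (hessian n \<Phi> rc) = n" by (simp_all add: hessian_def)
  then have dR: "dim_row R = n" "dim_col R = n" unfolding R by simp_all
  then have cR: "R \<in> carrier_mat n n" by auto
  have HR: "Hess (Suc i) (Suc j) = of_real (R $$ (i, j))" if "i < n" "j < n" for i j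
  proof -
    have "Hess (Suc i) (Suc j) = hessian n \<Phi> rc $$ (i, j)" using that by (simp add: hessian_def Hess_def)
    then show ?thesis using that dR by (simp add: R)
  qed
  show "Hess (Suc i) (Suc j) = of_real (Re (Hess (Suc i) (Suc j)))" if "i < n" "j < n" for i j
    by (simp add: HR[OF that])
  have CR: "C i j = r (Suc i) * r (Suc j) * R $$ (i, j)" if "i < n" "j < n" for i j
    by (simp add: C_def HR[OF that])
  have rp: "r (Suc i) > 0" if "i < n" for i using Suc_less_p(2)[OF that] by (rule r_pos)
  have symR: "R $$ (i, j) = R $$ (j, i)" if "i < n" "j < n" for i j
  proof -
    have "transpose_mat R $$ (i, j) = R $$ (j, i)" using that dR by simp
    then show ?thesis using pd by (simp add: positive_definite_def)
  qed
  have "quad_form n C x > 0" if "\<exists>i<n. x (Suc i) \<noteq> 0" for x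
  proof -
    let ?v = "Matrix.vec n (\<lambda>i. r (Suc i) * x (Suc i))"
    obtain k where k: "k < n" "x (Suc k) \<noteq> 0" using \<open>\<exists>i<n. x (Suc i) \<noteq> 0\<close> by blast
    have "?v \<noteq> 0\<^sub>v n"
    proof
      assume "?v = 0\<^sub>v n"
      then have "vec_index ?v k = vec_index (0\<^sub>v n) k" by simp
      then show False using k rp[OF k(1)] by simp
    qed
    moreover have "?v \<in> carrier_vec n" by simp
    ultimately have "0 < scalar_prod ?v (mult_mat_vec R ?v)" using pd dR by (simp add: positive_definite_def)
    also have "scalar_prod ?v (mult_mat_vec R ?v) = quad_form n C x"
    proof -
      have "scalar_prod ?v (mult_mat_vec R ?v) =
          (\<Sum>i<n. r (Suc i) * x (Suc i) * (\<Sum>j<n. R $$ (i, j) * (r (Suc j) * x (Suc j))))"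
        using dR unfolding scalar_prod_def[of ?v] lessThan_atLeast0
        by (simp only: dim_mult_mat_vec) (intro sum.cong refl, simp add: scalar_prod_def)
      also have "\<dots> = quad_form n C x"
        unfolding quad_form_def sum_distrib_left by (intro sum.cong refl) (simp add: CR)
      finally show ?thesis .
    qed
    finally show ?thesis .
  qed
  then show "pos_def_form n C" by (simp add: pos_def_form_def CR symR)
  have "Matrix.mat n n (\<lambda>(i, j). C i j) = Matrix.mat n n (\<lambda>(i, j). r (Suc i) * r (Suc j) * R $$ (i, j))"
    by (rule eq_matI) (auto simp: CR)
  moreover have "(\<Prod>i<n. r (Suc i)) = (\<Prod>i\<in>{1..<p}. r i)"
    by (intro prod.reindex_bij_witness[of _ "\<lambda>i. i - 1" Suc]) (auto simp: n_def)
  moreover have dh: "Determinant.det (hessian n \<Phi> rc) = of_real (Determinant.det R)"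
    unfolding R by (rule of_real_hom.hom_det)
  ultimately show "Determinant.det (Matrix.mat n n (\<lambda>(i, j). C i j)) =
    (\<Prod>i\<in>{1..<p}. r i)\<^sup>2 * Re (Determinant.det (hessian n \<Phi> rc))"
    using det_diag_scale[OF cR, of "\<lambda>i. r (Suc i)"] by simp
  show "Determinant.det (hessian n \<Phi> rc) = of_real (Re (Determinant.det (hessian n \<Phi> rc)))"
    unfolding dh by simp
qed

end

subsection \<open>The generating function near the critical point\<close>

text \<open>The constant 3 bounds exp on the unit disc; 4 = 3 + 1 then comes from the triangle
  inequality.\<close>

lemma norm_exp_minus_1_minus_le:
  assumes "norm (v :: complex) \<le> 1"
  shows "norm (exp v - 1 - v) \<le> 3 * norm v ^ 2" "norm (exp v - 1) \<le> 4 * norm v"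
proof -
  have "norm ((\<lambda>_. exp) (0::nat) v - (\<Sum>i\<le>1. (\<lambda>_. exp) i 0 * (v - 0) ^ i / fact i)) \<le> 3 * norm (v - 0) ^ Suc 1 / fact 1"
  proof (rule complex_Taylor[where S = "cball 0 1" and B = 3])
    fix x :: complex assume x: "x \<in> cball 0 1"
    have "norm (exp x) = exp (Re x)" by (rule norm_exp_eq_Re)
    also have "\<dots> \<le> exp 1" using x complex_Re_le_cmod[of x] by simp
    also have "\<dots> \<le> 3" by (rule exp_le)
    finally show "norm (exp x) \<le> 3" .
  qed (use assms in \<open>auto intro: DERIV_exp has_field_derivative_at_within\<close>)
  then show 1: "norm (exp v - 1 - v) \<le> 3 * norm v ^ 2" by (simp add: power2_eq_square diff_diff_eq)
  have "norm (exp v - 1) \<le> norm (exp v - 1 - v) + norm v"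
    using norm_triangle_ineq[of "exp v - 1 - v" v] by simp
  also have "\<dots> \<le> 3 * norm v ^ 2 + norm v" using 1 by simp
  also have "norm v ^ 2 \<le> norm v" using assms by (simp add: power2_eq_square mult_left_le)
  finally show "norm (exp v - 1) \<le> 4 * norm v" by simp
qed

text \<open>u tends to 0 from the right and \<theta> to 0 in the coordinates 1 to p; a neighbourhood
  filter of the function space would involve the other coordinates as well.\<close>

definition corner :: "nat \<Rightarrow> (real \<times> (nat \<Rightarrow> real)) filter" where
  "corner p = (INF d\<in>{0<..}. principal {t. 0 < fst t \<and> fst t < d \<and> (\<forall>i\<in>{1..p}. \<bar>snd t i\<bar> < d)})"

lemma eventually_corner:
  "eventually P (corner p) \<longleftrightarrow>
    (\<exists>d>0. \<forall>u \<theta>. 0 < u \<longrightarrow> u < d \<longrightarrow> (\<forall>i\<in>{1..p}. \<bar>\<theta> i\<bar> < d) \<longrightarrow> P (u, \<theta>))"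
proof -
  have "eventually P (corner p) \<longleftrightarrow>
    (\<exists>d\<in>{0<..}. eventually P (principal {t. 0 < fst t \<and> fst t < d \<and> (\<forall>i\<in>{1..p}. \<bar>snd t i\<bar> < d)}))"
    unfolding corner_def
  proof (rule eventually_INF_base)
    fix a b :: real assume "a \<in> {0<..}" "b \<in> {0<..}"
    then show "\<exists>x\<in>{0<..}. principal {t. 0 < fst t \<and> fst t < x \<and> (\<forall>i\<in>{1..p}. \<bar>snd t i\<bar> < x)}
      \<le> principal {t. 0 < fst t \<and> fst t < a \<and> (\<forall>i\<in>{1..p}. \<bar>snd t i\<bar> < a)} \<sqinter>
         principal {t. 0 < fst t \<and> fst t < b \<and> (\<forall>i\<in>{1..p}. \<bar>snd t i\<bar> < b)}"
      by (intro bexI[of _ "min a b"]) auto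
  qed auto
  then show ?thesis
    by (simp only: eventually_principal Bex_def greaterThan_iff Ball_def mem_Collect_eq split_paired_All
        fst_conv snd_conv imp_conjL)
qed

lemma tendsto_fst_corner: "(fst \<longlongrightarrow> 0) (corner p)"
  unfolding tendsto_iff eventually_corner
proof (intro allI impI)
  fix e :: real assume "e > 0"
  then show "\<exists>d>0. \<forall>(u :: real) (\<theta> :: nat \<Rightarrow> real). 0 < u \<longrightarrow> u < d \<longrightarrow> (\<forall>i\<in>{1..p}. \<bar>\<theta> i\<bar> < d) \<longrightarrow> dist (fst (u, \<theta>)) 0 < e"
    by (intro exI[of _ e]) simp
qed

lemma tendsto_snd_corner: "i \<in> {1..p} \<Longrightarrow> ((\<lambda>t. snd t i) \<longlongrightarrow> 0) (corner p)"
  unfolding tendsto_iff eventually_corner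
proof (intro allI impI)
  fix e :: real assume "e > 0" and i: "i \<in> {1..p}"
  then show "\<exists>d>0. \<forall>(u :: real) (\<theta> :: nat \<Rightarrow> real). 0 < u \<longrightarrow> u < d \<longrightarrow> (\<forall>i\<in>{1..p}. \<bar>\<theta> i\<bar> < d) \<longrightarrow> dist (snd (u, \<theta>) i) 0 < e"
    by (intro exI[of _ e]) simp
qed

lemma eventually_fst_corner: "eventually (\<lambda>t. fst t > 0) (corner p)"
  unfolding eventually_corner by (intro exI[of _ 1]) auto

section \<open>The local model of F\<close>

context critical_point
begin

definition Y :: "real \<Rightarrow> (nat \<Rightarrow> real) \<Rightarrow> nat \<Rightarrow> complex" where
  "Y u \<theta> i = of_real (r i) * exp (- of_real u + \<i> * of_real (\<theta> i))"

definition dir :: "(nat \<Rightarrow> real) \<Rightarrow> real" where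
  "dir \<theta> = (\<Sum>i\<in>{1..p}. \<alpha> i * \<theta> i)"

definition X :: "real \<Rightarrow> (nat \<Rightarrow> real) \<Rightarrow> complex" where
  "X u \<theta> = of_real (u + quad_form n C \<theta> / 2) - \<i> * of_real (dir \<theta>)"

lemma sum_Suc: "(\<Sum>i\<in>{1..<p}. f i) = (\<Sum>i<n. f (Suc i))"
  by (rule sum.reindex_bij_witness[of _ Suc "\<lambda>i. i - 1"]) (auto simp: n_def)

lemma sum_split_last: "(\<Sum>i\<in>{1..p}. f i) = (\<Sum>i\<in>{1..<p}. f i) + f p"
  using p_pos by (simp add: sum.last_plus add.commute flip: atLeastLessThanSuc_atLeastAtMost)

lemma quad_form_complex:
  "of_real (quad_form n C \<theta>) = (\<Sum>i\<in>{1..<p}. \<Sum>j\<in>{1..<p}. Hess i j * (of_real (r i * \<theta> i) * of_real (r j * \<theta> j)))"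
proof -
  have "of_real (quad_form n C \<theta>) = (\<Sum>i<n. \<Sum>j<n. Hess (Suc i) (Suc j) *
      (of_real (r (Suc i) * \<theta> (Suc i)) * of_real (r (Suc j) * \<theta> (Suc j))))"
    unfolding quad_form_def of_real_sum
  proof (intro sum.cong refl)
    fix i j assume "i \<in> {..<n}" "j \<in> {..<n}"
    then have "Hess (Suc i) (Suc j) = of_real (Re (Hess (Suc i) (Suc j)))" using Hess_real by simp
    then show "complex_of_real (C i j * \<theta> (Suc i) * \<theta> (Suc j)) = Hess (Suc i) (Suc j) *
      (of_real (r (Suc i) * \<theta> (Suc i)) * of_real (r (Suc j) * \<theta> (Suc j)))"
      by (subst \<open>Hess (Suc i) (Suc j) = _\<close>) (simp add: C_def)
  qed
  then show ?thesis by (simp only: sum_Suc)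
qed

lemma Y_tendsto: "i \<in> {1..p} \<Longrightarrow> ((\<lambda>t. Y (fst t) (snd t) i) \<longlongrightarrow> rc i) (corner p)"
proof -
  assume i: "i \<in> {1..p}"
  have "((\<lambda>t. of_real (r i) * exp (- of_real (fst t) + \<i> * of_real (snd t i))) \<longlongrightarrow>
      of_real (r i) * exp (- of_real 0 + \<i> * of_real 0)) (corner p)"
    by (intro tendsto_intros tendsto_fst_corner tendsto_snd_corner i)
  then show ?thesis by (simp add: Y_def)
qed

text \<open>Errors are measured by s = sqrt (u + sum of squares). Since u has at most the size
  \<open>s^2\<close>, each displacement agrees with \<open>\<i> * r i * \<theta> i\<close> up to
  O(s^2); the square of \<i> accounts for the sign of the quadratic form.\<close>

lemma Phi_cubic_bound:
  obtains K where "eventually (\<lambda>t. norm (\<Phi> (Y (fst t) (snd t)) - \<Phi> rc + of_real (quad_form n C (snd t) / 2)) \<le>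
     K * sqrt (fst t + (\<Sum>i\<in>{1..<p}. (snd t i)\<^sup>2)) ^ 3) (corner p)"
proof -
  let ?I = "{1..<p}"
  define R where "R = (\<Sum>i\<in>{1..p}. r i)"
  have rR: "r i \<le> R" "r i > 0" if "i \<in> ?I" for i
  proof -
    show "r i \<le> R" unfolding R_def using that r_pos by (intro member_le_sum) (auto intro: less_imp_le)
    show "r i > 0" using that r_pos by auto
  qed
  have R: "R \<ge> 0" unfolding R_def using r_pos by (intro sum_nonneg) (auto intro: less_imp_le)
  obtain C1 where "eventually (\<lambda>x. norm (\<Phi> (\<lambda>i. rc i + x i) - \<Phi> rc - quad_part ?I Hess x / 2) \<le>
      C1 * norm (cnorm1 ?I x ^ 3)) (small ?I)"
    using Phi_expansion by (elim landau_o.bigE)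
  then obtain d1 where d1: "d1 > 0" "\<And>x. norm (cnorm1 ?I x) < d1 \<Longrightarrow>
      norm (\<Phi> (\<lambda>i. rc i + x i) - \<Phi> rc - quad_part ?I Hess x / 2) \<le> C1 * norm (cnorm1 ?I x) ^ 3"
    unfolding eventually_small norm_power by blast
  define C2 where "C2 = max C1 0"
  have C2: "C1 \<le> C2" "0 \<le> C2" by (auto simp: C2_def)
  define H where "H = (\<Sum>i\<in>?I. \<Sum>j\<in>?I. norm (Hess i j))"
  \<comment> \<open>The first summand comes from the cubic remainder of \<Phi>, with l1 norm at most
    \<open>4 * R * p * s\<close>; the second from replacing displacements by their leading parts in
    the Hessian form, with 20 = 16 + 4.\<close>
  define K where "K = C2 * (4 * R * real p) ^ 3 + H * (20 * R\<^sup>2)"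
  let ?s = "\<lambda>t. sqrt (fst t + (\<Sum>i\<in>?I. (snd t i)\<^sup>2))"
  have "((\<lambda>t. 4 * R * real p * ?s t) \<longlongrightarrow> 4 * R * real p * sqrt (0 + (\<Sum>i\<in>?I. 0\<^sup>2))) (corner p)"
    by (intro tendsto_intros tendsto_fst_corner tendsto_snd_corner) auto
  then have s_small: "eventually (\<lambda>t. 4 * R * real p * ?s t < d1) (corner p)"
    by (rule order_tendstoD) (use d1 in simp)
  have box: "eventually (\<lambda>t. 0 < fst t \<and> fst t < 1/2 \<and> (\<forall>i\<in>{1..p}. \<bar>snd t i\<bar> < 1/2)) (corner p)"
    unfolding eventually_corner by (intro exI[of _ "1/2"]) auto
  have "eventually (\<lambda>t. norm (\<Phi> (Y (fst t) (snd t)) - \<Phi> rc + of_real (quad_form n C (snd t) / 2)) \<le> K * ?s t ^ 3) (corner p)"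
    using s_small box
  proof eventually_elim
    case (elim t)
    obtain u \<theta> where t: "t = (u, \<theta>)" by (cases t)
    define s where "s = sqrt (u + (\<Sum>i\<in>?I. (\<theta> i)\<^sup>2))"
    have u: "0 < u" "u < 1/2" and \<theta>: "\<And>i. i \<in> {1..p} \<Longrightarrow> \<bar>\<theta> i\<bar> < 1/2" using elim by (auto simp: t)
    have sd: "4 * R * real p * s < d1" using elim by (simp add: t s_def)
    have s2: "s\<^sup>2 = u + (\<Sum>i\<in>?I. (\<theta> i)\<^sup>2)" unfolding s_def using u by (intro real_sqrt_pow2 add_nonneg_nonneg sum_nonneg) auto
    have s0: "s \<ge> 0" unfolding s_def using u by (intro real_sqrt_ge_zero add_nonneg_nonneg sum_nonneg) auto
    let ?v = "\<lambda>i. - of_real u + \<i> * complex_of_real (\<theta> i)"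
    let ?x = "\<lambda>i. Y u \<theta> i - rc i" and ?b = "\<lambda>i. \<i> * complex_of_real (r i * \<theta> i)"
    have x: "norm (?x i) \<le> 4 * R * s" "norm (?x i - ?b i) \<le> 4 * R * s\<^sup>2" "norm (?b i) \<le> R * s"
      if i: "i \<in> ?I" for i
    proof -
      have ti: "(\<theta> i)\<^sup>2 \<le> (\<Sum>i\<in>?I. (\<theta> i)\<^sup>2)" using i by (intro member_le_sum) auto
      have uu: "u\<^sup>2 \<le> u" using u by (simp add: power2_eq_square mult_left_le)
      have v2: "norm (?v i) ^ 2 = u\<^sup>2 + (\<theta> i)\<^sup>2" by (simp add: cmod_power2)
      then have v2s: "norm (?v i) ^ 2 \<le> s\<^sup>2" using ti uu s2 by simp
      then have vs: "norm (?v i) \<le> s" using s0 by (rule power2_le_imp_le)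
      have "(\<theta> i)\<^sup>2 \<le> (1/2)\<^sup>2" using \<theta>[of i] i by (intro power2_le_iff_abs_le[THEN iffD2]) auto
      also have "(1 / 2 :: real)\<^sup>2 = 1 / 4" by (simp add: power2_eq_square)
      finally have "norm (?v i) ^ 2 \<le> 1\<^sup>2" unfolding power_one using v2 uu u by linarith
      then have v1: "norm (?v i) \<le> 1" by (rule power2_le_imp_le) simp
      note E = norm_exp_minus_1_minus_le[OF v1]
      have xi: "?x i = of_real (r i) * (exp (?v i) - 1)" by (simp add: Y_def algebra_simps)
      have "norm (?x i) = r i * norm (exp (?v i) - 1)" unfolding xi using rR(2)[OF i] by (simp add: norm_mult)
      also have "\<dots> \<le> R * (4 * s)" using E(2) vs rR[OF i] R by (intro mult_mono) auto
      finally show "norm (?x i) \<le> 4 * R * s" by simp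
      have "?x i - ?b i = of_real (r i) * ((exp (?v i) - 1 - ?v i) - of_real u)"
        unfolding xi by (simp add: algebra_simps)
      then have "norm (?x i - ?b i) = r i * norm ((exp (?v i) - 1 - ?v i) - of_real u)"
        using rR(2)[OF i] by (simp only: norm_mult norm_of_real abs_of_pos)
      also have "norm ((exp (?v i) - 1 - ?v i) - of_real u) \<le> norm (exp (?v i) - 1 - ?v i) + norm (of_real u :: complex)"
        by (rule norm_triangle_ineq4)
      also have "norm (of_real u :: complex) = u" using u by simp
      also have "norm (exp (?v i) - 1 - ?v i) \<le> 3 * s\<^sup>2" using E(1) v2s by linarith
      also have "u \<le> s\<^sup>2" using s2 sum_nonneg[of ?I "\<lambda>i. (\<theta> i)\<^sup>2"] by simp
      finally have "norm (?x i - ?b i) \<le> r i * (3 * s\<^sup>2 + s\<^sup>2)" using rR(2)[OF i] by simp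
      also have "\<dots> \<le> R * (3 * s\<^sup>2 + s\<^sup>2)" using rR(1)[OF i] by (intro mult_right_mono) auto
      finally show "norm (?x i - ?b i) \<le> 4 * R * s\<^sup>2" by simp
      have "(\<theta> i)\<^sup>2 \<le> s\<^sup>2" using s2 ti u by simp
      then have "\<bar>\<theta> i\<bar> \<le> s" using s0 by (simp add: power2_le_iff_abs_le)
      then have "r i * \<bar>\<theta> i\<bar> \<le> R * s" using rR[OF i] R by (intro mult_mono) auto
      then show "norm (?b i) \<le> R * s" using rR(2)[OF i] by (simp add: norm_mult abs_mult)
    qed
    have "norm (cnorm1 ?I ?x) \<le> (\<Sum>i\<in>?I. 4 * R * s)" unfolding norm_cnorm1 by (intro sum_mono x)
    also have "\<dots> = real (p - 1) * (4 * R * s)" by simp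
    also have "\<dots> \<le> real p * (4 * R * s)" using R s0 by (intro mult_right_mono mult_nonneg_nonneg) auto
    also have "\<dots> = 4 * R * real p * s" by simp
    finally have cn: "norm (cnorm1 ?I ?x) \<le> 4 * R * real p * s" .
    then have 1: "norm (\<Phi> (Y u \<theta>) - \<Phi> rc - quad_part ?I Hess ?x / 2) \<le> C1 * norm (cnorm1 ?I ?x) ^ 3"
      using d1(2)[of ?x] sd by simp
    also have "\<dots> \<le> C2 * (4 * R * real p * s) ^ 3" using cn C2 by (intro mult_mono power_mono) auto
    finally have 1: "norm (\<Phi> (Y u \<theta>) - \<Phi> rc - quad_part ?I Hess ?x / 2) \<le> C2 * (4 * R * real p * s) ^ 3" .
    have qeq: "quad_part ?I Hess ?x + of_real (quad_form n C \<theta>) =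
        (\<Sum>i\<in>?I. \<Sum>j\<in>?I. Hess i j * (?x i * ?x j - ?b i * ?b j))"
      unfolding quad_form_complex quad_part_def sum.distrib[symmetric]
      by (intro sum.cong refl) (simp add: algebra_simps)
    have "norm (\<Sum>i\<in>?I. \<Sum>j\<in>?I. Hess i j * (?x i * ?x j - ?b i * ?b j)) \<le>
        (\<Sum>i\<in>?I. \<Sum>j\<in>?I. norm (Hess i j) * (20 * R\<^sup>2 * s ^ 3))"
    proof (rule sum_norm_le, rule sum_norm_le)
      fix i j assume ij: "i \<in> ?I" "j \<in> ?I"
      have eq: "?x i * ?x j - ?b i * ?b j = ?x i * (?x j - ?b j) + (?x i - ?b i) * ?b j" by (simp add: algebra_simps)
      have "norm (?x i * ?x j - ?b i * ?b j) \<le> norm (?x i * (?x j - ?b j)) + norm ((?x i - ?b i) * ?b j)"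
        unfolding eq by (rule norm_triangle_ineq)
      then have "norm (?x i * ?x j - ?b i * ?b j) \<le> norm (?x i) * norm (?x j - ?b j) + norm (?x i - ?b i) * norm (?b j)"
        by (simp only: norm_mult)
      also have "\<dots> \<le> (4 * R * s) * (4 * R * s\<^sup>2) + (4 * R * s\<^sup>2) * (R * s)"
        using ij R s0 by (intro add_mono mult_mono x) auto
      also have "\<dots> = 20 * R\<^sup>2 * s ^ 3" by (simp add: power2_eq_square power3_eq_cube algebra_simps)
      finally show "norm (Hess i j * (?x i * ?x j - ?b i * ?b j)) \<le> norm (Hess i j) * (20 * R\<^sup>2 * s ^ 3)"
        unfolding norm_mult by (intro mult_left_mono) auto
    qed
    moreover have "(\<Sum>i\<in>?I. \<Sum>j\<in>?I. norm (Hess i j) * (20 * R\<^sup>2 * s ^ 3)) = H * (20 * R\<^sup>2) * s ^ 3"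
      unfolding H_def by (simp only: sum_distrib_right mult.assoc)
    ultimately have 2: "norm (quad_part ?I Hess ?x + of_real (quad_form n C \<theta>)) \<le> H * (20 * R\<^sup>2) * s ^ 3"
      unfolding qeq by (simp only:)
    have peq: "\<Phi> (Y u \<theta>) - \<Phi> rc + of_real (quad_form n C \<theta> / 2) =
      (\<Phi> (Y u \<theta>) - \<Phi> rc - quad_part ?I Hess ?x / 2) + (quad_part ?I Hess ?x + of_real (quad_form n C \<theta>)) / 2"
      by (simp add: field_simps)
    have "norm (\<Phi> (Y u \<theta>) - \<Phi> rc + of_real (quad_form n C \<theta> / 2)) \<le>
        norm (\<Phi> (Y u \<theta>) - \<Phi> rc - quad_part ?I Hess ?x / 2) + norm ((quad_part ?I Hess ?x + of_real (quad_form n C \<theta>)) / 2)"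
      unfolding peq by (rule norm_triangle_ineq)
    also have "\<dots> \<le> C2 * (4 * R * real p * s) ^ 3 + H * (20 * R\<^sup>2) * s ^ 3"
    proof (rule add_mono[OF 1])
      have "norm ((quad_part ?I Hess ?x + of_real (quad_form n C \<theta>)) / 2) \<le> norm (quad_part ?I Hess ?x + of_real (quad_form n C \<theta>))"
        by (simp add: norm_divide)
      then show "norm ((quad_part ?I Hess ?x + of_real (quad_form n C \<theta>)) / 2) \<le> H * (20 * R\<^sup>2) * s ^ 3"
        using 2 by (rule order.trans)
    qed
    also have "\<dots> = K * s ^ 3" by (simp add: K_def algebra_simps power_mult_distrib)
    finally show ?case by (simp add: t s_def)
  qed
  then show ?thesis by (rule that)
qed

lemma X_lower:
  obtains c where "c > 0" "\<And>u \<theta>. u \<ge> 0 \<Longrightarrow> c * (u + (\<Sum>i\<in>{1..<p}. (\<theta> i)\<^sup>2)) \<le> Re (X u \<theta>)"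
proof -
  obtain c where c: "c > 0" "\<And>\<theta>. quad_form n C \<theta> \<ge> c * (\<Sum>i<n. (\<theta> (Suc i))\<^sup>2)"
    using pos_def_form_lower_bound[OF C_pos_def] by blast
  have "min 1 (c / 2) * (u + (\<Sum>i\<in>{1..<p}. (\<theta> i)\<^sup>2)) \<le> Re (X u \<theta>)" if u: "u \<ge> 0" for u \<theta>
  proof -
    let ?S = "\<Sum>i\<in>{1..<p}. (\<theta> i)\<^sup>2"
    have S: "?S \<ge> 0" by (rule sum_nonneg) simp
    have "min 1 (c / 2) * (u + ?S) = min 1 (c / 2) * u + min 1 (c / 2) * ?S" by (rule distrib_left)
    also have "\<dots> \<le> 1 * u + (c / 2) * ?S"
      by (intro add_mono mult_right_mono min.cobounded1 min.cobounded2 u S)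
    also have "\<dots> \<le> u + quad_form n C \<theta> / 2"
      using c(2)[of \<theta>] unfolding sum_Suc by simp
    finally show ?thesis by (simp add: X_def)
  qed
  then show ?thesis using that[of "min 1 (c / 2)"] c(1) by simp
qed

lemma Re_X_pos: "u > 0 \<Longrightarrow> Re (X u \<theta>) > 0"
proof -
  assume u: "u > 0"
  obtain c where c: "c > 0" "\<And>u \<theta>. u \<ge> 0 \<Longrightarrow> c * (u + (\<Sum>i\<in>{1..<p}. (\<theta> i)\<^sup>2)) \<le> Re (X u \<theta>)"
    by (rule X_lower) blast
  have "0 < c * (u + (\<Sum>i\<in>{1..<p}. (\<theta> i)\<^sup>2))"
    using c(1) u by (intro mult_pos_pos add_pos_nonneg sum_nonneg) auto
  then show ?thesis using c(2)[of u \<theta>] u by linarith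
qed

text \<open>With \<open>w\<close> defined by \<open>y p = h y * exp w\<close>, the function \<open>F\<close> is affine in \<open>exp (- y p)\<close> and
  vanishes at \<open>y p = h y\<close>, hence is asymptotic to \<open>- A w\<close>; and \<open>\<alpha> p * w\<close> is
  \<open>- X\<close> up to the cubic error of the expansion of \<open>\<Phi>\<close>.\<close>

lemma F_asymp: "((\<lambda>t. F (Y (fst t) (snd t)) / X (fst t) (snd t)) \<longlongrightarrow> A / of_real (\<alpha> p)) (corner p)"
proof -
  let ?I = "{1..<p}" and ?V = "corner p"
  let ?Y = "\<lambda>t. Y (fst t) (snd t)" and ?X = "\<lambda>t. X (fst t) (snd t)"
  have ap: "\<alpha> p > 0" and rp: "r p > 0" using alpha_pos r_pos p_pos by auto
  define w where "w t = (- of_real (fst t) + \<i> * of_real (dir (snd t)) + (\<Phi> (?Y t) - \<Phi> rc)) / of_real (\<alpha> p)" for t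
  let ?D = "\<lambda>t. fst t + (\<Sum>i\<in>?I. (snd t i)\<^sup>2)"
  have Xpos: "eventually (\<lambda>t. ?X t \<noteq> 0) ?V"
    using eventually_fst_corner
  proof eventually_elim
    case (elim t)
    then show ?case using Re_X_pos[of "fst t" "snd t"] by auto
  qed
  have wX: "((\<lambda>t. of_real (\<alpha> p) * w t / ?X t + 1) \<longlongrightarrow> 0) ?V"
  proof -
    obtain K where K: "eventually (\<lambda>t. norm (\<Phi> (?Y t) - \<Phi> rc + of_real (quad_form n C (snd t) / 2)) \<le> K * sqrt (?D t) ^ 3) ?V"
      by (rule Phi_cubic_bound)
    obtain c where c: "c > 0" "\<And>u \<theta>. u \<ge> 0 \<Longrightarrow> c * (u + (\<Sum>i\<in>{1..<p}. (\<theta> i)\<^sup>2)) \<le> Re (X u \<theta>)"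
      by (rule X_lower) blast
    show ?thesis
    proof (rule Lim_null_comparison)
      \<comment> \<open>The error is cubic in \<open>sqrt (?D t)\<close>, while X is at least of
        order \<open>?D t\<close>; the quotient is of order \<open>sqrt (?D t)\<close>.\<close>
      show "eventually (\<lambda>t. norm (of_real (\<alpha> p) * w t / ?X t + 1) \<le> (\<bar>K\<bar> / c) * sqrt (?D t)) ?V"
        using K eventually_fst_corner Xpos
      proof eventually_elim
        case (elim t)
        have D: "?D t \<ge> 0" using elim by (intro add_nonneg_nonneg sum_nonneg) auto
        have "of_real (\<alpha> p) * w t / ?X t + 1 = (of_real (\<alpha> p) * w t + ?X t) / ?X t"
          using elim by (simp add: field_simps)
        also have "of_real (\<alpha> p) * w t + ?X t = \<Phi> (?Y t) - \<Phi> rc + of_real (quad_form n C (snd t) / 2)"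
          using ap by (simp add: w_def X_def)
        finally have "norm (of_real (\<alpha> p) * w t / ?X t + 1) =
            norm (\<Phi> (?Y t) - \<Phi> rc + of_real (quad_form n C (snd t) / 2)) / norm (?X t)"
          by (simp add: norm_divide)
        also have "\<dots> \<le> (\<bar>K\<bar> * sqrt (?D t) ^ 3) / norm (?X t)"
        proof (intro divide_right_mono)
          have "K * sqrt (?D t) ^ 3 \<le> \<bar>K\<bar> * sqrt (?D t) ^ 3" using D by (intro mult_right_mono) auto
          then show "norm (\<Phi> (?Y t) - \<Phi> rc + of_real (quad_form n C (snd t) / 2)) \<le> \<bar>K\<bar> * sqrt (?D t) ^ 3"
            using elim(1) by linarith
        qed simp
        also have "\<dots> \<le> (\<bar>K\<bar> / c) * sqrt (?D t)"
        proof -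
          have "c * ?D t \<le> norm (?X t)"
            using c(2)[of "fst t" "snd t"] elim(2) complex_Re_le_cmod[of "?X t"] by simp
          then have "(\<bar>K\<bar> / c) * sqrt (?D t) * (c * ?D t) \<le> (\<bar>K\<bar> / c) * sqrt (?D t) * norm (?X t)"
            using D c(1) by (intro mult_left_mono) auto
          moreover have "(\<bar>K\<bar> / c) * sqrt (?D t) * (c * ?D t) = \<bar>K\<bar> * sqrt (?D t) ^ 3"
            using c(1) D by (simp add: power3_eq_cube)
          ultimately show ?thesis using elim(3) by (simp add: divide_le_eq)
        qed
        finally show ?case .
      qed
      have "((\<lambda>t. (\<bar>K\<bar> / c) * sqrt (?D t)) \<longlongrightarrow> (\<bar>K\<bar> / c) * sqrt (0 + (\<Sum>i\<in>?I. 0\<^sup>2))) ?V"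
        using c(1) by (intro tendsto_intros tendsto_fst_corner tendsto_snd_corner) auto
      then show "((\<lambda>t. (\<bar>K\<bar> / c) * sqrt (?D t)) \<longlongrightarrow> 0) ?V" by simp
    qed
  qed
  have wX': "((\<lambda>t. w t / ?X t) \<longlongrightarrow> - 1 / of_real (\<alpha> p)) ?V"
  proof -
    have "((\<lambda>t. ((of_real (\<alpha> p) * w t / ?X t + 1) - 1) / of_real (\<alpha> p)) \<longlongrightarrow> (0 - 1) / of_real (\<alpha> p)) ?V"
      using ap by (intro tendsto_intros wX) auto
    then show ?thesis using ap by simp
  qed
  have X0: "(?X \<longlongrightarrow> 0) ?V"
  proof -
    have "((\<lambda>t. of_real (fst t + quad_form n C (snd t) / 2) - \<i> * of_real (dir (snd t))) \<longlongrightarrow>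
        of_real (0 + (\<Sum>i<n. \<Sum>j<n. C i j * 0 * 0) / 2) - \<i> * of_real (\<Sum>i\<in>{1..p}. \<alpha> i * 0)) ?V"
      unfolding quad_form_def dir_def
      by (intro tendsto_intros tendsto_fst_corner tendsto_snd_corner Suc_less_p(2)) auto
    then show ?thesis by (simp add: X_def)
  qed
  have w0: "(w \<longlongrightarrow> 0) ?V"
  proof -
    have "((\<lambda>t. w t / ?X t * ?X t) \<longlongrightarrow> - 1 / of_real (\<alpha> p) * 0) ?V" by (intro tendsto_mult wX' X0)
    then show ?thesis using Xpos by (auto elim!: Lim_transform_eventually elim: eventually_mono)
  qed
  have hY: "((\<lambda>t. h (?Y t)) \<longlongrightarrow> rc p) ?V"
    unfolding h_rc[symmetric] by (rule analytic_at_tendsto[OF _ h_analytic]) (auto intro: Y_tendsto)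
  have hpos: "eventually (\<lambda>t. h (?Y t) \<noteq> 0) ?V"
    using tendsto_imp_eventually_ne[OF hY, of 0] rp by simp
  \<comment> \<open>The contributions of the first p - 1 logarithms to \<open>dir\<close> and to
    \<Phi> cancel, leaving \<open>Ln (y p) - Ln (h y)\<close>. Angles below 1 keep the principal
    logarithm of the exponential exact.\<close>
  have expw: "eventually (\<lambda>t. ?Y t p = h (?Y t) * exp (w t)) ?V"
  proof -
    have "eventually (\<lambda>t. \<forall>i\<in>{1..p}. \<bar>snd t i\<bar> < 1) ?V"
      unfolding eventually_corner by (intro exI[of _ 1]) auto
    with hpos show ?thesis
    proof eventually_elim
      case (elim t)
      let ?v = "\<lambda>i. - of_real (fst t) + \<i> * complex_of_real (snd t i)"
      have LnY: "Ln (?Y t i) = Ln (rc i) + ?v i" if i: "i \<in> {1..p}" for i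
      proof -
        have "\<bar>snd t i\<bar> < pi" using elim(2) i pi_gt3 by force
        then have "Ln (exp (?v i)) = ?v i" by (intro Ln_exp) auto
        then show ?thesis using r_pos[OF i] by (simp add: Y_def Ln_times_of_real Ln_of_real)
      qed
      have e1: "\<Phi> (?Y t) - \<Phi> rc = - (\<Sum>i\<in>?I. of_real (\<alpha> i) * ?v i) - of_real (\<alpha> p) * (Ln (h (?Y t)) - Ln (rc p))"
      proof -
        have "(\<Sum>i\<in>?I. of_real (\<alpha> i) * Ln (?Y t i)) =
            (\<Sum>i\<in>?I. of_real (\<alpha> i) * Ln (rc i)) + (\<Sum>i\<in>?I. of_real (\<alpha> i) * ?v i)"
          unfolding sum.distrib[symmetric] by (intro sum.cong refl) (simp add: LnY algebra_simps)
        then show ?thesis unfolding Phi_fun_def h_rc by (simp add: algebra_simps)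
      qed
      have e2: "- of_real (fst t) + \<i> * of_real (dir (snd t)) = (\<Sum>i\<in>?I. of_real (\<alpha> i) * ?v i) + of_real (\<alpha> p) * ?v p"
      proof -
        have "(\<Sum>i\<in>{1..p}. of_real (\<alpha> i) * ?v i) = - of_real (fst t) * of_real (\<Sum>i\<in>{1..p}. \<alpha> i) + \<i> * of_real (dir (snd t))"
          by (simp add: dir_def sum_distrib_left sum.distrib algebra_simps sum_subtractf sum_negf)
        then have "(\<Sum>i\<in>{1..p}. of_real (\<alpha> i) * ?v i) = - of_real (fst t) + \<i> * of_real (dir (snd t))"
          by (simp only: alpha_sum of_real_1 mult_1_right)
        then show ?thesis by (simp only: sum_split_last)
      qed
      have "w t = ?v p + Ln (rc p) - Ln (h (?Y t))"
        unfolding w_def e1 e2 using ap by (simp add: field_simps)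
      then have "exp (w t) = exp (?v p) * rc p / h (?Y t)"
        using elim(1) rp by (simp add: exp_add exp_diff)
      then show ?case using elim(1) by (simp add: Y_def)
    qed
  qed
  have Fh: "eventually (\<lambda>t. F ((?Y t)(p := h (?Y t))) = 0) ?V"
  proof -
    obtain \<epsilon> where \<epsilon>: "\<epsilon> > 0" "\<And>y. (\<forall>i\<in>?I. norm (y i - rc i) < \<epsilon>) \<Longrightarrow> F (y(p := h y)) = 0"
      using F_h_eq_0 by blast
    have "eventually (\<lambda>t. \<forall>i\<in>?I. norm (?Y t i - rc i) < \<epsilon>) ?V"
    proof (subst eventually_ball_finite_distrib)
      show "\<forall>i\<in>?I. eventually (\<lambda>t. norm (?Y t i - rc i) < \<epsilon>) ?V"
        using Y_tendsto \<epsilon>(1) unfolding tendsto_iff dist_norm by auto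
    qed simp
    then show ?thesis by eventually_elim (rule \<epsilon>(2))
  qed
  \<comment> \<open>\<open>?z\<close> is \<open>h y - y p\<close> expressed through w; two uses of
    \<open>exp_quot\<close> extract w from \<open>exp (- y p) - exp (- h y)\<close>.\<close>
  let ?z = "\<lambda>t. - h (?Y t) * (w t * exp_quot (w t))"
  let ?B = "\<lambda>t. F_lead p E (?Y t) * exp (- h (?Y t)) * h (?Y t) * exp_quot (w t) * exp_quot (?z t)"
  have FB: "eventually (\<lambda>t. F (?Y t) = - w t * ?B t) ?V"
    using expw Fh
  proof eventually_elim
    case (elim t)
    have "F_free p E (?Y t) + (exp (- h (?Y t)) - 1) * F_lead p E (?Y t) = 0"
      using elim(2) unfolding F_fun_split by simp
    then have "F (?Y t) = F_lead p E (?Y t) * (exp (- ?Y t p) - exp (- h (?Y t)))"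
      unfolding F_fun_split by (simp add: algebra_simps eq_neg_iff_add_eq_0)
    also have "- ?Y t p = - h (?Y t) + ?z t"
      unfolding elim(1) exp_quot_mult by (simp add: algebra_simps)
    also have "exp (- h (?Y t) + ?z t) - exp (- h (?Y t)) = exp (- h (?Y t)) * (exp (?z t) - 1)"
      by (simp only: exp_add right_diff_distrib mult_1_right)
    also have "exp (?z t) - 1 = ?z t * exp_quot (?z t)" by (rule exp_quot_mult[symmetric])
    finally show ?case by (simp add: mult_ac)
  qed
  have z0: "(?z \<longlongrightarrow> 0) ?V"
  proof -
    have "(?z \<longlongrightarrow> - rc p * (0 * 1)) ?V" by (intro tendsto_intros hY w0 tendsto_exp_quot)
    then show ?thesis by simp
  qed
  have "((\<lambda>t. - (w t / ?X t) * ?B t) \<longlongrightarrow> - (- 1 / of_real (\<alpha> p)) * (F_lead p E rc * exp (- rc p) * rc p * 1 * 1)) ?V"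
  proof (intro tendsto_mult tendsto_minus tendsto_exp wX' hY tendsto_exp_quot w0 z0)
    show "((\<lambda>t. F_lead p E (?Y t)) \<longlongrightarrow> F_lead p E rc) ?V"
      by (rule F_lead_tendsto) (auto intro: Y_tendsto)
  qed
  moreover have "- (- 1 / of_real (\<alpha> p)) * (F_lead p E rc * exp (- rc p) * rc p * 1 * 1) = A / of_real (\<alpha> p)"
    unfolding A_def partial_deriv_F_last by simp
  moreover have "eventually (\<lambda>t. - (w t / ?X t) * ?B t = F (?Y t) / ?X t) ?V"
    using FB by eventually_elim simp
  ultimately show ?thesis by (auto elim: Lim_transform_eventually)
qed

end

subsection \<open>Exponential polynomials and the Euler operator\<close>

text \<open>A class that contains F, is stable under the Euler operator and consists of functions
  continuous in the coordinates of J. It houses the cofactors W that the operator produces next to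
  the powers of F.\<close>

inductive exp_poly :: "nat set \<Rightarrow> ((nat \<Rightarrow> complex) \<Rightarrow> complex) \<Rightarrow> bool" for J where
  exp_poly_const: "exp_poly J (\<lambda>_. c)"
| exp_poly_coord: "i \<in> J \<Longrightarrow> exp_poly J (\<lambda>y. y i)"
| exp_poly_exp: "i \<in> J \<Longrightarrow> exp_poly J (\<lambda>y. exp (- y i))"
| exp_poly_add: "exp_poly J f \<Longrightarrow> exp_poly J g \<Longrightarrow> exp_poly J (\<lambda>y. f y + g y)"
| exp_poly_mult: "exp_poly J f \<Longrightarrow> exp_poly J g \<Longrightarrow> exp_poly J (\<lambda>y. f y * g y)"

lemma exp_poly_tendsto:
  assumes "exp_poly J W" "\<And>i. i \<in> J \<Longrightarrow> ((\<lambda>t. \<gamma> t i) \<longlongrightarrow> a i) G"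
  shows "((\<lambda>t. W (\<gamma> t)) \<longlongrightarrow> W a) G"
  using assms by (induction rule: exp_poly.induct) (auto intro!: tendsto_intros)

lemma exp_poly_cong:
  assumes "exp_poly J W" "\<And>i. i \<in> J \<Longrightarrow> y i = y' i"
  shows "W y = W y'"
  using assms by (induction rule: exp_poly.induct) auto

text \<open>The Euler operator is taken as the derivative along \<open>z * y\<close> at z = 1, which
  avoids summing over partial derivatives.\<close>

lemma exp_poly_euler:
  assumes "exp_poly J W"
  shows "\<exists>W'. exp_poly J W' \<and> (\<forall>y. ((\<lambda>z. W (\<lambda>i. z * y i)) has_field_derivative W' y) (at 1))"
  using assms
proof (induction rule: exp_poly.induct)
  case (exp_poly_const c)
  show ?case by (intro exI[of _ "\<lambda>_. 0"]) (auto intro: exp_poly.intros)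
next
  case (exp_poly_coord i)
  then show ?case by (intro exI[of _ "\<lambda>y. y i"]) (auto intro: exp_poly.intros intro!: derivative_eq_intros)
next
  case (exp_poly_exp i)
  have "exp_poly J (\<lambda>y. (- 1) * y i * exp (- y i))"
    by (intro exp_poly.intros exp_poly_exp)
  moreover have "((\<lambda>z. exp (- (z * y i))) has_field_derivative (- 1) * y i * exp (- y i)) (at 1)" for y
    by (auto intro!: derivative_eq_intros)
  ultimately show ?case by blast
next
  case (exp_poly_add f g)
  then obtain f' g' where *: "exp_poly J f'" "\<And>y. ((\<lambda>z. f (\<lambda>i. z * y i)) has_field_derivative f' y) (at 1)"
    "exp_poly J g'" "\<And>y. ((\<lambda>z. g (\<lambda>i. z * y i)) has_field_derivative g' y) (at 1)" by blast
  have "exp_poly J (\<lambda>y. f' y + g' y)" by (intro exp_poly.intros *)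
  moreover have "((\<lambda>z. f (\<lambda>i. z * y i) + g (\<lambda>i. z * y i)) has_field_derivative f' y + g' y) (at 1)" for y
    by (intro DERIV_add *)
  ultimately show ?case by blast
next
  case (exp_poly_mult f g)
  then obtain f' g' where *: "exp_poly J f'" "\<And>y. ((\<lambda>z. f (\<lambda>i. z * y i)) has_field_derivative f' y) (at 1)"
    "exp_poly J g'" "\<And>y. ((\<lambda>z. g (\<lambda>i. z * y i)) has_field_derivative g' y) (at 1)" by blast
  have "exp_poly J (\<lambda>y. f' y * g y + g' y * f y)" by (intro exp_poly.intros * exp_poly_mult.hyps)
  moreover have "((\<lambda>z. f (\<lambda>i. z * y i) * g (\<lambda>i. z * y i)) has_field_derivative f' y * g y + g' y * f y) (at 1)" for y
    using DERIV_mult[OF *(2) *(4), of y y] by simp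
  ultimately show ?case by blast
qed

lemma exp_poly_sum: "finite S \<Longrightarrow> (\<And>s. s \<in> S \<Longrightarrow> exp_poly J (f s)) \<Longrightarrow> exp_poly J (\<lambda>y. \<Sum>s\<in>S. f s y)"
  by (induction S rule: finite_induct) (auto intro: exp_poly.intros)

lemma exp_poly_prod: "finite S \<Longrightarrow> (\<And>s. s \<in> S \<Longrightarrow> exp_poly J (f s)) \<Longrightarrow> exp_poly J (\<lambda>y. \<Prod>s\<in>S. f s y)"
  by (induction S rule: finite_induct) (auto intro: exp_poly.intros)

lemma exp_poly_F: "exp_poly {1..p} (F_fun p E)"
proof -
  have "exp_poly {1..p} (\<lambda>y. \<Sum>I\<in>independent_sets {1..p} E. \<Prod>i\<in>I. (exp (- y i) + (- 1)))"
  proof (intro exp_poly_sum exp_poly_prod exp_poly_add exp_poly_const exp_poly_exp)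
    fix I i assume "I \<in> independent_sets {1..p} E" "i \<in> I"
    then show "i \<in> {1..p}" by (auto simp: independent_sets_def)
  next
    fix I assume "I \<in> independent_sets {1..p} E"
    then show "finite I" by (auto simp: independent_sets_def intro: finite_subset)
  qed (simp add: finite_independent_sets)
  moreover have "F_fun p E = (\<lambda>y. \<Sum>I\<in>independent_sets {1..p} E. \<Prod>i\<in>I. (exp (- y i) + (- 1)))"
    by (rule ext) (simp add: F_fun_def B_fun_def)
  ultimately show ?thesis by (simp only:)
qed

lemma F_fun_0: "F_fun p E (\<lambda>_. 0) = 1"
proof -
  have "F_fun p E (\<lambda>_. 0) = (\<Sum>I\<in>independent_sets {1..p} E. of_bool (I = {}))"
    unfolding F_fun_def B_fun_def
  proof (intro sum.cong refl)
    fix I assume "I \<in> independent_sets {1..p} E"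
    then have "finite I" by (auto simp: independent_sets_def intro: finite_subset)
    then show "(\<Prod>i\<in>I. exp (- (0::complex)) - 1) = of_bool (I = {})" by (cases "I = {}") auto
  qed
  also have "\<dots> = (\<Sum>I\<in>{{} :: nat set}. of_bool (I = {}))"
    by (rule sum.mono_neutral_right) (auto simp: independent_sets_def)
  finally show ?thesis by simp
qed

section \<open>Reality of F, compact boxes and uniqueness of continuous logarithms\<close>

lemma F_fun_real: "F_fun p E (\<lambda>i. of_real (x i)) \<in> \<real>"
proof -
  have "exp (- complex_of_real t) - 1 = of_real (exp (- t) - 1)" for t by (simp flip: exp_of_real)
  then show ?thesis unfolding F_fun_def B_fun_def by (simp only:) (intro sum_in_Reals prod_in_Reals Reals_of_real)
qed

lemma F_lead_real: "F_lead p E (\<lambda>i. of_real (x i)) \<in> \<real>"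
proof -
  have "exp (- complex_of_real t) - 1 = of_real (exp (- t) - 1)" for t by (simp flip: exp_of_real)
  then show ?thesis unfolding F_lead_def by (simp only:) (intro sum_in_Reals prod_in_Reals Reals_of_real)
qed

text \<open>Tychonoff's theorem in the full function space.\<close>

lemma compact_box:
  assumes "\<And>i. compact (S i)"
  shows "compact {\<theta> :: nat \<Rightarrow> real. \<forall>i. \<theta> i \<in> S i}"
proof -
  have "compactin (product_topology (\<lambda>_. euclidean) UNIV) (PiE UNIV S)"
    using assms by (simp add: compactin_PiE compactin_euclidean_iff)
  moreover have "PiE UNIV S = {\<theta>. \<forall>i. \<theta> i \<in> S i}" by auto
  ultimately show ?thesis by (simp add: euclidean_product_topology compactin_euclidean_iff)
qed

text \<open>The difference of two continuous logarithms takes values in the discrete set of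
  multiples of \<open>2 * pi * \<i>\<close>, so it is constant on a connected set.\<close>

lemma log_unique:
  fixes f g :: "'a::topological_space \<Rightarrow> complex"
  assumes S: "connected S" and f: "continuous_on S f" and g: "continuous_on S g"
    and e: "\<And>x. x \<in> S \<Longrightarrow> exp (f x) = exp (g x)" and x0: "x0 \<in> S" "f x0 = g x0" and x: "x \<in> S"
  shows "f x = g x"
proof -
  let ?d = "\<lambda>x. f x - g x"
  have int: "\<exists>k::int. ?d x = 2 * of_int k * of_real pi * \<i>" if "x \<in> S" for x
  proof -
    have "exp (?d x) = 1" using e[OF that] by (simp add: exp_diff)
    then obtain k :: int where "Re (?d x) = 0" "Im (?d x) = of_int (2 * k) * pi" by (auto simp: exp_eq_1)
    then have "?d x = 2 * of_int k * of_real pi * \<i>" by (simp add: complex_eq_iff)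
    then show ?thesis ..
  qed
  have "?d constant_on S"
  proof (rule continuous_discrete_range_constant[OF S])
    show "continuous_on S ?d" by (intro continuous_on_diff f g)
    fix x assume x: "x \<in> S"
    show "\<exists>e>0. \<forall>y. y \<in> S \<and> ?d y \<noteq> ?d x \<longrightarrow> e \<le> norm (?d y - ?d x)"
    proof (intro exI[of _ 1] conjI allI impI)
      fix y assume y: "y \<in> S \<and> ?d y \<noteq> ?d x"
      obtain k l :: int where k: "?d x = 2 * of_int k * of_real pi * \<i>" and l: "?d y = 2 * of_int l * of_real pi * \<i>"
        using int[of x] int[of y] x y by auto
      have "k \<noteq> l" using y k l by auto
      then have "1 \<le> \<bar>real_of_int (l - k)\<bar>" by linarith
      have "?d y - ?d x = of_real (2 * pi * real_of_int (l - k)) * \<i>" unfolding k l by (simp add: algebra_simps)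
      then have "norm (?d y - ?d x) = \<bar>2 * pi * real_of_int (l - k)\<bar>" by (simp only: norm_mult norm_of_real norm_ii mult_1_right)
      also have "\<dots> = 2 * pi * \<bar>real_of_int (l - k)\<bar>" by (simp add: abs_mult)
      also have "\<dots> \<ge> 1 * 1" using \<open>1 \<le> _\<close> pi_gt3 by (intro mult_mono) auto
      finally show "1 \<le> norm (?d y - ?d x)" by simp
    qed simp
  qed
  then have "?d x = ?d x0" using x x0(1) unfolding constant_on_def by metis
  then show ?thesis using x0(2) by simp
qed

section \<open>Positivity towards the critical point and the lower bound on the torus\<close>

context critical_point
begin

lemma F_tendsto:
  assumes "\<And>i. i \<in> {1..p} \<Longrightarrow> ((\<lambda>t. \<gamma> t i) \<longlongrightarrow> a i) G"
  shows "((\<lambda>t. F (\<gamma> t)) \<longlongrightarrow> F a) G"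
  by (rule exp_poly_tendsto[OF exp_poly_F assms])

lemma norm_Y: "i \<in> {1..p} \<Longrightarrow> norm (Y u \<theta> i) = r i * exp (- u)"
  using r_pos[of i] by (simp add: Y_def norm_mult)

lemma Y_polydisc: "u > 0 \<Longrightarrow> Y u \<theta> \<in> open_polydisc p r"
  using r_pos by (simp add: open_polydisc_def norm_Y mult_less_cancel_left1)

text \<open>By strict minimality a zero in the closed polydisc has \<open>y p = r p\<close>, which
  the open polydisc excludes.\<close>

lemma F_nonzero: "y \<in> open_polydisc p r \<Longrightarrow> F y \<noteq> 0"
proof
  assume y: "y \<in> open_polydisc p r" and 0: "F y = 0"
  have "y \<in> closed_polydisc p r" using y by (auto simp: open_polydisc_def closed_polydisc_def intro: less_imp_le)
  then have "y p = of_real (r p)" using minimal 0 p_pos by (auto simp: strictly_minimal_def)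
  moreover have "norm (y p) < r p" using y p_pos by (simp add: open_polydisc_def)
  ultimately show False by simp
qed

lemma ray_polydisc: "0 \<le> t \<Longrightarrow> t < 1 \<Longrightarrow> (\<lambda>i. of_real (t * r i)) \<in> open_polydisc p r"
  unfolding open_polydisc_def
proof (intro CollectI ballI)
  fix i assume t: "0 \<le> t" "t < 1" and i: "i \<in> {1..p}"
  have "norm (complex_of_real (t * r i)) = t * r i"
    unfolding norm_of_real using t r_pos[OF i] by simp
  also have "\<dots> < 1 * r i" using t r_pos[OF i] by (intro mult_strict_right_mono) auto
  finally show "norm (complex_of_real (t * r i)) < r i" by simp
qed

text \<open>On the segment F is real, starts at 1 and has no zero before the end, so the
  intermediate value theorem keeps it positive.\<close>

lemma F_ray:
  assumes t: "0 \<le> t" "t < 1"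
  shows "F (\<lambda>i. of_real (t * r i)) = of_real (Re (F (\<lambda>i. of_real (t * r i))))" "Re (F (\<lambda>i. of_real (t * r i))) > 0"
proof -
  let ?f = "\<lambda>t. Re (F (\<lambda>i. of_real (t * r i)))"
  have real: "F (\<lambda>i. of_real (t * r i)) = of_real (?f t)" for t
    by (rule of_real_Re[OF F_fun_real, symmetric])
  then show "F (\<lambda>i. of_real (t * r i)) = of_real (?f t)" .
  have nz: "?f t \<noteq> 0" if "0 \<le> t" "t < 1" for t
    using F_nonzero[OF ray_polydisc[OF that]] real[of t] by auto
  have cont: "isCont ?f t" for t
    unfolding isCont_def by (intro tendsto_Re F_tendsto tendsto_intros)
  have f0: "?f 0 = 1" using F_fun_0 by simp
  show "?f t > 0"
  proof (rule ccontr)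
    assume "\<not> ?f t > 0"
    then have "\<exists>x. 0 \<le> x \<and> x \<le> t \<and> ?f x = 0"
      using f0 t cont by (intro IVT2) auto
    then show False using nz t by force
  qed
qed

lemma Y_ray: "Y u (\<lambda>_. 0) = (\<lambda>i. of_real (exp (- u) * r i))"
  by (simp add: Y_def fun_eq_iff exp_of_real[symmetric] mult.commute)

lemma ray_corner: "filterlim (\<lambda>u. (u, \<lambda>_. 0)) (corner p) (at_right 0)"
proof (rule filterlim_iff[THEN iffD2, rule_format])
  fix P assume "eventually P (corner p)"
  then obtain d where d: "d > 0" "\<And>u \<theta>. 0 < u \<Longrightarrow> u < d \<Longrightarrow> (\<forall>i\<in>{1..p}. \<bar>\<theta> i\<bar> < d) \<Longrightarrow> P (u, \<theta>)"
    unfolding eventually_corner by blast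
  show "eventually (\<lambda>u. P (u, \<lambda>_. 0)) (at_right 0)"
    using eventually_at_right_less[of 0] eventually_at_right_real[OF d(1)]
    by eventually_elim (rule d(2), use d(1) in auto)
qed

lemma X_ray: "X u (\<lambda>_. 0) = of_real u"
  by (simp add: X_def quad_form_def dir_def)

lemma F_ray_asymp: "((\<lambda>u. F (Y u (\<lambda>_. 0)) / of_real u) \<longlongrightarrow> A / of_real (\<alpha> p)) (at_right 0)"
  using filterlim_compose[OF F_asymp ray_corner] by (simp add: X_ray)

definition a :: real where "a = Re A"

text \<open>Positivity of F on the ray, where \<open>F / u\<close> tends to
  \<open>A / \<alpha> p\<close>, decides the sign of A; its powers can then be taken as real
  powers.\<close>

lemma A_real: "A = of_real a" and a_pos: "a > 0"
proof -
  have "A = of_real (r p) * exp (- of_real (r p)) * F_lead p E rc"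
    by (simp add: A_def partial_deriv_F_last)
  also have "\<dots> \<in> \<real>" by (intro Reals_mult Reals_of_real F_lead_real) (simp flip: exp_of_real of_real_minus)
  finally show real: "A = of_real a" by (simp add: a_def of_real_Re)
  have ap: "\<alpha> p > 0" using alpha_pos p_pos by auto
  have "((\<lambda>u. Re (F (Y u (\<lambda>_. 0)) / of_real u)) \<longlongrightarrow> Re (A / of_real (\<alpha> p))) (at_right 0)"
    by (intro tendsto_Re F_ray_asymp)
  moreover have "\<forall>\<^sub>F u in at_right 0. Re (F (Y u (\<lambda>_. 0)) / of_real u) \<ge> 0"
    using eventually_at_right_less[of 0]
  proof eventually_elim
    case (elim u)
    then show ?case using F_ray(2)[of "exp (- u)"] by (simp add: Y_ray Re_divide_of_real)
  qed
  ultimately have "Re (A / of_real (\<alpha> p)) \<ge> 0" by (intro tendsto_lowerbound) auto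
  then have "a \<ge> 0" using ap unfolding real by (simp add: zero_le_divide_iff)
  moreover have "a \<noteq> 0" using A_nonzero real by auto
  ultimately show "a > 0" by simp
qed

text \<open>The radial derivative at r is read off from the asymptotics on the ray, with
  \<open>exp (- u)\<close> as the scale. It is the factor that each application of the Euler
  operator to a power of F leaves at r, next to the exponent.\<close>

lemma euler_F:
  assumes "((\<lambda>z. F (\<lambda>i. z * rc i)) has_field_derivative D) (at 1)"
  shows "D = - of_real (a / \<alpha> p)"
proof -
  have "((\<lambda>z. F (\<lambda>i. exp (- z) * rc i)) has_field_derivative D * (exp (- 0) * (- 1))) (at 0)"
    by (rule DERIV_chain2[where f = "\<lambda>z. F (\<lambda>i. z * rc i)" and g = "\<lambda>z. exp (- z)"])
      (use assms in \<open>auto intro!: derivative_eq_intros\<close>)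
  then have "((\<lambda>z. F (\<lambda>i. exp (- z) * rc i)) has_field_derivative - D) (at 0)" by simp
  then have "((\<lambda>z. (F (\<lambda>i. exp (- z) * rc i) - F rc) / z) \<longlongrightarrow> - D) (at 0)"
    by (simp add: has_field_derivative_iff)
  then have "((\<lambda>z. F (\<lambda>i. exp (- z) * rc i) / z) \<longlongrightarrow> - D) (at 0)" using zero by simp
  moreover have "filterlim complex_of_real (at 0) (at_right 0)"
    unfolding filterlim_at using eventually_at_right_less[of "0::real"]
    by (auto intro!: tendsto_eq_intros elim: eventually_mono)
  ultimately have "((\<lambda>u. F (\<lambda>i. exp (- of_real u) * rc i) / of_real u) \<longlongrightarrow> - D) (at_right 0)"
    by (rule filterlim_compose)
  moreover have "(\<lambda>i. exp (- of_real u) * rc i) = Y u (\<lambda>_. 0)" for u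
    by (simp add: Y_def fun_eq_iff mult.commute)
  ultimately have "((\<lambda>u. F (Y u (\<lambda>_. 0)) / of_real u) \<longlongrightarrow> - D) (at_right 0)" by simp
  from tendsto_unique[OF _ this F_ray_asymp] have "- D = of_real (a / \<alpha> p)" by (simp add: A_real)
  then show ?thesis by (metis minus_minus)
qed

text \<open>Coordinates outside 1 to p are pinned to 0 for compactness in the infinite product;
  \<open>exp_poly_Y_restrict\<close> transfers bounds back to arbitrary \<theta>.\<close>

definition box :: "(nat \<Rightarrow> real) set" where
  "box = {\<theta>. \<forall>i. \<theta> i \<in> (if i \<in> {1..p} then {- pi..pi} else {0})}"

lemma compact_box': "compact ({0..1::real} \<times> box)"
  unfolding box_def by (intro compact_Times compact_box) auto

lemma continuous_on_exp_poly_Y: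
  assumes W: "exp_poly {1..p} W"
  shows "continuous_on S (\<lambda>t. W (Y (fst t) (snd t)))"
  unfolding continuous_on_def
proof
  fix t assume "t \<in> S"
  have "((\<lambda>t. snd t i) \<longlongrightarrow> snd t i) (at t within S)" for i
  proof -
    have "continuous_on UNIV (\<lambda>t :: real \<times> (nat \<Rightarrow> real). snd t i)"
      by (rule continuous_on_product_then_coordinatewise) (intro continuous_intros)
    then show ?thesis by (meson UNIV_I continuous_on_def continuous_on_subset subset_UNIV tendsto_within_subset)
  qed
  then show "((\<lambda>t. W (Y (fst t) (snd t))) \<longlongrightarrow> W (Y (fst t) (snd t))) (at t within S)"
    unfolding Y_def by (intro exp_poly_tendsto[OF W] tendsto_intros)
qed

lemma exp_poly_Y_restrict:
  assumes W: "exp_poly {1..p} W"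
  shows "W (Y u \<theta>) = W (Y u (\<lambda>i. if i \<in> {1..p} then \<theta> i else 0))"
  by (rule exp_poly_cong[OF W]) (simp add: Y_def)

lemma exp_poly_bounded:
  assumes W: "exp_poly {1..p} W"
  obtains K where "\<And>u \<theta>. 0 \<le> u \<Longrightarrow> u \<le> 1 \<Longrightarrow> (\<And>i. i \<in> {1..p} \<Longrightarrow> \<bar>\<theta> i\<bar> \<le> pi) \<Longrightarrow> norm (W (Y u \<theta>)) \<le> K"
proof -
  have "compact ((\<lambda>t. W (Y (fst t) (snd t))) ` ({0..1::real} \<times> box))"
    by (rule compact_continuous_image[OF continuous_on_exp_poly_Y[OF W] compact_box'])
  then have "bounded ((\<lambda>t. W (Y (fst t) (snd t))) ` ({0..1::real} \<times> box))" by (rule compact_imp_bounded)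
  then obtain K where K: "\<forall>x\<in>(\<lambda>t. W (Y (fst t) (snd t))) ` ({0..1::real} \<times> box). norm x \<le> K"
    by (auto simp only: bounded_iff)
  have "norm (W (Y u \<theta>)) \<le> K" if u: "0 \<le> u" "u \<le> 1" and \<theta>: "\<And>i. i \<in> {1..p} \<Longrightarrow> \<bar>\<theta> i\<bar> \<le> pi" for u \<theta>
  proof -
    let ?\<theta> = "\<lambda>i. if i \<in> {1..p} then \<theta> i else 0"
    have "(u, ?\<theta>) \<in> {0..1} \<times> box" using u \<theta> by (auto simp: box_def abs_le_iff minus_le_iff)
    then have "norm (W (Y u ?\<theta>)) \<le> K" using K by force
    then show ?thesis using exp_poly_Y_restrict[OF W] by simp
  qed
  then show ?thesis by (rule that)
qed

lemma F_Y_eq_0: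
  assumes u: "u \<ge> 0" and \<theta>: "\<And>i. i \<in> {1..p} \<Longrightarrow> \<bar>\<theta> i\<bar> \<le> pi" and 0: "F (Y u \<theta>) = 0"
  shows "u = 0" "\<And>i. i \<in> {1..p} \<Longrightarrow> \<theta> i = 0"
proof -
  have "Y u \<theta> \<in> closed_polydisc p r"
    using u r_pos by (auto simp: closed_polydisc_def norm_Y mult_le_cancel_left1)
  then have Yr: "Y u \<theta> i = rc i" if "i \<in> {1..p}" for i
    using minimal 0 that by (simp add: strictly_minimal_def)
  then have e: "exp (- of_real u + \<i> * of_real (\<theta> i)) = 1" if "i \<in> {1..p}" for i
    using Yr[OF that] r_pos[OF that] by (simp add: Y_def)
  show "u = 0" using e[of p] p_pos by (auto simp: exp_eq_1)
  show "\<theta> i = 0" if i: "i \<in> {1..p}" for i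
  proof -
    obtain k :: int where k: "\<theta> i = of_int (2 * k) * pi" using e[OF i] by (auto simp: exp_eq_1)
    have "\<bar>real_of_int (2 * k)\<bar> * pi \<le> 1 * pi" using \<theta>[OF i] by (simp add: k abs_mult)
    then have "\<bar>real_of_int (2 * k)\<bar> \<le> 1" using pi_gt_zero by (simp only: mult_le_cancel_right_pos)
    then have "k = 0" by linarith
    then show ?thesis using k by simp
  qed
qed

text \<open>Near the corner the bound comes from the model X, elsewhere from the minimum of F over a
  compact set. That set reaches down to u = 0, where strict minimality still excludes zeros, so the
  constant is uniform as u tends to 0.\<close>

lemma F_lower:
  obtains c where "c > 0" "\<And>u \<theta>. 0 < u \<Longrightarrow> u \<le> 1 \<Longrightarrow> (\<And>i. i \<in> {1..p} \<Longrightarrow> \<bar>\<theta> i\<bar> \<le> pi) \<Longrightarrow>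
    c * (u + \<bar>dir \<theta>\<bar> + (\<Sum>i\<in>{1..<p}. (\<theta> i)\<^sup>2)) \<le> norm (F (Y u \<theta>))"
proof -
  let ?I = "{1..<p}"
  let ?D = "\<lambda>u \<theta>. u + \<bar>dir \<theta>\<bar> + (\<Sum>i\<in>?I. (\<theta> i)\<^sup>2)"
  have ap: "\<alpha> p > 0" using alpha_pos p_pos by auto
  obtain c0 where c0: "c0 > 0" "\<And>u \<theta>. u \<ge> 0 \<Longrightarrow> c0 * (u + (\<Sum>i\<in>?I. (\<theta> i)\<^sup>2)) \<le> Re (X u \<theta>)"
    by (rule X_lower) blast
  \<comment> \<open>The real part of X dominates u and the squares, the imaginary part dominates
    \<open>dir\<close>; adding the two estimates costs the factor 2.\<close>
  define c1 where "c1 = min c0 1 / 2"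
  have c1: "c1 > 0" using c0(1) by (simp add: c1_def)
  have XD: "c1 * ?D u \<theta> \<le> norm (X u \<theta>)" if u: "u > 0" for u \<theta>
  proof -
    let ?e = "u + (\<Sum>i\<in>?I. (\<theta> i)\<^sup>2)"
    have e: "?e \<ge> 0" using u by (intro add_nonneg_nonneg sum_nonneg) auto
    have "min c0 1 * ?e \<le> c0 * ?e" using e by (intro mult_right_mono) auto
    also have "\<dots> \<le> norm (X u \<theta>)" using c0(2)[of u \<theta>] u complex_Re_le_cmod[of "X u \<theta>"] by simp
    finally have 1: "min c0 1 * ?e \<le> norm (X u \<theta>)" .
    have "min c0 1 * \<bar>dir \<theta>\<bar> \<le> 1 * \<bar>dir \<theta>\<bar>" by (intro mult_right_mono) auto
    also have "\<dots> \<le> norm (X u \<theta>)" using abs_Im_le_cmod[of "X u \<theta>"] by (simp add: X_def)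
    finally have 2: "min c0 1 * \<bar>dir \<theta>\<bar> \<le> norm (X u \<theta>)" .
    have "min c0 1 * ?D u \<theta> = min c0 1 * ?e + min c0 1 * \<bar>dir \<theta>\<bar>" by (simp only: ring_distribs add_ac)
    then show ?thesis using 1 2 unfolding c1_def by linarith
  qed
  have lim: "((\<lambda>t. norm (F (Y (fst t) (snd t)) / X (fst t) (snd t))) \<longlongrightarrow> a / \<alpha> p) (corner p)"
    using tendsto_norm[OF F_asymp] a_pos ap by (simp add: A_real norm_divide)
  have "eventually (\<lambda>t. norm (F (Y (fst t) (snd t)) / X (fst t) (snd t)) > a / \<alpha> p / 2) (corner p)"
  proof (rule order_tendstoD[OF lim])
    have "x / 2 < x" if "x > 0" for x :: real using that by simp
    then show "a / \<alpha> p / 2 < a / \<alpha> p" using divide_pos_pos[OF a_pos ap] by blast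
  qed
  then obtain d where d: "d > 0" "\<And>u \<theta>. 0 < u \<Longrightarrow> u < d \<Longrightarrow> (\<forall>i\<in>{1..p}. \<bar>\<theta> i\<bar> < d) \<Longrightarrow>
      norm (F (Y u \<theta>) / X u \<theta>) > a / \<alpha> p / 2"
    unfolding eventually_corner fst_conv snd_conv by blast
  let ?K = "({0..1::real} \<times> box) \<inter> ({t. d \<le> fst t} \<union> (\<Union>i\<in>{1..p}. {t. d \<le> \<bar>snd t i\<bar>}))"
  have contc: "continuous_on UNIV (\<lambda>t :: real \<times> (nat \<Rightarrow> real). snd t i)" for i
    by (rule continuous_on_product_then_coordinatewise) (intro continuous_intros)
  have "closed ({t :: real \<times> (nat \<Rightarrow> real). d \<le> fst t} \<union> (\<Union>i\<in>{1..p}. {t. d \<le> \<bar>snd t i\<bar>}))"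
    by (intro closed_Un closed_UN ballI closed_Collect_le continuous_intros contc) auto
  then have K: "compact ?K" by (intro compact_Int_closed compact_box')
  obtain m where m: "m > 0" "\<And>t. t \<in> ?K \<Longrightarrow> norm (F (Y (fst t) (snd t))) \<ge> m"
  proof (cases "?K = {}")
    case True
    then show ?thesis using that[of 1] by auto
  next
    case False
    have "continuous_on ?K (\<lambda>t. norm (F (Y (fst t) (snd t))))"
      by (intro continuous_on_norm continuous_on_exp_poly_Y exp_poly_F)
    from continuous_attains_inf[OF K False this] obtain t0 where
      t0: "t0 \<in> ?K" "\<forall>t\<in>?K. norm (F (Y (fst t0) (snd t0))) \<le> norm (F (Y (fst t) (snd t)))" by blast
    have "F (Y (fst t0) (snd t0)) \<noteq> 0"
    proof
      assume z: "F (Y (fst t0) (snd t0)) = 0"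
      have b: "\<bar>snd t0 i\<bar> \<le> pi" if "i \<in> {1..p}" for i
        using t0(1) that by (auto simp: box_def abs_le_iff split: if_splits dest!: spec[of _ i])
      have "fst t0 = 0" "\<And>i. i \<in> {1..p} \<Longrightarrow> snd t0 i = 0"
        using F_Y_eq_0[OF _ b z] t0(1) by auto
      then show False using t0(1) d(1) by auto
    qed
    then show ?thesis using that[of "norm (F (Y (fst t0) (snd t0)))"] t0(2) by simp
  qed
  \<comment> \<open>An upper bound for \<open>?D\<close> on the torus; pi bounds \<open>dir\<close>
    because the \<alpha> i sum to 1.\<close>
  define M where "M = 1 + pi + real p * pi\<^sup>2"
  have M: "M > 0" unfolding M_def using pi_gt_zero by (intro add_pos_nonneg) auto
  define c where "c = min (a / \<alpha> p / 2 * c1) (m / M)"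
  have c: "c > 0" using a_pos ap c1 m(1) M by (simp add: c_def)
  have "c * ?D u \<theta> \<le> norm (F (Y u \<theta>))"
    if u: "0 < u" "u \<le> 1" and \<theta>: "\<And>i. i \<in> {1..p} \<Longrightarrow> \<bar>\<theta> i\<bar> \<le> pi" for u \<theta>
  proof -
    have D0: "?D u \<theta> \<ge> 0" using u by (intro add_nonneg_nonneg sum_nonneg) auto
    show ?thesis
    proof (cases "u < d \<and> (\<forall>i\<in>{1..p}. \<bar>\<theta> i\<bar> < d)")
      case True
      have Xnz: "norm (X u \<theta>) > 0" using Re_X_pos[OF u(1), of \<theta>] by auto
      have "c * ?D u \<theta> \<le> (a / \<alpha> p / 2 * c1) * ?D u \<theta>"
        using D0 by (intro mult_right_mono) (auto simp: c_def)
      also have "\<dots> = a / \<alpha> p / 2 * (c1 * ?D u \<theta>)" by simp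
      also have "\<dots> \<le> a / \<alpha> p / 2 * norm (X u \<theta>)"
        using XD[OF u(1)] a_pos ap by (intro mult_left_mono) auto
      also have "\<dots> \<le> norm (F (Y u \<theta>))"
      proof -
        have "a / \<alpha> p / 2 < norm (F (Y u \<theta>)) / norm (X u \<theta>)"
          using d(2)[OF u(1)] True unfolding norm_divide by blast
        then show ?thesis unfolding pos_less_divide_eq[OF Xnz] by (rule less_imp_le)
      qed
      finally show ?thesis .
    next
      case False
      let ?\<theta> = "\<lambda>i. if i \<in> {1..p} then \<theta> i else 0"
      have mem: "?\<theta> \<in> box" using \<theta> by (auto simp: box_def abs_le_iff minus_le_iff)
      have "(u, ?\<theta>) \<in> ?K"
      proof (cases "u < d")
        case True
        then obtain i where "i \<in> {1..p}" "d \<le> \<bar>\<theta> i\<bar>" using False by force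
        then show ?thesis using u mem by auto
      qed (use u mem in auto)
      then have mF: "m \<le> norm (F (Y u \<theta>))"
        using m(2)[of "(u, ?\<theta>)"] exp_poly_Y_restrict[OF exp_poly_F, of E u \<theta>] by simp
      have "\<bar>dir \<theta>\<bar> \<le> (\<Sum>i\<in>{1..p}. \<alpha> i * pi)"
        unfolding dir_def
      proof (rule order.trans[OF sum_abs] , rule sum_mono)
        fix i assume "i \<in> {1..p}"
        then show "\<bar>\<alpha> i * \<theta> i\<bar> \<le> \<alpha> i * pi" using \<theta>[of i] alpha_pos[of i] by (simp add: abs_mult)
      qed
      also have "\<dots> = pi" unfolding sum_distrib_right[symmetric] alpha_sum by simp
      finally have dir: "\<bar>dir \<theta>\<bar> \<le> pi" .
      have "(\<Sum>i\<in>?I. (\<theta> i)\<^sup>2) \<le> (\<Sum>i\<in>?I. pi\<^sup>2)"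
      proof (rule sum_mono)
        fix i assume "i \<in> ?I"
        then show "(\<theta> i)\<^sup>2 \<le> pi\<^sup>2" using \<theta>[of i] by (intro power2_le_iff_abs_le[THEN iffD2]) auto
      qed
      also have "\<dots> = real (p - 1) * pi\<^sup>2" by simp
      also have "\<dots> \<le> real p * pi\<^sup>2" by (intro mult_right_mono) auto
      finally have "?D u \<theta> \<le> M" unfolding M_def using u dir by linarith
      then have "c * ?D u \<theta> \<le> m / M * M"
        using D0 c m(1) M by (intro mult_mono) (auto simp: c_def)
      then show ?thesis using mF M by simp
    qed
  qed
  then show ?thesis using that c by blast
qed

end

subsection \<open>The branch of the power and its power series\<close>

locale critical_power = critical_point +
  fixes s :: real and G :: "(nat \<Rightarrow> complex) \<Rightarrow> complex"
  assumes s: "s > 0" and G: "neg_power_branch p (F_fun p E) s r G"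
begin

definition L1 :: "(nat \<Rightarrow> complex) \<Rightarrow> complex" where
  "L1 = (SOME L. \<forall>y\<in>open_polydisc p r. analytic_at {1..p} L y \<and> exp (L y) = F y \<and>
     G y = exp (- of_real s * L y))"

text \<open>The logarithm normalised at the origin, where F = 1. Subtracting \<open>L1 0\<close>
  leaves G intact, since \<open>G 0 = 1\<close> means \<open>exp (- s * L1 0) = 1\<close>.\<close>

definition L0 :: "(nat \<Rightarrow> complex) \<Rightarrow> complex" where
  "L0 y = L1 y - L1 (\<lambda>_. 0)"

lemma L1:
  assumes "y \<in> open_polydisc p r"
  shows "analytic_at {1..p} L1 y" "exp (L1 y) = F y" "G y = exp (- of_real s * L1 y)"
proof -
  have "\<exists>L. \<forall>y\<in>open_polydisc p r. analytic_at {1..p} L y \<and> exp (L y) = F y \<and> G y = exp (- of_real s * L y)"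
    using G unfolding neg_power_branch_def by (rule conjunct2)
  from someI_ex[OF this]
  have "\<forall>y\<in>open_polydisc p r. analytic_at {1..p} L1 y \<and> exp (L1 y) = F y \<and> G y = exp (- of_real s * L1 y)"
    unfolding L1_def .
  then show "analytic_at {1..p} L1 y" "exp (L1 y) = F y" "G y = exp (- of_real s * L1 y)" using assms by auto
qed

lemma zero_polydisc: "(\<lambda>_. 0) \<in> open_polydisc p r"
  using r_pos by (simp add: open_polydisc_def)

lemma exp_L0: "y \<in> open_polydisc p r \<Longrightarrow> exp (L0 y) = F y"
  using L1(2)[of y] L1(2)[OF zero_polydisc] F_fun_0[of p E] by (simp add: L0_def exp_diff)

lemma G_L0:
  assumes "y \<in> open_polydisc p r"
  shows "G y = exp (- of_real s * L0 y)"
proof -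
  have "G (\<lambda>_. 0) = 1" using G by (simp add: neg_power_branch_def)
  then have "exp (- of_real s * L1 (\<lambda>_. 0)) = 1" using L1(3)[OF zero_polydisc] by simp
  moreover have "exp (- of_real s * L0 y) = exp (- of_real s * L1 y) / exp (- of_real s * L1 (\<lambda>_. 0))"
    unfolding exp_diff[symmetric] by (simp add: L0_def algebra_simps)
  ultimately show ?thesis using L1(3)[OF assms] by simp
qed

lemma L0_tendsto:
  assumes "y \<in> open_polydisc p r" "\<And>i. i \<in> {1..p} \<Longrightarrow> ((\<lambda>t. \<gamma> t i) \<longlongrightarrow> y i) Q"
  shows "((\<lambda>t. L0 (\<gamma> t)) \<longlongrightarrow> L0 y) Q"
  unfolding L0_def by (intro tendsto_intros analytic_at_tendsto[OF _ L1(1)[OF assms(1)] assms(2)]) auto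

lemma L0_line:
  assumes y: "(\<lambda>i. z0 * y i) \<in> open_polydisc p r"
  shows "(\<lambda>z. L0 (\<lambda>i. z * y i)) field_differentiable at z0"
proof -
  obtain \<epsilon> where \<epsilon>: "\<epsilon> > 0" "\<And>b d. (\<And>i. i \<in> {1..p} \<Longrightarrow> norm (b i - z0 * y i) < \<epsilon>) \<Longrightarrow>
    (\<lambda>z. L1 (\<lambda>i. b i + z * d i)) field_differentiable at 0"
    by (rule analytic_at_line[OF _ L1(1)[OF y]]) auto
  have "(\<lambda>z. L1 (\<lambda>i. z0 * y i + z * y i)) field_differentiable at (z0 - z0)"
    using \<epsilon>(2)[of "\<lambda>i. z0 * y i" y] \<epsilon>(1) by simp
  moreover have "(\<lambda>z. z - z0) field_differentiable at z0" by (intro derivative_intros)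
  ultimately have "((\<lambda>z. L1 (\<lambda>i. z0 * y i + z * y i)) \<circ> (\<lambda>z. z - z0)) field_differentiable at z0"
    by (intro field_differentiable_compose)
  moreover have "(\<lambda>i. z0 * y i + (z - z0) * y i) = (\<lambda>i. z * y i)" for z
    by (simp add: fun_eq_iff algebra_simps)
  ultimately have "(\<lambda>z. L1 (\<lambda>i. z * y i)) field_differentiable at z0" by (simp add: o_def)
  then show ?thesis unfolding L0_def by (intro field_differentiable_diff field_differentiable_const)
qed

text \<open>F is positive on the ray, so L0 and the principal logarithm are both continuous
  logarithms of F there, and they agree at the origin.\<close>

lemma L0_ray:
  assumes t: "0 \<le> t" "t < 1"
  shows "L0 (\<lambda>i. of_real (t * r i)) = Ln (F (\<lambda>i. of_real (t * r i)))"
proof (rule log_unique[of "{0..<1}" "\<lambda>t. L0 (\<lambda>i. of_real (t * r i))" "\<lambda>t. Ln (F (\<lambda>i. of_real (t * r i)))" 0])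
  have cF: "((\<lambda>t. F (\<lambda>i. of_real (t * r i))) \<longlongrightarrow> F (\<lambda>i. of_real (x * r i))) (at x within {0..<1})" for x
    by (intro F_tendsto tendsto_intros)
  show "continuous_on {0..<1} (\<lambda>t. L0 (\<lambda>i. of_real (t * r i)))"
    unfolding continuous_on_def
  proof
    fix x :: real assume "x \<in> {0..<1}"
    then show "((\<lambda>t. L0 (\<lambda>i. of_real (t * r i))) \<longlongrightarrow> L0 (\<lambda>i. of_real (x * r i))) (at x within {0..<1})"
      by (intro L0_tendsto ray_polydisc tendsto_intros) auto
  qed
  show "continuous_on {0..<1} (\<lambda>t. Ln (F (\<lambda>i. of_real (t * r i))))"
    unfolding continuous_on_def
  proof
    fix x :: real assume x: "x \<in> {0..<1}"
    have "Re (F (\<lambda>i. of_real (x * r i))) > 0" using F_ray(2)[of x] x by auto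
    then show "((\<lambda>t. Ln (F (\<lambda>i. of_real (t * r i)))) \<longlongrightarrow> Ln (F (\<lambda>i. of_real (x * r i)))) (at x within {0..<1})"
      by (intro tendsto_Ln cF) (auto simp: complex_nonpos_Reals_iff)
  qed
  show "exp (L0 (\<lambda>i. of_real (x * r i))) = exp (Ln (F (\<lambda>i. of_real (x * r i))))" if "x \<in> {0..<1}" for x
    using exp_L0[OF ray_polydisc[of x]] F_nonzero[OF ray_polydisc[of x]] that by simp
  show "L0 (\<lambda>i. of_real (0 * r i)) = Ln (F (\<lambda>i. of_real (0 * r i)))"
    using F_fun_0[of p E] by (simp add: L0_def)
qed (use t in auto)

text \<open>Close to the corner both \<open>F / X\<close> and X have positive real part, so F avoids
  the cut of Ln. Shrinking \<theta> to 0 at fixed u joins the point to the ray, where the two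
  logarithms agree.\<close>

lemma L0_near: "eventually (\<lambda>t. L0 (Y (fst t) (snd t)) = Ln (F (Y (fst t) (snd t)))) (corner p)"
proof -
  have ap: "\<alpha> p > 0" using alpha_pos p_pos by auto
  let ?k = "a / \<alpha> p"
  have k: "?k > 0" using a_pos ap by simp
  have "((\<lambda>t. Re (F (Y (fst t) (snd t)) / X (fst t) (snd t))) \<longlongrightarrow> Re (of_real ?k)) (corner p)"
    using tendsto_Re[OF F_asymp] by (simp add: A_real)
  then have "eventually (\<lambda>t. Re (F (Y (fst t) (snd t)) / X (fst t) (snd t)) > 0) (corner p)"
    by (rule order_tendstoD) (use k in simp)
  then obtain d where d: "d > 0" "\<And>u \<theta>. 0 < u \<Longrightarrow> u < d \<Longrightarrow> (\<forall>i\<in>{1..p}. \<bar>\<theta> i\<bar> < d) \<Longrightarrow>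
      Re (F (Y u \<theta>) / X u \<theta>) > 0"
    unfolding eventually_corner fst_conv snd_conv by blast
  show ?thesis
    unfolding eventually_corner fst_conv snd_conv
  proof (intro exI[of _ d] conjI allI impI d(1))
    fix u \<theta> assume u: "0 < u" "u < d" and \<theta>: "\<forall>i\<in>{1..p}. \<bar>\<theta> i\<bar> < d"
    let ?y = "\<lambda>\<tau>. Y u (\<lambda>i. \<tau> * \<theta> i)"
    have nonpos: "F (?y \<tau>) \<notin> \<real>\<^sub>\<le>\<^sub>0" if \<tau>: "\<tau> \<in> {0..1}" for \<tau>
    proof
      assume "F (?y \<tau>) \<in> \<real>\<^sub>\<le>\<^sub>0"
      then obtain x where x: "F (?y \<tau>) = of_real x" "x \<le> 0" by (auto elim!: nonpos_Reals_cases)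
      let ?X = "X u (\<lambda>i. \<tau> * \<theta> i)"
      have "\<forall>i\<in>{1..p}. \<bar>\<tau> * \<theta> i\<bar> < d"
      proof
        fix i assume "i \<in> {1..p}"
        have "\<bar>\<tau> * \<theta> i\<bar> \<le> 1 * \<bar>\<theta> i\<bar>" unfolding abs_mult using \<tau> by (intro mult_right_mono) auto
        also have "\<dots> < d" using \<theta> \<open>i \<in> {1..p}\<close> by simp
        finally show "\<bar>\<tau> * \<theta> i\<bar> < d" .
      qed
      then have "Re (of_real x / ?X) > 0" using d(2)[OF u] x(1) by metis
      moreover have "Re (of_real x / ?X) = x * Re ?X / (norm ?X)\<^sup>2"
        by (simp add: Re_divide cmod_power2)
      moreover have "x * Re ?X / (norm ?X)\<^sup>2 \<le> 0"
        using x(2) Re_X_pos[OF u(1), of "\<lambda>i. \<tau> * \<theta> i"] by (intro divide_nonpos_nonneg mult_nonpos_nonneg) auto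
      ultimately show False by simp
    qed
    have "L0 (?y 1) = Ln (F (?y 1))"
    proof (rule log_unique[of "{0..1::real}" "\<lambda>\<tau>. L0 (?y \<tau>)" "\<lambda>\<tau>. Ln (F (?y \<tau>))" 0])
      have cY: "((\<lambda>\<tau>. ?y \<tau> i) \<longlongrightarrow> ?y x i) (at x within {0..1})" for x i
        unfolding Y_def by (intro tendsto_intros)
      show "continuous_on {0..1} (\<lambda>\<tau>. L0 (?y \<tau>))"
        unfolding continuous_on_def by (intro ballI L0_tendsto Y_polydisc u cY)
      show "continuous_on {0..1} (\<lambda>\<tau>. Ln (F (?y \<tau>)))"
        unfolding continuous_on_def by (intro ballI tendsto_Ln F_tendsto cY nonpos)
      show "exp (L0 (?y \<tau>)) = exp (Ln (F (?y \<tau>)))" for \<tau>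
        using exp_L0[OF Y_polydisc[OF u(1)]] F_nonzero[OF Y_polydisc[OF u(1)]] by simp
      have "?y 0 = (\<lambda>i. of_real (exp (- u) * r i))" using Y_ray[of u] by simp
      then show "L0 (?y 0) = Ln (F (?y 0))" using L0_ray[of "exp (- u)"] u by simp
    qed auto
    then show "L0 (Y u \<theta>) = Ln (F (Y u \<theta>))" by simp
  qed
qed

text \<open>Along the ray to the critical point \<open>F\<close> is positive, and the quotient of \<open>F y\<close> and
  \<open>1 - y p / h y\<close> tends to \<open>A\<close>.\<close>

lemma induced_power:
  assumes "induced_neg_power p F s r h G w"
  shows "w = of_real (a powr (- s))"
proof -
  let ?V = "at_right (0 :: real)" and ?Y = "\<lambda>u. Y u (\<lambda>_. 0)"
  let ?q = "\<lambda>u. 1 - ?Y u p / h (?Y u)"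
  have rp: "r p > 0" using r_pos p_pos by auto
  have lim: "((\<lambda>y. G y * (1 - y p / h y) powr of_real s) \<longlongrightarrow> w) (at rc within open_polydisc p r)"
    using assms by (simp add: induced_neg_power_def Let_def)
  have pos: "eventually (\<lambda>u. 0 < u) ?V" by (rule eventually_at_right_less)
  have "filterlim ?Y (at rc within open_polydisc p r) ?V"
    unfolding filterlim_at
  proof
    have "continuous_on UNIV ?Y"
      unfolding Y_def by (intro continuous_on_coordinatewise_then_product continuous_intros)
    then have "(?Y \<longlongrightarrow> ?Y 0) (at 0)" by (simp add: continuous_on_def)
    moreover have "?Y 0 = rc" by (simp add: Y_def fun_eq_iff)
    ultimately show "(?Y \<longlongrightarrow> rc) ?V" using filterlim_at_within_not_equal by (metis tendsto_within_subset subset_UNIV)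
    show "\<forall>\<^sub>F u in ?V. ?Y u \<in> open_polydisc p r \<and> ?Y u \<noteq> rc"
      using pos
    proof eventually_elim
      case (elim u)
      have "?Y u p \<noteq> rc p" using norm_Y[of p u "\<lambda>_. 0"] p_pos rp elim by auto
      then show ?case using Y_polydisc[OF elim] by metis
    qed
  qed
  from filterlim_compose[OF lim this]
  have lim': "((\<lambda>u. G (?Y u) * ?q u powr of_real s) \<longlongrightarrow> w) ?V" .
  have Yi: "((\<lambda>u. ?Y u i) \<longlongrightarrow> rc i) ?V" if "i \<in> {1..p}" for i
    using filterlim_compose[OF Y_tendsto[OF that] ray_corner] by simp
  have hY: "((\<lambda>u. h (?Y u)) \<longlongrightarrow> rc p) ?V"
    unfolding h_rc[symmetric] by (rule analytic_at_tendsto[OF _ h_analytic]) (auto intro: Yi)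
  let ?z = "\<lambda>u. h (?Y u) - ?Y u p"
  \<comment> \<open>The cofactor of \<open>1 - y p / h y\<close> in F; its limit is A.\<close>
  let ?M = "\<lambda>u. h (?Y u) * F_lead p E (?Y u) * exp (- h (?Y u)) * exp_quot (?z u)"
  have "(?z \<longlongrightarrow> rc p - rc p) ?V" by (intro tendsto_diff hY Yi) (use p_pos in simp)
  then have z0: "(?z \<longlongrightarrow> 0) ?V" by simp
  have "(?M \<longlongrightarrow> rc p * F_lead p E rc * exp (- rc p) * 1) ?V"
    by (intro tendsto_mult tendsto_exp tendsto_minus hY tendsto_exp_quot z0 F_lead_tendsto Yi) auto
  then have M: "(?M \<longlongrightarrow> of_real a) ?V"
    unfolding A_real[symmetric] by (simp add: A_def partial_deriv_F_last mult_ac)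
  obtain \<epsilon> where \<epsilon>: "\<epsilon> > 0" "\<And>y. (\<forall>i\<in>{1..<p}. norm (y i - rc i) < \<epsilon>) \<Longrightarrow> F (y(p := h y)) = 0"
    using F_h_eq_0 by blast
  have near: "eventually (\<lambda>u. \<forall>i\<in>{1..<p}. norm (?Y u i - rc i) < \<epsilon>) ?V"
  proof (subst eventually_ball_finite_distrib)
    show "\<forall>i\<in>{1..<p}. eventually (\<lambda>u. norm (?Y u i - rc i) < \<epsilon>) ?V"
      using Yi \<epsilon>(1) unfolding tendsto_iff dist_norm by auto
  qed simp
  have hnz: "eventually (\<lambda>u. h (?Y u) \<noteq> 0) ?V"
    using tendsto_imp_eventually_ne[OF hY, of 0] rp by simp
  have Mnz: "eventually (\<lambda>u. ?M u \<noteq> 0) ?V"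
    using tendsto_imp_eventually_ne[OF M, of 0] a_pos by simp
  have eq: "eventually (\<lambda>u. (1 / ?M u) powr of_real s = G (?Y u) * ?q u powr of_real s) ?V"
    using pos near hnz Mnz
  proof eventually_elim
    case (elim u)
    define f where "f = Re (F (?Y u))"
    have f: "F (?Y u) = of_real f" "f > 0"
      using F_ray[of "exp (- u)"] elim(1) by (simp_all add: f_def Y_ray)
    have "F_free p E (?Y u) + (exp (- h (?Y u)) - 1) * F_lead p E (?Y u) = 0"
      using \<epsilon>(2)[OF elim(2)] unfolding F_fun_split by simp
    then have "F (?Y u) = F_lead p E (?Y u) * (exp (- ?Y u p) - exp (- h (?Y u)))"
      unfolding F_fun_split by (simp add: algebra_simps eq_neg_iff_add_eq_0)
    also have "- ?Y u p = - h (?Y u) + ?z u" by simp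
    also have "exp (- h (?Y u) + ?z u) - exp (- h (?Y u)) = exp (- h (?Y u)) * (exp (?z u) - 1)"
      by (simp only: exp_add right_diff_distrib mult_1_right)
    also have "exp (?z u) - 1 = ?z u * exp_quot (?z u)" by (rule exp_quot_mult[symmetric])
    finally have "of_real f = ?z u * (F_lead p E (?Y u) * exp (- h (?Y u)) * exp_quot (?z u))"
      unfolding f(1) by (simp only: mult_ac)
    moreover have "?z u = ?q u * h (?Y u)" using elim(3) by (simp add: left_diff_distrib)
    ultimately have "of_real f = ?q u * h (?Y u) * (F_lead p E (?Y u) * exp (- h (?Y u)) * exp_quot (?z u))" by metis
    then have "of_real f = ?q u * ?M u" by (simp only: mult_ac)
    then have q: "?q u = of_real f * (1 / ?M u)" using nonzero_mult_div_cancel_right[OF elim(4)] by (simp only: times_divide_eq_right mult_1_right)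
    have "L0 (?Y u) = Ln (F (?Y u))" unfolding Y_ray using L0_ray[of "exp (- u)"] elim(1) by simp
    then have "L0 (?Y u) = of_real (ln f)" unfolding f(1) using f(2) by (simp add: Ln_of_real)
    then have "G (?Y u) = exp (- of_real s * of_real (ln f))"
      using G_L0[OF Y_polydisc[OF elim(1)]] by simp
    also have "\<dots> = of_real (f powr (- s))" using f(2) by (simp add: powr_def exp_of_real[symmetric])
    \<comment> \<open>The positive number f may be taken out of the principal power, and its power
      cancels against that in G.\<close>
    finally have "G (?Y u) * ?q u powr of_real s = of_real (f powr (- s)) * (of_real (f powr s) * (1 / ?M u) powr of_real s)"
      unfolding q using powr_of_real_mult_left[OF f(2), of "1 / ?M u" s] elim(4) by simp
    also have "\<dots> = of_real (f powr (- s) * f powr s) * (1 / ?M u) powr of_real s" by simp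
    also have "f powr (- s) * f powr s = 1" using f(2) by (simp add: powr_add[symmetric])
    finally show ?case by simp
  qed
  have "((\<lambda>u. (1 / ?M u) powr of_real s) \<longlongrightarrow> (1 / of_real a) powr of_real s) ?V"
    using a_pos by (intro tendsto_powr_complex tendsto_divide M tendsto_const) (auto simp: complex_nonpos_Reals_iff Re_divide_of_real)
  then have "((\<lambda>u. G (?Y u) * ?q u powr of_real s) \<longlongrightarrow> (1 / of_real a) powr of_real s) ?V"
    by (rule Lim_transform_eventually[OF _ eq])
  from tendsto_unique[OF _ lim' this] have "w = (1 / of_real a) powr of_real s" by simp
  also have "\<dots> = of_real ((1 / a) powr s)" using powr_of_real[of "1 / a" s] a_pos by simp
  also have "(1 / a) powr s = a powr (- s)" using a_pos by (simp add: powr_minus_divide powr_divide)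
  finally show ?thesis .
qed

text \<open>The Taylor coefficients of F to the power \<open>- s\<close>; the sign stems from
  substituting \<open>- y\<close> into B.\<close>

definition coef :: "(nat \<Rightarrow> nat) \<Rightarrow> complex" where
  "coef l = (-1) ^ (\<Sum>i\<in>{1..p}. l i) *
     of_real (poly (chromatic_poly (blowup_verts {1..p} l) (blowup_edges E l)) (- s)) / (\<Prod>i\<in>{1..p}. fact (l i))"

definition P :: "nat \<Rightarrow> (nat \<Rightarrow> complex) \<Rightarrow> complex" where
  "P M y = (\<Sum>l\<in>degs {1..p} M. coef l * (\<Prod>i\<in>{1..p}. y i ^ l i))"

lemma P_scale: "P M (\<lambda>i. z * y i) = z ^ M * P M y"
  unfolding P_def sum_distrib_left
proof (rule sum.cong[OF refl])
  fix l assume "l \<in> degs {1..p} M"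
  then have "(\<Prod>i\<in>{1..p}. z ^ l i) = z ^ M" by (simp add: degs_def power_sum[symmetric])
  then show "coef l * (\<Prod>i\<in>{1..p}. (z * y i) ^ l i) = z ^ M * (coef l * (\<Prod>i\<in>{1..p}. y i ^ l i))"
    by (simp add: power_mult_distrib prod.distrib)
qed

text \<open>Room beyond z = 1 on the line through y, so that series in z can be evaluated and
  differentiated at 1.\<close>

lemma polydisc_enlarge:
  assumes y: "y \<in> open_polydisc p r"
  obtains R where "R > 1" "\<And>z. norm z < R \<Longrightarrow> (\<lambda>i. z * y i) \<in> open_polydisc p r"
proof -
  have "\<forall>i\<in>{1..p}. eventually (\<lambda>R. R * norm (y i) < r i) (at_right (1 :: real))"
  proof
    fix i assume i: "i \<in> {1..p}"
    have "((\<lambda>R. R * norm (y i)) \<longlongrightarrow> 1 * norm (y i)) (at_right (1 :: real))" by (intro tendsto_intros)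
    then show "eventually (\<lambda>R. R * norm (y i) < r i) (at_right (1 :: real))"
      by (rule order_tendstoD) (use y i in \<open>simp add: open_polydisc_def\<close>)
  qed
  then have "eventually (\<lambda>R. \<forall>i\<in>{1..p}. R * norm (y i) < r i) (at_right (1 :: real))"
    by (subst eventually_ball_finite_distrib) auto
  then have "eventually (\<lambda>R. R > 1 \<and> (\<forall>i\<in>{1..p}. R * norm (y i) < r i)) (at_right (1 :: real))"
    using eventually_at_right_less[of "1 :: real"] by eventually_elim auto
  then obtain R where R: "R > 1" "\<forall>i\<in>{1..p}. R * norm (y i) < r i"
    using eventually_happens'[OF trivial_limit_at_right_real] by blast
  have "(\<lambda>i. z * y i) \<in> open_polydisc p r" if "norm z < R" for z
    unfolding open_polydisc_def
  proof (intro CollectI ballI)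
    fix i assume i: "i \<in> {1..p}"
    have "norm (z * y i) \<le> R * norm (y i)" unfolding norm_mult using that by (intro mult_right_mono) auto
    then show "norm (z * y i) < r i" using R(2) i by force
  qed
  then show ?thesis using that R(1) by blast
qed

text \<open>On the line through y, \<open>exp (- s * L0)\<close> solves
  \<open>\<phi>' * b = - s * b' * \<phi>\<close> with constant term 1, where b is the restriction of
  F; \<open>B_fps_real_power_nth\<close> identifies its coefficients.\<close>

lemma power_series:
  assumes R: "R > 0" "\<And>z. norm z < R \<Longrightarrow> (\<lambda>i. z * y i) \<in> open_polydisc p r"
  shows "(\<lambda>z. exp (- of_real s * L0 (\<lambda>i. z * y i))) holomorphic_on ball 0 R"
    and "(deriv ^^ M) (\<lambda>z. exp (- of_real s * L0 (\<lambda>i. z * y i))) 0 / fact M = P M y"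
proof -
  let ?\<phi> = "\<lambda>z. exp (- of_real s * L0 (\<lambda>i. z * y i))" and ?b = "\<lambda>z. F (\<lambda>i. z * y i)"
  let ?J = "{1..p}"
  have J: "finite ?J" by simp
  have E: "\<forall>e\<in>E. e \<subseteq> ?J \<and> card e = 2" using graph by (simp add: simple_graph_def)
  have L: "(\<lambda>z. L0 (\<lambda>i. z * y i)) holomorphic_on ball 0 R"
    unfolding holomorphic_on_def using L0_line R(2) by (auto intro: field_differentiable_at_within)
  then show hol: "?\<phi> holomorphic_on ball 0 R" by (intro holomorphic_intros)
  let ?f = "fps_expansion ?\<phi> 0" and ?B = "B_fps ?J E (\<lambda>i. - y i)"
  have f: "?\<phi> has_fps_expansion ?f" by (rule has_fps_expansion_fps_expansion[OF open_ball _ hol]) (use R in simp)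
  have B: "?b has_fps_expansion ?B"
  proof -
    have "?b = (\<lambda>z. \<Sum>I\<in>independent_sets ?J E. \<Prod>i\<in>I. (exp ((- y i) * z) - 1))"
      by (simp add: F_fun_def B_fun_def mult.commute fun_eq_iff)
    then show ?thesis unfolding B_fps_def by (simp only:) (intro fps_expansion_intros)
  qed
  have bexp: "?b z = exp (L0 (\<lambda>i. z * y i))" if "z \<in> ball 0 R" for z
    using exp_L0[OF R(2)] that by simp
  have "eventually (\<lambda>z. z \<in> ball 0 R) (nhds (0 :: complex))" using R(1) by (intro eventually_nhds_in_open) auto
  then have ode: "eventually (\<lambda>z. deriv ?\<phi> z * ?b z = (- of_real s) * deriv ?b z * ?\<phi> z) (nhds 0)"
  proof eventually_elim
    case (elim z)
    obtain l where l: "((\<lambda>z. L0 (\<lambda>i. z * y i)) has_field_derivative l) (at z)"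
      using L elim by (meson holomorphic_derivI open_ball)
    have d\<phi>: "deriv ?\<phi> z = exp (- of_real s * L0 (\<lambda>i. z * y i)) * (- of_real s * l)"
      by (rule DERIV_imp_deriv) (auto intro!: derivative_eq_intros l)
    have "((\<lambda>z. exp (L0 (\<lambda>i. z * y i))) has_field_derivative exp (L0 (\<lambda>i. z * y i)) * l) (at z)"
      by (auto intro!: derivative_eq_intros l)
    then have "(?b has_field_derivative exp (L0 (\<lambda>i. z * y i)) * l) (at z)"
      by (rule has_field_derivative_transform_within_open[OF _ open_ball elim]) (use bexp in simp)
    then have db: "deriv ?b z = exp (L0 (\<lambda>i. z * y i)) * l" by (rule DERIV_imp_deriv)
    show ?case unfolding d\<phi> db bexp[OF elim] by simp
  qed
  have e1: "(\<lambda>z. deriv ?\<phi> z * ?b z) has_fps_expansion fps_deriv ?f * ?B"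
    by (intro has_fps_expansion_mult has_fps_expansion_deriv f B)
  have e2: "(\<lambda>z. (- of_real s) * deriv ?b z * ?\<phi> z) has_fps_expansion fps_const (- of_real s) * fps_deriv ?B * ?f"
    by (intro has_fps_expansion_mult has_fps_expansion_cmult_left has_fps_expansion_deriv f B has_fps_expansion_const)
  have "(\<lambda>z. deriv ?\<phi> z * ?b z) has_fps_expansion fps_const (- of_real s) * fps_deriv ?B * ?f"
    using has_fps_expansion_cong[OF ode refl] e2 by blast
  with e1 have "fps_deriv ?f * ?B = fps_const (- of_real s) * fps_deriv ?B * ?f"
    by (rule fps_expansion_unique_complex)
  then have ODE: "fps_deriv ?f * ?B = fps_const (of_real (- s)) * fps_deriv ?B * ?f" by simp
  have "fps_nth ?f 0 = 1"
    using has_fps_expansion_imp_0_eq_fps_nth_0[OF f] by (simp add: L0_def)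
  from B_fps_real_power_nth[OF J E this ODE, of M]
  have "fps_nth ?f M = (\<Sum>l\<in>degs ?J M. of_real (poly (chromatic_poly (blowup_verts ?J l) (blowup_edges E l)) (- s)) *
      (\<Prod>i\<in>?J. (- y i) ^ l i / fact (l i)))" .
  also have "\<dots> = P M y"
    unfolding P_def
  proof (intro sum.cong refl)
    fix l
    have "(\<Prod>i\<in>?J. (- y i) ^ l i / fact (l i)) = (\<Prod>i\<in>?J. (-1) ^ l i * y i ^ l i / fact (l i))"
      by (intro prod.cong refl) (simp add: power_minus[of "y _"])
    also have "\<dots> = (-1) ^ (\<Sum>i\<in>?J. l i) * (\<Prod>i\<in>?J. y i ^ l i) / (\<Prod>i\<in>?J. fact (l i))"
      by (simp add: prod_dividef prod.distrib power_sum)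
    finally show "of_real (poly (chromatic_poly (blowup_verts ?J l) (blowup_edges E l)) (- s)) *
      (\<Prod>i\<in>?J. (- y i) ^ l i / fact (l i)) = coef l * (\<Prod>i\<in>?J. y i ^ l i)"
      by (simp add: coef_def mult_ac)
  qed
  finally show "(deriv ^^ M) ?\<phi> 0 / fact M = P M y" by (simp add: fps_expansion_def)
qed

lemma power_series_sums:
  assumes y: "y \<in> open_polydisc p r"
  shows "(\<lambda>M. P M y) sums exp (- of_real s * L0 y)"
proof -
  obtain R where R: "R > 1" "\<And>z. norm z < R \<Longrightarrow> (\<lambda>i. z * y i) \<in> open_polydisc p r"
    using polydisc_enlarge[OF y] by blast
  have "R > 0" using R(1) by simp
  note S = power_series[of R y, OF this R(2)]
  have "(\<lambda>M. (deriv ^^ M) (\<lambda>z. exp (- of_real s * L0 (\<lambda>i. z * y i))) 0 / fact M * (1 - 0) ^ M) sums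
      exp (- of_real s * L0 (\<lambda>i. 1 * y i))"
    by (rule holomorphic_power_series[OF S(1)]) (use R(1) in auto)
  then have "(\<lambda>M. P M y * (1 - 0) ^ M) sums exp (- of_real s * L0 (\<lambda>i. 1 * y i))" by (simp only: S(2))
  then show ?thesis by simp
qed

text \<open>The Euler operator multiplies the \<open>M\<close>-th homogeneous component by \<open>M\<close> and raises the
  exponent of the singularity by 1, so that after sufficiently many applications the Fourier
  integral of the coefficients converges absolutely.\<close>

lemma euler_power_series:
  "\<exists>W. exp_poly {1..p} W \<and> W rc = of_real (pochhammer s k * (a / \<alpha> p) ^ k) \<and>
    (\<forall>y\<in>open_polydisc p r. (\<lambda>M. of_nat M ^ k * P M y) sums (exp (- of_real (s + real k) * L0 y) * W y))"
proof (induction k)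
  case 0
  show ?case by (intro exI[of _ "\<lambda>_. 1"]) (use power_series_sums in \<open>auto intro: exp_poly.intros\<close>)
next
  case (Suc k)
  let ?S = "complex_of_real (s + real k)"
  obtain W where W: "exp_poly {1..p} W" "W rc = of_real (pochhammer s k * (a / \<alpha> p) ^ k)"
    "\<And>y. y \<in> open_polydisc p r \<Longrightarrow> (\<lambda>M. of_nat M ^ k * P M y) sums (exp (- ?S * L0 y) * W y)"
    using Suc.IH by blast
  obtain W' where W': "exp_poly {1..p} W'" "\<And>y. ((\<lambda>z. W (\<lambda>i. z * y i)) has_field_derivative W' y) (at 1)"
    using exp_poly_euler[OF W(1)] by blast
  obtain D where D: "exp_poly {1..p} D" "\<And>y. ((\<lambda>z. F (\<lambda>i. z * y i)) has_field_derivative D y) (at 1)"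
    using exp_poly_euler[OF exp_poly_F] by blast
  \<comment> \<open>The Euler operator applied to \<open>exp (- ?S * L0) * W\<close>, with a factor
    \<open>1 / F\<close> taken out. At r the first summand vanishes and the second multiplies the
    value by \<open>?S * a / \<alpha> p\<close>, which builds up the Pochhammer symbol.\<close>
  let ?V = "\<lambda>y. F y * W' y + (- ?S) * D y * W y"
  have "exp_poly {1..p} ?V" by (intro exp_poly.intros exp_poly_F W W' D)
  moreover have "?V rc = of_real (pochhammer s (Suc k) * (a / \<alpha> p) ^ Suc k)"
    unfolding euler_F[OF D(2)] W(2) zero pochhammer_Suc
    by (simp only: mult_zero_left add_0_left minus_mult_minus of_real_mult power_Suc mult_ac)
  moreover have "(\<lambda>M. of_nat M ^ Suc k * P M y) sums (exp (- of_real (s + real (Suc k)) * L0 y) * ?V y)"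
    if y: "y \<in> open_polydisc p r" for y
  proof -
    obtain R where R: "R > 1" "\<And>z. norm z < R \<Longrightarrow> (\<lambda>i. z * y i) \<in> open_polydisc p r"
      using polydisc_enlarge[OF y] by blast
    let ?c = "\<lambda>M. of_nat M ^ k * P M y"
    let ?g = "\<lambda>z. exp (- ?S * L0 (\<lambda>i. z * y i)) * W (\<lambda>i. z * y i)"
    have sums: "(\<lambda>M. ?c M * z ^ M) sums ?g z" if "norm z < R" for z
      using W(3)[OF R(2)[OF that]] by (simp add: P_scale mult_ac)
    have sm: "summable (\<lambda>M. ?c M * z ^ M)" if "norm z < R" for z
      using sums_summable[OF sums[OF that]] .
    have 1: "norm (1 :: complex) < R" using R(1) by simp
    have "((\<lambda>z. \<Sum>M. ?c M * z ^ M) has_field_derivative (\<Sum>M. diffs ?c M * 1 ^ M)) (at 1)"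
      by (rule termdiffs_strong'[OF sm 1])
    then have g1: "(?g has_field_derivative (\<Sum>M. diffs ?c M * 1 ^ M)) (at 1)"
    proof (rule has_field_derivative_transform_within_open[OF _ open_ball])
      show "1 \<in> ball (0 :: complex) R" using 1 by simp
      fix z :: complex assume "z \<in> ball 0 R"
      then show "(\<Sum>M. ?c M * z ^ M) = ?g z" by (intro sums_unique[symmetric] sums) simp
    qed
    obtain l where l: "((\<lambda>z. L0 (\<lambda>i. z * y i)) has_field_derivative l) (at 1)"
      using L0_line[of 1 y] y by (auto simp: field_differentiable_def)
    have y1: "(\<lambda>i. 1 * y i) = y" by simp
    have "((\<lambda>z. exp (L0 (\<lambda>i. z * y i))) has_field_derivative F y * l) (at 1)"
      using exp_L0[OF y] by (auto intro!: derivative_eq_intros l)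
    then have "((\<lambda>z. F (\<lambda>i. z * y i)) has_field_derivative F y * l) (at 1)"
    proof (rule has_field_derivative_transform_within_open[OF _ open_ball])
      show "1 \<in> ball (0 :: complex) R" using 1 by simp
      show "exp (L0 (\<lambda>i. z * y i)) = F (\<lambda>i. z * y i)" if "z \<in> ball 0 R" for z
        using exp_L0[OF R(2)] that by simp
    qed
    then have Fl: "F y * l = D y" using D(2) by (rule DERIV_unique)
    have "((\<lambda>z. exp (- ?S * L0 (\<lambda>i. z * y i))) has_field_derivative exp (- ?S * L0 y) * (- ?S * l)) (at 1)"
      by (auto intro!: derivative_eq_intros l)
    from DERIV_mult[OF this W'(2)[of y]]
    have "(?g has_field_derivative exp (- ?S * L0 y) * (- ?S * l) * W y + W' y * exp (- ?S * L0 y)) (at 1)"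
      unfolding y1 .
    with g1 have "(\<Sum>M. diffs ?c M * 1 ^ M) = exp (- ?S * L0 y) * (- ?S * l) * W y + W' y * exp (- ?S * L0 y)"
      by (rule DERIV_unique)
    also have "\<dots> = exp (- of_real (s + real (Suc k)) * L0 y) * ?V y"
    proof -
      have "exp (- of_real (s + real (Suc k)) * L0 y) = exp (- ?S * L0 y) / F y"
        unfolding exp_L0[OF y, symmetric] exp_diff[symmetric] by (rule arg_cong[of _ _ exp]) (simp add: algebra_simps)
      then show ?thesis using F_nonzero[OF y] by (simp add: Fl[symmetric] field_simps)
    qed
    finally have "(\<Sum>M. diffs ?c M * 1 ^ M) = exp (- of_real (s + real (Suc k)) * L0 y) * ?V y" .
    moreover have "(\<lambda>M. of_nat M * ?c M * 1 ^ (M - Suc 0)) sums (\<Sum>M. diffs ?c M * 1 ^ M)"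
      by (rule diffs_equiv, rule termdiff_converges[OF 1 sm])
    ultimately show ?thesis by (simp add: mult.assoc)
  qed
  ultimately show ?case by blast
qed

text \<open>Cauchy's inequality on the unit circle of the line through \<open>Y u \<theta>\<close>:
  this circle keeps all moduli, so \<open>F_lower\<close> applies on it, uniformly in M and
  \<theta>.\<close>

lemma P_bound:
  assumes u: "0 < u" "u \<le> 1"
  obtains B where "\<And>\<theta> M. norm (P M (Y u \<theta>)) \<le> B"
proof -
  obtain c where c: "c > 0" "\<And>u \<theta>. 0 < u \<Longrightarrow> u \<le> 1 \<Longrightarrow> (\<And>i. i \<in> {1..p} \<Longrightarrow> \<bar>\<theta> i\<bar> \<le> pi) \<Longrightarrow>
    c * (u + \<bar>dir \<theta>\<bar> + (\<Sum>i\<in>{1..<p}. (\<theta> i)\<^sup>2)) \<le> norm (F (Y u \<theta>))"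
    by (rule F_lower) blast
  have lower: "c * u \<le> norm (F y)" if y: "\<And>i. i \<in> {1..p} \<Longrightarrow> norm (y i) = r i * exp (- u)" for y
  proof -
    \<comment> \<open>A point with these moduli is \<open>Y u \<theta>\<close> for its own arguments
      \<theta>.\<close>
    let ?\<theta> = "\<lambda>i. Arg (y i)"
    have "F y = F (Y u ?\<theta>)"
    proof (rule exp_poly_cong[OF exp_poly_F])
      fix i assume i: "i \<in> {1..p}"
      have "y i \<noteq> 0" using y[OF i] r_pos[OF i] by auto
      then have "y i = of_real (norm (y i)) * exp (\<i> * Arg (y i))" by (rule Arg_eq)
      also have "of_real (norm (y i)) = of_real (r i) * exp (- complex_of_real u)"
        unfolding y[OF i] by (simp add: exp_of_real[symmetric])
      finally show "y i = Y u ?\<theta> i" unfolding Y_def exp_add by (simp only: mult.assoc)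
    qed
    moreover have "c * (u + \<bar>dir ?\<theta>\<bar> + (\<Sum>i\<in>{1..<p}. (?\<theta> i)\<^sup>2)) \<le> norm (F (Y u ?\<theta>))"
    proof (rule c(2)[OF u])
      show "\<bar>Arg (y i)\<bar> \<le> pi" for i using Arg_le_pi[of "y i"] mpi_less_Arg[of "y i"] by linarith
    qed
    moreover have "c * u \<le> c * (u + \<bar>dir ?\<theta>\<bar> + (\<Sum>i\<in>{1..<p}. (?\<theta> i)\<^sup>2))"
      using c(1) by (intro mult_left_mono) (auto intro!: sum_nonneg add_nonneg_nonneg)
    ultimately show ?thesis by simp
  qed
  have "norm (P M (Y u \<theta>)) \<le> (c * u) powr (- s)" for \<theta> M
  proof -
    let ?y = "Y u \<theta>" and ?\<phi> = "\<lambda>z. exp (- of_real s * L0 (\<lambda>i. z * Y u \<theta> i))"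
    obtain R where R: "R > 1" "\<And>z. norm z < R \<Longrightarrow> (\<lambda>i. z * ?y i) \<in> open_polydisc p r"
      using polydisc_enlarge[OF Y_polydisc[OF u(1)]] by blast
    have "R > 0" using R(1) by simp
    note S = power_series[of R ?y, OF this R(2)]
    have sub: "cball 0 1 \<subseteq> ball (0 :: complex) R" using R(1) by auto
    have "norm ((deriv ^^ M) ?\<phi> 0) \<le> fact M * (c * u) powr (- s) / 1 ^ M"
    proof (rule Cauchy_inequality)
      show "?\<phi> holomorphic_on ball 0 1" using S(1) sub ball_subset_cball by (blast intro: holomorphic_on_subset)
      show "continuous_on (cball 0 1) ?\<phi>"
        using holomorphic_on_imp_continuous_on[OF S(1)] sub by (rule continuous_on_subset)
      fix z :: complex assume "norm (0 - z) = 1"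
      then have z: "norm z = 1" by simp
      let ?zy = "\<lambda>i. z * ?y i"
      have zy: "?zy \<in> open_polydisc p r" using R z by simp
      have "norm (?\<phi> z) = exp (- s * Re (L0 ?zy))" by (simp add: norm_exp_eq_Re)
      also have "\<dots> = norm (F ?zy) powr (- s)"
        unfolding exp_L0[OF zy, symmetric] by (simp add: norm_exp_eq_Re powr_def)
      also have "\<dots> \<le> (c * u) powr (- s)"
      proof (rule powr_mono2')
        show "0 < c * u" using c(1) u(1) by simp
        show "c * u \<le> norm (F ?zy)" by (rule lower) (simp add: norm_mult z norm_Y)
      qed (use s in simp)
      finally show "norm (?\<phi> z) \<le> (c * u) powr (- s)" .
    qed simp
    then have "norm ((deriv ^^ M) ?\<phi> 0 / fact M) \<le> (c * u) powr (- s)"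
      by (simp add: norm_divide divide_le_eq mult.commute)
    then show ?thesis by (simp only: S(2))
  qed
  then show ?thesis by (rule that)
qed

end

subsection \<open>Coefficients as Fourier integrals\<close>

lemma summable_power_times_geometric:
  fixes x :: real
  shows "\<bar>x\<bar> < 1 \<Longrightarrow> summable (\<lambda>m. real m ^ k * x ^ m)"
proof (induction k arbitrary: x)
  case 0
  then show ?case using summable_geometric[of x] by simp
next
  case (Suc k)
  have "summable (\<lambda>m. diffs (\<lambda>m. real m ^ k) m * x ^ m)"
    by (rule termdiff_converges[of x 1]) (use Suc in auto)
  then have "summable (\<lambda>m. diffs (\<lambda>m. real m ^ k) m * x ^ m * x)" by (rule summable_mult2)
  then have "summable (\<lambda>m. real (Suc m) ^ Suc k * x ^ Suc m)"
    by (simp add: diffs_def mult_ac)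
  then show ?case by (subst (asm) summable_Suc_iff)
qed

context critical_power
begin

lemma measurable_Y [measurable]: "i \<in> {1..p} \<Longrightarrow> (\<lambda>\<theta>. Y u \<theta> i) \<in> borel_measurable (lborel_power {1..p})"
proof -
  assume i: "i \<in> {1..p}"
  have "(\<lambda>\<theta>. \<theta> i) \<in> lborel_power {1..p} \<rightarrow>\<^sub>M (lborel :: real measure)"
    by (rule measurable_component_singleton[OF i])
  then have [measurable]: "(\<lambda>\<theta>. \<theta> i) \<in> borel_measurable (lborel_power {1..p})" by simp
  show ?thesis unfolding Y_def by measurable
qed

text \<open>Measurability is drawn from the series, a pointwise limit of polynomials in the
  coordinates of \<open>Y u \<theta>\<close>.\<close>

lemma measurable_power_series:
  assumes u: "u > 0"
    and sums: "\<And>y. y \<in> open_polydisc p r \<Longrightarrow> (\<lambda>M. of_nat M ^ k * P M y) sums Q y"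
  shows "(\<lambda>\<theta>. Q (Y u \<theta>)) \<in> borel_measurable (lborel_power {1..p})"
proof -
  have "(\<lambda>\<theta>. Q (Y u \<theta>)) = (\<lambda>\<theta>. \<Sum>M. of_nat M ^ k * P M (Y u \<theta>))"
    using sums_unique[OF sums[OF Y_polydisc[OF u]]] by (simp add: fun_eq_iff)
  also have "\<dots> \<in> borel_measurable (lborel_power {1..p})"
    unfolding P_def
    by (intro borel_measurable_suminf borel_measurable_times borel_measurable_const borel_measurable_sum
        borel_measurable_prod borel_measurable_power measurable_Y)
  finally show ?thesis .
qed

text \<open>Orthogonality of the characters of the torus, one coordinate at a time: only the
  multi-index l survives, and it occurs only in its own degree.\<close>

lemma integral_homogeneous_part:
  assumes l: "l \<in> degs {1..p} M0"
  shows "integrable (lborel_power {1..p}) (\<lambda>\<theta>. (\<Prod>i\<in>{1..p}. indicator {-pi..pi} (\<theta> i) :: real) *\<^sub>R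
      (P M (Y u \<theta>) * exp (- (\<i> * of_real (\<Sum>i\<in>{1..p}. real (l i) * \<theta> i)))))"
    and "(LINT \<theta>|lborel_power {1..p}. (\<Prod>i\<in>{1..p}. indicator {-pi..pi} (\<theta> i) :: real) *\<^sub>R
      (P M (Y u \<theta>) * exp (- (\<i> * of_real (\<Sum>i\<in>{1..p}. real (l i) * \<theta> i))))) =
      (if M = M0 then (2 * of_real pi) ^ p * coef l * (\<Prod>i\<in>{1..p}. of_real (r i * exp (- u)) ^ l i) else 0)"
proof -
  let ?J = "{1..p}"
  let ?M = "lborel_power ?J" and ?ind = "\<lambda>\<theta>. \<Prod>i\<in>?J. indicator {-pi..pi} (\<theta> i) :: real"
  let ?e = "\<lambda>\<theta>. exp (- (\<i> * of_real (\<Sum>i\<in>?J. real (l i) * \<theta> i)))"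
  let ?t = "\<lambda>l' i x. indicator {-pi..pi} x *\<^sub>R exp (\<i> * of_int (int (l' i) - int (l i)) * of_real x)"
  let ?c = "\<lambda>l'. coef l' * (\<Prod>i\<in>?J. of_real (r i * exp (- u)) ^ l' i)"
  have J: "finite ?J" by simp
  have t: "integrable lborel (?t l' i)" for l' i
    by (intro borel_integrable_compact continuous_intros) simp
  have tI: "integrable ?M (\<lambda>\<theta>. \<Prod>i\<in>?J. ?t l' i (\<theta> i))" for l'
    by (rule lborel_power.product_integrable_prod[OF J t])
  have tV: "(LINT \<theta>|?M. (\<Prod>i\<in>?J. ?t l' i (\<theta> i))) = (if l' = l then (2 * of_real pi) ^ p else 0)"
    if l': "l' \<in> degs ?J M" for l'
  proof -
    have "(LINT \<theta>|?M. (\<Prod>i\<in>?J. ?t l' i (\<theta> i))) = (\<Prod>i\<in>?J. LINT x|lborel. ?t l' i x)"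
      by (rule lborel_power.product_integral_prod[OF J t])
    also have "\<dots> = (\<Prod>i\<in>?J. if int (l' i) - int (l i) = 0 then 2 * of_real pi else 0)"
      by (simp only: integral_exp_ii_int)
    also have "\<dots> = (if l' = l then (2 * of_real pi) ^ p else 0)"
    proof (cases "l' = l")
      case False
      have "\<exists>i\<in>?J. l' i \<noteq> l i"
        using PiE_ext[of l' ?J "\<lambda>_. UNIV" l] l l' False unfolding degs_def by blast
      then show ?thesis using False J by (auto intro: prod_zero)
    qed simp
    finally show ?thesis .
  qed
  have factor: "complex_of_real (indicator {-pi..pi} (\<theta> i)) * (Y u \<theta> i ^ m * exp (- (\<i> * of_real (real k * \<theta> i)))) =
      of_real (r i * exp (- u)) ^ m * (indicator {-pi..pi} (\<theta> i) *\<^sub>R exp (\<i> * of_int (int m - int k) * of_real (\<theta> i)))" for \<theta> i m k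
  proof -
    have "Y u \<theta> i = of_real (r i * exp (- u)) * exp (\<i> * of_real (\<theta> i))"
      unfolding Y_def exp_add of_real_minus[symmetric] exp_of_real by simp
    then have "Y u \<theta> i ^ m = of_real (r i * exp (- u)) ^ m * exp (of_nat m * (\<i> * of_real (\<theta> i)))"
      by (simp only: power_mult_distrib exp_of_nat_mult)
    moreover have "exp (\<i> * of_int (int m - int k) * of_real (\<theta> i)) =
        exp (of_nat m * (\<i> * of_real (\<theta> i))) * exp (- (\<i> * of_real (real k * \<theta> i)))"
      unfolding exp_add[symmetric] by (rule arg_cong[of _ _ exp]) (simp add: algebra_simps)
    ultimately show ?thesis by (simp only: scaleR_conv_of_real mult_ac)
  qed
  have pt: "?ind \<theta> *\<^sub>R (P M (Y u \<theta>) * ?e \<theta>) = (\<Sum>l'\<in>degs ?J M. ?c l' * (\<Prod>i\<in>?J. ?t l' i (\<theta> i)))" for \<theta>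
    unfolding P_def sum_distrib_right scaleR_sum_right
  proof (rule sum.cong[OF refl])
    fix l'
    have e: "?e \<theta> = (\<Prod>i\<in>?J. exp (- (\<i> * of_real (real (l i) * \<theta> i))))"
      by (simp add: exp_sum[symmetric] sum_distrib_left sum_negf)
    have "?ind \<theta> *\<^sub>R (coef l' * (\<Prod>i\<in>?J. Y u \<theta> i ^ l' i) * ?e \<theta>) =
        coef l' * (\<Prod>i\<in>?J. complex_of_real (indicator {-pi..pi} (\<theta> i)) * (Y u \<theta> i ^ l' i * exp (- (\<i> * of_real (real (l i) * \<theta> i)))))"
      unfolding e prod.distrib scaleR_conv_of_real of_real_prod by (simp only: mult_ac)
    also have "\<dots> = ?c l' * (\<Prod>i\<in>?J. ?t l' i (\<theta> i))"
      unfolding factor prod.distrib by (simp only: mult.assoc)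
    finally show "?ind \<theta> *\<^sub>R (coef l' * (\<Prod>i\<in>?J. Y u \<theta> i ^ l' i) * ?e \<theta>) = ?c l' * (\<Prod>i\<in>?J. ?t l' i (\<theta> i))" .
  qed
  show "integrable ?M (\<lambda>\<theta>. ?ind \<theta> *\<^sub>R (P M (Y u \<theta>) * ?e \<theta>))"
    unfolding pt by (intro Bochner_Integration.integrable_sum integrable_mult_right tI)
  have "(LINT \<theta>|?M. ?ind \<theta> *\<^sub>R (P M (Y u \<theta>) * ?e \<theta>)) =
      (\<Sum>l'\<in>degs ?J M. LINT \<theta>|?M. ?c l' * (\<Prod>i\<in>?J. ?t l' i (\<theta> i)))"
    unfolding pt by (rule Bochner_Integration.integral_sum) (intro integrable_mult_right tI)
  also have "\<dots> = (\<Sum>l'\<in>degs ?J M. if l' = l then ?c l * (2 * of_real pi) ^ p else 0)"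
  proof (rule sum.cong[OF refl])
    fix l' assume l': "l' \<in> degs ?J M"
    have "(LINT \<theta>|?M. ?c l' * (\<Prod>i\<in>?J. ?t l' i (\<theta> i))) = ?c l' * (LINT \<theta>|?M. (\<Prod>i\<in>?J. ?t l' i (\<theta> i)))"
      by (rule integral_mult_right_zero)
    also have "\<dots> = (if l' = l then ?c l * (2 * of_real pi) ^ p else 0)"
      unfolding tV[OF l'] by (cases "l' = l") (simp_all only: if_True if_False mult_zero_right simp_thms)
    finally show "(LINT \<theta>|?M. ?c l' * (\<Prod>i\<in>?J. ?t l' i (\<theta> i))) = (if l' = l then ?c l * (2 * of_real pi) ^ p else 0)" .
  qed
  also have "\<dots> = (if l \<in> degs ?J M then ?c l * (2 * of_real pi) ^ p else 0)"
    by (rule sum.delta) (rule finite_degs[OF J])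
  also have "l \<in> degs ?J M \<longleftrightarrow> M = M0" using l by (auto simp: degs_def)
  finally show "(LINT \<theta>|?M. ?ind \<theta> *\<^sub>R (P M (Y u \<theta>) * ?e \<theta>)) =
      (if M = M0 then (2 * of_real pi) ^ p * coef l * (\<Prod>i\<in>?J. of_real (r i * exp (- u)) ^ l i) else 0)"
    by (simp only: mult_ac)
qed

text \<open>Integration term by term rests on geometric decay in M, obtained by comparing the torus
  at u with the larger one at u / 2.\<close>

lemma coefficient_integral:
  assumes u: "0 < u" "u \<le> 1" and l: "l \<in> degs {1..p} M0"
    and sums: "\<And>y. y \<in> open_polydisc p r \<Longrightarrow> (\<lambda>M. of_nat M ^ k * P M y) sums Q y"
  shows "(LINT \<theta>|lborel_power {1..p}. (\<Prod>i\<in>{1..p}. indicator {-pi..pi} (\<theta> i) :: real) *\<^sub>R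
      (Q (Y u \<theta>) * exp (- (\<i> * of_real (\<Sum>i\<in>{1..p}. real (l i) * \<theta> i))))) =
      of_nat M0 ^ k * ((2 * of_real pi) ^ p * coef l * (\<Prod>i\<in>{1..p}. of_real (r i * exp (- u)) ^ l i))"
proof -
  let ?J = "{1..p}"
  let ?M = "lborel_power ?J" and ?ind = "\<lambda>\<theta>. \<Prod>i\<in>?J. indicator {-pi..pi} (\<theta> i) :: real"
  let ?e = "\<lambda>\<theta>. exp (- (\<i> * of_real (\<Sum>i\<in>?J. real (l i) * \<theta> i)))"
  let ?V = "(2 * of_real pi) ^ p * coef l * (\<Prod>i\<in>?J. complex_of_real (r i * exp (- u)) ^ l i)"
  let ?f = "\<lambda>M \<theta>. of_nat M ^ k * (?ind \<theta> *\<^sub>R (P M (Y u \<theta>) * ?e \<theta>))"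
  have J: "finite ?J" by simp
  obtain B where B: "\<And>\<theta> M. norm (P M (Y (u / 2) \<theta>)) \<le> B" by (rule P_bound[of "u / 2"]) (use u in auto)
  let ?x = "exp (- u / 2)"
  have x: "\<bar>?x\<bar> < 1" using u by simp
  note S = summable_power_times_geometric[OF x, of k]
  have Pb: "norm (P M (Y u \<theta>)) \<le> ?x ^ M * B" for M \<theta>
  proof -
    have "Y u \<theta> = (\<lambda>i. of_real ?x * Y (u / 2) \<theta> i)"
    proof
      fix i
      have "complex_of_real ?x * exp (- of_real (u / 2) + \<i> * of_real (\<theta> i)) = exp (- of_real u + \<i> * of_real (\<theta> i))"
        unfolding exp_of_real[symmetric] exp_add[symmetric] by (rule arg_cong[of _ _ exp]) (simp add: field_simps)
      then show "Y u \<theta> i = of_real ?x * Y (u / 2) \<theta> i" unfolding Y_def by (simp only: mult_ac)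
    qed
    then have "norm (P M (Y u \<theta>)) = ?x ^ M * norm (P M (Y (u / 2) \<theta>))"
      by (simp only: P_scale norm_mult norm_power norm_of_real abs_exp_cancel)
    also have "\<dots> \<le> ?x ^ M * B" by (intro mult_left_mono B) simp
    finally show ?thesis .
  qed
  have ind: "?ind \<theta> \<ge> 0" "?ind \<theta> \<le> 1" for \<theta> by (auto intro!: prod_nonneg prod_le_1)
  have e: "norm (?e \<theta>) = 1" for \<theta> by (simp add: norm_exp_eq_Re)
  have fb: "norm (?f M \<theta>) \<le> real M ^ k * ?x ^ M * B * ?ind \<theta>" for M \<theta>
  proof -
    have "norm (?f M \<theta>) = real M ^ k * (?ind \<theta> * norm (P M (Y u \<theta>)))"
      using ind(1)[of \<theta>] by (simp only: norm_mult norm_scaleR norm_power norm_of_nat e mult_1_right abs_of_nonneg)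
    also have "\<dots> \<le> real M ^ k * (?ind \<theta> * (?x ^ M * B))"
      by (intro mult_left_mono Pb ind) auto
    finally show ?thesis by (simp only: mult_ac)
  qed
  have indI: "integrable ?M ?ind" by (intro lborel_power.product_integrable_prod J) auto
  have fI: "integrable ?M (?f M)" for M
    by (intro integrable_mult_right integral_homogeneous_part(1)[OF l])
  have "(LINT \<theta>|?M. (\<Sum>M. ?f M \<theta>)) = (\<Sum>M. LINT \<theta>|?M. ?f M \<theta>)"
  proof (rule integral_suminf[OF fI])
    show "AE \<theta> in ?M. summable (\<lambda>M. norm (?f M \<theta>))"
    proof (rule AE_I2, rule summable_comparison_test'[where N = 0])
      fix \<theta>
      show "summable (\<lambda>M. real M ^ k * ?x ^ M * B * ?ind \<theta>)" by (intro summable_mult2 S)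
      show "norm (norm (?f M \<theta>)) \<le> real M ^ k * ?x ^ M * B * ?ind \<theta>" for M
        unfolding real_norm_def abs_norm_cancel by (rule fb)
    qed
    show "summable (\<lambda>M. LINT \<theta>|?M. norm (?f M \<theta>))"
    proof (rule summable_comparison_test'[where N = 0])
      show "summable (\<lambda>M. real M ^ k * ?x ^ M * B * (LINT \<theta>|?M. ?ind \<theta>))" by (intro summable_mult2 S)
      fix M
      have "(LINT \<theta>|?M. norm (?f M \<theta>)) \<le> (LINT \<theta>|?M. real M ^ k * ?x ^ M * B * ?ind \<theta>)"
        by (intro integral_mono integrable_norm fI integrable_mult_right indI fb)
      then have "(LINT \<theta>|?M. norm (?f M \<theta>)) \<le> real M ^ k * ?x ^ M * B * (LINT \<theta>|?M. ?ind \<theta>)" by simp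
      moreover have "(LINT \<theta>|?M. norm (?f M \<theta>)) \<ge> 0" by (intro integral_nonneg_AE AE_I2 norm_ge_zero)
      ultimately show "norm (LINT \<theta>|?M. norm (?f M \<theta>)) \<le> real M ^ k * ?x ^ M * B * (LINT \<theta>|?M. ?ind \<theta>)" by simp
    qed
  qed
  also have "(\<lambda>\<theta>. \<Sum>M. ?f M \<theta>) = (\<lambda>\<theta>. ?ind \<theta> *\<^sub>R (Q (Y u \<theta>) * ?e \<theta>))"
  proof
    fix \<theta>
    have eq: "?f M \<theta> = of_real (?ind \<theta>) * (of_nat M ^ k * P M (Y u \<theta>) * ?e \<theta>)" for M
      unfolding scaleR_conv_of_real by (simp only: mult_ac)
    have "(\<lambda>M. ?f M \<theta>) sums (of_real (?ind \<theta>) * (Q (Y u \<theta>) * ?e \<theta>))"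
      unfolding eq by (intro sums_mult sums_mult2 sums Y_polydisc u)
    then have "(\<lambda>M. ?f M \<theta>) sums (?ind \<theta> *\<^sub>R (Q (Y u \<theta>) * ?e \<theta>))"
      by (simp only: scaleR_conv_of_real)
    then show "(\<Sum>M. ?f M \<theta>) = ?ind \<theta> *\<^sub>R (Q (Y u \<theta>) * ?e \<theta>)" by (rule sums_unique[symmetric])
  qed
  also have "(\<lambda>M. LINT \<theta>|?M. ?f M \<theta>) = (\<lambda>M. if M = M0 then of_nat M ^ k * ?V else 0)"
  proof
    fix M
    have "(LINT \<theta>|?M. ?f M \<theta>) = of_nat M ^ k * (LINT \<theta>|?M. ?ind \<theta> *\<^sub>R (P M (Y u \<theta>) * ?e \<theta>))" by (rule integral_mult_right_zero)
    then show "(LINT \<theta>|?M. ?f M \<theta>) = (if M = M0 then of_nat M ^ k * ?V else 0)"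
      unfolding integral_homogeneous_part(2)[OF l] by (simp only: if_distrib[of "\<lambda>x. _ * x"] mult_zero_right)
  qed
  also have "(\<Sum>M. if M = M0 then of_nat M ^ k * ?V else 0) = of_nat M0 ^ k * ?V"
    using sums_unique[OF sums_single[of M0 "\<lambda>M. of_nat M ^ k * ?V"]] by simp
  finally show ?thesis .
qed

end

subsection \<open>Asymptotics of the coefficients\<close>

locale critical_sequence = critical_power +
  fixes \<delta> :: "nat \<Rightarrow> nat \<Rightarrow> real" and lam :: "nat \<Rightarrow> nat \<Rightarrow> nat"
  assumes lam: "\<And>N i. i \<in> {1..p} \<Longrightarrow> real (lam N i) = \<alpha> i * real N + \<delta> N i"
    and delta_bounded: "\<And>i. i \<in> {1..p} \<Longrightarrow> (\<lambda>N. \<delta> N i) \<in> O(\<lambda>_. 1)"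
    and delta_sum: "\<And>N. (\<Sum>i\<in>{1..p}. \<delta> N i) = 0"
begin

lemma alpha_p: "\<alpha> p > 0"
  using alpha_pos p_pos by auto

lemma sum_lam: "(\<Sum>i\<in>{1..p}. lam N i) = N"
proof -
  have "real (\<Sum>i\<in>{1..p}. lam N i) = (\<Sum>i\<in>{1..p}. \<alpha> i * real N + \<delta> N i)"
    unfolding of_nat_sum by (intro sum.cong refl lam)
  also have "\<dots> = real N"
    unfolding sum.distrib sum_distrib_right[symmetric] alpha_sum delta_sum by simp
  finally show ?thesis by (simp only: of_nat_eq_iff)
qed

lemma restrict_lam_degs: "restrict (lam N) {1..p} \<in> degs {1..p} N"
  using sum_lam[of N] by (simp add: degs_def)

text \<open>Needed because \<open>degs\<close> consists of extensional functions, while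
  \<open>lam N\<close> is arbitrary outside 1 to p.\<close>

lemma coef_restrict: "coef (restrict l {1..p}) = coef l"
proof -
  have v: "blowup_verts {1..p} (restrict l {1..p}) = blowup_verts {1..p} l"
    by (auto simp: blowup_verts_def)
  have "i \<in> {1..p} \<and> j \<in> {1..p}" if "{i, j} \<in> E" for i j
  proof -
    have "{i, j} \<subseteq> {1..p}" using graph that by (simp only: simple_graph_def)
    then show ?thesis by (simp only: insert_subset)
  qed
  then have "({i, j} \<in> E \<and> x < restrict l {1..p} i \<and> y < restrict l {1..p} j) \<longleftrightarrow> ({i, j} \<in> E \<and> x < l i \<and> y < l j)" for i j x y
    by (cases "{i, j} \<in> E") (simp_all only: restrict_apply' simp_thms)
  then have e: "blowup_edges E (restrict l {1..p}) = blowup_edges E l"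
    unfolding blowup_edges_def by (simp only:)
  have "(\<Sum>i\<in>{1..p}. restrict l {1..p} i) = (\<Sum>i\<in>{1..p}. l i)"
    "(\<Prod>i\<in>{1..p}. fact (restrict l {1..p} i)) = (\<Prod>i\<in>{1..p}. fact (l i) :: complex)"
    by (auto intro!: sum.cong prod.cong)
  then show ?thesis unfolding coef_def v e by (simp only:)
qed

lemma quad_form_nonneg: "quad_form n C \<phi> \<ge> 0"
proof -
  obtain c where c: "c > 0" "\<And>u \<theta>. u \<ge> 0 \<Longrightarrow> c * (u + (\<Sum>i\<in>{1..<p}. (\<theta> i)\<^sup>2)) \<le> Re (X u \<theta>)"
    by (rule X_lower) blast
  have "0 \<le> c * (0 + (\<Sum>i\<in>{1..<p}. (\<phi> i)\<^sup>2))"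
    using c(1) by (intro mult_nonneg_nonneg add_nonneg_nonneg sum_nonneg) auto
  also have "\<dots> \<le> Re (X 0 \<phi>)" by (rule c(2)) simp
  finally show ?thesis by (simp add: X_def)
qed

definition b :: "(nat \<Rightarrow> real) \<Rightarrow> real" where
  "b \<phi> = 1 + quad_form n C \<phi> / 2"

lemma b_ge_1: "b \<phi> \<ge> 1"
  using quad_form_nonneg[of \<phi>] by (simp add: b_def)

text \<open>The displacement of the last angle that cancels the transversal angles in
  \<open>dir\<close>.\<close>

definition shift :: "nat \<Rightarrow> (nat \<Rightarrow> real) \<Rightarrow> real" where
  "shift N \<phi> = - (\<Sum>i\<in>{1..<p}. \<alpha> i * \<phi> i) / (sqrt (real N) * \<alpha> p)"

text \<open>The scaling adapted to the singularity: of order \<open>1 / N\<close> along the direction \<open>\<alpha>\<close> and of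
  order \<open>1 / sqrt N\<close> in the transversal directions.\<close>

definition T :: "nat \<Rightarrow> (nat \<Rightarrow> real) \<Rightarrow> nat \<Rightarrow> real" where
  "T N = shear_map p {1..<p} (1 / sqrt (real N)) (1 / (real N * \<alpha> p)) (shift N)"

lemma insert_p: "insert p {1..<p} = {1..p}"
  using p_pos by auto

lemma T_less: "i \<in> {1..<p} \<Longrightarrow> T N \<phi> i = \<phi> i / sqrt (real N)"
  and T_p: "T N \<phi> p = shift N \<phi> + \<phi> p / (real N * \<alpha> p)"
  by (auto simp: T_def shear_map_def)

lemma dir_T:
  assumes "N \<ge> 1"
  shows "dir (T N \<phi>) = \<phi> p / real N"
proof -
  have "dir (T N \<phi>) = (\<Sum>i\<in>{1..<p}. \<alpha> i * T N \<phi> i) + \<alpha> p * T N \<phi> p"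
    unfolding dir_def by (rule sum_split_last)
  also have "(\<Sum>i\<in>{1..<p}. \<alpha> i * T N \<phi> i) = (\<Sum>i\<in>{1..<p}. \<alpha> i * \<phi> i) / sqrt (real N)"
    unfolding sum_divide_distrib by (intro sum.cong refl) (simp add: T_less)
  finally show ?thesis using assms alpha_p by (simp add: T_p shift_def field_simps)
qed

lemma sum_squares_T: "(\<Sum>i\<in>{1..<p}. (T N \<phi> i)\<^sup>2) = (\<Sum>i\<in>{1..<p}. (\<phi> i)\<^sup>2) / real N"
  unfolding sum_divide_distrib by (intro sum.cong refl) (simp add: T_less power_divide)

lemma quad_form_T: "quad_form n C (T N \<phi>) = quad_form n C \<phi> / real N"
  unfolding quad_form_def sum_divide_distrib
proof (intro sum.cong refl)
  fix i j assume "i \<in> {..<n}" "j \<in> {..<n}"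
  then show "C i j * T N \<phi> (Suc i) * T N \<phi> (Suc j) = C i j * \<phi> (Suc i) * \<phi> (Suc j) / real N"
    using Suc_less_p(1)[of i] Suc_less_p(1)[of j] by (simp add: T_less)
qed

text \<open>Every term of the model scales like 1 / N, which is the purpose of this scaling and of u
  = 1 / N.\<close>

lemma X_T:
  assumes "N \<ge> 1"
  shows "X (1 / real N) (T N \<phi>) = (of_real (b \<phi>) - \<i> * of_real (\<phi> p)) / of_nat N"
  unfolding X_def quad_form_T dir_T[OF assms] b_def using assms by (simp add: field_simps)

lemma T_tendsto: "i \<in> {1..p} \<Longrightarrow> (\<lambda>N. T N \<phi> i) \<longlonglongrightarrow> 0"
proof -
  assume i: "i \<in> {1..p}"
  have s: "(\<lambda>N. 1 / sqrt (real N)) \<longlonglongrightarrow> 0" by real_asymp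
  show ?thesis
  proof (cases "i = p")
    case True
    have "(\<lambda>N. (- (\<Sum>i\<in>{1..<p}. \<alpha> i * \<phi> i) / \<alpha> p) * (1 / sqrt (real N)) + (\<phi> p / \<alpha> p) * (1 / real N)) \<longlonglongrightarrow>
        (- (\<Sum>i\<in>{1..<p}. \<alpha> i * \<phi> i) / \<alpha> p) * 0 + (\<phi> p / \<alpha> p) * 0"
      by (intro tendsto_intros s lim_1_over_n)
    moreover have "T N \<phi> i = (- (\<Sum>i\<in>{1..<p}. \<alpha> i * \<phi> i) / \<alpha> p) * (1 / sqrt (real N)) + (\<phi> p / \<alpha> p) * (1 / real N)" for N
      unfolding True T_p shift_def by (simp add: mult.commute)
    ultimately show ?thesis by simp
  next
    case False
    then have T: "T N \<phi> i = \<phi> i * (1 / sqrt (real N))" for N using i by (simp add: T_less)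
    have "(\<lambda>N. \<phi> i * (1 / sqrt (real N))) \<longlonglongrightarrow> \<phi> i * 0" by (intro tendsto_intros s)
    then show ?thesis unfolding T by simp
  qed
qed

lemma T_small: "d > 0 \<Longrightarrow> eventually (\<lambda>N. \<forall>i\<in>{1..p}. \<bar>T N \<phi> i\<bar> < d) sequentially"
proof (subst eventually_ball_finite_distrib)
  assume "d > 0"
  then show "\<forall>i\<in>{1..p}. eventually (\<lambda>N. \<bar>T N \<phi> i\<bar> < d) sequentially"
    using T_tendsto[of _ \<phi>] unfolding tendsto_iff dist_real_def by auto
qed simp

lemma T_corner: "filterlim (\<lambda>N. (1 / real N, T N \<phi>)) (corner p) sequentially"
proof (rule filterlim_iff[THEN iffD2, rule_format])
  fix Q assume "eventually Q (corner p)"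
  then obtain d where d: "d > 0" "\<And>u \<theta>. 0 < u \<Longrightarrow> u < d \<Longrightarrow> (\<forall>i\<in>{1..p}. \<bar>\<theta> i\<bar> < d) \<Longrightarrow> Q (u, \<theta>)"
    unfolding eventually_corner by blast
  have "eventually (\<lambda>N. 1 / real N < d) sequentially"
    using lim_1_over_n by (rule order_tendstoD) (rule d(1))
  then show "eventually (\<lambda>N. Q (1 / real N, T N \<phi>)) sequentially"
    using T_small[OF d(1), of \<phi>] eventually_gt_at_top[of 0] by eventually_elim (rule d(2), auto)
qed

definition S :: real where "S = s + real (p + 1)"

definition indic :: "(nat \<Rightarrow> real) \<Rightarrow> real" where
  "indic \<theta> = (\<Prod>i\<in>{1..p}. indicator {-pi..pi} (\<theta> i))"

definition integrand :: "((nat \<Rightarrow> complex) \<Rightarrow> complex) \<Rightarrow> nat \<Rightarrow> (nat \<Rightarrow> real) \<Rightarrow> complex" where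
  "integrand W N \<theta> = indic \<theta> *\<^sub>R (exp (- of_real S * L0 (Y (1 / real N) \<theta>)) * W (Y (1 / real N) \<theta>) *
     exp (- (\<i> * of_real (\<Sum>i\<in>{1..p}. real (lam N i) * \<theta> i))))"

text \<open>The part of the phase proportional to N is \<open>N * dir\<close>, which equals
  \<open>\<phi> p\<close> exactly; the rest is a combination of angles tending to 0 with bounded
  coefficients \<delta>.\<close>

lemma phase_tendsto: "(\<lambda>N. \<Sum>i\<in>{1..p}. real (lam N i) * T N \<phi> i) \<longlonglongrightarrow> \<phi> p"
proof -
  have "(\<lambda>N. \<delta> N i * T N \<phi> i) \<longlonglongrightarrow> 0" if i: "i \<in> {1..p}" for i
  proof -
    obtain K where K: "eventually (\<lambda>N. norm (\<delta> N i) \<le> K * norm (1 :: real)) sequentially"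
      using landau_o.bigE[OF delta_bounded[OF i]] by blast
    show ?thesis
    proof (rule Lim_null_comparison)
      show "eventually (\<lambda>N. norm (\<delta> N i * T N \<phi> i) \<le> K * \<bar>T N \<phi> i\<bar>) sequentially"
        using K by eventually_elim (auto simp: abs_mult intro!: mult_right_mono)
      show "(\<lambda>N. K * \<bar>T N \<phi> i\<bar>) \<longlonglongrightarrow> 0"
        by (rule tendsto_mult_right_zero, rule tendsto_rabs_zero, rule T_tendsto[OF i])
    qed
  qed
  then have "(\<lambda>N. \<phi> p + (\<Sum>i\<in>{1..p}. \<delta> N i * T N \<phi> i)) \<longlonglongrightarrow> \<phi> p + (\<Sum>i\<in>{1..p}. 0)"
    by (intro tendsto_intros)
  moreover have "eventually (\<lambda>N. \<phi> p + (\<Sum>i\<in>{1..p}. \<delta> N i * T N \<phi> i) = (\<Sum>i\<in>{1..p}. real (lam N i) * T N \<phi> i)) sequentially"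
    using eventually_ge_at_top[of 1]
  proof eventually_elim
    case (elim N)
    have "(\<Sum>i\<in>{1..p}. real (lam N i) * T N \<phi> i) = (\<Sum>i\<in>{1..p}. real N * (\<alpha> i * T N \<phi> i) + \<delta> N i * T N \<phi> i)"
      by (intro sum.cong refl) (simp add: lam algebra_simps)
    also have "\<dots> = real N * dir (T N \<phi>) + (\<Sum>i\<in>{1..p}. \<delta> N i * T N \<phi> i)"
      unfolding sum.distrib dir_def sum_distrib_left ..
    finally show ?case using elim by (simp add: dir_T)
  qed
  ultimately show ?thesis by (simp add: filterlim_cong)
qed

text \<open>\<open>N * F\<close> tends to a positive multiple of
  \<open>b \<phi> - \<i> * \<phi> p\<close>, in the right half-plane, where principal powers are
  continuous. \<open>L0_near\<close> ensures that the branch in use is eventually the principal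
  one.\<close>

lemma integrand_tendsto:
  assumes W: "exp_poly {1..p} W"
  shows "(\<lambda>N. of_real (real N powr (- S)) * integrand W N (T N \<phi>)) \<longlonglongrightarrow>
    of_real ((a / \<alpha> p) powr (- S)) * W rc *
      (exp (- (\<i> * of_real (\<phi> p))) * (of_real (b \<phi>) - \<i> * of_real (\<phi> p)) powr (- of_real S))"
proof -
  let ?Y = "\<lambda>N. Y (1 / real N) (T N \<phi>)" and ?Z = "of_real (b \<phi>) - \<i> * of_real (\<phi> p)"
  have k: "a / \<alpha> p > 0" using a_pos alpha_p by simp
  have Z: "Re ?Z > 0" using b_ge_1[of \<phi>] by simp
  have "(\<lambda>N. F (?Y N) / X (1 / real N) (T N \<phi>)) \<longlonglongrightarrow> of_real (a / \<alpha> p)"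
    using filterlim_compose[OF F_asymp T_corner] by (simp add: A_real)
  then have "(\<lambda>N. F (?Y N) / X (1 / real N) (T N \<phi>) * ?Z) \<longlonglongrightarrow> of_real (a / \<alpha> p) * ?Z"
    by (rule tendsto_mult_right)
  moreover have "eventually (\<lambda>N. F (?Y N) / X (1 / real N) (T N \<phi>) * ?Z = of_real (real N) * F (?Y N)) sequentially"
    using eventually_ge_at_top[of 1]
  proof eventually_elim
    case (elim N)
    have "?Z \<noteq> 0" using Z by auto
    then show ?case unfolding X_T[OF elim] using elim by (simp add: field_simps)
  qed
  ultimately have NF: "(\<lambda>N. of_real (real N) * F (?Y N)) \<longlonglongrightarrow> of_real (a / \<alpha> p) * ?Z"
    by (rule Lim_transform_eventually)
  have "of_real (a / \<alpha> p) * ?Z \<notin> \<real>\<^sub>\<le>\<^sub>0"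
  proof -
    have "Re (of_real (a / \<alpha> p) * ?Z) = a / \<alpha> p * b \<phi>" by (simp del: of_real_divide)
    also have "\<dots> > 0" using k b_ge_1[of \<phi>] by (intro mult_pos_pos) auto
    finally show ?thesis by (auto simp only: complex_nonpos_Reals_iff)
  qed
  then have "(\<lambda>N. (of_real (real N) * F (?Y N)) powr (of_real (- S))) \<longlonglongrightarrow> (of_real (a / \<alpha> p) * ?Z) powr (of_real (- S))"
    by (intro tendsto_powr_complex NF tendsto_const)
  also have "(of_real (a / \<alpha> p) * ?Z) powr (of_real (- S)) = of_real ((a / \<alpha> p) powr (- S)) * ?Z powr (of_real (- S))"
    by (rule powr_of_real_mult_left[OF k]) (use Z in auto)
  finally have lim: "(\<lambda>N. (of_real (real N) * F (?Y N)) powr (of_real (- S))) \<longlonglongrightarrow> \<dots>" .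
  have Wl: "(\<lambda>N. W (?Y N)) \<longlonglongrightarrow> W rc"
    by (rule exp_poly_tendsto[OF W]) (use filterlim_compose[OF Y_tendsto T_corner] in simp)
  have near: "eventually (\<lambda>N. L0 (?Y N) = Ln (F (?Y N))) sequentially"
    using eventually_compose_filterlim[OF L0_near T_corner] by simp
  have ph: "(\<lambda>N. exp (- (\<i> * of_real (\<Sum>i\<in>{1..p}. real (lam N i) * T N \<phi> i)))) \<longlonglongrightarrow> exp (- (\<i> * of_real (\<phi> p)))"
    by (intro tendsto_intros phase_tendsto)
  have "(\<lambda>N. (of_real (real N) * F (?Y N)) powr (of_real (- S)) * W (?Y N) *
      exp (- (\<i> * of_real (\<Sum>i\<in>{1..p}. real (lam N i) * T N \<phi> i)))) \<longlonglongrightarrow>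
      of_real ((a / \<alpha> p) powr (- S)) * ?Z powr (of_real (- S)) * W rc * exp (- (\<i> * of_real (\<phi> p)))"
    by (intro tendsto_mult lim Wl ph)
  moreover have "eventually (\<lambda>N. (of_real (real N) * F (?Y N)) powr (of_real (- S)) * W (?Y N) *
      exp (- (\<i> * of_real (\<Sum>i\<in>{1..p}. real (lam N i) * T N \<phi> i))) =
      of_real (real N powr (- S)) * integrand W N (T N \<phi>)) sequentially"
    using near T_small[OF pi_gt_zero, of \<phi>]
      eventually_gt_at_top[of 0]
  proof eventually_elim
    case (elim N)
    have u: "1 / real N > 0" using elim(3) by simp
    have "indic (T N \<phi>) = 1" unfolding indic_def
    proof (rule prod.neutral, rule ballI)
      fix i assume "i \<in> {1..p}"
      then have "\<bar>T N \<phi> i\<bar> < pi" using elim(2) by blast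
      then show "indicator {-pi..pi} (T N \<phi> i) = (1 :: real)" by (auto simp: indicator_def)
    qed
    moreover have "exp (- of_real S * L0 (?Y N)) = F (?Y N) powr of_real (- S)"
      using elim(1) F_nonzero[OF Y_polydisc[OF u]] by (simp add: powr_def)
    moreover have "(of_real (real N) * F (?Y N)) powr (of_real (- S)) = of_real (real N powr (- S)) * F (?Y N) powr of_real (- S)"
      by (rule powr_of_real_mult_left) (use elim(3) F_nonzero[OF Y_polydisc[OF u]] in auto)
    ultimately show ?case unfolding integrand_def by (simp only: scaleR_one mult.assoc)
  qed
  ultimately show ?thesis by (simp only: filterlim_cong of_real_minus mult_ac)
qed

text \<open>In the scaled variables \<open>F_lower\<close> bounds the modulus of F below by
  \<open>c * ?D / N\<close>, so the powers of N cancel and a bound in \<phi> alone remains.\<close>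

lemma integrand_bound:
  assumes W: "exp_poly {1..p} W"
  obtains K where "\<And>N \<phi>. N \<ge> 1 \<Longrightarrow> norm (of_real (real N powr (- S)) * integrand W N (T N \<phi>)) \<le>
    K * (\<Prod>i\<in>{1..p}. 1 / (1 + (\<phi> i)\<^sup>2))"
proof -
  obtain c where c: "c > 0" "\<And>u \<theta>. 0 < u \<Longrightarrow> u \<le> 1 \<Longrightarrow> (\<And>i. i \<in> {1..p} \<Longrightarrow> \<bar>\<theta> i\<bar> \<le> pi) \<Longrightarrow>
    c * (u + \<bar>dir \<theta>\<bar> + (\<Sum>i\<in>{1..<p}. (\<theta> i)\<^sup>2)) \<le> norm (F (Y u \<theta>))"
    by (rule F_lower) blast
  obtain K where K: "\<And>u \<theta>. 0 \<le> u \<Longrightarrow> u \<le> 1 \<Longrightarrow> (\<And>i. i \<in> {1..p} \<Longrightarrow> \<bar>\<theta> i\<bar> \<le> pi) \<Longrightarrow> norm (W (Y u \<theta>)) \<le> K"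
    using exp_poly_bounded[OF W] by blast
  have K0: "K \<ge> 0" using K[of 0 "\<lambda>_. 0"] order.trans[OF norm_ge_zero] by simp
  have S: "S > 0" using s by (simp add: S_def)
  have "norm (of_real (real N powr (- S)) * integrand W N (T N \<phi>)) \<le>
      c powr (- S) * K * (\<Prod>i\<in>{1..p}. 1 / (1 + (\<phi> i)\<^sup>2))" if N: "N \<ge> 1" for N \<phi>
  proof -
    let ?\<Pi> = "\<Prod>i\<in>{1..p}. 1 / (1 + (\<phi> i)\<^sup>2)"
    have \<Pi>: "?\<Pi> \<ge> 0" by (intro prod_nonneg) (auto intro: add_nonneg_nonneg)
    have u: "0 < 1 / real N" "1 / real N \<le> 1" using N by auto
    let ?y = "Y (1 / real N) (T N \<phi>)" and ?D = "1 + \<bar>\<phi> p\<bar> + (\<Sum>i\<in>{1..<p}. (\<phi> i)\<^sup>2)"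
    have D: "?D \<ge> 1" using sum_nonneg[of "{1..<p}" "\<lambda>i. (\<phi> i)\<^sup>2"] by simp
    show ?thesis
    proof (cases "\<forall>i\<in>{1..p}. \<bar>T N \<phi> i\<bar> \<le> pi")
      case False
      then obtain i where "i \<in> {1..p}" "\<not> \<bar>T N \<phi> i\<bar> \<le> pi" by blast
      moreover from this have "indicator {-pi..pi} (T N \<phi> i) = (0 :: real)" by (auto simp: indicator_def)
      ultimately have "indic (T N \<phi>) = 0" unfolding indic_def by (intro prod_zero bexI[of _ i]) auto
      then show ?thesis using K0 \<Pi> by (simp add: integrand_def)
    next
      case True
      have "indic (T N \<phi>) \<le> 1" "indic (T N \<phi>) \<ge> 0"
        unfolding indic_def by (auto intro!: prod_nonneg prod_le_1)
      then have ind: "\<bar>indic (T N \<phi>)\<bar> \<le> 1" by simp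
      have "real N powr (- S) * norm (exp (- of_real S * L0 ?y)) \<le> c powr (- S) * ?\<Pi>"
      proof -
        have "norm (exp (- of_real S * L0 ?y)) = norm (F ?y) powr (- S)"
          unfolding exp_L0[OF Y_polydisc[OF u(1)], symmetric] by (simp add: norm_exp_eq_Re powr_def)
        also have "\<dots> \<le> (c * (?D / real N)) powr (- S)"
        proof (rule powr_mono2')
          show "0 < c * (?D / real N)" using c(1) D N by (intro mult_pos_pos divide_pos_pos) auto
          have "1 / real N + \<bar>dir (T N \<phi>)\<bar> + (\<Sum>i\<in>{1..<p}. (T N \<phi> i)\<^sup>2) = ?D / real N"
            unfolding dir_T[OF N] sum_squares_T by (simp add: add_divide_distrib)
          then show "c * (?D / real N) \<le> norm (F ?y)"
            using c(2)[OF u, of "T N \<phi>"] True by simp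
        qed (use S in simp)
        also have "\<dots> = c powr (- S) * (?D powr (- S) / real N powr (- S))"
          using c(1) D by (simp only: powr_mult powr_divide)
        finally have "real N powr (- S) * norm (exp (- of_real S * L0 ?y)) \<le>
            real N powr (- S) * (c powr (- S) * (?D powr (- S) / real N powr (- S)))"
          by (intro mult_left_mono) auto
        also have "\<dots> = c powr (- S) * ?D powr (- S)" using N by simp
        also have "\<dots> \<le> c powr (- S) * ?\<Pi>"
        proof (intro mult_left_mono)
          \<comment> \<open>The surplus exponent p + 1 is spent as follows: two factors
            \<open>?D\<close> for \<open>1 + (\<phi> p)^2\<close>, as \<open>?D\<close> is only
            linear in \<open>\<phi> p\<close>, and one for each of the p - 1 other
            coordinates.\<close>
          have "?D powr (- S) \<le> ?D powr (- real (p + 1))"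
            by (rule powr_mono) (use D s in \<open>simp_all add: S_def\<close>)
          also have "\<dots> = 1 / ?D ^ (p + 1)"
            using D powr_realpow[of ?D "p + 1"] by (simp only: powr_minus_divide)
          also have "\<dots> \<le> 1 / (\<Prod>i\<in>{1..p}. 1 + (\<phi> i)\<^sup>2)"
          proof (rule divide_left_mono)
            have "(\<Prod>i\<in>{1..p}. 1 + (\<phi> i)\<^sup>2) = (1 + (\<phi> p)\<^sup>2) * (\<Prod>i\<in>{1..<p}. 1 + (\<phi> i)\<^sup>2)"
              unfolding insert_p[symmetric] by (rule prod.insert) auto
            also have "\<dots> \<le> ?D\<^sup>2 * (\<Prod>i\<in>{1..<p}. ?D)"
            proof (intro mult_mono prod_mono conjI)
              have "1 + (\<phi> p)\<^sup>2 \<le> (1 + \<bar>\<phi> p\<bar>)\<^sup>2" by (simp add: power2_sum)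
              also have "\<dots> \<le> ?D\<^sup>2" by (intro power_mono) (auto intro!: sum_nonneg)
              finally show "1 + (\<phi> p)\<^sup>2 \<le> ?D\<^sup>2" .
              fix i assume i: "i \<in> {1..<p}"
              have "(\<phi> i)\<^sup>2 \<le> (\<Sum>i\<in>{1..<p}. (\<phi> i)\<^sup>2)" by (rule member_le_sum[OF i]) auto
              then show "1 + (\<phi> i)\<^sup>2 \<le> ?D" by simp
            qed (auto intro!: prod_nonneg add_nonneg_nonneg)
            also have "\<dots> = ?D ^ (p + 1)"
            proof -
              have "p + 1 = 2 + card {1..<p}" using p_pos by simp
              then show ?thesis by (simp only: prod_constant power_add)
            qed
            finally show "(\<Prod>i\<in>{1..p}. 1 + (\<phi> i)\<^sup>2) \<le> ?D ^ (p + 1)" .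
            have "0 < (\<Prod>i\<in>{1..p}. 1 + (\<phi> i)\<^sup>2)" by (intro prod_pos ballI add_pos_nonneg) auto
            moreover have "0 < ?D ^ (p + 1)" using D by (intro zero_less_power) simp
            ultimately show "0 < ?D ^ (p + 1) * (\<Prod>i\<in>{1..p}. 1 + (\<phi> i)\<^sup>2)" by simp
          qed simp
          also have "\<dots> = ?\<Pi>" by (simp only: prod_dividef prod.neutral_const)
          finally show "?D powr (- S) \<le> ?\<Pi>" .
        qed simp
        finally show ?thesis .
      qed
      moreover have "norm (W ?y) \<le> K" by (rule K) (use u True in auto)
      moreover have "norm (of_real (real N powr (- S)) * integrand W N (T N \<phi>)) =
          \<bar>indic (T N \<phi>)\<bar> * ((real N powr (- S) * norm (exp (- of_real S * L0 ?y))) * norm (W ?y))"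
        by (simp add: integrand_def norm_mult norm_exp_eq_Re)
      moreover have "\<bar>indic (T N \<phi>)\<bar> * ((real N powr (- S) * norm (exp (- of_real S * L0 ?y))) * norm (W ?y)) \<le>
          1 * ((c powr (- S) * ?\<Pi>) * K)" if "norm (W ?y) \<le> K"
        "real N powr (- S) * norm (exp (- of_real S * L0 ?y)) \<le> c powr (- S) * ?\<Pi>"
        using \<Pi> K0 by (intro mult_mono that ind) auto
      ultimately show ?thesis by (simp only: mult_1 mult_ac)
    qed
  qed
  then show ?thesis by (rule that)
qed

end

section \<open>Passage to the limit and evaluation of the limit integral\<close>

context critical_sequence
begin

lemma measurable_coord: "i \<in> {1..p} \<Longrightarrow> (\<lambda>\<theta>. \<theta> i) \<in> borel_measurable (lborel_power {1..p})"
  using measurable_component_singleton[of i "{1..p}" "\<lambda>_. lborel :: real measure"] by simp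

lemma measurable_integrand:
  assumes sums: "\<And>y. y \<in> open_polydisc p r \<Longrightarrow> (\<lambda>M. of_nat M ^ k * P M y) sums (exp (- of_real S * L0 y) * W y)"
    and N: "N \<ge> 1"
  shows "integrand W N \<in> borel_measurable (lborel_power {1..p})"
proof -
  have "(\<lambda>\<theta>. exp (- of_real S * L0 (Y (1 / real N) \<theta>)) * W (Y (1 / real N) \<theta>)) \<in> borel_measurable (lborel_power {1..p})"
    by (rule measurable_power_series[of _ k, OF _ sums]) (use N in auto)
  moreover have "indic \<in> borel_measurable (lborel_power {1..p})"
  proof -
    have "(\<lambda>\<theta>. indicator {-pi..pi} (\<theta> i) :: real) \<in> borel_measurable (lborel_power {1..p})" if "i \<in> {1..p}" for i
      using measurable_compose[OF measurable_coord[OF that], of "indicator {-pi..pi}" borel] by simp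
    then show ?thesis unfolding indic_def by (intro borel_measurable_prod)
  qed
  moreover have "(\<lambda>\<theta>. exp (- (\<i> * of_real (\<Sum>i\<in>{1..p}. real (lam N i) * \<theta> i)))) \<in> borel_measurable (lborel_power {1..p})"
  proof -
    have "(\<lambda>\<theta>. \<Sum>i\<in>{1..p}. real (lam N i) * \<theta> i) \<in> borel_measurable (lborel_power {1..p})"
      by (intro borel_measurable_sum borel_measurable_times borel_measurable_const measurable_coord)
    then show ?thesis by measurable
  qed
  ultimately show ?thesis unfolding integrand_def by measurable
qed

lemma measurable_shift: "shift N \<in> borel_measurable (lborel_power (insert p {1..<p}))"
proof -
  have "(\<lambda>\<phi>. \<phi> i) \<in> borel_measurable (lborel_power (insert p {1..<p}))" if "i \<in> {1..<p}" for i
    unfolding insert_p by (rule measurable_coord) (use that in auto)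
  then have "(\<lambda>\<phi>. \<Sum>i\<in>{1..<p}. \<alpha> i * \<phi> i) \<in> borel_measurable (lborel_power (insert p {1..<p}))"
    by (intro borel_measurable_sum borel_measurable_times borel_measurable_const)
  then show ?thesis unfolding shift_def by measurable
qed

lemma shift_dep: "shift N (\<phi>(p := y)) = shift N \<phi>"
proof -
  have "(\<Sum>i\<in>{1..<p}. \<alpha> i * (\<phi>(p := y)) i) = (\<Sum>i\<in>{1..<p}. \<alpha> i * \<phi> i)"
    by (intro sum.cong refl) auto
  then show ?thesis unfolding shift_def by (simp only:)
qed

lemma integral_T:
  assumes "f \<in> borel_measurable (lborel_power {1..p})" "N \<ge> 1"
  shows "(LINT \<theta>|lborel_power {1..p}. f \<theta>) =
    of_real ((1 / sqrt (real N)) ^ n * (1 / (real N * \<alpha> p))) * (LINT \<phi>|lborel_power {1..p}. (f (T N \<phi>) :: complex))"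
proof -
  have "(LINT \<theta>|lborel_power (insert p {1..<p}). f \<theta>) =
    ((1 / sqrt (real N)) ^ card {1..<p} * (1 / (real N * \<alpha> p))) *\<^sub>R (LINT \<phi>|lborel_power (insert p {1..<p}). f (T N \<phi>))"
    unfolding T_def
    by (rule integral_shear_map) (use assms alpha_p measurable_shift shift_dep in \<open>auto simp: insert_p simp del: One_nat_def\<close>)
  moreover have "card {1..<p} = n" by (simp add: n_def)
  ultimately show ?thesis unfolding insert_p by (simp only: scaleR_conv_of_real)
qed

definition limit_fun :: "(nat \<Rightarrow> real) \<Rightarrow> complex" where
  "limit_fun \<phi> = exp (- (\<i> * of_real (\<phi> p))) * (of_real (b \<phi>) - \<i> * of_real (\<phi> p)) powr (- of_real S)"

definition D :: real where
  "D = Re (Determinant.det (hessian n \<Phi> rc))"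

lemma D_pos: "D > 0"
proof -
  have "0 < (\<Prod>i\<in>{1..<p}. r i)\<^sup>2 * D"
    using gaussian_integral(3)[OF C_pos_def] unfolding det_C D_def .
  then show ?thesis by (simp add: zero_less_mult_iff)
qed

text \<open>b does not involve the last variable, so the inner integral is the inverted Gamma
  density. Its factor \<open>exp (- b)\<close> splits into \<open>exp (- 1)\<close> and the Gaussian
  that the outer integral evaluates.\<close>

lemma integral_limit_fun:
  assumes "integrable (lborel_power {1..p}) limit_fun"
  shows "(LINT \<phi>|lborel_power {1..p}. limit_fun \<phi>) =
    of_real (2 * pi * exp (- 1) / Gamma S * ((2 * pi) powr (real n / 2) / ((\<Prod>i\<in>{1..<p}. r i) * sqrt D)))"
proof -
  have I: "finite {1..<p}" "p \<notin> {1..<p}" by auto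
  have S: "S \<ge> 2" using s p_pos by (simp add: S_def)
  have b: "b (x(p := y)) = b x" for x y
  proof -
    have "(x(p := y)) (Suc i) = x (Suc i)" if "i < n" for i
      using Suc_less_p(1)[OF that] by auto
    then show ?thesis unfolding b_def quad_form_def
      by (intro arg_cong2[of _ _ _ _ "(+)"] arg_cong2[of _ _ _ _ "(/)"] sum.cong refl) (simp only: lessThan_iff)
  qed
  have prod: "(\<Prod>i\<in>{1..<p}. r i) > 0" using r_pos by (intro prod_pos) auto
  have "(LINT \<phi>|lborel_power {1..p}. limit_fun \<phi>) = (LINT x|lborel_power {1..<p}. LINT y|lborel. limit_fun (x(p := y)))"
    using lborel_power.product_integral_insert[OF I, of limit_fun] assms unfolding insert_p by simp
  also have "\<dots> = (LINT x|lborel_power {1..<p}. of_real (2 * pi * exp (- 1) / Gamma S * exp (- quad_form n C x / 2)))"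
  proof (rule Bochner_Integration.integral_cong[OF refl])
    fix x
    have "(LINT y|lborel. limit_fun (x(p := y))) = 2 * of_real (pi * exp (- b x) / Gamma S)"
      unfolding limit_fun_def b fun_upd_same by (rule gamma_density_inversion[OF S b_ge_1])
    also have "\<dots> = of_real (2 * (pi * exp (- b x) / Gamma S))" by (simp only: of_real_mult of_real_numeral)
    also have "exp (- b x) = exp (- 1) * exp (- quad_form n C x / 2)"
      unfolding exp_add[symmetric] b_def by simp
    also have "2 * (pi * (exp (- 1) * exp (- quad_form n C x / 2)) / Gamma S) =
        2 * pi * exp (- 1) / Gamma S * exp (- quad_form n C x / 2)" by simp
    finally show "(LINT y|lborel. limit_fun (x(p := y))) = of_real (2 * pi * exp (- 1) / Gamma S * exp (- quad_form n C x / 2))" .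
  qed
  also have "\<dots> = of_real (2 * pi * exp (- 1) / Gamma S * (LINT x|lborel_power {1..<p}. exp (- quad_form n C x / 2)))"
    by (simp only: integral_complex_of_real integral_mult_right_zero)
  also have "{1..<p} = {1..<Suc n}" using p_pos by (simp add: n_def)
  also have "(LINT x|lborel_power {1..<Suc n}. exp (- quad_form n C x / 2)) =
      (2 * pi) powr (real n / 2) / ((\<Prod>i\<in>{1..<p}. r i) * sqrt D)"
    unfolding gaussian_integral(2)[OF C_pos_def] det_C D_def[symmetric] real_sqrt_mult using prod by simp
  finally show ?thesis .
qed

text \<open>Dominated convergence with the majorant of \<open>integrand_bound\<close>, which is
  valid from N = 1 on, whence the shift to \<open>Suc N\<close>.\<close>

lemma integral_integrand_tendsto:
  assumes W: "exp_poly {1..p} W"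
    and sums: "\<And>y. y \<in> open_polydisc p r \<Longrightarrow> (\<lambda>M. of_nat M ^ k * P M y) sums (exp (- of_real S * L0 y) * W y)"
  shows "(\<lambda>N. of_real (real N powr (- S)) * (LINT \<phi>|lborel_power {1..p}. integrand W N (T N \<phi>))) \<longlonglongrightarrow>
    of_real ((a / \<alpha> p) powr (- S)) * W rc *
    of_real (2 * pi * exp (- 1) / Gamma S * ((2 * pi) powr (real n / 2) / ((\<Prod>i\<in>{1..<p}. r i) * sqrt D)))"
proof -
  let ?M = "lborel_power {1..p}" and ?c = "of_real ((a / \<alpha> p) powr (- S)) * W rc"
  let ?g = "\<lambda>N \<phi>. of_real (real N powr (- S)) * integrand W N (T N \<phi>)"
  have c: "(a / \<alpha> p) powr (- S) > 0" using a_pos alpha_p by simp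
  obtain K where K: "\<And>N \<phi>. N \<ge> 1 \<Longrightarrow> norm (?g N \<phi>) \<le> K * (\<Prod>i\<in>{1..p}. 1 / (1 + (\<phi> i)\<^sup>2))"
    using integrand_bound[OF W] by blast
  have wI: "integrable ?M (\<lambda>\<phi>. K * (\<Prod>i\<in>{1..p}. 1 / (1 + (\<phi> i)\<^sup>2)))"
    by (intro integrable_mult_right lborel_power.product_integrable_prod integrable_inverse_1_plus_square_lborel) simp
  have lim: "(\<lambda>N. ?g (Suc N) \<phi>) \<longlonglongrightarrow> ?c * limit_fun \<phi>" for \<phi>
    using LIMSEQ_Suc[OF integrand_tendsto[OF W, of \<phi>]] unfolding limit_fun_def .
  have gm: "?g (Suc N) \<in> borel_measurable ?M" for N
  proof -
    have T: "T (Suc N) \<in> ?M \<rightarrow>\<^sub>M ?M"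
      using measurable_shear_map[OF measurable_shift] unfolding T_def insert_p .
    have "integrand W (Suc N) \<in> borel_measurable ?M" by (rule measurable_integrand[OF sums]) simp_all
    from measurable_compose[OF T this] show ?thesis by measurable
  qed
  have fm: "(\<lambda>\<phi>. ?c * limit_fun \<phi>) \<in> borel_measurable ?M"
    by (rule borel_measurable_LIMSEQ_metric[OF gm lim])
  have bd: "AE \<phi> in ?M. norm (?g (Suc N) \<phi>) \<le> K * (\<Prod>i\<in>{1..p}. 1 / (1 + (\<phi> i)\<^sup>2))" for N
    by (intro AE_I2 K) simp
  note dct = fm gm wI AE_I2[OF lim] bd
  have "(\<lambda>N. LINT \<phi>|?M. ?g (Suc N) \<phi>) \<longlonglongrightarrow> (LINT \<phi>|?M. ?c * limit_fun \<phi>)"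
    by (rule integral_dominated_convergence[OF dct])
  then have "(\<lambda>N. LINT \<phi>|?M. ?g N \<phi>) \<longlonglongrightarrow> (LINT \<phi>|?M. ?c * limit_fun \<phi>)"
    by (rule LIMSEQ_imp_Suc)
  moreover have "(LINT \<phi>|?M. ?c * limit_fun \<phi>) = ?c *
    of_real (2 * pi * exp (- 1) / Gamma S * ((2 * pi) powr (real n / 2) / ((\<Prod>i\<in>{1..<p}. r i) * sqrt D)))"
  proof (cases "W rc = 0")
    case False
    \<comment> \<open>Integrability of \<open>limit_fun\<close> is inherited from the dominated
      limit, after division by its constant factor.\<close>
    have "integrable ?M (\<lambda>\<phi>. ?c * limit_fun \<phi>)"
      by (rule integrable_dominated_convergence[OF dct])
    then have "integrable ?M (\<lambda>\<phi>. (1 / ?c) * (?c * limit_fun \<phi>))" by (rule integrable_mult_right)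
    then have "integrable ?M limit_fun" using False c by simp
    then show ?thesis by (simp only: integral_mult_right_zero integral_limit_fun)
  qed simp
  ultimately show ?thesis by (simp only: integral_mult_right_zero)
qed

text \<open>Undoes the effect of the Euler operator on the Gamma function.\<close>

lemma Gamma_ratio: "pochhammer s k / Gamma (s + real k) = 1 / Gamma s"
proof -
  have "s \<notin> \<int>\<^sub>\<le>\<^sub>0" using s by (auto elim!: nonpos_Ints_cases)
  then have "pochhammer s k = Gamma (s + real k) / Gamma s" by (rule pochhammer_Gamma)
  moreover have "Gamma (s + real k) > 0" using s by (intro Gamma_real_pos) simp
  ultimately show ?thesis by simp
qed

text \<open>Combines coefficient extraction at u = 1 / N, the substitution T and the limit integral.
  \<open>exp (- 1 / N) ^ N\<close> on the side of the coefficient cancels the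
  \<open>exp (- 1)\<close> of the limit integral.\<close>

lemma coef_asymp:
  "(\<lambda>N. coef (lam N) * of_real ((\<Prod>i\<in>{1..p}. r i ^ lam N i) * real N powr (1 + real n / 2 - s))) \<longlonglongrightarrow>
    of_real (a powr (- s) * \<alpha> p powr (s - 1) / (Gamma s * (2 * pi) powr (real n / 2) * (\<Prod>i\<in>{1..<p}. r i) * sqrt D))"
proof -
  let ?k = "p + 1" and ?J = "{1..p}" and ?R = "\<Prod>i\<in>{1..<p}. r i"
  obtain W where W: "exp_poly ?J W" "W rc = of_real (pochhammer s ?k * (a / \<alpha> p) ^ ?k)"
    "\<And>y. y \<in> open_polydisc p r \<Longrightarrow> (\<lambda>M. of_nat M ^ ?k * P M y) sums (exp (- of_real S * L0 y) * W y)"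
    using euler_power_series[of ?k] unfolding S_def by blast
  let ?I = "\<lambda>N. LINT \<phi>|lborel_power ?J. integrand W N (T N \<phi>)"
  \<comment> \<open>Collects the \<open>exp (- 1)\<close> of the radii, the
    \<open>(2 * pi) ^ p\<close> of the Fourier extraction and the \<open>1 / \<alpha> p\<close> of
    the Jacobian, solved for the coefficient.\<close>
  let ?K = "exp 1 / (2 * pi) ^ p / \<alpha> p"
  let ?V = "2 * pi * exp (- 1) / Gamma S * ((2 * pi) powr (real n / 2) / (?R * sqrt D))"
  have R: "?R > 0" using r_pos by (intro prod_pos) auto
  have "(\<lambda>N. of_real ?K * (of_real (real N powr (- S)) * ?I N)) \<longlonglongrightarrow>
      of_real ?K * (of_real ((a / \<alpha> p) powr (- S)) * W rc * of_real ?V)"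
    by (intro tendsto_mult_left integral_integrand_tendsto[OF W(1) W(3)])
  moreover have "eventually (\<lambda>N. of_real ?K * (of_real (real N powr (- S)) * ?I N) =
      coef (lam N) * of_real ((\<Prod>i\<in>?J. r i ^ lam N i) * real N powr (1 + real n / 2 - s))) sequentially"
    using eventually_ge_at_top[of 1]
  proof eventually_elim
    case (elim N)
    let ?u = "1 / real N" and ?l = "restrict (lam N) ?J"
    have N: "real N > 0" using elim by simp
    have u: "0 < ?u" "?u \<le> 1" using elim by auto
    have e: "(\<Sum>i\<in>?J. real (?l i) * \<theta> i) = (\<Sum>i\<in>?J. real (lam N i) * \<theta> i)" for \<theta>
      by (intro sum.cong refl) simp
    have pr: "(\<Prod>i\<in>?J. complex_of_real (r i * exp (- ?u)) ^ ?l i) = of_real ((\<Prod>i\<in>?J. r i ^ lam N i) * exp (- 1))"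
    proof -
      have "(\<Prod>i\<in>?J. complex_of_real (r i * exp (- ?u)) ^ ?l i) = of_real (\<Prod>i\<in>?J. (r i * exp (- ?u)) ^ lam N i)"
        unfolding of_real_prod by (intro prod.cong refl) simp
      also have "(\<Prod>i\<in>?J. (r i * exp (- ?u)) ^ lam N i) = (\<Prod>i\<in>?J. r i ^ lam N i) * exp (- ?u) ^ N"
        unfolding power_mult_distrib prod.distrib power_sum[symmetric] sum_lam ..
      also have "exp (- ?u) ^ N = exp (- 1)"
        unfolding exp_of_nat_mult[symmetric] using N by simp
      finally show ?thesis .
    qed
    have "of_nat N ^ ?k * ((2 * of_real pi) ^ p * coef ?l * (\<Prod>i\<in>?J. complex_of_real (r i * exp (- ?u)) ^ ?l i)) =
        (LINT \<theta>|lborel_power ?J. integrand W N \<theta>)"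
      using coefficient_integral[OF u restrict_lam_degs W(3)] unfolding integrand_def indic_def e by simp
    also have "\<dots> = of_real ((1 / sqrt (real N)) ^ n * (1 / (real N * \<alpha> p))) * ?I N"
      by (rule integral_T[OF measurable_integrand[OF W(3) elim] elim])
    also have "(1 / sqrt (real N)) ^ n = real N powr (- (real n / 2))"
    proof -
      have "(1 / sqrt (real N)) ^ n = (real N powr (- (1 / 2))) ^ n"
        using N by (simp add: powr_half_sqrt[symmetric] powr_minus_divide)
      also have "\<dots> = (real N powr (- (1 / 2))) powr real n" using N by (simp add: powr_realpow)
      also have "\<dots> = real N powr (- (real n / 2))" by (simp add: powr_powr)
      finally show ?thesis .
    qed
    finally have eq: "of_nat N ^ ?k * ((2 * of_real pi) ^ p * coef (lam N) * of_real ((\<Prod>i\<in>?J. r i ^ lam N i) * exp (- 1))) =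
        of_real (real N powr (- (real n / 2)) * (1 / (real N * \<alpha> p))) * ?I N"
      unfolding coef_restrict pr .
    let ?c = "coef (lam N)" and ?q = "\<Prod>i\<in>?J. r i ^ lam N i"
    \<comment> \<open>The Jacobian accounts for the exponent n / 2 + 1 of N, the Euler operator for
      p + 1; the latter is also contained in S.\<close>
    have pw: "real N powr (- S) = real N powr (- (real n / 2)) * (1 / real N) * real N powr (1 + real n / 2 - s) / real N ^ ?k"
    proof -
      have "real N ^ ?k = real N powr (real ?k)" using N by (simp only: powr_realpow)
      moreover have "1 / real N = real N powr (- 1)" using N by (simp add: powr_minus_divide)
      moreover have "- S = - (real n / 2) + - 1 + (1 + real n / 2 - s) - real ?k" by (simp add: S_def)
      ultimately show ?thesis by (simp only: powr_add powr_diff)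
    qed
    have "of_real ?K * (of_real (real N powr (- S)) * ?I N) =
        of_real (exp 1 / (2 * pi) ^ p * real N powr (1 + real n / 2 - s) / real N ^ ?k) *
        (of_real (real N powr (- (real n / 2)) * (1 / (real N * \<alpha> p))) * ?I N)"
      unfolding pw by (simp add: mult_ac)
    also have "\<dots> = of_real (exp 1 / (2 * pi) ^ p * real N powr (1 + real n / 2 - s) / real N ^ ?k) *
        (of_real (real N ^ ?k * (2 * pi) ^ p * (?q * exp (- 1))) * ?c)"
      unfolding eq[symmetric] by simp
    also have "\<dots> = of_real ((exp 1 / (2 * pi) ^ p * real N powr (1 + real n / 2 - s) / real N ^ ?k) *
        (real N ^ ?k * (2 * pi) ^ p * (?q * exp (- 1)))) * ?c"
      by (simp only: of_real_mult mult.assoc)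
    also have "(exp 1 / (2 * pi) ^ p * real N powr (1 + real n / 2 - s) / real N ^ ?k) *
        (real N ^ ?k * (2 * pi) ^ p * (?q * exp (- 1))) = ?q * real N powr (1 + real n / 2 - s)"
      using N by (simp add: exp_minus)
    finally show ?case by (simp only: mult.commute)
  qed
  ultimately have "(\<lambda>N. coef (lam N) * of_real ((\<Prod>i\<in>?J. r i ^ lam N i) * real N powr (1 + real n / 2 - s))) \<longlonglongrightarrow>
      of_real ?K * (of_real ((a / \<alpha> p) powr (- S)) * W rc * of_real ?V)"
    by (rule Lim_transform_eventually)
  also have "of_real ?K * (of_real ((a / \<alpha> p) powr (- S)) * W rc * of_real ?V) =
      of_real (?K * ((a / \<alpha> p) powr (- S) * (pochhammer s ?k * (a / \<alpha> p) ^ ?k) * ?V))"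
    unfolding W(2) by (simp only: of_real_mult)
  also have "?K * ((a / \<alpha> p) powr (- S) * (pochhammer s ?k * (a / \<alpha> p) ^ ?k) * ?V) =
      a powr (- s) * \<alpha> p powr (s - 1) / (Gamma s * (2 * pi) powr (real n / 2) * ?R * sqrt D)"
  proof -
    have 1: "(a / \<alpha> p) powr (- S) * (a / \<alpha> p) ^ ?k = a powr (- s) * \<alpha> p powr s"
    proof -
      have "(a / \<alpha> p) powr (- S) * (a / \<alpha> p) ^ ?k = (a / \<alpha> p) powr (- S + real ?k)"
        using a_pos alpha_p by (simp only: powr_add powr_realpow divide_pos_pos)
      also have "\<dots> = (a / \<alpha> p) powr (- s)" by (simp add: S_def)
      also have "\<dots> = a powr (- s) * \<alpha> p powr s" using a_pos alpha_p by (simp add: powr_divide powr_minus_divide)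
      finally show ?thesis .
    qed
    have 2: "pochhammer s ?k / Gamma S = 1 / Gamma s" using Gamma_ratio[of ?k] by (simp only: S_def)
    have 3: "(2 * pi) powr (real n / 2) * (2 * pi) / (2 * pi) ^ p = 1 / (2 * pi) powr (real n / 2)"
    proof -
      have "(2 * pi) ^ p = (2 * pi) powr (real n / 2 + real n / 2 + 1)"
        using powr_realpow[of "2 * pi" p] p_pos by (simp add: n_def of_nat_diff)
      also have "\<dots> = (2 * pi) powr (real n / 2) * (2 * pi) powr (real n / 2) * (2 * pi)"
        by (simp only: powr_add powr_one_gt_zero_iff) (simp add: powr_one)
      finally show ?thesis by simp
    qed
    have 4: "\<alpha> p powr (s - 1) = \<alpha> p powr s / \<alpha> p" using alpha_p by (simp add: powr_diff)
    have 5: "exp 1 * exp (- 1) = (1 :: real)" by (simp add: exp_minus)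
    have "?K * ((a / \<alpha> p) powr (- S) * (pochhammer s ?k * (a / \<alpha> p) ^ ?k) * ?V) =
        ((a / \<alpha> p) powr (- S) * (a / \<alpha> p) ^ ?k) * (pochhammer s ?k / Gamma S) *
        ((2 * pi) powr (real n / 2) * (2 * pi) / (2 * pi) ^ p) * (exp 1 * exp (- 1)) / (\<alpha> p * (?R * sqrt D))"
      by (simp only: times_divide_eq_right times_divide_eq_left divide_divide_eq_left mult_ac)
    also have "\<dots> = a powr (- s) * \<alpha> p powr (s - 1) / (Gamma s * (2 * pi) powr (real n / 2) * ?R * sqrt D)"
      unfolding 1 2 3 4 5 by (simp only: times_divide_eq_right times_divide_eq_left divide_divide_eq_left mult_ac mult_1_right mult_1)
    finally show ?thesis .
  qed
  finally show ?thesis .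
qed

end

section \<open>From the coefficients to the chromatic and Tutte polynomials\<close>

context critical_sequence
begin

text \<open>Allows \<open>lam N p powr (s - 1)\<close> to replace
  \<open>(\<alpha> p * N) powr (s - 1)\<close> in the final formula.\<close>

lemma lam_ratio: "i \<in> {1..p} \<Longrightarrow> (\<lambda>N. real (lam N i) / real N) \<longlonglongrightarrow> \<alpha> i"
proof -
  assume i: "i \<in> {1..p}"
  obtain K where K: "eventually (\<lambda>N. norm (\<delta> N i) \<le> K * norm (1 :: real)) sequentially"
    using landau_o.bigE[OF delta_bounded[OF i]] by blast
  have "(\<lambda>N. \<delta> N i * (1 / real N)) \<longlonglongrightarrow> 0"
  proof (rule Lim_null_comparison)
    show "eventually (\<lambda>N. norm (\<delta> N i * (1 / real N)) \<le> K * (1 / real N)) sequentially"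
      using K by eventually_elim (auto simp: abs_mult divide_right_mono)
    show "(\<lambda>N. K * (1 / real N)) \<longlonglongrightarrow> 0" by (rule tendsto_mult_right_zero, rule lim_1_over_n)
  qed
  then have "(\<lambda>N. \<alpha> i + \<delta> N i * (1 / real N)) \<longlonglongrightarrow> \<alpha> i + 0" by (intro tendsto_intros)
  moreover have "eventually (\<lambda>N. \<alpha> i + \<delta> N i * (1 / real N) = real (lam N i) / real N) sequentially"
    using eventually_gt_at_top[of 0] by eventually_elim (simp add: lam[OF i] field_simps)
  ultimately show ?thesis by (auto elim: Lim_transform_eventually)
qed

lemma lam_pos: "eventually (\<lambda>N. \<forall>i\<in>{1..p}. lam N i > 0) sequentially"
proof (subst eventually_ball_finite_distrib)
  show "\<forall>i\<in>{1..p}. eventually (\<lambda>N. lam N i > 0) sequentially"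
  proof
    fix i assume i: "i \<in> {1..p}"
    have "eventually (\<lambda>N. real (lam N i) / real N > 0) sequentially"
      using lam_ratio[OF i] by (rule order_tendstoD) (rule alpha_pos[OF i])
    then show "eventually (\<lambda>N. lam N i > 0) sequentially"
      by eventually_elim (simp add: zero_less_divide_iff)
  qed
qed simp

lemma Phi_rc: "\<Phi> rc = of_real (- (\<Sum>i\<in>{1..p}. \<alpha> i * ln (r i)))"
proof -
  have "(\<Sum>i\<in>{1..<p}. of_real (\<alpha> i) * Ln (rc i)) = of_real (\<Sum>i\<in>{1..<p}. \<alpha> i * ln (r i))"
    unfolding of_real_sum by (intro sum.cong refl) (use r_pos in \<open>simp add: Ln_of_real\<close>)
  moreover have "Ln (rc p) = of_real (ln (r p))" using r_pos[of p] p_pos by (simp add: Ln_of_real)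
  ultimately show ?thesis unfolding Phi_fun_def h_rc sum_split_last by simp
qed

text \<open>The sum in the exponential is \<open>- \<Phi> rc\<close> before its sign is reversed,
  and \<open>lam N i - \<delta> N i = \<alpha> i * N\<close>, so all powers of r cancel.\<close>

lemma prod_r: "(\<Prod>i\<in>{1..p}. r i ^ lam N i) * (\<Prod>i\<in>{1..p}. r i powr (- \<delta> N i)) *
    exp (real N * (- (\<Sum>i\<in>{1..p}. \<alpha> i * ln (r i)))) = 1"
proof -
  have "(\<Prod>i\<in>{1..p}. r i ^ lam N i) * (\<Prod>i\<in>{1..p}. r i powr (- \<delta> N i)) *
      exp (real N * (- (\<Sum>i\<in>{1..p}. \<alpha> i * ln (r i)))) =
      (\<Prod>i\<in>{1..p}. r i ^ lam N i * r i powr (- \<delta> N i) * exp (- (real N * (\<alpha> i * ln (r i)))))"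
    by (simp add: prod.distrib exp_sum[symmetric] sum_negf sum_distrib_left)
  also have "\<dots> = (\<Prod>i\<in>{1..p}. 1)"
  proof (rule prod.cong[OF refl])
    fix i assume i: "i \<in> {1..p}"
    have "r i ^ lam N i * r i powr (- \<delta> N i) = r i powr (\<alpha> i * real N)"
      unfolding powr_realpow[OF r_pos[OF i], symmetric] powr_add[symmetric] by (simp add: lam[OF i])
    then show "r i ^ lam N i * r i powr (- \<delta> N i) * exp (- (real N * (\<alpha> i * ln (r i)))) = 1"
      using r_pos[OF i] by (simp add: powr_def exp_add[symmetric])
  qed
  finally show ?thesis by simp
qed

text \<open>Every factor on the right is a real number: \<open>induced_power\<close> turns w into
  \<open>a powr (- s)\<close>, and the Hessian determinant is positive. The quotient of the two
  sides then reduces to the sequence of \<open>coef_asymp\<close>.\<close>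

lemma chromatic_asymp:
  assumes w: "induced_neg_power p F s r h G w"
  shows "(\<lambda>N. complex_of_real
            ((-1) ^ N * poly (chromatic_poly (blowup_verts {1..p} (lam N)) (blowup_edges E (lam N))) (- s)))
      \<sim>[at_top]
         (\<lambda>N. of_real (\<Prod>i\<in>{1..p}. fact (lam N i)) * of_real (\<Prod>i\<in>{1..p}. r i powr (- \<delta> N i)) *
            of_real (real (lam N p) powr (s - 1) / Gamma s) *
            (w / of_real (\<Prod>i\<in>{1..<p}. r i)) *
            (exp (of_nat N * \<Phi> rc) /
              (of_real ((2 * pi * real N) powr (real (p - 1) / 2)) *
                csqrt (Determinant.det (hessian (p - 1) \<Phi> rc)))))"
    (is "?lhs \<sim>[at_top] ?rhs")
proof (rule asymp_equivI')
  let ?R = "\<Prod>i\<in>{1..<p}. r i"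
  \<comment> \<open>The limit of \<open>coef_asymp\<close> without
    \<open>\<alpha> p powr (s - 1)\<close>, which is matched with
    \<open>(lam N p / N) powr (s - 1)\<close> instead.\<close>
  define K where "K = a powr (- s) / (Gamma s * (2 * pi) powr (real n / 2) * ?R * sqrt D)"
  let ?c = "\<lambda>N. coef (lam N) * of_real ((\<Prod>i\<in>{1..p}. r i ^ lam N i) * real N powr (1 + real n / 2 - s))"
  have R: "?R > 0" using r_pos by (intro prod_pos) auto
  have G: "Gamma s > 0" using s by (rule Gamma_real_pos)
  have K: "K > 0" unfolding K_def using R G D_pos a_pos by (intro divide_pos_pos mult_pos_pos) auto
  have pI: "p \<in> {1..p}" using p_pos by simp
  have "(\<lambda>N. of_real ((real (lam N p) / real N) powr (s - 1) * K)) \<longlonglongrightarrow> complex_of_real (\<alpha> p powr (s - 1) * K)"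
    using alpha_p by (intro tendsto_of_real tendsto_mult tendsto_powr lam_ratio[OF pI] tendsto_const) auto
  moreover have L: "\<alpha> p powr (s - 1) * K > 0" using K alpha_p by (intro mult_pos_pos) auto
  ultimately have "(\<lambda>N. ?c N / of_real ((real (lam N p) / real N) powr (s - 1) * K)) \<longlonglongrightarrow>
      of_real (a powr (- s) * \<alpha> p powr (s - 1) / (Gamma s * (2 * pi) powr (real n / 2) * ?R * sqrt D)) /
      complex_of_real (\<alpha> p powr (s - 1) * K)"
    by (intro tendsto_divide coef_asymp) (simp_all only: of_real_eq_0_iff less_imp_neq[symmetric] not_False_eq_True)
  also have "a powr (- s) * \<alpha> p powr (s - 1) / (Gamma s * (2 * pi) powr (real n / 2) * ?R * sqrt D) = \<alpha> p powr (s - 1) * K"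
    unfolding K_def by simp
  also have "complex_of_real (\<alpha> p powr (s - 1) * K) / of_real (\<alpha> p powr (s - 1) * K) = 1"
    using L by (intro divide_self) (simp only: of_real_eq_0_iff less_imp_neq[symmetric] not_False_eq_True)
  finally have "(\<lambda>N. ?c N / of_real ((real (lam N p) / real N) powr (s - 1) * K)) \<longlonglongrightarrow> 1" .
  moreover have "eventually (\<lambda>N. ?c N / of_real ((real (lam N p) / real N) powr (s - 1) * K) = ?lhs N / ?rhs N) sequentially"
    using lam_pos eventually_gt_at_top[of 0]
  proof eventually_elim
    case (elim N)
    let ?f = "\<Prod>i\<in>{1..p}. fact (lam N i) :: real" and ?q = "\<Prod>i\<in>{1..p}. r i ^ lam N i"
      and ?Q = "\<Prod>i\<in>{1..p}. r i powr (- \<delta> N i)" and ?x = "exp (real N * (- (\<Sum>i\<in>{1..p}. \<alpha> i * ln (r i))))"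
    have f: "?f \<noteq> 0" by simp
    have q: "?q > 0" using r_pos by (intro prod_pos) auto
    have Qx: "?Q * ?x = 1 / ?q" 
    proof (rule eq_divide_imp)
      show "?q \<noteq> 0" using q by linarith
      show "?Q * ?x * ?q = 1" using prod_r[of N] by (simp only: mult_ac)
    qed
    have l: "?lhs N = coef (lam N) * of_real ?f"
      unfolding coef_def sum_lam by (simp add: of_real_prod)
    have cs: "csqrt (Determinant.det (hessian (p - 1) \<Phi> rc)) = of_real (sqrt D)"
    proof -
      have "Determinant.det (hessian (p - 1) \<Phi> rc) = of_real D"
        unfolding D_def n_def[symmetric] by (rule det_hessian_real)
      then show ?thesis using csqrt_of_real_nonneg[of D] D_pos by simp
    qed
    have ex: "exp (of_nat N * \<Phi> rc) = of_real ?x"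
      unfolding Phi_rc exp_of_real[symmetric] by (simp only: of_real_mult of_real_of_nat_eq)
    have r: "?rhs N = of_real (?f * ?Q * (real (lam N p) powr (s - 1) / Gamma s) * (a powr (- s) / ?R) *
        (?x / ((2 * pi * real N) powr (real n / 2) * sqrt D)))"
      unfolding induced_power[OF w] cs ex n_def by (simp only: of_real_mult of_real_divide)
    let ?L = "real (lam N p) powr (s - 1)" and ?M = "real N powr (s - 1)" and ?H = "real N powr (real n / 2)"
      and ?P = "(2 * pi) powr (real n / 2)"
    have pos: "?L > 0" "?M > 0" "?H > 0" "?P > 0" "a powr (- s) > 0" "sqrt D > 0"
      using elim pI a_pos D_pos by auto
    have "?f / (?f * ?Q * (?L / Gamma s) * (a powr (- s) / ?R) * (?x / ((2 * pi * real N) powr (real n / 2) * sqrt D))) =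
        ?f / (?f * (?Q * ?x) * (?L / Gamma s) * (a powr (- s) / ?R) * (1 / (?P * ?H * sqrt D)))"
      by (simp add: powr_mult mult_ac)
    also have "\<dots> = ?q * (?H / ?M) / ((?L / ?M) * K)"
      unfolding Qx K_def using f q pos G R by (simp add: field_simps)
    also have "?H / ?M = real N powr (1 + real n / 2 - s)"
      unfolding powr_diff[symmetric] by (simp add: algebra_simps)
    also have "?L / ?M = (real (lam N p) / real N) powr (s - 1)" by (simp only: powr_divide)
    finally have eq: "?f / (?f * ?Q * (?L / Gamma s) * (a powr (- s) / ?R) * (?x / ((2 * pi * real N) powr (real n / 2) * sqrt D))) =
      ?q * real N powr (1 + real n / 2 - s) / ((real (lam N p) / real N) powr (s - 1) * K)" .
    have "coef (lam N) * of_real x / of_real y = coef (lam N) * of_real (x / y)" for x y by simp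
    then show ?case unfolding l r by (simp only: eq)
  qed
  ultimately show "(\<lambda>N. ?lhs N / ?rhs N) \<longlonglongrightarrow> 1" by (rule Lim_transform_eventually)
qed

text \<open>For a single vertex F is \<open>exp (- y 1)\<close>, which has no zero. A critical point
  thus rules out the one-vertex graph, which is connected although its blow-ups are independent
  sets.\<close>

lemma p_ge_2: "p \<ge> 2"
proof (rule ccontr)
  assume "\<not> p \<ge> 2"
  then have p: "p = 1" using p_pos by simp
  have "{1} \<notin> E" using graph by (auto simp: simple_graph_def)
  then have "independent_sets {1..p} E = {{}, {1}}" by (auto simp: independent_sets_def p subset_singleton_iff)
  then have "F rc = exp (- rc 1)" by (simp add: F_fun_def B_fun_def)
  then show False using zero by simp
qed

lemma chromatic_tutte:
  assumes conn: "connected_graph {1..p} E"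
  shows "\<forall>\<^sub>F N in at_top.
    connected_graph (blowup_verts {1..p} (lam N)) (blowup_edges E (lam N)) \<and>
    (-1) ^ N * poly (chromatic_poly (blowup_verts {1..p} (lam N)) (blowup_edges E (lam N))) (- s)
      = s * tutte (blowup_verts {1..p} (lam N)) (blowup_edges E (lam N)) (1 + s) 0"
  using lam_pos
proof eventually_elim
  case (elim N)
  let ?V = "blowup_verts {1..p} (lam N)" and ?E = "blowup_edges E (lam N)"
  have E: "\<forall>e\<in>E. e \<subseteq> {1..p} \<and> card e = 2" using graph by (simp add: simple_graph_def)
  have c: "connected_graph ?V ?E"
    by (rule connected_blowup[OF _ conn, of 1 2]) (use E elim p_ge_2 in auto)
  have "card ?V = N" unfolding blowup_verts_def using sum_lam[of N] by simp
  moreover have "finite ?V" by (simp add: blowup_verts_def)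
  ultimately show ?case using c chromatic_poly_eq_tutte[OF _ blowup_edges_wf[OF E] c] by metis
qed

end

theorem theorem1:
  fixes p :: nat and E :: "nat set set" and s :: real
    and \<alpha> r :: "nat \<Rightarrow> real" and \<delta> :: "nat \<Rightarrow> nat \<Rightarrow> real" and lam :: "nat \<Rightarrow> nat \<Rightarrow> nat"
    and h G :: "(nat \<Rightarrow> complex) \<Rightarrow> complex" and A_pow :: complex
  defines "F \<equiv> F_fun p E"
    and "rc \<equiv> (\<lambda>i. complex_of_real (r i))"
    and "\<Phi> \<equiv> Phi_fun p \<alpha> h"
  assumes graph: "simple_graph {1..p} E"
    and s: "s > 0"
    and alpha_pos: "\<And>i. i \<in> {1..p} \<Longrightarrow> \<alpha> i > 0"
    and alpha_sum: "(\<Sum>i\<in>{1..p}. \<alpha> i) = 1"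
    and lam: "\<And>N i. i \<in> {1..p} \<Longrightarrow> real (lam N i) = \<alpha> i * real N + \<delta> N i"
    and delta_bounded: "\<And>i. i \<in> {1..p} \<Longrightarrow> (\<lambda>N. \<delta> N i) \<in> O(\<lambda>_. 1)"
    and delta_sum: "\<And>N. (\<Sum>i\<in>{1..p}. \<delta> N i) = 0"
    and r_pos: "\<And>i. i \<in> {1..p} \<Longrightarrow> r i > 0"
    and zero: "F rc = 0"
    and smooth: "partial_deriv p F rc \<noteq> 0"
    and critical: "\<And>i. i \<in> {1..<p} \<Longrightarrow>
      of_real (\<alpha> i) / rc i = of_real (\<alpha> p) * partial_deriv i F rc / (rc p * partial_deriv p F rc)"
    and h: "local_solution p F rc h"
    and minimal: "strictly_minimal p F r"
    and nondeg: "nondegenerate (hessian (p - 1) \<Phi> rc)"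
    and G: "neg_power_branch p F s r G"
    and A_pow: "induced_neg_power p F s r h G A_pow"
  shows "(\<lambda>N. complex_of_real
            ((-1) ^ N * poly (chromatic_poly (blowup_verts {1..p} (lam N)) (blowup_edges E (lam N))) (- s)))
      \<sim>[at_top]
         (\<lambda>N. of_real (\<Prod>i\<in>{1..p}. fact (lam N i)) * of_real (\<Prod>i\<in>{1..p}. r i powr (- \<delta> N i)) *
            of_real (real (lam N p) powr (s - 1) / Gamma s) *
            (A_pow / of_real (\<Prod>i\<in>{1..<p}. r i)) *
            (exp (of_nat N * \<Phi> rc) /
              (of_real ((2 * pi * real N) powr (real (p - 1) / 2)) *
                csqrt (Determinant.det (hessian (p - 1) \<Phi> rc)))))
    \<and> (connected_graph {1..p} E \<longrightarrow>
         (\<forall>\<^sub>F N in at_top.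
            connected_graph (blowup_verts {1..p} (lam N)) (blowup_edges E (lam N)) \<and>
            (-1) ^ N * poly (chromatic_poly (blowup_verts {1..p} (lam N)) (blowup_edges E (lam N))) (- s)
              = s * tutte (blowup_verts {1..p} (lam N)) (blowup_edges E (lam N)) (1 + s) 0))"
proof -
  interpret critical_sequence p E \<alpha> r h s G \<delta> lam
    by unfold_locales
      (fact graph alpha_pos alpha_sum r_pos zero[unfolded F_def rc_def] smooth[unfolded F_def rc_def]
        critical[unfolded F_def rc_def] h[unfolded F_def rc_def] minimal[unfolded F_def]
        nondeg[unfolded \<Phi>_def rc_def] s G[unfolded F_def] lam delta_bounded delta_sum)+
  show ?thesis
    unfolding F_def rc_def \<Phi>_def
    using chromatic_asymp[OF A_pow[unfolded F_def]] chromatic_tutte by blast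
qed

end
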